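(* Let all notation (game, admissible set $\mathcal A$, objective functionals $J_p^{\lambda,F},J_c^{\lambda,F}$, functions $K_p,\Lambda_p,K_c,\Lambda_c$, matrix functions $\pi,\widehat\pi$, vector function $h$, and $T_{max}$) be as in the context. Assume: (A1) $T<T_{max}$; (A2) $\ell_p-2(K_p(t)+\pi_{11}(t))>0$ and $\ell_c-2(K_c(t)+\pi_{22}(t))>0$ for all $t\in[0,T]$. Then: 1. There exists a Nash equilibrium $((u^*,z^* )^\top,(v^*,y^* )^\top)\in\mathcal A\times\mathcal A$ in the following feedback form, where $(q,c)$ is the corresponding state process, $\bar q_t=\mathbb E[q_t]$ and $\bar c_t=\mathbb E[c_t]$: $$u^*_t=\frac{2}{k_p}\Big[(K_p(t)+\pi_{11}(t))(q_t-\bar q_t)+\pi_{12}(t)(c_t-\bar c_t)+(\Lambda_p(t)+\widehat\pi_{11}(t))\bar q_t+\widehat\pi_{12}(t)\bar c_t+h_1(t)\Big],$$ $$z^*(t)=\frac{\sigma_p\ell_p}{\ell_p-2(K_p(t)+\pi_{11}(t))},$$ $$v^*_t=\frac{2}{k_c}\Big[(K_c(t)+\pi_{22}(t))(c_t-\bar c_t)+\pi_{21}(t)(q_t-\bar q_t)+(\Lambda_c(t)+\widehat\pi_{22}(t))\bar c_t+\widehat\pi_{21}(t)\bar q_t+h_2(t)\Big],$$ $$y^*(t)=\frac{\sigma_c\ell_c}{\ell_c-2(K_c(t)+\pi_{22}(t))}.$$ 2. The equilibrium payoffs $J_p^*(\lambda,F)=J_p^{\lambda,F}(u^*,z^*;v^*,y^*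 )$ and $J_c^*(\lambda,F)=J_c^{\lambda,F}(v^*,y^*;u^*,z^* )$ satisfy $$J_p^*(\lambda,F)=\Lambda_p(0)q_0^2+2\bar Y^p_0q_0+R_p(0)+F-\lambda s_0-\tfrac12\ell_p\sigma_p^2T,$$ $$J_c^*(\lambda,F)=\Lambda_c(0)c_0^2+2\bar Y^c_0c_0+R_c(0)-F+\lambda s_0-\tfrac12\ell_c\sigma_c^2T,$$ $$\bar Y^p_t=\widehat\pi_{11}(t)\bar q_t+\widehat\pi_{12}(t)\bar c_t+h_1(t),\qquad \bar Y^c_t=\widehat\pi_{22}(t)\bar c_t+\widehat\pi_{21}(t)\bar q_t+h_2(t),$$ where (all state processes being taken at the equilibrium, and $Y^p,Y^c$ as in the context) $$R_p(0)=\int_0^T\left[\frac{2}{k_p}\mathbb E[(Y^p_u)^2]-\eta_p\lambda^2\gamma^2\rho_c^2\,\mathbb V[c_u]+\frac{2\big(\pi_{11}(u)z^*_u+\frac{\ell_p\sigma_p}{2}\big)^2}{\ell_p-2K_p(u)}\right]du-\lambda\gamma\rho_c\,\mathbb E[c_T],$$ $$R_c(0)=\int_0^T\left[\frac{2}{k_c}\mathbb E[(Y^c_u)^2]-\eta_c\lambda^2\rho_p^2\,\mathbb V[q_u]+\frac{2\big(\pi_{22}(u)y^*_u+\frac{\ell_c\sigma_c}{2}\big)^2}{\ell_c-2K_c(u)}\right]du-\lambda\rho_p\,\mathbb E[q_T].$$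
   Context: **Game.** $T>0$; $(\Omega,\mathcal F,\mathbb P)$ carries a two-dimensional Brownian motion $(W,B)$ with its natural filtration $\mathbb F=(\mathcal F_t)_{t\in[0,T]}$ augmented with the null sets. $\mathbb V$ denotes variance. Parameters: $k_p,k_c>0$, $\ell_p,\ell_c\ge0$, $\sigma_p,\sigma_c>0$, $s_0,q_0,c_0>0$, $\rho_p,\rho_c,\gamma>0$, $p_0,p_1,\delta>0$ with $\gamma>p_1$, $\eta_p,\eta_c>0$, and fixed real numbers $\lambda,F$. The set of admissible strategies of each player is $\mathcal A=L^2_{\mathbb F}(\Omega\times[0,T],\mathbb R^2)$, the $\mathbb F$-adapted $\mathbb R^2$-valued processes $\eta$ with $\mathbb E[\int_0^T|\eta_t|^2dt]<\infty$. The producer chooses $(u,z)^\top\in\mathcal A$, the consumer chooses $(v,y)^\top\in\mathcal A$, and the states are $$dq_t=u_t\,dt+z_t\,dW_t,\qquad dc_t=v_t\,dt+y_t\,dB_t,$$ with deterministic initial values $q_0,c_0$. The price is $S_t=s_0-\rho_pq_t+\gamma\rho_cc_t$. Profit rates: $$\pi^p_t=q_tS_t-\tfrac{k_p}{2}u_t^2-\tfrac{\ell_p}{2}(z_t-\sigma_p)^2,\quad \pi^c_t=c_t(p_0+p_1S_t)-\gamma c_t(S_t+\delta)-\tfrac{k_c}{2}v_t^2-\tfrac{\ell_c}{2}(y_t-\sigma_c)^2.$$ Objective functionals (to be maximized by producer and consumer respectively): $$J_p^{\lambda,F}(u,z;v,y)=\mathbb E\Big[\int_0^T\pi^p_tdt+F-\lambda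 S_T\Big]-\eta_p\int_0^T\mathbb V[\lambda S_t]dt,$$ $$J_c^{\lambda,F}(v,y;u,z)=\mathbb E\Big[\int_0^T\pi^c_tdt-F+\lambda S_T\Big]-\eta_c\int_0^T\mathbb V[\lambda S_t]dt.$$ A pair $((u^*,z^* )^\top,(v^*,y^* )^\top)\in\mathcal A\times\mathcal A$ is a *Nash equilibrium* if $J_p^{\lambda,F}(u^*,z^*;v^*,y^* )\ge J_p^{\lambda,F}(u,z;v^*,y^* )$ for all $(u,z)^\top\in\mathcal A$ and $J_c^{\lambda,F}(v^*,y^*;u^*,z^* )\ge J_c^{\lambda,F}(v,y;u^*,z^* )$ for all $(v,y)^\top\in\mathcal A$. **Functions.** For $t\in[0,T]$, $$K_p(t)=-\tfrac{k_p}{2}\sqrt{\tfrac{2(\rho_p+\eta_p\lambda^2\rho_p^2)}{k_p}}\tanh\Big(\sqrt{\tfrac{2(\rho_p+\eta_p\lambda^2\rho_p^2)}{k_p}}(T-t)\Big),\quad \Lambda_p(t)=-\tfrac{k_p}{2}\sqrt{\tfrac{2\rho_p}{k_p}}\tanh\Big(\sqrt{\tfrac{2\rho_p}{k_p}}(T-t)\Big),$$ $$K_c(t)=-\tfrac{k_c}{2}\sqrt{\tfrac{2(\gamma\rho_c(\gamma-p_1)+\eta_c\lambda^2\gamma^2\rho_c^2)}{k_c}}\tanh\Big(\sqrt{\tfrac{2(\gamma\rho_c(\gamma-p_1)+\eta_c\lambda^2\gamma^2\rho_c^2)}{k_c}}(T-t)\Big),$$ $$\Lambda_c(t)=-\tfrac{k_c}{2}\sqrt{\tfrac{2\gamma\rho_c(\gamma-p_1)}{k_c}}\tanh\Big(\sqrt{\tfrac{2\gamma\rho_c(\gamma-p_1)}{k_c}}(T-t)\Big).$$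 $$\Xi=\begin{pmatrix}0&-\rho_p\gamma\rho_c\eta_p\lambda^2-\frac{\gamma\rho_c}{2}\\-\rho_p\gamma\rho_c\eta_c\lambda^2-\frac{\rho_p(\gamma-p_1)}{2}&0\end{pmatrix},\quad \widehat\Xi=\begin{pmatrix}0&-\frac{\gamma\rho_c}{2}\\-\frac{\rho_p(\gamma-p_1)}{2}&0\end{pmatrix},\quad R=\begin{pmatrix}-\frac2{k_p}&0\\0&-\frac2{k_c}\end{pmatrix},$$ $$\Phi(t)=\begin{pmatrix}-\frac2{k_p}K_p(t)&0\\0&-\frac2{k_c}K_c(t)\end{pmatrix},\quad \widehat\Phi(t)=\begin{pmatrix}-\frac2{k_p}\Lambda_p(t)&0\\0&-\frac2{k_c}\Lambda_c(t)\end{pmatrix},\quad \Psi=\begin{pmatrix}-s_0/2\\-\frac{p_0+p_1s_0-\gamma(\delta+s_0)}{2}\end{pmatrix}.$$ The $\mathbb R^{2\times2}$-valued functions $\pi=(\pi_{ij})$, $\widehat\pi=(\widehat\pi_{ij})$ solve the Riccati system $$\pi'(t)=\Xi+\Phi(t)\pi(t)+\pi(t)\Phi(t)+\pi(t)R\pi(t),\ \pi(T)=0;\qquad \widehat\pi'(t)=\widehat\Xi+\widehat\Phi(t)\widehat\pi(t)+\widehat\pi(t)\widehat\Phi(t)+\widehat\pi(t)R\widehat\pi(t),\ \widehat\pi(T)=0,$$ and $h=(h_1,h_2)^\top$ solves the linear ODE $h'(t)=[\widehat\pi(t)R+\widehat\Phi(t)]h(t)+\Psi$, $h(T)=\frac12\lambda(\rho_p,\gamma\rho_c)^\top$.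 $T_{max}$ denotes the right end of the interval on which the Riccati system for $(\pi,\widehat\pi)$ admits a unique solution according to the Picard–Lindelöf theorem, applied after time inversion $t\mapsto T-t$ (after which the system is an initial value problem started from $0$ at time $0$ with right-hand side not depending on $T$). In the formulas for $R_p(0),R_c(0)$, $$Y^p_t=\pi_{11}(t)(q_t-\bar q_t)+\pi_{12}(t)(c_t-\bar c_t)+\widehat\pi_{11}(t)\bar q_t+\widehat\pi_{12}(t)\bar c_t+h_1(t),$$ $$Y^c_t=\pi_{21}(t)(q_t-\bar q_t)+\pi_{22}(t)(c_t-\bar c_t)+\widehat\pi_{21}(t)\bar q_t+\widehat\pi_{22}(t)\bar c_t+h_2(t).$$ *)

theory Defs
  imports "HOL-Probability.Probability"
begin

section \<open>Brownian motion, filtration, Ito integral\<close>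

definition natural_sets ::
  "'a measure \<Rightarrow> (real \<Rightarrow> 'a \<Rightarrow> real) \<Rightarrow> (real \<Rightarrow> 'a \<Rightarrow> real) \<Rightarrow> real \<Rightarrow> 'a set set" where
  "natural_sets M W B t =
     {W s -` A \<inter> space M | s A. s \<in> {0..t} \<and> A \<in> sets borel} \<union>
     {B s -` A \<inter> space M | s A. s \<in> {0..t} \<and> A \<in> sets borel}"

definition natural_filtration ::
  "'a measure \<Rightarrow> (real \<Rightarrow> 'a \<Rightarrow> real) \<Rightarrow> (real \<Rightarrow> 'a \<Rightarrow> real) \<Rightarrow> real \<Rightarrow> 'a measure" where
  "natural_filtration M W B t = sigma (space M) (natural_sets M W B t)"

definition augmented_filtration ::
  "'a measure \<Rightarrow> (real \<Rightarrow> 'a \<Rightarrow> real) \<Rightarrow> (real \<Rightarrow> 'a \<Rightarrow> real) \<Rightarrow> real \<Rightarrow> 'a measure" where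
  "augmented_filtration M W B t = sigma (space M) (natural_sets M W B t \<union> null_sets M)"

definition brownian_motion_2d ::
  "'a measure \<Rightarrow> real \<Rightarrow> (real \<Rightarrow> 'a \<Rightarrow> real) \<Rightarrow> (real \<Rightarrow> 'a \<Rightarrow> real) \<Rightarrow> bool" where
  "brownian_motion_2d M T W B \<longleftrightarrow>
     (\<forall>t\<in>{0..T}. W t \<in> borel_measurable M \<and> B t \<in> borel_measurable M) \<and>
     (AE \<omega> in M. W 0 \<omega> = 0 \<and> B 0 \<omega> = 0) \<and>
     (AE \<omega> in M. continuous_on {0..T} (\<lambda>t. W t \<omega>) \<and> continuous_on {0..T} (\<lambda>t. B t \<omega>)) \<and>
     (\<forall>s t. 0 \<le> s \<and> s < t \<and> t \<le> T \<longrightarrow>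
        distributed M lborel (\<lambda>\<omega>. W t \<omega> - W s \<omega>) (normal_density 0 (sqrt (t - s))) \<and>
        distributed M lborel (\<lambda>\<omega>. B t \<omega> - B s \<omega>) (normal_density 0 (sqrt (t - s))) \<and>
        prob_space.indep_var M borel (\<lambda>\<omega>. W t \<omega> - W s \<omega>) borel (\<lambda>\<omega>. B t \<omega> - B s \<omega>) \<and>
        prob_space.indep_set M
          (sets (vimage_algebra (space M) (\<lambda>\<omega>. (W t \<omega> - W s \<omega>, B t \<omega> - B s \<omega>))
                   (borel :: (real \<times> real) measure)))
          (sets (natural_filtration M W B s)))"

text \<open>
  Jointly measurable, adapted, square integrable pairs of processes: the space
  \<open>L\<^sup>2\<^sub>F(\<Omega> \<times> [0,T], R\<^sup>2)\<close>. Processes are functions on the whole real line whose values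
  outside \<open>[0,T]\<close> are irrelevant. Square integrability is stated with the Lebesgue
  integral of nonnegative functions, since the Bochner integral of a non-integrable
  function is \<open>0\<close>.
\<close>

definition admissible ::
  "'a measure \<Rightarrow> (real \<Rightarrow> 'a measure) \<Rightarrow> real \<Rightarrow>
     ((real \<Rightarrow> 'a \<Rightarrow> real) \<times> (real \<Rightarrow> 'a \<Rightarrow> real)) set" where
  "admissible M \<F> T =
     {(a, b).
        (\<lambda>(t, \<omega>). a t \<omega>) \<in> borel_measurable (restrict_space borel {0..T} \<Otimes>\<^sub>M M) \<and>
        (\<lambda>(t, \<omega>). b t \<omega>) \<in> borel_measurable (restrict_space borel {0..T} \<Otimes>\<^sub>M M) \<and>
        (\<forall>t\<in>{0..T}. a t \<in> borel_measurable (\<F> t) \<and> b t \<in> borel_measurable (\<F> t)) \<and>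
        (\<integral>\<^sup>+\<omega>. (\<integral>\<^sup>+t\<in>{0..T}. ennreal ((a t \<omega>)\<^sup>2 + (b t \<omega>)\<^sup>2) \<partial>lborel) \<partial>M) < \<infinity>}"

text \<open>
  Simple integrands \<open>\<Sum>i<n. \<xi>\<^sub>i 1\<^bsub>(g\<^sub>i, g\<^sub>i\<^sub>+\<^sub>1]\<^esub>\<close> with bounded, \<open>\<F> g\<^sub>i\<close>-measurable \<open>\<xi>\<^sub>i\<close>,
  and their integrals up to time \<open>t\<close> against \<open>W\<close>.
\<close>

definition simple_integrand ::
  "(real \<Rightarrow> 'a measure) \<Rightarrow> real \<Rightarrow> nat \<Rightarrow> (nat \<Rightarrow> real) \<Rightarrow> (nat \<Rightarrow> 'a \<Rightarrow> real) \<Rightarrow> bool" where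
  "simple_integrand \<F> T n g \<xi> \<longleftrightarrow>
     0 \<le> g 0 \<and> g n \<le> T \<and> (\<forall>i<n. g i \<le> g (Suc i)) \<and>
     (\<forall>i<n. \<xi> i \<in> borel_measurable (\<F> (g i)) \<and>
            (\<exists>C. \<forall>\<omega>\<in>space (\<F> (g i)). \<bar>\<xi> i \<omega>\<bar> \<le> C))"

definition simple_process ::
  "nat \<Rightarrow> (nat \<Rightarrow> real) \<Rightarrow> (nat \<Rightarrow> 'a \<Rightarrow> real) \<Rightarrow> real \<Rightarrow> 'a \<Rightarrow> real" where
  "simple_process n g \<xi> t \<omega> = (\<Sum>i<n. \<xi> i \<omega> * indicator {g i<..g (Suc i)} t)"

definition simple_integral ::
  "(real \<Rightarrow> 'a \<Rightarrow> real) \<Rightarrow> nat \<Rightarrow> (nat \<Rightarrow> real) \<Rightarrow> (nat \<Rightarrow> 'a \<Rightarrow> real) \<Rightarrow> real \<Rightarrow> 'a \<Rightarrow> real" where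
  "simple_integral W n g \<xi> t \<omega> =
     (\<Sum>i<n. \<xi> i \<omega> * (W (min (g (Suc i)) t) \<omega> - W (min (g i) t) \<omega>))"

text \<open>
  \<open>I\<close> is a version of the Ito integral process \<open>(\<integral>\<^sub>0\<^sup>t H\<^sub>s dW\<^sub>s)\<close>, \<open>t \<in> [0,T]\<close>: it is adapted,
  almost surely continuous, and an \<open>L\<^sup>2\<close> limit of integrals of simple integrands that
  converge to \<open>H\<close> in \<open>L\<^sup>2(\<Omega> \<times> [0,T])\<close>. It is determined by \<open>H\<close> up to
  indistinguishability.
\<close>

definition ito_integral ::
  "'a measure \<Rightarrow> (real \<Rightarrow> 'a measure) \<Rightarrow> real \<Rightarrow> (real \<Rightarrow> 'a \<Rightarrow> real) \<Rightarrow>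
     (real \<Rightarrow> 'a \<Rightarrow> real) \<Rightarrow> (real \<Rightarrow> 'a \<Rightarrow> real) \<Rightarrow> bool" where
  "ito_integral M \<F> T W H I \<longleftrightarrow>
     (\<forall>t\<in>{0..T}. I t \<in> borel_measurable (\<F> t)) \<and>
     (AE \<omega> in M. continuous_on {0..T} (\<lambda>t. I t \<omega>)) \<and>
     (\<exists>n g \<xi>.
        (\<forall>k. simple_integrand \<F> T (n k) (g k) (\<xi> k)) \<and>
        (\<lambda>k. \<integral>\<^sup>+\<omega>. (\<integral>\<^sup>+t\<in>{0..T}.
               ennreal ((simple_process (n k) (g k) (\<xi> k) t \<omega> - H t \<omega>)\<^sup>2) \<partial>lborel) \<partial>M)
          \<longlonglongrightarrow> 0 \<and>
        (\<forall>t\<in>{0..T}.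
          (\<lambda>k. \<integral>\<^sup>+\<omega>. ennreal ((simple_integral W (n k) (g k) (\<xi> k) t \<omega> - I t \<omega>)\<^sup>2) \<partial>M)
            \<longlonglongrightarrow> 0))"

text \<open>
  \<open>X\<close> solves \<open>dX\<^sub>t = a\<^sub>t dt + b\<^sub>t dW\<^sub>t\<close> on \<open>[0,T]\<close> with \<open>X\<^sub>0 = x\<^sub>0\<close>. We take a version all
  of whose paths are continuous, which makes \<open>X\<close> jointly measurable even if \<open>M\<close> is
  not complete.
\<close>

definition state_process ::
  "'a measure \<Rightarrow> (real \<Rightarrow> 'a measure) \<Rightarrow> real \<Rightarrow> (real \<Rightarrow> 'a \<Rightarrow> real) \<Rightarrow> real \<Rightarrow>
     (real \<Rightarrow> 'a \<Rightarrow> real) \<Rightarrow> (real \<Rightarrow> 'a \<Rightarrow> real) \<Rightarrow> (real \<Rightarrow> 'a \<Rightarrow> real) \<Rightarrow> bool" where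
  "state_process M \<F> T W x0 a b X \<longleftrightarrow>
     (\<forall>t\<in>{0..T}. X t \<in> borel_measurable (\<F> t)) \<and>
     (\<forall>\<omega>\<in>space M. continuous_on {0..T} (\<lambda>t. X t \<omega>)) \<and>
     (\<exists>I. ito_integral M \<F> T W b I \<and>
          (AE \<omega> in M. \<forall>t\<in>{0..T}.
             X t \<omega> = x0 + (LINT s:{0..t}|lborel. a s \<omega>) + I t \<omega>))"

abbreviation mean :: "'a measure \<Rightarrow> (real \<Rightarrow> 'a \<Rightarrow> real) \<Rightarrow> real \<Rightarrow> real" where
  "mean M X t \<equiv> prob_space.expectation M (X t)"

section \<open>The game\<close>

record params =
  k_p :: real   k_c :: real
  l_p :: real   l_c :: real
  \<sigma>_p :: real   \<sigma>_c :: real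
  s_0 :: real   q_0 :: real   c_0 :: real
  \<rho>_p :: real   \<rho>_c :: real
  \<gamma> :: real
  p_0 :: real   p_1 :: real
  \<delta> :: real
  \<eta>_p :: real   \<eta>_c :: real

definition valid_params :: "params \<Rightarrow> bool" where
  "valid_params P \<longleftrightarrow>
     k_p P > 0 \<and> k_c P > 0 \<and> l_p P \<ge> 0 \<and> l_c P \<ge> 0 \<and> \<sigma>_p P > 0 \<and> \<sigma>_c P > 0 \<and>
     s_0 P > 0 \<and> q_0 P > 0 \<and> c_0 P > 0 \<and> \<rho>_p P > 0 \<and> \<rho>_c P > 0 \<and> \<gamma> P > 0 \<and>
     p_0 P > 0 \<and> p_1 P > 0 \<and> \<delta> P > 0 \<and> \<gamma> P > p_1 P \<and> \<eta>_p P > 0 \<and> \<eta>_c P > 0"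

definition price ::
  "params \<Rightarrow> (real \<Rightarrow> 'a \<Rightarrow> real) \<Rightarrow> (real \<Rightarrow> 'a \<Rightarrow> real) \<Rightarrow> real \<Rightarrow> 'a \<Rightarrow> real" where
  "price P q c t \<omega> = s_0 P - \<rho>_p P * q t \<omega> + \<gamma> P * \<rho>_c P * c t \<omega>"

definition profit_p ::
  "params \<Rightarrow> (real \<Rightarrow> 'a \<Rightarrow> real) \<Rightarrow> (real \<Rightarrow> 'a \<Rightarrow> real) \<Rightarrow>
     (real \<Rightarrow> 'a \<Rightarrow> real) \<Rightarrow> (real \<Rightarrow> 'a \<Rightarrow> real) \<Rightarrow> real \<Rightarrow> 'a \<Rightarrow> real" where
  "profit_p P u z q c t \<omega> =
     q t \<omega> * price P q c t \<omega> - k_p P / 2 * (u t \<omega>)\<^sup>2 - l_p P / 2 * (z t \<omega> - \<sigma>_p P)\<^sup>2"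

definition profit_c ::
  "params \<Rightarrow> (real \<Rightarrow> 'a \<Rightarrow> real) \<Rightarrow> (real \<Rightarrow> 'a \<Rightarrow> real) \<Rightarrow>
     (real \<Rightarrow> 'a \<Rightarrow> real) \<Rightarrow> (real \<Rightarrow> 'a \<Rightarrow> real) \<Rightarrow> real \<Rightarrow> 'a \<Rightarrow> real" where
  "profit_c P v y q c t \<omega> =
     c t \<omega> * (p_0 P + p_1 P * price P q c t \<omega>) - \<gamma> P * c t \<omega> * (price P q c t \<omega> + \<delta> P)
     - k_c P / 2 * (v t \<omega>)\<^sup>2 - l_c P / 2 * (y t \<omega> - \<sigma>_c P)\<^sup>2"

text \<open>
  The objective functionals as functions of a player's strategy and of the states
  \<open>q\<close>, \<open>c\<close> it generates together with the opponent's strategy; the opponent's strategy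
  enters only through the states.
\<close>

definition J_p ::
  "params \<Rightarrow> real \<Rightarrow> real \<Rightarrow> 'a measure \<Rightarrow> real \<Rightarrow>
     (real \<Rightarrow> 'a \<Rightarrow> real) \<Rightarrow> (real \<Rightarrow> 'a \<Rightarrow> real) \<Rightarrow>
     (real \<Rightarrow> 'a \<Rightarrow> real) \<Rightarrow> (real \<Rightarrow> 'a \<Rightarrow> real) \<Rightarrow> real" where
  "J_p P lam F M T u z q c =
     prob_space.expectation M (\<lambda>\<omega>.
       (LINT t:{0..T}|lborel. profit_p P u z q c t \<omega>) + F - lam * price P q c T \<omega>)
     - \<eta>_p P * (LINT t:{0..T}|lborel. prob_space.variance M (\<lambda>\<omega>. lam * price P q c t \<omega>))"

definition J_c ::
  "params \<Rightarrow> real \<Rightarrow> real \<Rightarrow> 'a measure \<Rightarrow> real \<Rightarrow>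
     (real \<Rightarrow> 'a \<Rightarrow> real) \<Rightarrow> (real \<Rightarrow> 'a \<Rightarrow> real) \<Rightarrow>
     (real \<Rightarrow> 'a \<Rightarrow> real) \<Rightarrow> (real \<Rightarrow> 'a \<Rightarrow> real) \<Rightarrow> real" where
  "J_c P lam F M T v y q c =
     prob_space.expectation M (\<lambda>\<omega>.
       (LINT t:{0..T}|lborel. profit_c P v y q c t \<omega>) - F + lam * price P q c T \<omega>)
     - \<eta>_c P * (LINT t:{0..T}|lborel. prob_space.variance M (\<lambda>\<omega>. lam * price P q c t \<omega>))"

text \<open>
  Since states are unique only up to indistinguishability, the inequalities are
  required for all versions \<open>q\<close>, \<open>c\<close> of the equilibrium states and \<open>q'\<close>, \<open>c'\<close> of the
  states of a deviation.
\<close>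

definition nash_equilibrium ::
  "params \<Rightarrow> real \<Rightarrow> real \<Rightarrow> 'a measure \<Rightarrow> real \<Rightarrow>
     (real \<Rightarrow> 'a \<Rightarrow> real) \<Rightarrow> (real \<Rightarrow> 'a \<Rightarrow> real) \<Rightarrow>
     (real \<Rightarrow> 'a \<Rightarrow> real) \<times> (real \<Rightarrow> 'a \<Rightarrow> real) \<Rightarrow>
     (real \<Rightarrow> 'a \<Rightarrow> real) \<times> (real \<Rightarrow> 'a \<Rightarrow> real) \<Rightarrow> bool" where
  "nash_equilibrium P lam F M T W B = (\<lambda>(u, z) (v, y).
     let \<F> = augmented_filtration M W B;
         \<A> = admissible M \<F> T;
         state_q = state_process M \<F> T W (q_0 P);
         state_c = state_process M \<F> T B (c_0 P)
     in (u, z) \<in> \<A> \<and> (v, y) \<in> \<A> \<and>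
        (\<exists>q. state_q u z q) \<and> (\<exists>c. state_c v y c) \<and>
        (\<forall>q c. state_q u z q \<longrightarrow> state_c v y c \<longrightarrow>
           (\<forall>u' z' q'. (u', z') \<in> \<A> \<longrightarrow> state_q u' z' q' \<longrightarrow>
              J_p P lam F M T u z q c \<ge> J_p P lam F M T u' z' q' c) \<and>
           (\<forall>v' y' c'. (v', y') \<in> \<A> \<longrightarrow> state_c v' y' c' \<longrightarrow>
              J_c P lam F M T v y q c \<ge> J_c P lam F M T v' y' q c')))"

section \<open>Coefficient functions and the Riccati system\<close>

definition K_p :: "params \<Rightarrow> real \<Rightarrow> real \<Rightarrow> real \<Rightarrow> real" where
  "K_p P lam T t =
     (let a = sqrt (2 * (\<rho>_p P + \<eta>_p P * lam\<^sup>2 * (\<rho>_p P)\<^sup>2) / k_p P)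
      in - (k_p P / 2) * a * tanh (a * (T - t)))"

definition \<Lambda>_p :: "params \<Rightarrow> real \<Rightarrow> real \<Rightarrow> real" where
  "\<Lambda>_p P T t =
     (let a = sqrt (2 * \<rho>_p P / k_p P) in - (k_p P / 2) * a * tanh (a * (T - t)))"

definition K_c :: "params \<Rightarrow> real \<Rightarrow> real \<Rightarrow> real \<Rightarrow> real" where
  "K_c P lam T t =
     (let a = sqrt (2 * (\<gamma> P * \<rho>_c P * (\<gamma> P - p_1 P)
                         + \<eta>_c P * lam\<^sup>2 * (\<gamma> P)\<^sup>2 * (\<rho>_c P)\<^sup>2) / k_c P)
      in - (k_c P / 2) * a * tanh (a * (T - t)))"

definition \<Lambda>_c :: "params \<Rightarrow> real \<Rightarrow> real \<Rightarrow> real" where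
  "\<Lambda>_c P T t =
     (let a = sqrt (2 * \<gamma> P * \<rho>_c P * (\<gamma> P - p_1 P) / k_c P)
      in - (k_c P / 2) * a * tanh (a * (T - t)))"

definition mat2 :: "real \<Rightarrow> real \<Rightarrow> real \<Rightarrow> real \<Rightarrow> real^2^2" where
  "mat2 a b c d = vector [vector [a, b], vector [c, d]]"

definition \<Xi> :: "params \<Rightarrow> real \<Rightarrow> real^2^2" where
  "\<Xi> P lam = mat2
     0
     (- (\<rho>_p P * \<gamma> P * \<rho>_c P * \<eta>_p P * lam\<^sup>2) - \<gamma> P * \<rho>_c P / 2)
     (- (\<rho>_p P * \<gamma> P * \<rho>_c P * \<eta>_c P * lam\<^sup>2) - \<rho>_p P * (\<gamma> P - p_1 P) / 2)
     0"

definition \<Xi>_hat :: "params \<Rightarrow> real^2^2" where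
  "\<Xi>_hat P = mat2 0 (- (\<gamma> P * \<rho>_c P / 2)) (- (\<rho>_p P * (\<gamma> P - p_1 P) / 2)) 0"

definition R_mat :: "params \<Rightarrow> real^2^2" where
  "R_mat P = mat2 (- 2 / k_p P) 0 0 (- 2 / k_c P)"

definition \<Phi> :: "params \<Rightarrow> real \<Rightarrow> real \<Rightarrow> real \<Rightarrow> real^2^2" where
  "\<Phi> P lam T t = mat2 (- 2 / k_p P * K_p P lam T t) 0 0 (- 2 / k_c P * K_c P lam T t)"

definition \<Phi>_hat :: "params \<Rightarrow> real \<Rightarrow> real \<Rightarrow> real^2^2" where
  "\<Phi>_hat P T t = mat2 (- 2 / k_p P * \<Lambda>_p P T t) 0 0 (- 2 / k_c P * \<Lambda>_c P T t)"

definition \<Psi> :: "params \<Rightarrow> real^2" where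
  "\<Psi> P = vector [- s_0 P / 2, - (p_0 P + p_1 P * s_0 P - \<gamma> P * (\<delta> P + s_0 P)) / 2]"

definition riccati_rhs :: "params \<Rightarrow> real \<Rightarrow> real \<Rightarrow> real \<Rightarrow> real^2^2 \<Rightarrow> real^2^2" where
  "riccati_rhs P lam T t X =
     \<Xi> P lam + \<Phi> P lam T t ** X + X ** \<Phi> P lam T t + X ** R_mat P ** X"

definition riccati_hat_rhs :: "params \<Rightarrow> real \<Rightarrow> real \<Rightarrow> real^2^2 \<Rightarrow> real^2^2" where
  "riccati_hat_rhs P T t X =
     \<Xi>_hat P + \<Phi>_hat P T t ** X + X ** \<Phi>_hat P T t + X ** R_mat P ** X"

definition riccati_solution ::
  "params \<Rightarrow> real \<Rightarrow> real \<Rightarrow> (real \<Rightarrow> real^2^2) \<Rightarrow> (real \<Rightarrow> real^2^2) \<Rightarrow> bool" where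
  "riccati_solution P lam T X X_hat \<longleftrightarrow>
     X T = 0 \<and> X_hat T = 0 \<and>
     (\<forall>t\<in>{0..T}.
        (X has_vector_derivative riccati_rhs P lam T t (X t)) (at t within {0..T}) \<and>
        (X_hat has_vector_derivative riccati_hat_rhs P T t (X_hat t)) (at t within {0..T}))"

definition h_solution ::
  "params \<Rightarrow> real \<Rightarrow> real \<Rightarrow> (real \<Rightarrow> real^2^2) \<Rightarrow> (real \<Rightarrow> real^2) \<Rightarrow> bool" where
  "h_solution P lam T X_hat h \<longleftrightarrow>
     h T = (lam / 2) *\<^sub>R vector [\<rho>_p P, \<gamma> P * \<rho>_c P] \<and>
     (\<forall>t\<in>{0..T}.
        (h has_vector_derivative ((X_hat t ** R_mat P + \<Phi>_hat P T t) *v h t + \<Psi> P))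
          (at t within {0..T}))"

text \<open>
  The system after time inversion \<open>t \<mapsto> T - t\<close>, as an initial value problem on \<open>[0,\<tau>]\<close>.
  The coefficients depend on horizon and time only through the remaining time, so
  at inverted time \<open>s\<close> they are those for horizon \<open>s\<close> and time \<open>0\<close>.
\<close>

definition inverted_riccati_solution ::
  "params \<Rightarrow> real \<Rightarrow> real \<Rightarrow> (real \<Rightarrow> real^2^2) \<Rightarrow> (real \<Rightarrow> real^2^2) \<Rightarrow> bool" where
  "inverted_riccati_solution P lam \<tau> X X_hat \<longleftrightarrow>
     X 0 = 0 \<and> X_hat 0 = 0 \<and>
     (\<forall>s\<in>{0..\<tau>}.
        (X has_vector_derivative - riccati_rhs P lam s 0 (X s)) (at s within {0..\<tau>}) \<and>
        (X_hat has_vector_derivative - riccati_hat_rhs P s 0 (X_hat s)) (at s within {0..\<tau>}))"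

definition T_max :: "params \<Rightarrow> real \<Rightarrow> ereal" where
  "T_max P lam = Sup {ereal \<tau> | \<tau>. \<tau> > 0 \<and>
     (\<exists>X X_hat. inverted_riccati_solution P lam \<tau> X X_hat \<and>
        (\<forall>Z Z_hat. inverted_riccati_solution P lam \<tau> Z Z_hat \<longrightarrow>
           (\<forall>s\<in>{0..\<tau>}. Z s = X s \<and> Z_hat s = X_hat s)))}"

section \<open>Equilibrium volatilities and remainder terms\<close>

definition z_star :: "params \<Rightarrow> real \<Rightarrow> real \<Rightarrow> (real \<Rightarrow> real^2^2) \<Rightarrow> real \<Rightarrow> real" where
  "z_star P lam T X t = \<sigma>_p P * l_p P / (l_p P - 2 * (K_p P lam T t + X t $ 1 $ 1))"

definition y_star :: "params \<Rightarrow> real \<Rightarrow> real \<Rightarrow> (real \<Rightarrow> real^2^2) \<Rightarrow> real \<Rightarrow> real" where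
  "y_star P lam T X t = \<sigma>_c P * l_c P / (l_c P - 2 * (K_c P lam T t + X t $ 2 $ 2))"

text \<open>\<open>Y_i\<close> is \<open>Y\<^sup>p\<close> for \<open>i = 1\<close> and \<open>Y\<^sup>c\<close> for \<open>i = 2\<close>.\<close>

definition Y_i ::
  "2 \<Rightarrow> 'a measure \<Rightarrow> (real \<Rightarrow> real^2^2) \<Rightarrow> (real \<Rightarrow> real^2^2) \<Rightarrow> (real \<Rightarrow> real^2) \<Rightarrow>
     (real \<Rightarrow> 'a \<Rightarrow> real) \<Rightarrow> (real \<Rightarrow> 'a \<Rightarrow> real) \<Rightarrow> real \<Rightarrow> 'a \<Rightarrow> real" where
  "Y_i i M X X_hat h q c t \<omega> =
     X t $ i $ 1 * (q t \<omega> - mean M q t) + X t $ i $ 2 * (c t \<omega> - mean M c t)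
     + X_hat t $ i $ 1 * mean M q t + X_hat t $ i $ 2 * mean M c t + h t $ i"

definition Y_bar ::
  "2 \<Rightarrow> 'a measure \<Rightarrow> (real \<Rightarrow> real^2^2) \<Rightarrow> (real \<Rightarrow> real^2) \<Rightarrow>
     (real \<Rightarrow> 'a \<Rightarrow> real) \<Rightarrow> (real \<Rightarrow> 'a \<Rightarrow> real) \<Rightarrow> real \<Rightarrow> real" where
  "Y_bar i M X_hat h q c t =
     X_hat t $ i $ 1 * mean M q t + X_hat t $ i $ 2 * mean M c t + h t $ i"

definition R_p ::
  "params \<Rightarrow> real \<Rightarrow> 'a measure \<Rightarrow> real \<Rightarrow>
     (real \<Rightarrow> real^2^2) \<Rightarrow> (real \<Rightarrow> real^2^2) \<Rightarrow> (real \<Rightarrow> real^2) \<Rightarrow>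
     (real \<Rightarrow> 'a \<Rightarrow> real) \<Rightarrow> (real \<Rightarrow> 'a \<Rightarrow> real) \<Rightarrow> real" where
  "R_p P lam M T X X_hat h q c =
     (LINT t:{0..T}|lborel.
        2 / k_p P * prob_space.expectation M (\<lambda>\<omega>. (Y_i 1 M X X_hat h q c t \<omega>)\<^sup>2)
        - \<eta>_p P * lam\<^sup>2 * (\<gamma> P)\<^sup>2 * (\<rho>_c P)\<^sup>2 * prob_space.variance M (c t)
        + 2 * (X t $ 1 $ 1 * z_star P lam T X t + l_p P * \<sigma>_p P / 2)\<^sup>2
            / (l_p P - 2 * K_p P lam T t))
     - lam * \<gamma> P * \<rho>_c P * mean M c T"

definition R_c ::
  "params \<Rightarrow> real \<Rightarrow> 'a measure \<Rightarrow> real \<Rightarrow>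
     (real \<Rightarrow> real^2^2) \<Rightarrow> (real \<Rightarrow> real^2^2) \<Rightarrow> (real \<Rightarrow> real^2) \<Rightarrow>
     (real \<Rightarrow> 'a \<Rightarrow> real) \<Rightarrow> (real \<Rightarrow> 'a \<Rightarrow> real) \<Rightarrow> real" where
  "R_c P lam M T X X_hat h q c =
     (LINT t:{0..T}|lborel.
        2 / k_c P * prob_space.expectation M (\<lambda>\<omega>. (Y_i 2 M X X_hat h q c t \<omega>)\<^sup>2)
        - \<eta>_c P * lam\<^sup>2 * (\<rho>_p P)\<^sup>2 * prob_space.variance M (q t)
        + 2 * (X t $ 2 $ 2 * y_star P lam T X t + l_c P * \<sigma>_c P / 2)\<^sup>2
            / (l_c P - 2 * K_c P lam T t))
     - lam * \<rho>_p P * mean M q T"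

end

theory Submission
  imports Defs
begin

text \<open>
  Freeze the strategy of one player. The payoff of the other player is concave in his control and
  state, so a strategy is optimal as soon as the first order term of a deviation vanishes. The
  adjoint process of the candidate is \<open>p = k u\<close>; the feedback form of \<open>u\<close>, the Riccati equations and
  the equation for \<open>h\<close> say that \<open>p\<close> has exactly the drift, the volatility and the terminal value that
  cancel this term by the product rule for \<open>E (\<Delta>\<^sub>T p\<^sub>T)\<close>, where \<open>\<Delta>\<close> is the deviation of the state.
  The equilibrium payoffs come from the same product rule applied to
  \<open>E (x\<^sub>T (p\<^sub>T - K (x\<^sub>T - E x\<^sub>T) - \<Lambda> E x\<^sub>T))\<close>. Only product rules in expectation are needed, so that the Ito
  isometry and the martingale property replace the Ito formula.

  The equilibrium volatilities are deterministic and continuously differentiable. Their stochastic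
  integrals can thus be defined pathwise by partial integration, and the linear state equation is
  solved pathwise by variation of constants.
\<close>

section \<open>Square integrable functions\<close>

text \<open>The variance penalty makes the problem one of mean-field type: its derivative along a
  deviation \<open>\<Delta>\<close> contains \<open>\<Delta> - E \<Delta>\<close>. This factor is
  paired with a centred variable, so the mean of \<open>\<Delta>\<close> drops out and an ordinary
  adjoint equation remains. Fluctuations and means of the states then evolve separately, which is
  why \<open>K\<close>, \<open>\<pi>\<close> govern the former and \<open>\<Lambda>\<close>,
  \<open>\<pi>_hat\<close>, \<open>h\<close> the latter. A deviation may use any square integrable
  random volatility. Isometry and martingale property are therefore needed for general integrands,
  but such integrals always come with a given state; integrals have to be constructed only for the
  deterministic equilibrium volatilities. States are determined up to null sets only, and the
  equilibrium inequalities concern every version of them. Hence the feedback formulas enter the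
  optimality argument as almost sure identities at each fixed time, not as identities of
  paths.\<close>

definition l2 :: "'a measure \<Rightarrow> ('a \<Rightarrow> real) \<Rightarrow> bool" where
  "l2 N f \<longleftrightarrow> f \<in> borel_measurable N \<and> integrable N (\<lambda>x. (f x)\<^sup>2)"

lemma l2_measurable: "l2 N f \<Longrightarrow> f \<in> borel_measurable N"
  by (simp add: l2_def)

lemma l2_integrable_sq: "l2 N f \<Longrightarrow> integrable N (\<lambda>x. (f x)\<^sup>2)"
  by (simp add: l2_def)

lemma l2_integrable_mult:
  assumes "l2 N f" "l2 N g"
  shows "integrable N (\<lambda>x. f x * g x)"
proof (rule Bochner_Integration.integrable_bound)
  show "integrable N (\<lambda>x. (f x)\<^sup>2 + (g x)\<^sup>2)"
    using assms by (auto simp: l2_def)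
  show "(\<lambda>x. f x * g x) \<in> borel_measurable N" using assms by (auto simp: l2_def)
  show "AE x in N. norm (f x * g x) \<le> norm ((f x)\<^sup>2 + (g x)\<^sup>2)"
  proof (intro AE_I2)
    fix x
    have "0 \<le> (\<bar>f x\<bar> - \<bar>g x\<bar>)\<^sup>2" by simp
    then have "2 * (\<bar>f x\<bar> * \<bar>g x\<bar>) \<le> (f x)\<^sup>2 + (g x)\<^sup>2"
      by (simp add: power2_eq_square algebra_simps)
    moreover have "0 \<le> \<bar>f x\<bar> * \<bar>g x\<bar>" by simp
    ultimately show "norm (f x * g x) \<le> norm ((f x)\<^sup>2 + (g x)\<^sup>2)"
      unfolding real_norm_def abs_mult by linarith
  qed
qed

lemma l2_add:
  assumes "l2 N f" "l2 N g"
  shows "l2 N (\<lambda>x. f x + g x)"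
  using assms l2_integrable_mult[OF assms]
  by (auto simp: l2_def power2_sum mult.assoc)

lemma l2_cmult: "l2 N f \<Longrightarrow> l2 N (\<lambda>x. c * f x)"
  by (auto simp: l2_def power_mult_distrib)

lemma l2_diff:
  assumes "l2 N f" "l2 N g"
  shows "l2 N (\<lambda>x. f x - g x)"
  using l2_add[OF assms(1) l2_cmult[OF assms(2), of "-1"]] by simp

lemma l2_const: "finite_measure N \<Longrightarrow> l2 N (\<lambda>x. c)"
  by (simp add: l2_def finite_measure.integrable_const)

lemma l2_integrable: "finite_measure N \<Longrightarrow> l2 N f \<Longrightarrow> integrable N f"
  using l2_integrable_mult[of N f "\<lambda>_. 1"] l2_const[of N 1] by simp

lemma l2_bounded_mult:
  assumes "l2 N f" "g \<in> borel_measurable N" "\<And>x. x \<in> space N \<Longrightarrow> \<bar>g x\<bar> \<le> C"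
  shows "l2 N (\<lambda>x. g x * f x)"
  unfolding l2_def
proof
  show "(\<lambda>x. g x * f x) \<in> borel_measurable N" using assms by (auto simp: l2_def)
  show "integrable N (\<lambda>x. (g x * f x)\<^sup>2)"
  proof (rule Bochner_Integration.integrable_bound)
    show "integrable N (\<lambda>x. C\<^sup>2 * (f x)\<^sup>2)" using assms(1) by (simp add: l2_def)
    show "(\<lambda>x. (g x * f x)\<^sup>2) \<in> borel_measurable N" using assms by (auto simp: l2_def)
    show "AE x in N. norm ((g x * f x)\<^sup>2) \<le> norm (C\<^sup>2 * (f x)\<^sup>2)"
    proof (intro AE_I2)
      fix x assume "x \<in> space N"
      then have "(g x)\<^sup>2 \<le> C\<^sup>2" by (metis assms(3) abs_ge_zero power2_abs power_mono)
      then show "norm ((g x * f x)\<^sup>2) \<le> norm (C\<^sup>2 * (f x)\<^sup>2)"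
        by (simp add: power_mult_distrib mult_right_mono)
    qed
  qed
qed

lemma l2_bounded:
  assumes "finite_measure N" "g \<in> borel_measurable N" "\<And>x. x \<in> space N \<Longrightarrow> \<bar>g x\<bar> \<le> C"
  shows "l2 N g"
  using l2_bounded_mult[OF l2_const[OF assms(1), of 1] assms(2,3)] by simp

lemma l2_sum: "(\<And>i. i \<in> I \<Longrightarrow> l2 N (f i)) \<Longrightarrow> l2 N (\<lambda>x. \<Sum>i\<in>I. f i x)"
proof (induction I rule: infinite_finite_induct)
  case (insert i I)
  then show ?case using l2_add[of N "f i" "\<lambda>x. \<Sum>i\<in>I. f i x"] by simp
qed (auto simp: l2_def)

lemma l2_cong_AE:
  assumes "l2 N f" "AE x in N. f x = g x" "g \<in> borel_measurable N"
  shows "l2 N g"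
proof -
  have "integrable N (\<lambda>x. (f x)\<^sup>2) \<longleftrightarrow> integrable N (\<lambda>x. (g x)\<^sup>2)"
    using assms by (intro integrable_cong_AE) (auto simp: l2_def)
  then show ?thesis using assms by (simp add: l2_def)
qed

text \<open>The second moment of \<open>f - r * g\<close> is a nonnegative quadratic polynomial in
  \<open>r\<close>. Evaluating it at its minimiser gives the inequality; for \<open>?a = 0\<close>
  it is affine, and nonnegativity forces the slope to vanish.\<close>

lemma l2_Cauchy_Schwarz:
  assumes "l2 N f" "l2 N g"
  shows "(\<integral>x. f x * g x \<partial>N)\<^sup>2 \<le> (\<integral>x. (f x)\<^sup>2 \<partial>N) * (\<integral>x. (g x)\<^sup>2 \<partial>N)"
proof -
  let ?a = "\<integral>x. (g x)\<^sup>2 \<partial>N" and ?b = "\<integral>x. f x * g x \<partial>N" and ?c = "\<integral>x. (f x)\<^sup>2 \<partial>N"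
  have q: "0 \<le> ?c - 2 * r * ?b + r\<^sup>2 * ?a" for r
  proof -
    have "0 \<le> (\<integral>x. (f x - r * g x)\<^sup>2 \<partial>N)" by simp
    also have "\<dots> = (\<integral>x. (f x)\<^sup>2 - 2 * r * (f x * g x) + r\<^sup>2 * (g x)\<^sup>2 \<partial>N)"
      by (intro Bochner_Integration.integral_cong) (auto simp: power2_eq_square algebra_simps)
    also have "\<dots> = ?c - 2 * r * ?b + r\<^sup>2 * ?a"
      using assms l2_integrable_mult[OF assms] by (simp add: l2_def)
    finally show ?thesis .
  qed
  have a0: "0 \<le> ?a" by simp
  show ?thesis
  proof (cases "?a = 0")
    case False
    then have "?a > 0" using a0 by linarith
    have "0 \<le> ?c - 2 * (?b / ?a) * ?b + (?b / ?a)\<^sup>2 * ?a" by (rule q)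
    also have "\<dots> = ?c - ?b\<^sup>2 / ?a" using False by (simp add: power2_eq_square)
    finally have "?b\<^sup>2 / ?a \<le> ?c" by simp
    then show ?thesis using \<open>?a > 0\<close> by (simp add: pos_divide_le_eq)
  next
    case True
    have "?b = 0"
    proof (rule ccontr)
      assume nz: "?b \<noteq> 0"
      \<comment> \<open>Here \<open>r\<close> is chosen so that the affine function takes the value
        \<open>-1\<close>.\<close>
      have "0 \<le> ?c - 2 * ((?c + 1) / (2 * ?b)) * ?b" using q[of "(?c + 1) / (2 * ?b)"] True by simp
      also have "\<dots> = -1" using nz by (simp add: field_simps)
      finally show False by simp
    qed
    then show ?thesis using True by simp
  qed
qed

text \<open>Expand around the limits. By Cauchy-Schwarz the product of the two errors vanishes, and
  so do the two mixed terms, in which one factor is fixed.\<close>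

lemma l2_tendsto_mult:
  assumes X: "\<And>k. l2 N (X k)" "l2 N x" "(\<lambda>k. \<integral>w. (X k w - x w)\<^sup>2 \<partial>N) \<longlonglongrightarrow> 0"
    and Y: "\<And>k. l2 N (Y k)" "l2 N y" "(\<lambda>k. \<integral>w. (Y k w - y w)\<^sup>2 \<partial>N) \<longlonglongrightarrow> 0"
  shows "(\<lambda>k. \<integral>w. X k w * Y k w \<partial>N) \<longlonglongrightarrow> (\<integral>w. x w * y w \<partial>N)"
proof -
  have cs: "(\<lambda>k. \<integral>w. f k w * g k w \<partial>N) \<longlonglongrightarrow> 0"
    if f: "\<And>k. l2 N (f k)" "\<And>k. l2 N (g k)"
      "(\<lambda>k. (\<integral>w. (f k w)\<^sup>2 \<partial>N) * (\<integral>w. (g k w)\<^sup>2 \<partial>N)) \<longlonglongrightarrow> 0"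
    for f g :: "nat \<Rightarrow> 'a \<Rightarrow> real"
  proof -
    have "(\<lambda>k. (\<integral>w. f k w * g k w \<partial>N)\<^sup>2) \<longlonglongrightarrow> 0"
      by (rule tendsto_sandwich[OF _ _ tendsto_const f(3)])
         (auto intro!: always_eventually l2_Cauchy_Schwarz f)
    then show ?thesis by simp
  qed
  have dX: "l2 N (\<lambda>w. X k w - x w)" for k using X by (intro l2_diff)
  have dY: "l2 N (\<lambda>w. Y k w - y w)" for k using Y by (intro l2_diff)
  have 1: "(\<lambda>k. \<integral>w. (X k w - x w) * (Y k w - y w) \<partial>N) \<longlonglongrightarrow> 0"
    by (rule cs[OF dX dY]) (use tendsto_mult[OF X(3) Y(3)] in simp)
  have 2: "(\<lambda>k. \<integral>w. (X k w - x w) * y w \<partial>N) \<longlonglongrightarrow> 0"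
    by (rule cs[OF dX Y(2)]) (use tendsto_mult_left_zero[OF X(3)] in simp)
  have 3: "(\<lambda>k. \<integral>w. x w * (Y k w - y w) \<partial>N) \<longlonglongrightarrow> 0"
    by (rule cs[OF X(2) dY]) (use tendsto_mult_right_zero[OF Y(3)] in simp)
  have "(\<integral>w. X k w * Y k w \<partial>N) = (\<integral>w. (X k w - x w) * (Y k w - y w) \<partial>N)
     + (\<integral>w. (X k w - x w) * y w \<partial>N) + (\<integral>w. x w * (Y k w - y w) \<partial>N) + (\<integral>w. x w * y w \<partial>N)" for k
  proof -
    have "(\<integral>w. X k w * Y k w \<partial>N) = (\<integral>w. (X k w - x w) * (Y k w - y w)
        + (X k w - x w) * y w + x w * (Y k w - y w) + x w * y w \<partial>N)"
      by (intro Bochner_Integration.integral_cong) (auto simp: algebra_simps)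
    also have "\<dots> = (\<integral>w. (X k w - x w) * (Y k w - y w) \<partial>N)
     + (\<integral>w. (X k w - x w) * y w \<partial>N) + (\<integral>w. x w * (Y k w - y w) \<partial>N) + (\<integral>w. x w * y w \<partial>N)"
      using l2_integrable_mult[OF dX dY] l2_integrable_mult[OF dX Y(2)]
        l2_integrable_mult[OF X(2) dY] l2_integrable_mult[OF X(2) Y(2)] by simp
    finally show ?thesis .
  qed
  then show ?thesis
    using tendsto_add[OF tendsto_add[OF tendsto_add[OF 1 2] 3] tendsto_const[of "\<integral>w. x w * y w \<partial>N"]] by simp
qed

lemma l2_nn:
  assumes "f \<in> borel_measurable N" "(\<integral>\<^sup>+x. ennreal ((f x)\<^sup>2) \<partial>N) < \<infinity>"
  shows "l2 N f"
  using assms by (auto simp: l2_def integrable_iff_bounded)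

lemma l2_nn_eq:
  assumes "l2 N f"
  shows "(\<integral>\<^sup>+x. ennreal ((f x)\<^sup>2) \<partial>N) = ennreal (\<integral>x. (f x)\<^sup>2 \<partial>N)"
  using assms by (intro nn_integral_eq_integral) (auto simp: l2_def)

text \<open>The Ito integral is defined through limits of nonnegative integrals. Convergence to 0
  makes these eventually finite, and a single approximant at finite distance already shows that the
  limit is square integrable. From then on the limits can be read as limits of real
  integrals.\<close>

lemma l2_nn_tendsto:
  assumes X: "\<And>k. l2 N (X k)" and x: "x \<in> borel_measurable N"
    and lim: "(\<lambda>k. \<integral>\<^sup>+w. ennreal ((X k w - x w)\<^sup>2) \<partial>N) \<longlonglongrightarrow> 0"
  shows "l2 N x" "(\<lambda>k. \<integral>w. (X k w - x w)\<^sup>2 \<partial>N) \<longlonglongrightarrow> 0"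
proof -
  have "eventually (\<lambda>k. (\<integral>\<^sup>+w. ennreal ((X k w - x w)\<^sup>2) \<partial>N) < 1) sequentially"
    using lim by (rule order_tendstoD) simp
  then obtain k where "(\<integral>\<^sup>+w. ennreal ((X k w - x w)\<^sup>2) \<partial>N) < 1"
    by (auto simp: eventually_sequentially)
  then have "(\<integral>\<^sup>+w. ennreal ((X k w - x w)\<^sup>2) \<partial>N) < \<infinity>"
    using order_less_trans by fastforce
  then have "l2 N (\<lambda>w. X k w - x w)"
    using x l2_measurable[OF X] by (intro l2_nn) auto
  from l2_diff[OF X[of k] this] show x2: "l2 N x" by simp
  have "(\<lambda>k. ennreal (\<integral>w. (X k w - x w)\<^sup>2 \<partial>N)) \<longlonglongrightarrow> ennreal 0"
    using lim l2_nn_eq[OF l2_diff[OF X x2]] by simp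
  then show "(\<lambda>k. \<integral>w. (X k w - x w)\<^sup>2 \<partial>N) \<longlonglongrightarrow> 0"
    by (subst (asm) tendsto_ennreal_iff) auto
qed

text \<open>Time is rounded down to multiples of \<open>1 / real (Suc n)\<close>: the rounded
  process takes countably many times, hence is jointly measurable, and path continuity gives
  pointwise convergence. Rounding down keeps the time inside \<open>{0..t}\<close>. Taking
  \<open>N\<close> as \<open>M\<close> serves the states, taking it as \<open>F t\<close> the
  adaptedness of time integrals.\<close>

lemma continuous_paths_joint_measurable:
  fixes X :: "real \<Rightarrow> 'a \<Rightarrow> real"
  assumes meas: "\<And>s. s \<in> {0..t} \<Longrightarrow> X s \<in> borel_measurable N"
    and cont: "\<And>\<omega>. \<omega> \<in> space N \<Longrightarrow> continuous_on {0..t} (\<lambda>s. X s \<omega>)"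
  shows "(\<lambda>(s, \<omega>). X s \<omega>) \<in> borel_measurable (restrict_space borel {0..t} \<Otimes>\<^sub>M N)"
proof -
  let ?r = "\<lambda>n s. real_of_int \<lfloor>s * real (Suc n)\<rfloor> / real (Suc n)"
  define G where "G n = (\<lambda>x. case x of (s, \<omega>) \<Rightarrow> if ?r n s \<in> {0..t} then X (?r n s) \<omega> else 0)" for n
  show ?thesis
  proof (rule borel_measurable_LIMSEQ_real)
    fix n
    have *: "(\<lambda>x. if real_of_int i / real (Suc n) \<in> {0..t} then X (real_of_int i / real (Suc n)) (snd x) else 0)
        \<in> borel_measurable (restrict_space borel {0..t} \<Otimes>\<^sub>M N)" for i
    proof (cases "real_of_int i / real (Suc n) \<in> {0..t}")
      case True
      show ?thesis
        unfolding if_P[OF True] by (rule measurable_compose[OF measurable_snd meas[OF True]])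
    next
      case False
      show ?thesis unfolding if_not_P[OF False] by simp
    qed
    have "fst \<in> borel_measurable (restrict_space borel {0..t} \<Otimes>\<^sub>M N)"
      using measurable_compose[OF measurable_fst measurable_restrict_space1[OF measurable_ident]]
      by (simp add: id_def)
    then have "(\<lambda>x. \<lfloor>fst x * real (Suc n)\<rfloor>) \<in> restrict_space borel {0..t} \<Otimes>\<^sub>M N \<rightarrow>\<^sub>M count_space UNIV"
      by measurable
    from measurable_compose_countable[OF * this]
    show "G n \<in> borel_measurable (restrict_space borel {0..t} \<Otimes>\<^sub>M N)"
      by (simp add: G_def case_prod_beta)
  next
    fix x assume "x \<in> space (restrict_space borel {0..t} \<Otimes>\<^sub>M N)"
    then obtain s \<omega> where x: "x = (s, \<omega>)" "s \<in> {0..t}" "\<omega> \<in> space N"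
      by (auto simp: space_pair_measure)
    have r: "?r n s \<in> {0..t}" for n
    proof -
      have "0 \<le> ?r n s" using x by simp
      moreover have "?r n s \<le> s" by (simp add: pos_divide_le_eq)
      ultimately show ?thesis using x by auto
    qed
    have lim: "(\<lambda>n. ?r n s) \<longlonglongrightarrow> s"
    proof (rule tendsto_sandwich[where f = "\<lambda>n. s - inverse (real (Suc n))" and h = "\<lambda>_. s"])
      have "s - inverse (real (Suc n)) \<le> ?r n s" for n
      proof -
        have "s * real (Suc n) - 1 \<le> real_of_int \<lfloor>s * real (Suc n)\<rfloor>" by linarith
        then show ?thesis
          by (simp add: pos_le_divide_eq left_diff_distrib inverse_eq_divide)
      qed
      then show "\<forall>\<^sub>F n in sequentially. s - inverse (real (Suc n)) \<le> ?r n s" by simp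
      show "\<forall>\<^sub>F n in sequentially. ?r n s \<le> s" by (simp add: pos_divide_le_eq)
      show "(\<lambda>n. s - inverse (real (Suc n))) \<longlonglongrightarrow> s"
        using tendsto_diff[OF tendsto_const LIMSEQ_inverse_real_of_nat] by simp
    qed simp
    have "(\<lambda>n. X (?r n s) \<omega>) \<longlonglongrightarrow> X s \<omega>"
    proof -
      have "\<And>y a. a \<in> {0..t} \<Longrightarrow> (\<forall>n. y n \<in> {0..t}) \<Longrightarrow> y \<longlonglongrightarrow> a \<Longrightarrow> (\<lambda>n. X (y n) \<omega>) \<longlonglongrightarrow> X a \<omega>"
        using cont[OF x(3)] unfolding continuous_on_sequentially comp_def by blast
      from this[OF x(2) _ lim] show ?thesis using r by (simp only: simp_thms)
    qed
    then show "(\<lambda>n. G n x) \<longlonglongrightarrow> (\<lambda>(s, \<omega>). X s \<omega>) x"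
      using r by (simp add: G_def x)
  qed
qed

section \<open>Absolutely continuous functions\<close>

text \<open>The product of the two integrals is an integral over the plane. Splitting the plane
  along the diagonal and integrating each half in a suitable order gives the two terms. This is
  partial integration for densities that are merely integrable.\<close>

lemma integral_triangles:
  fixes f g :: "real \<Rightarrow> real"
  assumes f: "integrable lborel f" and g: "integrable lborel g"
  shows "integrable lborel (\<lambda>s. f s * (\<integral>r. indicator {..s} r * g r \<partial>lborel))"
    and "(\<integral>s. f s * (\<integral>r. indicator {..s} r * g r \<partial>lborel) \<partial>lborel)
      + (\<integral>s. g s * (\<integral>r. indicator {..s} r * f r \<partial>lborel) \<partial>lborel)
      = (\<integral>s. f s \<partial>lborel) * (\<integral>s. g s \<partial>lborel)"
proof -
  have mf[measurable]: "f \<in> borel_measurable borel" and mg[measurable]: "g \<in> borel_measurable borel"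
    using f g by auto
  define h where "h A x = f (fst x) * g (snd x) * indicator A x" for A :: "(real \<times> real) set" and x
  let ?P = "lborel \<Otimes>\<^sub>M lborel :: (real \<times> real) measure"
  define U where "U = {x::real\<times>real. snd x \<le> fst x}"
  define V where "V = {x::real\<times>real. fst x < snd x}"
  have hU: "integrable ?P (h UNIV)"
  proof (rule lborel_pair.Fubini_integrable)
    show "h UNIV \<in> borel_measurable ?P" unfolding h_def by measurable
    show "integrable lborel (\<lambda>x. \<integral>y. norm (h UNIV (x, y)) \<partial>lborel)"
      using f by (simp add: h_def abs_mult)
    show "AE x in lborel. integrable lborel (\<lambda>y. h UNIV (x, y))"
      using g by (simp add: h_def)
  qed
  have "U = {x \<in> space ?P. snd x \<le> fst x}" "V = {x \<in> space ?P. fst x < snd x}"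
    by (auto simp: U_def V_def space_pair_measure)
  moreover have "{x \<in> space ?P. snd x \<le> fst x} \<in> sets ?P" "{x \<in> space ?P. fst x < snd x} \<in> sets ?P"
    by measurable
  ultimately have sets[measurable]: "U \<in> sets ?P" "V \<in> sets ?P" by metis+
  have hA: "integrable ?P (h A)" if [measurable]: "A \<in> sets ?P" for A
  proof (rule Bochner_Integration.integrable_bound[OF hU])
    show "h A \<in> borel_measurable ?P" unfolding h_def by measurable
    show "AE x in ?P. norm (h A x) \<le> norm (h UNIV x)" by (auto simp: h_def indicator_def)
  qed
  have inner1: "(\<integral>y. h U (s, y) \<partial>lborel) = f s * (\<integral>r. indicator {..s} r * g r \<partial>lborel)" for s
  proof -
    have "(\<integral>y. h U (s, y) \<partial>lborel) = (\<integral>r. f s * (indicator {..s} r * g r) \<partial>lborel)"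
      by (intro Bochner_Integration.integral_cong) (auto simp: h_def U_def indicator_def)
    then show ?thesis by simp
  qed
  have inner2: "(\<integral>x. h V (x, s) \<partial>lborel) = g s * (\<integral>r. indicator {..s} r * f r \<partial>lborel)" for s
  proof -
    have "(\<integral>x. h V (x, s) \<partial>lborel) = (\<integral>r. g s * (indicator {..s} r * f r) \<partial>lborel)"
    proof (rule integral_cong_AE)
      \<comment> \<open>\<open>V\<close> omits the diagonal while the half-line includes its end
        point; the difference is a null set.\<close>
      have "AE x in lborel. x \<noteq> s" by (rule AE_lborel_singleton)
      then show "AE x in lborel. h V (x, s) = g s * (indicator {..s} x * f x)"
        by eventually_elim (auto simp: h_def V_def indicator_def)
      show "(\<lambda>x. h V (x, s)) \<in> borel_measurable lborel"
      proof -
        have "h V \<in> borel_measurable ?P" unfolding h_def by measurable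
        then show ?thesis by (rule measurable_compose[rotated]) simp
      qed
    qed simp
    then show ?thesis by simp
  qed
  show 1: "integrable lborel (\<lambda>s. f s * (\<integral>r. indicator {..s} r * g r \<partial>lborel))"
    using lborel_pair.integrable_fst'[OF hA[OF sets(1)]] unfolding inner1 .
  have "(\<integral>s. f s * (\<integral>r. indicator {..s} r * g r \<partial>lborel) \<partial>lborel)
      + (\<integral>s. g s * (\<integral>r. indicator {..s} r * f r \<partial>lborel) \<partial>lborel)
    = (\<integral>x. h U x \<partial>?P) + (\<integral>x. h V x \<partial>?P)"
    using lborel_pair.integral_fst'[OF hA[OF sets(1)]] lborel_pair.integral_snd[of "\<lambda>x y. h V (x, y)"] hA[OF sets(2)]
    by (simp add: inner1 inner2)
  also have "\<dots> = (\<integral>x. h U x + h V x \<partial>?P)" using hA[OF sets(1)] hA[OF sets(2)] by simp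
  also have "\<dots> = (\<integral>x. h UNIV x \<partial>?P)"
    by (intro Bochner_Integration.integral_cong) (auto simp: h_def U_def V_def indicator_def)
  also have "\<dots> = (\<integral>s. f s \<partial>lborel) * (\<integral>s. g s \<partial>lborel)"
    unfolding lborel_pair.integral_fst'[OF hU, symmetric] by (simp add: h_def)
  finally show "(\<integral>s. f s * (\<integral>r. indicator {..s} r * g r \<partial>lborel) \<partial>lborel)
      + (\<integral>s. g s * (\<integral>r. indicator {..s} r * f r \<partial>lborel) \<partial>lborel)
      = (\<integral>s. f s \<partial>lborel) * (\<integral>s. g s \<partial>lborel)" .
qed

lemma set_integral_singleton: "(LINT s:{a..a}|lborel. f s :: real) = 0" for a :: real
proof -
  have "AE s in lborel. indicator {a..a} s *\<^sub>R f s = 0"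
    using AE_lborel_singleton[of a] by eventually_elim simp
  then show ?thesis unfolding set_lebesgue_integral_def by (rule integral_eq_zero_AE)
qed

text \<open>Absolute continuity in integrated form. The density is only integrable, because
  expectations that involve controls have no continuity in time.\<close>

definition ac :: "real \<Rightarrow> (real \<Rightarrow> real) \<Rightarrow> (real \<Rightarrow> real) \<Rightarrow> bool" where
  "ac T F f \<longleftrightarrow> set_integrable lborel {0..T} f \<and> (\<forall>t\<in>{0..T}. F t = F 0 + (LINT s:{0..t}|lborel. f s))"

lemma acD: "ac T F f \<Longrightarrow> t \<in> {0..T} \<Longrightarrow> F t = F 0 + (LINT s:{0..t}|lborel. f s)"
  unfolding ac_def by (drule conjunct2) (rule bspec)

lemma ac_int: "ac T F f \<Longrightarrow> set_integrable lborel {0..T} f"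
  unfolding ac_def by (rule conjunct1)

lemma ac_int_sub: "ac T F f \<Longrightarrow> t \<in> {0..T} \<Longrightarrow> set_integrable lborel {0..t} f"
  by (rule set_integrable_subset[OF ac_int]) auto

lemma ac_add:
  assumes F: "ac T F f" and G: "ac T G g"
  shows "ac T (\<lambda>t. F t + G t) (\<lambda>t. f t + g t)"
  unfolding ac_def
proof (intro conjI ballI)
  show "set_integrable lborel {0..T} (\<lambda>t. f t + g t)"
    by (intro set_integral_add(1) ac_int[OF F] ac_int[OF G])
  fix t assume t: "t \<in> {0..T}"
  show "F t + G t = F 0 + G 0 + (LINT s:{0..t}|lborel. f s + g s)"
    unfolding set_integral_add(2)[OF ac_int_sub[OF F t] ac_int_sub[OF G t]] acD[OF F t] acD[OF G t] by simp
qed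

text \<open>After both densities are restricted to \<open>{0..t}\<close>, the inner integrals in
  \<open>integral_triangles\<close> become \<open>F s - F 0\<close> and \<open>G s - G 0\<close>;
  the contributions of the initial values recombine to the constant
  \<open>F 0 * G 0\<close>.\<close>

lemma ac_mult:
  assumes F: "ac T F f" and G: "ac T G g"
  shows "ac T (\<lambda>t. F t * G t) (\<lambda>t. f t * G t + F t * g t)"
proof -
  have key: "set_integrable lborel {0..t} (\<lambda>s. f s * G s) \<and> set_integrable lborel {0..t} (\<lambda>s. F s * g s) \<and>
     F t * G t = F 0 * G 0 + (LINT s:{0..t}|lborel. f s * G s + F s * g s)" if t: "t \<in> {0..T}" for t
  proof -
    define f' where "f' s = indicator {0..t} s * f s" for s
    define g' where "g' s = indicator {0..t} s * g s" for s
    have i: "integrable lborel f'" "integrable lborel g'"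
      using ac_int_sub[OF F t] ac_int_sub[OF G t] by (simp_all add: set_integrable_def f'_def[abs_def] g'_def[abs_def])
    have inn: "(\<integral>r. indicator {..s} r * f' r \<partial>lborel) = F s - F 0"
      "(\<integral>r. indicator {..s} r * g' r \<partial>lborel) = G s - G 0" if s: "s \<in> {0..t}" for s
    proof -
      have "indicator {..s} r * f' r = indicator {0..s} r *\<^sub>R f r"
        "indicator {..s} r * g' r = indicator {0..s} r *\<^sub>R g r" for r
        using s by (auto simp: f'_def g'_def indicator_def)
      then show "(\<integral>r. indicator {..s} r * f' r \<partial>lborel) = F s - F 0"
      "(\<integral>r. indicator {..s} r * g' r \<partial>lborel) = G s - G 0"
        using acD[OF F, of s] acD[OF G, of s] s t by (auto simp: set_lebesgue_integral_def)
    qed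
    have eq1: "f' s * (\<integral>r. indicator {..s} r * g' r \<partial>lborel) = indicator {0..t} s *\<^sub>R (f s * G s) - G 0 * f' s" for s
    proof (cases "s \<in> {0..t}")
      case True
      show ?thesis unfolding inn(2)[OF True] using True by (simp add: f'_def algebra_simps)
    qed (simp add: f'_def)
    have eq2: "g' s * (\<integral>r. indicator {..s} r * f' r \<partial>lborel) = indicator {0..t} s *\<^sub>R (F s * g s) - F 0 * g' s" for s
    proof (cases "s \<in> {0..t}")
      case True
      show ?thesis unfolding inn(1)[OF True] using True by (simp add: g'_def algebra_simps)
    qed (simp add: g'_def)
    have i1: "integrable lborel (\<lambda>s. indicator {0..t} s *\<^sub>R (f s * G s) - G 0 * f' s)"
      using integral_triangles(1)[OF i] by (simp only: eq1)
    have i2: "integrable lborel (\<lambda>s. indicator {0..t} s *\<^sub>R (F s * g s) - F 0 * g' s)"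
      using integral_triangles(1)[OF i(2,1)] by (simp only: eq2)
    have j1: "integrable lborel (\<lambda>s. indicator {0..t} s *\<^sub>R (f s * G s))"
      using Bochner_Integration.integrable_add[OF i1 integrable_mult_right[OF i(1), of "G 0"]] by simp
    have j2: "integrable lborel (\<lambda>s. indicator {0..t} s *\<^sub>R (F s * g s))"
      using Bochner_Integration.integrable_add[OF i2 integrable_mult_right[OF i(2), of "F 0"]] by simp
    have If: "(\<integral>s. f' s \<partial>lborel) = F t - F 0" "(\<integral>s. g' s \<partial>lborel) = G t - G 0"
      using acD[OF F t] acD[OF G t] by (auto simp: set_lebesgue_integral_def f'_def g'_def)
    have "(\<integral>s. indicator {0..t} s *\<^sub>R (f s * G s) \<partial>lborel) - G 0 * (F t - F 0)
        + ((\<integral>s. indicator {0..t} s *\<^sub>R (F s * g s) \<partial>lborel) - F 0 * (G t - G 0)) = (F t - F 0) * (G t - G 0)"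
      using integral_triangles(2)[OF i] i j1 j2 unfolding eq1 eq2 by (simp add: If)
    moreover have "(LINT s:{0..t}|lborel. f s * G s + F s * g s) =
      (\<integral>s. indicator {0..t} s *\<^sub>R (f s * G s) \<partial>lborel) + (\<integral>s. indicator {0..t} s *\<^sub>R (F s * g s) \<partial>lborel)"
      using j1 j2 by (subst set_integral_add) (auto simp: set_integrable_def set_lebesgue_integral_def)
    ultimately show ?thesis using j1 j2
      by (auto simp: set_integrable_def algebra_simps)
  qed
  show ?thesis
  proof (cases "T \<ge> 0")
    case True
    then have "T \<in> {0..T}" by simp
    from key[OF this] have "set_integrable lborel {0..T} (\<lambda>s. f s * G s + F s * g s)"
      by (intro set_integral_add(1)) auto
    then show ?thesis unfolding ac_def by (intro conjI ballI conjunct2[OF conjunct2[OF key]])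
  next
    case False
    then have "{0..T} = {}" by auto
    then show ?thesis by (auto simp: ac_def set_integrable_def)
  qed
qed

lemma ac_C1:
  assumes "\<And>t. t \<in> {0..T} \<Longrightarrow> (F has_real_derivative f t) (at t within {0..T})"
    "continuous_on {0..T} f"
  shows "ac T F f"
  unfolding ac_def
proof (intro conjI ballI)
  show "set_integrable lborel {0..T} f"
    by (rule borel_integrable_atLeastAtMost'[OF assms(2)])
  fix t assume t: "t \<in> {0..T}"
  have "(LINT s:{0..t}|lborel. f s) = F t - F 0"
  proof -
    have "(\<integral>s. indicator {0..t} s *\<^sub>R f s \<partial>lborel) = F t - F 0"
    proof (rule integral_FTC_Icc)
      show "0 \<le> t" using t by simp
      show "(F has_vector_derivative f x) (at x within {0..t})" if "0 \<le> x" "x \<le> t" for x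
        using assms(1)[of x] that t unfolding has_real_derivative_iff_has_vector_derivative
        by (auto intro: has_vector_derivative_within_subset)
      show "continuous_on {0..t} f" using assms(2) t by (auto intro: continuous_on_subset)
    qed
    then show ?thesis by (simp add: set_lebesgue_integral_def)
  qed
  then show "F t = F 0 + (LINT s:{0..t}|lborel. f s)" by simp
qed

lemma ac_continuous: "ac T F f \<Longrightarrow> continuous_on {0..T} F"
proof -
  assume a: "ac T F f"
  have "f integrable_on {0..T}" by (rule set_borel_integral_eq_integral(1)[OF ac_int[OF a]])
  then have "continuous_on {0..T} (\<lambda>t. F 0 + integral {0..t} f)"
    by (intro continuous_intros indefinite_integral_continuous_1)
  moreover have "F 0 + integral {0..t} f = F t" if "t \<in> {0..T}" for t
    using acD[OF a that] set_borel_integral_eq_integral(2)[OF ac_int_sub[OF a that]] by linarith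
  ultimately show ?thesis by (rule continuous_on_eq)
qed

section \<open>Linear differential equations\<close>

text \<open>The solution is the Neumann series of iterated Volterra integrals of \<open>n\<close>.
  The factorial in the bound on the k-th term comes from integrating over ordered times, so the
  series converges uniformly on the whole interval, however large \<open>C\<close> and
  \<open>T\<close> are. Working in a Banach space covers vectors and matrices alike, with
  \<open>L\<close> acting from the left or from the right.\<close>

lemma linear_volterra_exists:
  fixes n :: "real \<Rightarrow> 'b::banach"
  assumes T: "0 \<le> T"
    and lin: "\<And>t x y. t \<in> {0..T} \<Longrightarrow> L t (x + y) = L t x + L t y"
    and bd: "\<And>t x. t \<in> {0..T} \<Longrightarrow> norm (L t x) \<le> C * norm x"
    and cont: "\<And>x. continuous_on {0..T} x \<Longrightarrow> continuous_on {0..T} (\<lambda>t. L t (x t))"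
    and n: "continuous_on {0..T} n"
  shows "\<exists>x. continuous_on {0..T} x \<and> (\<forall>t\<in>{0..T}. x t = n t + integral {0..t} (\<lambda>s. L s (x s)))"
proof -
  define d where "d = rec_nat n (\<lambda>_ y t. integral {0..t} (\<lambda>s. L s (y s)))"
  have d0: "d 0 = n" and dS: "d (Suc k) = (\<lambda>t. integral {0..t} (\<lambda>s. L s (d k s)))" for k
    by (auto simp: d_def)
  \<comment> \<open>\<open>C\<close> comes without a sign, but the monotonicity of the powers of
    \<open>C' * t\<close> requires a nonnegative constant.\<close>
  define C' where "C' = max C 0"
  have C': "C' \<ge> 0" and bd': "norm (L t x) \<le> C' * norm x" if "t \<in> {0..T}" for t x
  proof -
    show "C' \<ge> 0" by (simp add: C'_def)
    have "C * norm x \<le> C' * norm x" by (rule mult_right_mono) (auto simp: C'_def)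
    then show "norm (L t x) \<le> C' * norm x" using bd[OF that, of x] by linarith
  qed
  have cd: "continuous_on {0..T} (d k)" for k
  proof (induction k)
    case (Suc k)
    have "(\<lambda>s. L s (d k s)) integrable_on {0..T}"
      using cont[OF Suc] by (rule integrable_continuous_real)
    then show ?case unfolding dS by (rule indefinite_integral_continuous_1)
  qed (simp add: d0 n)
  have "bounded (n ` {0..T})" using n by (intro compact_imp_bounded compact_continuous_image) auto
  then obtain A where A: "\<And>t. t \<in> {0..T} \<Longrightarrow> norm (n t) \<le> A"
    unfolding bounded_iff by blast
  have est: "norm (d k t) \<le> A * (C' * t) ^ k / fact k" if "t \<in> {0..T}" for k t
    using that
  proof (induction k arbitrary: t)
    case 0
    then show ?case using A by (simp add: d0)
  next
    case (Suc k)
    have sub: "{0..t} \<subseteq> {0..T}" using Suc.prems by auto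
    have i1: "(\<lambda>s. L s (d k s)) integrable_on {0..t}"
      using continuous_on_subset[OF cont[OF cd[of k]] sub] by (rule integrable_continuous_real)
    have F: "((\<lambda>s. C' * (A * (C' * s) ^ k / fact k)) has_integral
       (A * (C' * t) ^ Suc k / fact (Suc k) - A * (C' * 0) ^ Suc k / fact (Suc k))) {0..t}"
    proof (rule fundamental_theorem_of_calculus)
      show "0 \<le> t" using Suc.prems by simp
      fix x assume "x \<in> {0..t}"
      have "((\<lambda>s. A * (C' * s) ^ Suc k / fact (Suc k)) has_real_derivative
          A * (real (Suc k) * (C' * x) ^ k * C') / fact (Suc k)) (at x within {0..t})"
        by (rule derivative_eq_intros refl | simp)+
      moreover have "A * (real (Suc k) * (C' * x) ^ k * C') / fact (Suc k) = C' * (A * (C' * x) ^ k / fact k)"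
        by (simp add: divide_simps del: of_nat_Suc)
      ultimately show "((\<lambda>s. A * (C' * s) ^ Suc k / fact (Suc k)) has_vector_derivative C' * (A * (C' * x) ^ k / fact k)) (at x within {0..t})"
        unfolding has_real_derivative_iff_has_vector_derivative by (simp only:)
    qed
    have "norm (integral {0..t} (\<lambda>s. L s (d k s))) \<le> integral {0..t} (\<lambda>s. C' * (A * (C' * s) ^ k / fact k))"
    proof (rule integral_norm_bound_integral[OF i1])
      show "(\<lambda>s. C' * (A * (C' * s) ^ k / fact k)) integrable_on {0..t}" using F by (rule has_integral_integrable)
      fix s assume "s \<in> {0..t}"
      then have s: "s \<in> {0..T}" using sub by auto
      show "norm (L s (d k s)) \<le> C' * (A * (C' * s) ^ k / fact k)"
        using order_trans[OF bd'[OF s, of "d k s"] mult_left_mono[OF Suc.IH[OF s] C'[OF s]]] .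
    qed
    then show ?case using integral_unique[OF F] by (simp add: dS)
  qed
  define M where "M k = A * (C' * T) ^ k / fact k" for k
  have A0: "A \<ge> 0" using order_trans[OF norm_ge_zero A[of 0]] T by simp
  have C0: "C' \<ge> 0" by (simp add: C'_def)
  have estM: "norm (d k t) \<le> M k" if "t \<in> {0..T}" for k t
  proof -
    have "(C' * t) ^ k \<le> (C' * T) ^ k" using that C0 by (intro power_mono mult_left_mono) auto
    then have "A * (C' * t) ^ k / fact k \<le> M k"
      unfolding M_def using A0 by (intro divide_right_mono mult_left_mono) auto
    then show ?thesis using est[OF that, of k] by linarith
  qed
  have sM: "summable M"
  proof -
    have "summable (\<lambda>k. A * ((C' * T) ^ k /\<^sub>R fact k))"
      by (intro summable_mult summable_exp_generic)
    then show ?thesis by (simp add: M_def[abs_def] divide_inverse mult_ac)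
  qed
  define x where "x t = (\<Sum>k. d k t)" for t
  define p where "p m t = (\<Sum>k<m. d k t)" for m t
  have ul: "uniform_limit {0..T} p x sequentially"
    unfolding x_def[abs_def] p_def[abs_def]
    by (rule Weierstrass_m_test[OF _ sM]) (use estM in auto)
  have cp: "continuous_on {0..T} (p m)" for m
    unfolding p_def[abs_def] by (intro continuous_intros cd)
  have cx: "continuous_on {0..T} x"
    by (rule uniform_limit_theorem[OF _ ul]) (auto simp: cp)
  have L0: "L t 0 = 0" if "t \<in> {0..T}" for t using bd[OF that, of 0] by simp
  have Lneg: "L t (a - b) = L t a - L t b" if "t \<in> {0..T}" for t a b
    using lin[OF that, of "a - b" b] by (simp add: algebra_simps)
  have Lsum: "L t (\<Sum>k<m. d k s) = (\<Sum>k<m. L t (d k s))" if "t \<in> {0..T}" for t m s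
    by (induction m) (auto simp: lin[OF that] L0[OF that])
  \<comment> \<open>Each partial sum is the previous one inserted into the integral equation, so the
    equation passes to the uniform limit.\<close>
  have pS: "p (Suc m) t = n t + integral {0..t} (\<lambda>s. L s (p m s))" if t: "t \<in> {0..T}" for m t
  proof -
    have sub: "{0..t} \<subseteq> {0..T}" using t by auto
    have "integral {0..t} (\<lambda>s. L s (p m s)) = integral {0..t} (\<lambda>s. \<Sum>k<m. L s (d k s))"
      using sub by (intro integral_cong) (auto simp: p_def Lsum)
    also have "\<dots> = (\<Sum>k<m. integral {0..t} (\<lambda>s. L s (d k s)))"
      by (intro integral_sum integrable_continuous_real continuous_on_subset[OF cont[OF cd] sub]) auto
    finally show ?thesis
      by (simp add: p_def sum.lessThan_Suc_shift d0 dS del: sum.lessThan_Suc)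
  qed
  have "x t = n t + integral {0..t} (\<lambda>s. L s (x s))" if t: "t \<in> {0..T}" for t
  proof -
    have sub: "{0..t} \<subseteq> {0..T}" using t by auto
    have ulL: "uniform_limit {0..t} (\<lambda>m s. L s (p m s)) (\<lambda>s. L s (x s)) sequentially"
    proof (rule uniform_limitI)
      fix e :: real assume "e > 0"
      then have "e / (C' + 1) > 0" using C0 by simp
      from uniform_limitD[OF ul this]
      show "\<forall>\<^sub>F m in sequentially. \<forall>s\<in>{0..t}. dist (L s (p m s)) (L s (x s)) < e"
      proof eventually_elim
        case (elim m)
        show ?case
        proof
          fix s assume "s \<in> {0..t}"
          then have s: "s \<in> {0..T}" using sub by auto
          have "dist (L s (p m s)) (L s (x s)) \<le> C' * dist (p m s) (x s)"
            using bd'[OF s] Lneg[OF s] by (simp add: dist_norm flip: Lneg[OF s])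
          also have "\<dots> \<le> (C' + 1) * dist (p m s) (x s)" by (intro mult_right_mono) auto
          also have "\<dots> < (C' + 1) * (e / (C' + 1))"
            using elim s C0 by (intro mult_strict_left_mono) auto
          also have "\<dots> = e" using C0 by simp
          finally show "dist (L s (p m s)) (L s (x s)) < e" .
        qed
      qed
    qed
    have "(\<lambda>m. integral {0..t} (\<lambda>s. L s (p m s))) \<longlonglongrightarrow> integral {0..t} (\<lambda>s. L s (x s))"
    proof -
      obtain I J where IJ: "\<And>m. ((\<lambda>s. L s (p m s)) has_integral I m) {0..t}"
        "((\<lambda>s. L s (x s)) has_integral J) {0..t}" "(I \<longlongrightarrow> J) sequentially"
        by (rule uniform_limit_integral[OF ulL continuous_on_subset[OF cont[OF cp] sub] sequentially_bot]) (rule that)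
      show ?thesis unfolding integral_unique[OF IJ(1)] integral_unique[OF IJ(2)] by (rule IJ(3))
    qed
    then have "(\<lambda>m. p (Suc m) t) \<longlonglongrightarrow> n t + integral {0..t} (\<lambda>s. L s (x s))"
      unfolding pS[OF t] by (intro tendsto_intros)
    moreover have "(\<lambda>m. p (Suc m) t) \<longlonglongrightarrow> x t"
      using tendsto_uniform_limitI[OF ul t] by (rule LIMSEQ_Suc)
    ultimately show ?thesis using LIMSEQ_unique by blast
  qed
  then show ?thesis using cx by blast
qed

section \<open>Increments of the Brownian motion\<close>

locale brownian2 = prob_space M for M :: "'a measure" +
  fixes T :: real and W B :: "real \<Rightarrow> 'a \<Rightarrow> real"
  assumes T_pos: "0 < T" and bm: "brownian_motion_2d M T W B"
begin

abbreviation F :: "real \<Rightarrow> 'a measure" where "F \<equiv> augmented_filtration M W B"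

text \<open>Both Brownian motions under one name: \<open>True\<close> stands for \<open>W\<close>,
  \<open>False\<close> for \<open>B\<close>. Through the factor \<open>\<kappa>\<close> one
  statement then covers the isometry for one motion and the orthogonality between the two.\<close>

definition Z :: "bool \<Rightarrow> real \<Rightarrow> 'a \<Rightarrow> real" where "Z i = (if i then W else B)"

lemma Z_measurable_M [measurable]: "t \<in> {0..T} \<Longrightarrow> Z i t \<in> borel_measurable M"
  using bm by (auto simp: Z_def brownian_motion_2d_def)

lemma natural_sets_subset: "t \<le> T \<Longrightarrow> natural_sets M W B t \<subseteq> sets M"
proof
  fix A assume t: "t \<le> T" and "A \<in> natural_sets M W B t"
  then consider s D where "A = Z True s -` D \<inter> space M" "s \<in> {0..t}" "D \<in> sets borel"
    | s D where "A = Z False s -` D \<inter> space M" "s \<in> {0..t}" "D \<in> sets borel"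
    unfolding natural_sets_def Z_def by auto
  then show "A \<in> sets M"
  proof cases
    case 1
    have "s \<in> {0..T}" using 1 t by simp
    show ?thesis unfolding 1(1) by (rule measurable_sets[OF Z_measurable_M[OF \<open>s \<in> {0..T}\<close>] 1(3)])
  next
    case 2
    have "s \<in> {0..T}" using 2 t by simp
    show ?thesis unfolding 2(1) by (rule measurable_sets[OF Z_measurable_M[OF \<open>s \<in> {0..T}\<close>] 2(3)])
  qed
qed

lemma natural_sets_Pow: "natural_sets M W B t \<subseteq> Pow (space M)"
  by (auto simp: natural_sets_def)

lemma space_F [simp]: "space (F t) = space M"
  by (simp add: augmented_filtration_def space_measure_of_conv)

lemma sets_F: "sets (F t) = sigma_sets (space M) (natural_sets M W B t \<union> null_sets M)"
  unfolding augmented_filtration_def using natural_sets_Pow sets.space_closed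
  by (intro sets_measure_of) (auto simp: null_sets_def dest: sets.sets_into_space)

lemma sets_natural: "sets (natural_filtration M W B t) = sigma_sets (space M) (natural_sets M W B t)"
  unfolding natural_filtration_def using natural_sets_Pow by (intro sets_measure_of)

lemma sets_F_subset: "t \<le> T \<Longrightarrow> sets (F t) \<subseteq> sets M"
  unfolding sets_F using natural_sets_subset[of t] by (intro sets.sigma_sets_subset) auto

lemma natural_sets_mono: "s \<le> t \<Longrightarrow> natural_sets M W B s \<subseteq> natural_sets M W B t"
proof
  fix A assume st: "s \<le> t" and "A \<in> natural_sets M W B s"
  then consider r D where "A = W r -` D \<inter> space M" "r \<in> {0..s}" "D \<in> sets borel"
    | r D where "A = B r -` D \<inter> space M" "r \<in> {0..s}" "D \<in> sets borel"
    unfolding natural_sets_def by auto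
  then show "A \<in> natural_sets M W B t"
  proof cases
    case 1
    have "r \<in> {0..t}" using 1 st by simp
    then show ?thesis unfolding natural_sets_def using 1 by blast
  next
    case 2
    have "r \<in> {0..t}" using 2 st by simp
    then show ?thesis unfolding natural_sets_def using 2 by blast
  qed
qed

lemma sets_F_mono: "s \<le> t \<Longrightarrow> sets (F s) \<subseteq> sets (F t)"
  unfolding sets_F using natural_sets_mono[of s t] by (intro sigma_sets_mono') auto

lemma F_imp_M: "X \<in> borel_measurable (F t) \<Longrightarrow> t \<le> T \<Longrightarrow> X \<in> borel_measurable M"
  by (erule measurable_from_subalg[rotated]) (simp add: subalgebra_def sets_F_subset)

lemma F_mono: "X \<in> borel_measurable (F s) \<Longrightarrow> s \<le> t \<Longrightarrow> X \<in> borel_measurable (F t)"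
  by (erule measurable_from_subalg[rotated]) (simp add: subalgebra_def sets_F_mono)

lemma null_sets_F: "A \<in> null_sets M \<Longrightarrow> A \<in> sets (F t)"
  unfolding sets_F by (intro sigma_sets.Basic) auto

lemma Z_measurable_F: 
  assumes "0 \<le> s" "s \<le> t"
  shows "Z i s \<in> borel_measurable (F t)"
proof (rule measurableI)
  fix A :: "real set" assume "A \<in> sets borel"
  then have "Z i s -` A \<inter> space M \<in> natural_sets M W B t"
    using assms unfolding natural_sets_def Z_def by (cases i) fastforce+
  then show "Z i s -` A \<inter> space (F t) \<in> sets (F t)"
    unfolding sets_F space_F by (intro sigma_sets.Basic) auto
qed simp

text \<open>Increments are independent of the natural filtration by definition, whereas controls are
  adapted to the augmented one. The sets that agree with a natural one up to a null set form a
  sigma-algebra containing all generators of the augmentation, so probabilities of intersections can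
  be computed with natural sets.\<close>

lemma augmented_ae_natural:
  assumes "A \<in> sets (F t)" "t \<le> T"
  shows "\<exists>A'\<in>sets (natural_filtration M W B t). (A - A') \<union> (A' - A) \<in> null_sets M"
  using assms(1) unfolding sets_F
proof (induction rule: sigma_sets.induct)
  case (Basic A)
  then show ?case
  proof
    assume "A \<in> natural_sets M W B t"
    then show ?thesis unfolding sets_natural by (intro bexI[of _ A]) auto
  next
    assume "A \<in> null_sets M"
    then show ?thesis unfolding sets_natural by (intro bexI[of _ "{}"]) (auto intro: sigma_sets.Empty)
  qed
next
  case Empty
  then show ?case by (intro bexI[of _ "{}"]) auto
next
  case (Compl A)
  then obtain A' where A': "A' \<in> sets (natural_filtration M W B t)" "(A - A') \<union> (A' - A) \<in> null_sets M" by auto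
  have sub: "A \<subseteq> space M" using Compl(1) sets_F[of t] sets.sets_into_space[of A "F t"] by auto
  have sub': "A' \<subseteq> space M" using A'(1) sets.sets_into_space[of A' "natural_filtration M W B t"]
    by (auto simp: natural_filtration_def space_measure_of_conv)
  show ?case
  proof (intro bexI[of _ "space M - A'"])
    have "(space M - A - (space M - A')) \<union> (space M - A' - (space M - A)) = (A - A') \<union> (A' - A)"
      using sub sub' by auto
    then show "(space M - A - (space M - A')) \<union> (space M - A' - (space M - A)) \<in> null_sets M"
      using A'(2) by simp
    show "space M - A' \<in> sets (natural_filtration M W B t)"
      using A'(1) unfolding sets_natural by (rule sigma_sets.Compl)
  qed
next
  case (Union a)
  then have "\<forall>i. \<exists>A'. A' \<in> sets (natural_filtration M W B t) \<and> (a i - A') \<union> (A' - a i) \<in> null_sets M" by blast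
  then obtain b where b: "\<And>i. b i \<in> sets (natural_filtration M W B t)"
    "\<And>i::nat. (a i - b i) \<union> (b i - a i) \<in> null_sets M" by metis
  have am: "a i \<in> sets M" for i using Union(1)[of i] sets_F_subset[OF assms(2)] unfolding sets_F by auto
  have bm': "b i \<in> sets M" for i using b(1)[of i] natural_sets_subset[OF assms(2)] unfolding sets_natural
    using sets.sigma_sets_subset by blast
  show ?case
  proof (intro bexI[of _ "\<Union>i. b i"])
    \<comment> \<open>The symmetric difference of the unions lies in the union of the symmetric
      differences. Its measurability is a separate point, as \<open>M\<close> need not be
      complete.\<close>
    show "(\<Union>i. a i) - (\<Union>i. b i) \<union> ((\<Union>i. b i) - (\<Union>i. a i)) \<in> null_sets M"
    proof (rule null_sets_subset)
      show "(\<Union>i. (a i - b i) \<union> (b i - a i)) \<in> null_sets M" using b(2) by (rule null_sets_UN)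
      show "(\<Union>i. a i) - (\<Union>i. b i) \<union> ((\<Union>i. b i) - (\<Union>i. a i)) \<in> sets M"
        using am bm' by auto
    qed auto
    show "(\<Union>i. b i) \<in> sets (natural_filtration M W B t)" using b(1) by auto
  qed
qed

text \<open>Allowing a Borel function of the joint increment of \<open>(W, B)\<close> makes single
  increments and products of two, also mixed ones, independent of the past by one argument.\<close>

lemma indep_increment:
  assumes st: "0 \<le> s" "s < t" "t \<le> T" and X: "X \<in> borel_measurable (F s)"
    and g: "g \<in> borel_measurable (borel :: (real \<times> real) measure)"
  shows "indep_var borel X borel (\<lambda>\<omega>. g (W t \<omega> - W s \<omega>, B t \<omega> - B s \<omega>))"
proof -
  let ?D = "\<lambda>\<omega>. (W t \<omega> - W s \<omega>, B t \<omega> - B s \<omega>)"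
  let ?V = "vimage_algebra (space M) ?D (borel :: (real \<times> real) measure)"
  have ind: "indep_set (sets ?V) (sets (natural_filtration M W B s))"
    using bm st unfolding brownian_motion_2d_def by auto
  have "W t \<in> borel_measurable M" "B t \<in> borel_measurable M" "W s \<in> borel_measurable M" "B s \<in> borel_measurable M"
    using bm st unfolding brownian_motion_2d_def by auto
  then have Dm[measurable]: "?D \<in> borel_measurable M"
    by (intro borel_measurable_Pair borel_measurable_diff)
  have XM: "X \<in> borel_measurable M" using F_imp_M[OF X] st by simp
  have sX: "sigma_sets (space M) {X -` A \<inter> space M |A. A \<in> sets borel} \<subseteq> sets (F s)"
  proof -
    have "{X -` A \<inter> space M |A. A \<in> sets borel} \<subseteq> sets (F s)"
      using measurable_sets[OF X] by auto
    then show ?thesis using sets.sigma_sets_subset[of _ "F s"] by simp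
  qed
  have sg: "sigma_sets (space M) {(\<lambda>\<omega>. g (?D \<omega>)) -` A \<inter> space M |A. A \<in> sets borel} \<subseteq> sets ?V"
  proof -
    have "(\<lambda>\<omega>. g (?D \<omega>)) \<in> borel_measurable ?V"
      using measurable_compose[OF measurable_vimage_algebra1 g, of ?D "space M"] by auto
    then have "{(\<lambda>\<omega>. g (?D \<omega>)) -` A \<inter> space M |A. A \<in> sets borel} \<subseteq> sets ?V"
      by (auto dest: measurable_sets)
    then show ?thesis using sets.sigma_sets_subset[of _ ?V] by simp
  qed
  have "indep_set (sets (F s)) (sets ?V)"
    unfolding indep_sets2_eq
  proof (intro conjI ballI)
    show "sets (F s) \<subseteq> events" using sets_F_subset st by simp
    show "sets ?V \<subseteq> events" using ind unfolding indep_sets2_eq by simp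
    fix a b assume a: "a \<in> sets (F s)" and b: "b \<in> sets ?V"
    obtain a' where a': "a' \<in> sets (natural_filtration M W B s)" "(a - a') \<union> (a' - a) \<in> null_sets M"
      using augmented_ae_natural[OF a] st by auto
    have m: "a \<in> events" "a' \<in> events" "b \<in> events"
      using a b a' ind sets_F_subset[of s] st unfolding indep_sets2_eq by auto
    have ae: "AE x in M. x \<in> a \<longleftrightarrow> x \<in> a'"
      by (rule AE_I'[OF a'(2)]) auto
    \<comment> \<open>Replacing \<open>a\<close> by the natural set \<open>a'\<close> changes no
      probability, and for \<open>a'\<close> the independence is known.\<close>
    have "prob (a \<inter> b) = prob (a' \<inter> b)"
      using ae m by (intro measure_eq_AE) auto
    also have "\<dots> = prob b * prob a'"
      using ind a'(1) b unfolding indep_sets2_eq by (metis Int_commute)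
    also have "prob a' = prob a"
      using ae m by (intro measure_eq_AE) auto
    finally show "prob (a \<inter> b) = prob a * prob b" by simp
  qed
  then have "indep_set (sigma_sets (space M) {X -` A \<inter> space M |A. A \<in> sets borel})
    (sigma_sets (space M) {(\<lambda>\<omega>. g (?D \<omega>)) -` A \<inter> space M |A. A \<in> sets borel})"
    using sX sg unfolding indep_sets2_eq by (meson subset_iff)
  moreover have "(\<lambda>\<omega>. g (?D \<omega>)) \<in> borel_measurable M"
    using measurable_compose[OF Dm g] .
  ultimately show ?thesis unfolding indep_var_eq using XM by simp
qed

abbreviation \<kappa> :: "bool \<Rightarrow> bool \<Rightarrow> real" where "\<kappa> i j \<equiv> (if i = j then 1 else 0)"

text \<open>Equal indices give the variance of a normal variable; for different ones the mixed
  moment factorises by independence of the \<open>W\<close> and \<open>B\<close> increments and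
  vanishes.\<close>

lemma increment_moments:
  assumes st: "0 \<le> s" "s < t" "t \<le> T"
  shows "integrable M (\<lambda>\<omega>. Z i t \<omega> - Z i s \<omega>)" "expectation (\<lambda>\<omega>. Z i t \<omega> - Z i s \<omega>) = 0"
    "integrable M (\<lambda>\<omega>. (Z i t \<omega> - Z i s \<omega>) * (Z j t \<omega> - Z j s \<omega>))"
    "expectation (\<lambda>\<omega>. (Z i t \<omega> - Z i s \<omega>) * (Z j t \<omega> - Z j s \<omega>)) = \<kappa> i j * (t - s)"
proof -
  let ?D = "\<lambda>i \<omega>. Z i t \<omega> - Z i s \<omega>"
  have sq: "0 < sqrt (t - s)" using st by simp
  have D: "distributed M lborel (?D i) (normal_density 0 (sqrt (t - s)))" for i
    using bm st unfolding brownian_motion_2d_def Z_def by (cases i) auto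
  have i1: "integrable M (?D i)" for i
    using distributed_integrable[OF D[of i], of "\<lambda>x. x"] integrable_normal_moment_nz_1[OF sq, of 0] by simp
  have i2: "integrable M (\<lambda>\<omega>. (?D i \<omega>)\<^sup>2)" for i
    using distributed_integrable[OF D[of i], of "\<lambda>x. x\<^sup>2"] integrable_normal_moment[OF sq, of 0 2] by simp
  have e1: "expectation (?D i) = 0" for i
    by (rule normal_distributed_expectation[OF sq D])
  have e2: "expectation (\<lambda>\<omega>. (?D i \<omega>)\<^sup>2) = t - s" for i
    using normal_distributed_variance[OF sq D[of i]] st by (simp add: e1)
  have ind: "indep_var borel (?D True) borel (?D False)"
    using bm st unfolding brownian_motion_2d_def Z_def by auto
  note c = indep_var_integrable[OF ind i1 i1] indep_var_lebesgue_integral[OF ind i1 i1]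
  show "integrable M (?D i)" "expectation (?D i) = 0" by (fact i1) (fact e1)
  show "integrable M (\<lambda>\<omega>. ?D i \<omega> * ?D j \<omega>)" "expectation (\<lambda>\<omega>. ?D i \<omega> * ?D j \<omega>) = \<kappa> i j * (t - s)"
    using i2[of i] e2[of i] c by (cases i; cases j; simp add: power2_eq_square e1 mult.commute)+
qed

text \<open>Independence of \<open>X\<close> from the increment takes the place of conditional
  expectations. Only integrability of \<open>X\<close> is asked for, because \<open>X\<close> will
  itself contain earlier increments.\<close>

lemma expectation_increment:
  assumes st: "0 \<le> s" "s \<le> t" "t \<le> T" and X: "X \<in> borel_measurable (F s)" "integrable M X"
  shows "integrable M (\<lambda>\<omega>. X \<omega> * (Z i t \<omega> - Z i s \<omega>))"
    "expectation (\<lambda>\<omega>. X \<omega> * (Z i t \<omega> - Z i s \<omega>)) = 0"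
    "integrable M (\<lambda>\<omega>. X \<omega> * ((Z i t \<omega> - Z i s \<omega>) * (Z j t \<omega> - Z j s \<omega>)))"
    "expectation (\<lambda>\<omega>. X \<omega> * ((Z i t \<omega> - Z i s \<omega>) * (Z j t \<omega> - Z j s \<omega>))) = \<kappa> i j * (t - s) * expectation X"
proof -
  have "integrable M (\<lambda>\<omega>. X \<omega> * (Z i t \<omega> - Z i s \<omega>)) \<and>
    expectation (\<lambda>\<omega>. X \<omega> * (Z i t \<omega> - Z i s \<omega>)) = 0 \<and>
    integrable M (\<lambda>\<omega>. X \<omega> * ((Z i t \<omega> - Z i s \<omega>) * (Z j t \<omega> - Z j s \<omega>))) \<and>
    expectation (\<lambda>\<omega>. X \<omega> * ((Z i t \<omega> - Z i s \<omega>) * (Z j t \<omega> - Z j s \<omega>))) = \<kappa> i j * (t - s) * expectation X"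
  proof (cases "s = t")
    case False
    then have lt: "s < t" using st by simp
    note m = increment_moments[OF st(1) lt st(3)]
    define g where "g i x = (if i then fst x else snd x)" for i and x :: "real \<times> real"
    have gm: "g i \<in> borel_measurable borel" for i
      unfolding g_def[abs_def]
      by (cases i) (auto intro!: borel_measurable_continuous_onI continuous_on_fst continuous_on_snd)
    have g: "g i (W t \<omega> - W s \<omega>, B t \<omega> - B s \<omega>) = Z i t \<omega> - Z i s \<omega>" for i \<omega>
      by (simp add: g_def Z_def)
    have ind1: "indep_var borel X borel (\<lambda>\<omega>. Z i t \<omega> - Z i s \<omega>)"
      using indep_increment[OF st(1) lt st(3) X(1) gm[of i]] by (simp add: g)
    have ind2: "indep_var borel X borel (\<lambda>\<omega>. (Z i t \<omega> - Z i s \<omega>) * (Z j t \<omega> - Z j s \<omega>))"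
      using indep_increment[OF st(1) lt st(3) X(1), of "\<lambda>x. g i x * g j x"] borel_measurable_times[OF gm[of i] gm[of j]]
      by (simp add: g)
    show ?thesis
      using indep_var_integrable[OF ind1 X(2) m(1)] indep_var_lebesgue_integral[OF ind1 X(2) m(1)]
        indep_var_integrable[OF ind2 X(2) m(3)] indep_var_lebesgue_integral[OF ind2 X(2) m(3)] m(2,4)
      by simp
  qed simp
  then show "integrable M (\<lambda>\<omega>. X \<omega> * (Z i t \<omega> - Z i s \<omega>))"
    "expectation (\<lambda>\<omega>. X \<omega> * (Z i t \<omega> - Z i s \<omega>)) = 0"
    "integrable M (\<lambda>\<omega>. X \<omega> * ((Z i t \<omega> - Z i s \<omega>) * (Z j t \<omega> - Z j s \<omega>)))"
    "expectation (\<lambda>\<omega>. X \<omega> * ((Z i t \<omega> - Z i s \<omega>) * (Z j t \<omega> - Z j s \<omega>))) = \<kappa> i j * (t - s) * expectation X"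
    by auto
qed

lemma Z_l2: "0 \<le> s \<Longrightarrow> s \<le> t \<Longrightarrow> t \<le> T \<Longrightarrow> l2 M (\<lambda>\<omega>. Z i t \<omega> - Z i s \<omega>)"
proof (cases "s = t")
  case False
  assume "0 \<le> s" "s \<le> t" "t \<le> T"
  with False show ?thesis
    using increment_moments(3)[of s t i i] by (simp add: l2_def power2_eq_square)
qed (simp add: l2_def)

section \<open>Covariances of increments weighted with bounded adapted coefficients\<close>

definition bdd :: "real \<Rightarrow> ('a \<Rightarrow> real) \<Rightarrow> bool" where
  "bdd a \<xi> \<longleftrightarrow> \<xi> \<in> borel_measurable (F a) \<and> (\<exists>C. \<forall>\<omega>\<in>space M. \<bar>\<xi> \<omega>\<bar> \<le> C)"

lemma bdd_mono: "bdd a \<xi> \<Longrightarrow> a \<le> b \<Longrightarrow> bdd b \<xi>"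
  unfolding bdd_def using F_mono by blast

lemma bdd_mult:
  assumes "bdd a \<xi>" "bdd a \<zeta>" shows "bdd a (\<lambda>\<omega>. \<xi> \<omega> * \<zeta> \<omega>)"
proof -
  obtain C D where "\<And>\<omega>. \<omega> \<in> space M \<Longrightarrow> \<bar>\<xi> \<omega>\<bar> \<le> C" "\<And>\<omega>. \<omega> \<in> space M \<Longrightarrow> \<bar>\<zeta> \<omega>\<bar> \<le> D"
    using assms unfolding bdd_def by blast
  then have "\<bar>\<xi> \<omega> * \<zeta> \<omega>\<bar> \<le> \<bar>C\<bar> * \<bar>D\<bar>" if "\<omega> \<in> space M" for \<omega>
    using that unfolding abs_mult by (intro mult_mono) (auto intro: order_trans[OF _ abs_ge_self])
  moreover have "(\<lambda>\<omega>. \<xi> \<omega> * \<zeta> \<omega>) \<in> borel_measurable (F a)"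
    using assms unfolding bdd_def by (intro borel_measurable_times) auto
  ultimately show ?thesis unfolding bdd_def by blast
qed

lemma bdd_l2_mult: "bdd a \<xi> \<Longrightarrow> a \<le> T \<Longrightarrow> l2 M X \<Longrightarrow> l2 M (\<lambda>\<omega>. \<xi> \<omega> * X \<omega>)"
  unfolding bdd_def using l2_bounded_mult F_imp_M by blast

lemma bdd_l2: "bdd a \<xi> \<Longrightarrow> a \<le> T \<Longrightarrow> l2 M \<xi>"
  using bdd_l2_mult[OF _ _ l2_const[of M 1]] finite_measure_axioms by simp

text \<open>With \<open>a \<le> a'\<close>, all that happens before \<open>a'\<close> is known when
  the second interval begins. Either the intervals do not overlap, or both increments are cut at the
  ends of the overlap; then every product vanishes in expectation except that of the two pieces over
  the overlap.\<close>

lemma increment_product_aux: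
  assumes ab: "0 \<le> a" "a \<le> b" "b \<le> T" and ab': "a \<le> a'" "a' \<le> b'" "b' \<le> T"
    and \<xi>: "bdd a \<xi>" and \<zeta>: "bdd a' \<zeta>"
  shows "expectation (\<lambda>\<omega>. \<xi> \<omega> * (Z i b \<omega> - Z i a \<omega>) * (\<zeta> \<omega> * (Z j b' \<omega> - Z j a' \<omega>)))
     = \<kappa> i j * expectation (\<lambda>\<omega>. \<xi> \<omega> * \<zeta> \<omega>) * max 0 (min b b' - a')"
proof -
  have \<xi>\<zeta>: "bdd a' (\<lambda>\<omega>. \<xi> \<omega> * \<zeta> \<omega>)" using bdd_mult[OF bdd_mono[OF \<xi> ab'(1)] \<zeta>] .
  have a'T: "a' \<le> T" using ab' by simp
  show ?thesis
  proof (cases "b \<le> a'")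
    case True
    let ?X = "\<lambda>\<omega>. \<xi> \<omega> * \<zeta> \<omega> * (Z i b \<omega> - Z i a \<omega>)"
    have Xm: "?X \<in> borel_measurable (F a')"
      using \<xi>\<zeta> ab True Z_measurable_F[of a a' i] Z_measurable_F[of b a' i] ab'
      by (auto simp: bdd_def)
    have Xi: "integrable M ?X"
      using l2_integrable[OF _ bdd_l2_mult[OF \<xi>\<zeta> a'T Z_l2[OF ab]]] finite_measure_axioms by simp
    have "expectation (\<lambda>\<omega>. ?X \<omega> * (Z j b' \<omega> - Z j a' \<omega>)) = 0"
      using expectation_increment(2)[OF _ _ _ Xm Xi] ab ab' by simp
    then show ?thesis using True by (simp add: mult_ac)
  next
    case False
    \<comment> \<open>End of the overlap, which begins at \<open>a'\<close>.\<close>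
    define m where "m = min b b'"
    have m: "a' \<le> m" "m \<le> b" "m \<le> b'" "m \<le> T" using False ab ab' by (auto simp: m_def)
    have a'0: "0 \<le> a'" using ab ab' by simp
    let ?X0 = "\<lambda>\<omega>. \<xi> \<omega> * \<zeta> \<omega>"
    let ?X1 = "\<lambda>\<omega>. \<xi> \<omega> * \<zeta> \<omega> * (Z i a' \<omega> - Z i a \<omega>)"
    let ?X2 = "\<lambda>\<omega>. \<xi> \<omega> * \<zeta> \<omega> * (Z i m \<omega> - Z i a' \<omega>)"
    let ?X3 = "\<lambda>\<omega>. \<xi> \<omega> * \<zeta> \<omega> * (Z j m \<omega> - Z j a' \<omega>)"
    have X0m: "?X0 \<in> borel_measurable (F a')" using \<xi>\<zeta> by (simp add: bdd_def)
    have X0i: "integrable M ?X0" using l2_integrable[OF _ bdd_l2[OF \<xi>\<zeta> a'T]] finite_measure_axioms by simp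
    have X1m: "?X1 \<in> borel_measurable (F a')"
      by (intro borel_measurable_times[OF X0m] borel_measurable_diff Z_measurable_F) (use ab ab' in auto)
    have X1i: "integrable M ?X1"
      using l2_integrable[OF _ bdd_l2_mult[OF \<xi>\<zeta> a'T Z_l2[of a a' i]]] finite_measure_axioms ab ab' by simp
    have X2m: "?X2 \<in> borel_measurable (F m)"
      by (intro borel_measurable_times[OF F_mono[OF X0m m(1)]] borel_measurable_diff Z_measurable_F) (use ab ab' m in auto)
    have X2i: "integrable M ?X2"
      using l2_integrable[OF _ bdd_l2_mult[OF \<xi>\<zeta> a'T Z_l2[of a' m i]]] finite_measure_axioms a'0 m by simp
    have X3m: "?X3 \<in> borel_measurable (F m)"
      by (intro borel_measurable_times[OF F_mono[OF X0m m(1)]] borel_measurable_diff Z_measurable_F) (use ab ab' m in auto)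
    have X3i: "integrable M ?X3"
      using l2_integrable[OF _ bdd_l2_mult[OF \<xi>\<zeta> a'T Z_l2[of a' m j]]] finite_measure_axioms a'0 m by simp
    note e0 = expectation_increment(3,4)[OF a'0 m(1,4) X0m X0i, of i j]
    note e1 = expectation_increment(1,2)[OF a'0 ab'(2,3) X1m X1i, of j]
    have m0: "0 \<le> m" using a'0 m by simp
    note e2 = expectation_increment(1,2)[OF m0 m(3) ab'(3) X2m X2i, of j]
    note e3 = expectation_increment(1,2)[OF m0 m(2) ab(3) X3m X3i, of i]
    \<comment> \<open>One of the two intervals ends at \<open>m\<close>, so beyond \<open>m\<close>
      at most one of the increments is nonzero.\<close>
    have "(Z i b \<omega> - Z i m \<omega>) * (Z j b' \<omega> - Z j m \<omega>) = 0" for \<omega>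
      by (cases "b \<le> b'") (simp_all add: m_def min_def)
    then have nul: "\<xi> \<omega> * \<zeta> \<omega> * ((Z i b \<omega> - Z i m \<omega>) * (Z j b' \<omega> - Z j m \<omega>)) = 0" for \<omega>
      by simp
    have "\<xi> \<omega> * (Z i b \<omega> - Z i a \<omega>) * (\<zeta> \<omega> * (Z j b' \<omega> - Z j a' \<omega>))
      = ?X0 \<omega> * ((Z i m \<omega> - Z i a' \<omega>) * (Z j m \<omega> - Z j a' \<omega>)) + ?X1 \<omega> * (Z j b' \<omega> - Z j a' \<omega>)
        + ?X2 \<omega> * (Z j b' \<omega> - Z j m \<omega>) + ?X3 \<omega> * (Z i b \<omega> - Z i m \<omega>)" for \<omega>
      using nul[of \<omega>] by (simp add: algebra_simps)
    then have "expectation (\<lambda>\<omega>. \<xi> \<omega> * (Z i b \<omega> - Z i a \<omega>) * (\<zeta> \<omega> * (Z j b' \<omega> - Z j a' \<omega>))) =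
      \<kappa> i j * (m - a') * expectation ?X0"
      using e0 e1 e2 e3 by simp
    then show ?thesis using m by (simp add: m_def)
  qed
qed

text \<open>The last factor is the length of the common part of the two intervals and
  \<open>{0..t}\<close>. A stopped integral evaluates the motion at the minimum with
  \<open>t\<close>, which amounts to shortening both intervals; the case \<open>a' \<le> a\<close>
  follows by exchanging the roles.\<close>

lemma increment_product:
  assumes ab: "0 \<le> a" "a \<le> b" "b \<le> T" and ab': "0 \<le> a'" "a' \<le> b'" "b' \<le> T"
    and \<xi>: "bdd a \<xi>" and \<zeta>: "bdd a' \<zeta>" and t: "0 \<le> t"
  shows "expectation (\<lambda>\<omega>. \<xi> \<omega> * (Z i (min b t) \<omega> - Z i (min a t) \<omega>) *
        (\<zeta> \<omega> * (Z j (min b' t) \<omega> - Z j (min a' t) \<omega>)))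
     = \<kappa> i j * expectation (\<lambda>\<omega>. \<xi> \<omega> * \<zeta> \<omega>) * max 0 (min (min b b') t - max a a')"
proof -
  consider "t \<le> a \<or> t \<le> a'" | "a < t" "a' < t" "a \<le> a'" | "a < t" "a' < t" "a' \<le> a" by linarith
  then show ?thesis
  proof cases
    case 1
    then have "min b t = min a t \<or> min b' t = min a' t" using ab ab' by auto
    then have "Z i (min b t) \<omega> - Z i (min a t) \<omega> = 0 \<or> Z j (min b' t) \<omega> - Z j (min a' t) \<omega> = 0" for \<omega>
      by auto
    then have "(\<lambda>\<omega>. \<xi> \<omega> * (Z i (min b t) \<omega> - Z i (min a t) \<omega>) *
        (\<zeta> \<omega> * (Z j (min b' t) \<omega> - Z j (min a' t) \<omega>))) = (\<lambda>\<omega>. 0)" by force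
    moreover have "min (min b b') t - max a a' \<le> 0" using 1 by auto
    ultimately show ?thesis by simp
  next
    case 2
    have e: "min a t = a" "min a' t = a'" "max a a' = a'" "min (min b t) (min b' t) = min (min b b') t" using 2 by auto
    show ?thesis
      using increment_product_aux[of a "min b t" a' "min b' t" \<xi> \<zeta> i j] assms 2 e by simp
  next
    case 3
    have e: "min a t = a" "min a' t = a'" "max a a' = a" "min (min b' t) (min b t) = min (min b b') t" using 3 by auto
    have "expectation (\<lambda>\<omega>. \<xi> \<omega> * (Z i (min b t) \<omega> - Z i (min a t) \<omega>) *
        (\<zeta> \<omega> * (Z j (min b' t) \<omega> - Z j (min a' t) \<omega>)))
      = expectation (\<lambda>\<omega>. \<zeta> \<omega> * (Z j (min b' t) \<omega> - Z j (min a' t) \<omega>) *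
          (\<xi> \<omega> * (Z i (min b t) \<omega> - Z i (min a t) \<omega>)))"
      by (simp add: mult_ac)
    also have "\<dots> = \<kappa> j i * expectation (\<lambda>\<omega>. \<zeta> \<omega> * \<xi> \<omega>) * max 0 (min (min b b') t - a)"
    proof -
      have "a' \<le> min b' t" "min b' t \<le> T" "a \<le> min b t" "min b t \<le> T" using ab ab' 3 by auto
      from increment_product_aux[OF ab'(1) this(1,2) 3(3) this(3,4) \<zeta> \<xi>, of j i]
      show ?thesis unfolding e by (simp only:)
    qed
    also have "\<kappa> j i = \<kappa> i j" by auto
    also have "(\<lambda>\<omega>. \<zeta> \<omega> * \<xi> \<omega>) = (\<lambda>\<omega>. \<xi> \<omega> * \<zeta> \<omega>)" by (simp only: mult.commute)
    finally show ?thesis unfolding e(3) .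
  qed
qed

section \<open>Lebesgue measure on the time interval times the probability: Fubini\<close>

abbreviation LT :: "real measure" where "LT \<equiv> restrict_space lborel {0..T}"
abbreviation PT :: "(real \<times> 'a) measure" where "PT \<equiv> LT \<Otimes>\<^sub>M M"

lemma emeasure_LT: "emeasure LT (space LT) = ennreal T"
proof -
  have "emeasure LT (space LT) = emeasure lborel {0..T}"
    unfolding space_restrict_space by (subst emeasure_restrict_space) auto
  then show ?thesis using emeasure_lborel_Icc[of 0 T] T_pos by simp
qed

lemma finite_measure_LT: "finite_measure LT"
  by (rule finite_measureI) (unfold emeasure_LT, simp)

lemma finite_measure_PT: "finite_measure PT"
proof (rule finite_measureI)
  interpret sigma_finite_measure M by unfold_locales
  have "emeasure PT (space PT) = emeasure LT (space LT) * emeasure M (space M)"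
    unfolding space_pair_measure by (intro emeasure_pair_measure_Times sets.top)
  then show "emeasure PT (space PT) \<noteq> \<infinity>"
    unfolding emeasure_LT emeasure_space_1 by simp
qed

lemma pair_sigma_finite_PT: "pair_sigma_finite LT M"
proof -
  interpret finite_measure LT by (rule finite_measure_LT)
  show ?thesis by unfold_locales
qed

lemma borel_measurable_PT_iff:
  "f \<in> borel_measurable PT \<longleftrightarrow> f \<in> borel_measurable (restrict_space borel {0..T} \<Otimes>\<^sub>M M)"
  by (intro arg_cong[where f = "\<lambda>A. f \<in> A"] measurable_cong_sets sets_pair_measure_cong sets_restrict_space_cong) auto

lemma fst_measurable_PT [measurable]: "fst \<in> borel_measurable PT"
proof -
  have "(\<lambda>x::real. x) \<in> borel_measurable LT" by (rule measurable_restrict_space1) simp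
  show ?thesis by (rule measurable_compose[OF measurable_fst \<open>(\<lambda>x::real. x) \<in> borel_measurable LT\<close>])
qed

lemma snd_measurable_PT [measurable]: "X \<in> borel_measurable M \<Longrightarrow> (\<lambda>x. X (snd x)) \<in> borel_measurable PT"
  by (rule measurable_compose[OF measurable_snd])

lemma set_integrable_LT: 
  fixes f :: "real \<Rightarrow> real"
  shows "set_integrable lborel {0..T} f \<longleftrightarrow> integrable LT f"
  unfolding set_integrable_def by (subst integrable_restrict_space) auto

lemma set_integral_LT:
  fixes f :: "real \<Rightarrow> real"
  assumes "t \<in> {0..T}"
  shows "(LINT s:{0..t}|lborel. f s) = (\<integral>s. indicator {0..t} s * f s \<partial>LT)"
proof -
  have "indicator {0..t} s *\<^sub>R f s = indicator {0..T} s *\<^sub>R (indicator {0..t} s * f s)" for s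
    using assms by (auto simp: indicator_def)
  moreover have "(\<integral>s. indicator {0..t} s * f s \<partial>LT) = (\<integral>s. indicator {0..T} s *\<^sub>R (indicator {0..t} s * f s) \<partial>lborel)"
    by (rule integral_restrict_space) simp
  ultimately show ?thesis unfolding set_lebesgue_integral_def by (simp only:)
qed

lemma Fubini_PT:
  fixes f :: "real \<times> 'a \<Rightarrow> real"
  assumes f: "integrable PT f"
  shows "AE t in LT. integrable M (\<lambda>\<omega>. f (t, \<omega>))"
    "set_integrable lborel {0..T} (\<lambda>t. expectation (\<lambda>\<omega>. f (t, \<omega>)))"
    "AE \<omega> in M. set_integrable lborel {0..T} (\<lambda>t. f (t, \<omega>))"
    "t \<in> {0..T} \<Longrightarrow> integrable M (\<lambda>\<omega>. LINT s:{0..t}|lborel. f (s, \<omega>))"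
    "t \<in> {0..T} \<Longrightarrow> expectation (\<lambda>\<omega>. LINT s:{0..t}|lborel. f (s, \<omega>))
        = (LINT s:{0..t}|lborel. expectation (\<lambda>\<omega>. f (s, \<omega>)))"
    "t \<in> {0..T} \<Longrightarrow> (LINT s:{0..t}|lborel. expectation (\<lambda>\<omega>. f (s, \<omega>)))
        = (\<integral>x. indicator {0..t} (fst x) * f x \<partial>PT)"
    "t \<in> {0..T} \<Longrightarrow> integrable PT (\<lambda>x. indicator {0..t} (fst x) * f x)"
proof -
  interpret PTp: pair_sigma_finite LT M by (rule pair_sigma_finite_PT)
  show "AE t in LT. integrable M (\<lambda>\<omega>. f (t, \<omega>))" by (rule PTp.AE_integrable_fst'[OF f])
  show "set_integrable lborel {0..T} (\<lambda>t. expectation (\<lambda>\<omega>. f (t, \<omega>)))"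
    unfolding set_integrable_LT by (rule PTp.integrable_fst'[OF f])
  show "AE \<omega> in M. set_integrable lborel {0..T} (\<lambda>t. f (t, \<omega>))"
    unfolding set_integrable_LT using PTp.AE_integrable_snd[of "\<lambda>t \<omega>. f (t, \<omega>)"] f by simp
  assume t: "t \<in> {0..T}"
  show g: "integrable PT (\<lambda>x. indicator {0..t} (fst x) * f x)"
  proof (rule Bochner_Integration.integrable_bound[OF f])
    show "(\<lambda>x. indicator {0..t} (fst x) * f x) \<in> borel_measurable PT"
      using f by (intro borel_measurable_times) auto
    show "AE x in PT. norm (indicator {0..t} (fst x) * f x) \<le> norm (f x)" by (auto simp: indicator_def)
  qed
  show "integrable M (\<lambda>\<omega>. LINT s:{0..t}|lborel. f (s, \<omega>))"
    unfolding set_integral_LT[OF t] using PTp.integrable_snd[of "\<lambda>s \<omega>. indicator {0..t} s * f (s, \<omega>)"] g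
    by (simp add: case_prod_beta')
  show eq: "(LINT s:{0..t}|lborel. expectation (\<lambda>\<omega>. f (s, \<omega>))) = (\<integral>x. indicator {0..t} (fst x) * f x \<partial>PT)"
    unfolding set_integral_LT[OF t] using PTp.integral_fst'[OF g] by simp
  show "expectation (\<lambda>\<omega>. LINT s:{0..t}|lborel. f (s, \<omega>)) = (LINT s:{0..t}|lborel. expectation (\<lambda>\<omega>. f (s, \<omega>)))"
    unfolding eq unfolding set_integral_LT[OF t]
    using PTp.integral_snd[of "\<lambda>s \<omega>. indicator {0..t} s * f (s, \<omega>)"] g by (simp add: case_prod_beta')
qed

section \<open>The Ito isometry\<close>

lemma nn_integral_PT:
  assumes f: "f \<in> borel_measurable PT"
  shows "(\<integral>\<^sup>+\<omega>. (\<integral>\<^sup>+t\<in>{0..T}. f (t, \<omega>) \<partial>lborel) \<partial>M) = (\<integral>\<^sup>+x. f x \<partial>PT)"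
    "(\<integral>\<^sup>+t. (\<integral>\<^sup>+\<omega>. f (t, \<omega>) \<partial>M) \<partial>LT) = (\<integral>\<^sup>+x. f x \<partial>PT)"
proof -
  interpret PTp: pair_sigma_finite LT M by (rule pair_sigma_finite_PT)
  have "(\<integral>\<^sup>+t. f (t, \<omega>) \<partial>LT) = (\<integral>\<^sup>+t\<in>{0..T}. f (t, \<omega>) \<partial>lborel)" for \<omega>
    by (rule nn_integral_restrict_space) simp
  then show "(\<integral>\<^sup>+\<omega>. (\<integral>\<^sup>+t\<in>{0..T}. f (t, \<omega>) \<partial>lborel) \<partial>M) = (\<integral>\<^sup>+x. f x \<partial>PT)"
    using PTp.nn_integral_snd[OF f] by simp
  show "(\<integral>\<^sup>+t. (\<integral>\<^sup>+\<omega>. f (t, \<omega>) \<partial>M) \<partial>LT) = (\<integral>\<^sup>+x. f x \<partial>PT)"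
    by (rule nn_integral_fst[OF f]) 
qed

text \<open>Tonelli over the finite measure \<open>LT\<close>. Estimates at fixed times, uniform in
  the time, thus become square integrability over \<open>PT\<close>.\<close>

lemma l2_PT_bound:
  assumes m: "(\<lambda>(t, \<omega>). X t \<omega>) \<in> borel_measurable PT"
    and l2: "\<And>t. t \<in> {0..T} \<Longrightarrow> l2 M (X t)"
    and le: "\<And>t. t \<in> {0..T} \<Longrightarrow> expectation (\<lambda>\<omega>. (X t \<omega>)\<^sup>2) \<le> C"
  shows "l2 PT (\<lambda>x. X (fst x) (snd x))"
proof (rule l2_nn)
  show m': "(\<lambda>x. X (fst x) (snd x)) \<in> borel_measurable PT" using m by (simp add: case_prod_beta')
  have "(\<lambda>x. ennreal ((X (fst x) (snd x))\<^sup>2)) \<in> borel_measurable PT" using m' by simp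
  from nn_integral_PT(2)[OF this]
  have "(\<integral>\<^sup>+x. ennreal ((X (fst x) (snd x))\<^sup>2) \<partial>PT) = (\<integral>\<^sup>+t. (\<integral>\<^sup>+\<omega>. ennreal ((X t \<omega>)\<^sup>2) \<partial>M) \<partial>LT)"
    by simp
  also have "\<dots> \<le> (\<integral>\<^sup>+t. ennreal C \<partial>LT)"
  proof (rule nn_integral_mono)
    fix t assume "t \<in> space LT"
    then have t: "t \<in> {0..T}" by (simp add: space_restrict_space)
    show "(\<integral>\<^sup>+\<omega>. ennreal ((X t \<omega>)\<^sup>2) \<partial>M) \<le> ennreal C"
      unfolding l2_nn_eq[OF l2[OF t]] by (rule ennreal_leI[OF le[OF t]])
  qed
  also have "\<dots> = ennreal C * ennreal T" unfolding nn_integral_const emeasure_LT ..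
  also have "\<dots> < \<infinity>" by (simp add: ennreal_mult_less_top)
  finally show "(\<integral>\<^sup>+x. ennreal ((X (fst x) (snd x))\<^sup>2) \<partial>PT) < \<infinity>" .
qed

lemma l2_PT_snd: "l2 M X \<Longrightarrow> l2 PT (\<lambda>x. X (snd x))"
  using l2_PT_bound[of "\<lambda>t. X" "expectation (\<lambda>\<omega>. (X \<omega>)\<^sup>2)"] snd_measurable_PT[of X]
  by (simp add: case_prod_beta' l2_measurable)

lemma indicator_mult_integral_PT:
  assumes X: "integrable M X" and a: "0 \<le> a" "b \<le> T"
  shows "(\<integral>x. indicator {a<..b} (fst x) * X (snd x) \<partial>PT) = max 0 (b - a) * expectation X"
proof -
  interpret PTp: pair_sigma_finite LT M by (rule pair_sigma_finite_PT)
  have int: "integrable PT (\<lambda>x. indicator {a<..b} (fst x) * X (snd x))"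
  proof (rule PTp.Fubini_integrable)
    show "(\<lambda>x. indicator {a<..b} (fst x) * X (snd x)) \<in> borel_measurable PT"
      using X by (intro borel_measurable_times) auto
    have "integrable LT (\<lambda>x. indicator {a<..b} x * expectation (\<lambda>\<omega>. norm (X \<omega>)))"
    proof (intro integrable_mult_left finite_measure.integrable_const_bound[OF finite_measure_LT, where B = 1])
      show "(\<lambda>x. indicator {a<..b} x :: real) \<in> borel_measurable LT" by (rule measurable_restrict_space1) simp
    qed (simp add: indicator_def)
    then show "integrable LT (\<lambda>x. \<integral>y. norm (indicator {a<..b} (fst (x, y)) * X (snd (x, y))) \<partial>M)"
      by (simp add: abs_mult)
    show "AE x in LT. integrable M (\<lambda>y. indicator {a<..b} (fst (x, y)) * X (snd (x, y)))"
      using X by simp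
  qed
  have "(\<integral>x. indicator {a<..b} (fst x) * X (snd x) \<partial>PT) = (\<integral>t. indicator {a<..b} t \<partial>LT) * expectation X"
    using PTp.integral_fst'[OF int] by simp
  also have "(\<integral>t. (indicator {a<..b} t :: real) \<partial>LT) = (\<integral>t. indicator {0..T} t *\<^sub>R (indicator {a<..b} t :: real) \<partial>lborel)"
    by (rule integral_restrict_space) simp
  also have "\<dots> = (\<integral>t. (indicator {a<..b} t :: real) \<partial>lborel)"
    using a by (intro Bochner_Integration.integral_cong) (auto simp: indicator_def)
  also have "\<dots> = max 0 (b - a)" by (cases "a \<le> b") auto
  finally show ?thesis .
qed

section \<open>Simple integrands: isometry and martingale property\<close>

lemma simple_integrand_grid:
  assumes s: "simple_integrand F T n g \<xi>" and i: "i < n"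
  shows "0 \<le> g i" "g i \<le> g (Suc i)" "g (Suc i) \<le> T" "bdd (g i) (\<xi> i)" "g i \<le> T"
proof -
  have st: "0 \<le> g 0" "g n \<le> T" "\<And>i. i < n \<Longrightarrow> g i \<le> g (Suc i)" 
    using s by (auto simp: simple_integrand_def)
  have up: "k \<le> n \<Longrightarrow> g 0 \<le> g k" for k
  proof (induction k)
    case (Suc k)
    then show ?case using st(3)[of k] by simp
  qed simp
  have dn: "k \<le> n \<Longrightarrow> g (n - k) \<le> g n" for k
  proof (induction k)
    case (Suc k)
    then have "g (n - Suc k) \<le> g (Suc (n - Suc k))" by (intro st) auto
    also have "Suc (n - Suc k) = n - k" using Suc by simp
    finally show ?case using Suc by simp
  qed simp
  show "0 \<le> g i" using up[of i] st i by simp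
  show gi: "g i \<le> g (Suc i)" using st i by simp
  have "g (n - (n - Suc i)) \<le> g n" by (rule dn) simp
  moreover have "n - (n - Suc i) = Suc i" using i by simp
  ultimately show gT: "g (Suc i) \<le> T" using st(2) by simp
  show "g i \<le> T" using gi gT by simp
  show "bdd (g i) (\<xi> i)" using s i by (auto simp: simple_integrand_def bdd_def)
qed

lemma simple_term_l2:
  assumes s: "simple_integrand F T n g \<xi>" and i: "i < n" and t: "t \<in> {0..T}"
  shows "l2 M (\<lambda>\<omega>. \<xi> i \<omega> * (Z k (min (g (Suc i)) t) \<omega> - Z k (min (g i) t) \<omega>))"
  using simple_integrand_grid[OF s i] t by (intro bdd_l2_mult[of "g i"] Z_l2) auto

lemma simple_integral_l2:
  assumes s: "simple_integrand F T n g \<xi>" and t: "t \<in> {0..T}"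
  shows "l2 M (simple_integral (Z k) n g \<xi> t)"
  unfolding simple_integral_def[abs_def] by (intro l2_sum simple_term_l2[OF s _ t]) auto

lemma simple_process_term_l2:
  assumes s: "simple_integrand F T n g \<xi>" and i: "i < n"
  shows "l2 PT (\<lambda>x. \<xi> i (snd x) * indicator {g i<..g (Suc i)} (fst x))"
proof -
  note b = simple_integrand_grid[OF s i]
  have "l2 PT (\<lambda>x. indicator {g i<..g (Suc i)} (fst x) * \<xi> i (snd x))"
    by (rule l2_bounded_mult[OF l2_PT_snd[OF bdd_l2[OF b(4,5)]], where C = 1])
      (auto intro: measurable_compose[OF fst_measurable_PT] simp: indicator_def)
  then show ?thesis by (simp add: mult.commute)
qed

lemma simple_process_l2:
  assumes s: "simple_integrand F T n g \<xi>"
  shows "l2 PT (\<lambda>x. simple_process n g \<xi> (fst x) (snd x))"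
  unfolding simple_process_def[abs_def] by (intro l2_sum simple_process_term_l2[OF s]) auto

lemma indicator_t_measurable [measurable]: "(\<lambda>x. indicator {0..t} (fst x) :: real) \<in> borel_measurable PT"
  by (rule measurable_compose[OF fst_measurable_PT]) simp

lemma l2_PT_indicator: "l2 PT f \<Longrightarrow> l2 PT (\<lambda>x. indicator {0..t} (fst x) * f x)"
  by (rule l2_bounded_mult[where C = 1]) (auto simp: indicator_def)

lemma integral_double_sum:
  fixes f :: "nat \<Rightarrow> nat \<Rightarrow> 'b \<Rightarrow> real"
  assumes "\<And>i j. i < n \<Longrightarrow> j < m \<Longrightarrow> integrable N (f i j)"
  shows "(\<integral>x. (\<Sum>i<n. \<Sum>j<m. f i j x) \<partial>N) = (\<Sum>i<n. \<Sum>j<m. \<integral>x. f i j x \<partial>N)"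
proof -
  have "(\<integral>x. (\<Sum>i<n. \<Sum>j<m. f i j x) \<partial>N) = (\<Sum>i<n. \<integral>x. (\<Sum>j<m. f i j x) \<partial>N)"
    using assms by (intro Bochner_Integration.integral_sum Bochner_Integration.integrable_sum) auto
  also have "\<dots> = (\<Sum>i<n. \<Sum>j<m. \<integral>x. f i j x \<partial>N)"
    using assms by (intro sum.cong refl Bochner_Integration.integral_sum) auto
  finally show ?thesis .
qed

text \<open>The polarised form with two motions is what a product rule for two states needs. By
  bilinearity it reduces to two summands; there both sides equal \<open>\<kappa> k l\<close> times
  the expectation of the product of the coefficients times the length of the overlap.\<close>

lemma simple_isometry:
  assumes s: "simple_integrand F T n g \<xi>" and s': "simple_integrand F T m g' \<zeta>" and t: "t \<in> {0..T}"
  shows "expectation (\<lambda>\<omega>. simple_integral (Z k) n g \<xi> t \<omega> * simple_integral (Z l) m g' \<zeta> t \<omega>)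
    = \<kappa> k l * (\<integral>x. indicator {0..t} (fst x) * simple_process n g \<xi> (fst x) (snd x) * simple_process m g' \<zeta> (fst x) (snd x) \<partial>PT)"
proof -
  let ?A = "\<lambda>i \<omega>. \<xi> i \<omega> * (Z k (min (g (Suc i)) t) \<omega> - Z k (min (g i) t) \<omega>)"
  let ?B = "\<lambda>j \<omega>. \<zeta> j \<omega> * (Z l (min (g' (Suc j)) t) \<omega> - Z l (min (g' j) t) \<omega>)"
  let ?a = "\<lambda>i x. \<xi> i (snd x) * indicator {g i<..g (Suc i)} (fst x)"
  let ?b = "\<lambda>j x. \<zeta> j (snd x) * indicator {g' j<..g' (Suc j)} (fst x)"
  have term_eq: "expectation (\<lambda>\<omega>. ?A i \<omega> * ?B j \<omega>) = \<kappa> k l * (\<integral>x. indicator {0..t} (fst x) * ?a i x * ?b j x \<partial>PT)"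
    if i: "i < n" and j: "j < m" for i j
  proof -
    note gi = simple_integrand_grid[OF s i] and gj = simple_integrand_grid[OF s' j]
    let ?lo = "max (g i) (g' j)" and ?hi = "min (min (g (Suc i)) (g' (Suc j))) t"
    have int: "integrable M (\<lambda>\<omega>. \<xi> i \<omega> * \<zeta> j \<omega>)"
      by (rule l2_integrable_mult[OF bdd_l2[OF gi(4,5)] bdd_l2[OF gj(4,5)]])
    have "(\<lambda>x. indicator {0..t} (fst x) * ?a i x * ?b j x) = (\<lambda>x. indicator {?lo<..?hi} (fst x) * (\<xi> i (snd x) * \<zeta> j (snd x)))"
    proof
      fix x :: "real \<times> 'a"
      have "(indicator {?lo<..?hi} (fst x) :: real) = indicator {0..t} (fst x) *
          (indicator {g i<..g (Suc i)} (fst x) * indicator {g' j<..g' (Suc j)} (fst x))"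
        using gi(1) by (auto simp: indicator_def)
      then show "indicator {0..t} (fst x) * ?a i x * ?b j x = indicator {?lo<..?hi} (fst x) * (\<xi> i (snd x) * \<zeta> j (snd x))"
        by (simp only: mult_ac)
    qed
    then have "(\<integral>x. indicator {0..t} (fst x) * ?a i x * ?b j x \<partial>PT) = max 0 (?hi - ?lo) * expectation (\<lambda>\<omega>. \<xi> i \<omega> * \<zeta> j \<omega>)"
    proof (simp only:)
      have "0 \<le> ?lo" "?hi \<le> T" using gi gj by auto
      then show "(\<integral>x. indicator {?lo<..?hi} (fst x) * (\<xi> i (snd x) * \<zeta> j (snd x)) \<partial>PT) =
          max 0 (?hi - ?lo) * expectation (\<lambda>\<omega>. \<xi> i \<omega> * \<zeta> j \<omega>)"
        by (rule indicator_mult_integral_PT[OF int])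
    qed
    moreover have "0 \<le> t" using t by simp
    note increment_product[OF gi(1,2,3) gj(1,2,3) gi(4) gj(4) this, of k l]
    ultimately show ?thesis by (simp only: mult_ac)
  qed
  have "expectation (\<lambda>\<omega>. simple_integral (Z k) n g \<xi> t \<omega> * simple_integral (Z l) m g' \<zeta> t \<omega>)
      = expectation (\<lambda>\<omega>. \<Sum>i<n. \<Sum>j<m. ?A i \<omega> * ?B j \<omega>)"
    unfolding simple_integral_def sum_product ..
  also have "\<dots> = (\<Sum>i<n. \<Sum>j<m. expectation (\<lambda>\<omega>. ?A i \<omega> * ?B j \<omega>))"
  proof -
    have "integrable M (\<lambda>\<omega>. ?A i \<omega> * ?B j \<omega>)" if "i < n" "j < m" for i j
      by (rule l2_integrable_mult[OF simple_term_l2[OF s that(1) t] simple_term_l2[OF s' that(2) t]])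
    then show ?thesis by (rule integral_double_sum)
  qed
  also have "\<dots> = (\<Sum>i<n. \<Sum>j<m. \<kappa> k l * (\<integral>x. indicator {0..t} (fst x) * ?a i x * ?b j x \<partial>PT))"
    by (intro sum.cong refl term_eq) auto
  also have "\<dots> = \<kappa> k l * (\<Sum>i<n. \<Sum>j<m. (\<integral>x. indicator {0..t} (fst x) * ?a i x * ?b j x \<partial>PT))"
    unfolding sum_distrib_left ..
  also have "(\<Sum>i<n. \<Sum>j<m. (\<integral>x. indicator {0..t} (fst x) * ?a i x * ?b j x \<partial>PT))
      = (\<integral>x. (\<Sum>i<n. \<Sum>j<m. indicator {0..t} (fst x) * ?a i x * ?b j x) \<partial>PT)"
  proof -
    have "integrable PT (\<lambda>x. indicator {0..t} (fst x) * ?a i x * ?b j x)" if "i < n" "j < m" for i j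
      by (rule l2_integrable_mult[OF l2_PT_indicator[OF simple_process_term_l2[OF s that(1)]] simple_process_term_l2[OF s' that(2)]])
    then show ?thesis by (rule integral_double_sum[symmetric])
  qed
  also have "(\<lambda>x. \<Sum>i<n. \<Sum>j<m. indicator {0..t} (fst x) * ?a i x * ?b j x) =
     (\<lambda>x. indicator {0..t} (fst x) * simple_process n g \<xi> (fst x) (snd x) * simple_process m g' \<zeta> (fst x) (snd x))"
    unfolding simple_process_def mult.assoc sum_product by (simp only: sum_distrib_left)
  finally show ?thesis .
qed

text \<open>Testing against a variable known at time \<open>r\<close> replaces conditional
  expectations. Between \<open>r\<close> and \<open>t\<close> a summand changes only by the
  increment over the part of its interval lying there, which is orthogonal to the past.\<close>

lemma simple_martingale:
  assumes s: "simple_integrand F T n g \<xi>" and st: "0 \<le> r" "r \<le> t" "t \<le> T"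
    and G: "G \<in> borel_measurable (F r)" "l2 M G"
  shows "expectation (\<lambda>\<omega>. G \<omega> * (simple_integral (Z k) n g \<xi> t \<omega> - simple_integral (Z k) n g \<xi> r \<omega>)) = 0"
proof -
  let ?A = "\<lambda>t i \<omega>. \<xi> i \<omega> * (Z k (min (g (Suc i)) t) \<omega> - Z k (min (g i) t) \<omega>)"
  have zero: "expectation (\<lambda>\<omega>. G \<omega> * (?A t i \<omega> - ?A r i \<omega>)) = 0" if i: "i < n" for i
  proof -
    note gi = simple_integrand_grid[OF s i]
    \<comment> \<open>\<open>a\<close> and \<open>b\<close> are the ends of the i-th grid interval,
      clamped to the interval from \<open>r\<close> to \<open>t\<close>.\<close>
    define a where "a = min (max (g i) r) t"
    define b where "b = min (max (g (Suc i)) r) t"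
    have ab: "0 \<le> a" "a \<le> b" "b \<le> T" "r \<le> a" using gi st by (auto simp: a_def b_def)
    have inc: "?A t i \<omega> - ?A r i \<omega> = \<xi> i \<omega> * (Z k b \<omega> - Z k a \<omega>)" for \<omega>
    proof -
      have "Z k (min x t) \<omega> - Z k (min x r) \<omega> = Z k (min (max x r) t) \<omega> - Z k r \<omega>" for x
        using st by (cases "x \<le> r") (auto simp: min_def max_def)
      from this[of "g i"] this[of "g (Suc i)"]
      have "(Z k (min (g (Suc i)) t) \<omega> - Z k (min (g i) t) \<omega>) - (Z k (min (g (Suc i)) r) \<omega> - Z k (min (g i) r) \<omega>)
        = Z k b \<omega> - Z k a \<omega>"
        unfolding a_def b_def by linarith
      then show ?thesis unfolding right_diff_distrib[symmetric] by (simp only:)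
    qed
    show ?thesis
    proof (cases "a = b")
      case False
      \<comment> \<open>A nondegenerate clamped interval begins no earlier than \<open>g i\<close>,
        so the coefficient is known at its beginning.\<close>
      have ga: "g i \<le> a"
      proof (rule ccontr)
        assume "\<not> g i \<le> a"
        then have "a = t" using st by (auto simp: a_def min_def split: if_splits)
        moreover have "b \<le> t" by (simp add: b_def)
        ultimately show False using False ab by simp
      qed
      have \<xi>a: "bdd a (\<xi> i)" by (rule bdd_mono[OF gi(4) ga])
      have aT: "a \<le> T" using ab by simp
      have l: "l2 M (\<lambda>\<omega>. \<xi> i \<omega> * G \<omega>)" by (rule bdd_l2_mult[OF \<xi>a aT G(2)])
      have m: "(\<lambda>\<omega>. \<xi> i \<omega> * G \<omega>) \<in> borel_measurable (F a)"
        using \<xi>a F_mono[OF G(1) ab(4)] by (auto simp: bdd_def)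
      have "expectation (\<lambda>\<omega>. \<xi> i \<omega> * G \<omega> * (Z k b \<omega> - Z k a \<omega>)) = 0"
        by (rule expectation_increment(2)[OF ab(1,2,3) m l2_integrable[OF finite_measure_axioms l]])
      then show ?thesis unfolding inc by (simp add: mult_ac)
    qed (simp add: inc)
  qed
  have rt: "r \<in> {0..T}" "t \<in> {0..T}" using st by auto
  have "expectation (\<lambda>\<omega>. G \<omega> * (simple_integral (Z k) n g \<xi> t \<omega> - simple_integral (Z k) n g \<xi> r \<omega>))
    = expectation (\<lambda>\<omega>. \<Sum>i<n. G \<omega> * (?A t i \<omega> - ?A r i \<omega>))"
    unfolding simple_integral_def sum_subtractf[symmetric] sum_distrib_left ..
  also have "\<dots> = (\<Sum>i<n. expectation (\<lambda>\<omega>. G \<omega> * (?A t i \<omega> - ?A r i \<omega>)))"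
    by (intro Bochner_Integration.integral_sum l2_integrable_mult[OF G(2) l2_diff] simple_term_l2[OF s _ rt(1)] simple_term_l2[OF s _ rt(2)]) auto
  also have "\<dots> = 0" using zero by simp
  finally show ?thesis .
qed

text \<open>\<open>ito_integral\<close> speaks of iterated nonnegative integrals and asks for no
  measurability of \<open>H\<close>. With joint measurability these become integrals over
  \<open>PT\<close>, and square integrability of \<open>H\<close> and of \<open>I t\<close> follows
  from the approximation alone.\<close>

lemma ito_approx:
  assumes I: "ito_integral M F T (Z k) H I" and Hm: "(\<lambda>(t, \<omega>). H t \<omega>) \<in> borel_measurable PT"
  obtains n g \<xi> where "\<And>j. simple_integrand F T (n j) (g j) (\<xi> j)"
    "l2 PT (\<lambda>x. H (fst x) (snd x))" "\<And>t. t \<in> {0..T} \<Longrightarrow> l2 M (I t)"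
    "(\<lambda>j. \<integral>x. (simple_process (n j) (g j) (\<xi> j) (fst x) (snd x) - H (fst x) (snd x))\<^sup>2 \<partial>PT) \<longlonglongrightarrow> 0"
    "\<And>t. t \<in> {0..T} \<Longrightarrow> (\<lambda>j. \<integral>\<omega>. (simple_integral (Z k) (n j) (g j) (\<xi> j) t \<omega> - I t \<omega>)\<^sup>2 \<partial>M) \<longlonglongrightarrow> 0"
proof -
  have Hm': "(\<lambda>x. H (fst x) (snd x)) \<in> borel_measurable PT" using Hm by (simp add: case_prod_beta')
  have Im: "I t \<in> borel_measurable M" if "t \<in> {0..T}" for t
    using I that by (intro F_imp_M[of "I t" t]) (auto simp: ito_integral_def)
  obtain n g \<xi> where s: "\<And>j. simple_integrand F T (n j) (g j) (\<xi> j)" and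
    l1: "(\<lambda>j. \<integral>\<^sup>+\<omega>. (\<integral>\<^sup>+t\<in>{0..T}. ennreal ((simple_process (n j) (g j) (\<xi> j) t \<omega> - H t \<omega>)\<^sup>2) \<partial>lborel) \<partial>M) \<longlonglongrightarrow> 0"
    and l2: "\<And>t. t \<in> {0..T} \<Longrightarrow> (\<lambda>j. \<integral>\<^sup>+\<omega>. ennreal ((simple_integral (Z k) (n j) (g j) (\<xi> j) t \<omega> - I t \<omega>)\<^sup>2) \<partial>M) \<longlonglongrightarrow> 0"
    using I unfolding ito_integral_def by blast
  have "(\<integral>\<^sup>+\<omega>. (\<integral>\<^sup>+t\<in>{0..T}. ennreal ((simple_process (n j) (g j) (\<xi> j) t \<omega> - H t \<omega>)\<^sup>2) \<partial>lborel) \<partial>M)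
    = (\<integral>\<^sup>+x. ennreal ((simple_process (n j) (g j) (\<xi> j) (fst x) (snd x) - H (fst x) (snd x))\<^sup>2) \<partial>PT)" for j
    using nn_integral_PT(1)[of "\<lambda>x. ennreal ((simple_process (n j) (g j) (\<xi> j) (fst x) (snd x) - H (fst x) (snd x))\<^sup>2)"]
      l2_measurable[OF simple_process_l2[OF s[of j]]] Hm' by simp
  with l1 have l1': "(\<lambda>j. \<integral>\<^sup>+x. ennreal ((simple_process (n j) (g j) (\<xi> j) (fst x) (snd x) - H (fst x) (snd x))\<^sup>2) \<partial>PT) \<longlonglongrightarrow> 0"
    by (simp only:)
  show thesis
  proof (rule that[OF s])
    show "l2 PT (\<lambda>x. H (fst x) (snd x))"
      by (rule l2_nn_tendsto(1)[OF simple_process_l2[OF s] Hm' l1'])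
    show "(\<lambda>j. \<integral>x. (simple_process (n j) (g j) (\<xi> j) (fst x) (snd x) - H (fst x) (snd x))\<^sup>2 \<partial>PT) \<longlonglongrightarrow> 0"
      by (rule l2_nn_tendsto(2)[OF simple_process_l2[OF s] Hm' l1'])
    show "l2 M (I t)" if "t \<in> {0..T}" for t
      by (rule l2_nn_tendsto(1)[OF simple_integral_l2[OF s that] Im[OF that] l2[OF that]])
    show "(\<lambda>j. \<integral>\<omega>. (simple_integral (Z k) (n j) (g j) (\<xi> j) t \<omega> - I t \<omega>)\<^sup>2 \<partial>M) \<longlonglongrightarrow> 0" if "t \<in> {0..T}" for t
      by (rule l2_nn_tendsto(2)[OF simple_integral_l2[OF s that] Im[OF that] l2[OF that]])
  qed
qed

text \<open>Both sides are limits of their counterparts for simple integrands, since convergence in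
  L2 of the factors suffices for products. For \<open>k \<noteq> l\<close> this is the orthogonality
  of integrals against \<open>W\<close> and \<open>B\<close>.\<close>

lemma ito_isometry:
  assumes I: "ito_integral M F T (Z k) H I" and Hm: "(\<lambda>(t, \<omega>). H t \<omega>) \<in> borel_measurable PT"
    and J: "ito_integral M F T (Z l) K J" and Km: "(\<lambda>(t, \<omega>). K t \<omega>) \<in> borel_measurable PT"
    and t: "t \<in> {0..T}"
  shows "expectation (\<lambda>\<omega>. I t \<omega> * J t \<omega>) =
    \<kappa> k l * (\<integral>x. indicator {0..t} (fst x) * H (fst x) (snd x) * K (fst x) (snd x) \<partial>PT)"
proof -
  obtain n g \<xi> where 1: "\<And>j. simple_integrand F T (n j) (g j) (\<xi> j)"
    "l2 PT (\<lambda>x. H (fst x) (snd x))" "\<And>t. t \<in> {0..T} \<Longrightarrow> l2 M (I t)"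
    "(\<lambda>j. \<integral>x. (simple_process (n j) (g j) (\<xi> j) (fst x) (snd x) - H (fst x) (snd x))\<^sup>2 \<partial>PT) \<longlonglongrightarrow> 0"
    "\<And>t. t \<in> {0..T} \<Longrightarrow> (\<lambda>j. \<integral>\<omega>. (simple_integral (Z k) (n j) (g j) (\<xi> j) t \<omega> - I t \<omega>)\<^sup>2 \<partial>M) \<longlonglongrightarrow> 0"
    using ito_approx[OF I Hm] by blast
  obtain m f \<zeta> where 2: "\<And>j. simple_integrand F T (m j) (f j) (\<zeta> j)"
    "l2 PT (\<lambda>x. K (fst x) (snd x))" "\<And>t. t \<in> {0..T} \<Longrightarrow> l2 M (J t)"
    "(\<lambda>j. \<integral>x. (simple_process (m j) (f j) (\<zeta> j) (fst x) (snd x) - K (fst x) (snd x))\<^sup>2 \<partial>PT) \<longlonglongrightarrow> 0"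
    "\<And>t. t \<in> {0..T} \<Longrightarrow> (\<lambda>j. \<integral>\<omega>. (simple_integral (Z l) (m j) (f j) (\<zeta> j) t \<omega> - J t \<omega>)\<^sup>2 \<partial>M) \<longlonglongrightarrow> 0"
    using ito_approx[OF J Km] by blast
  let ?S = "\<lambda>j x. simple_process (n j) (g j) (\<xi> j) (fst x) (snd x)"
  let ?S' = "\<lambda>j x. simple_process (m j) (f j) (\<zeta> j) (fst x) (snd x)"
  \<comment> \<open>Cutting off at \<open>t\<close> is a contraction in L2, so the truncated
    approximants converge as well.\<close>
  have "(\<lambda>j. \<integral>x. (indicator {0..t} (fst x) * ?S j x - indicator {0..t} (fst x) * H (fst x) (snd x))\<^sup>2 \<partial>PT) \<longlonglongrightarrow> 0"
  proof (rule tendsto_sandwich[OF _ _ tendsto_const 1(4)]; intro always_eventually allI)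
    fix j
    show "0 \<le> (\<integral>x. (indicator {0..t} (fst x) * ?S j x - indicator {0..t} (fst x) * H (fst x) (snd x))\<^sup>2 \<partial>PT)" by simp
    show "(\<integral>x. (indicator {0..t} (fst x) * ?S j x - indicator {0..t} (fst x) * H (fst x) (snd x))\<^sup>2 \<partial>PT) \<le>
      (\<integral>x. (?S j x - H (fst x) (snd x))\<^sup>2 \<partial>PT)"
      by (intro integral_mono l2_integrable_sq l2_diff l2_PT_indicator 1 simple_process_l2[OF 1(1)])
        (simp add: indicator_def)
  qed
  from l2_tendsto_mult[OF l2_PT_indicator[OF simple_process_l2[OF 1(1)]] l2_PT_indicator[OF 1(2)] this
      simple_process_l2[OF 2(1)] 2(2,4)]
  have "(\<lambda>j. \<kappa> k l * (\<integral>x. indicator {0..t} (fst x) * ?S j x * ?S' j x \<partial>PT)) \<longlonglongrightarrow>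
    \<kappa> k l * (\<integral>x. indicator {0..t} (fst x) * H (fst x) (snd x) * K (fst x) (snd x) \<partial>PT)"
    by (rule tendsto_mult_left)
  moreover have "(\<lambda>j. \<kappa> k l * (\<integral>x. indicator {0..t} (fst x) * ?S j x * ?S' j x \<partial>PT)) \<longlonglongrightarrow> expectation (\<lambda>\<omega>. I t \<omega> * J t \<omega>)"
    unfolding simple_isometry[OF 1(1) 2(1) t, symmetric]
    by (rule l2_tendsto_mult[OF simple_integral_l2[OF 1(1) t] 1(3)[OF t] 1(5)[OF t] simple_integral_l2[OF 2(1) t] 2(3)[OF t] 2(5)[OF t]])
  ultimately show ?thesis by (rule LIMSEQ_unique[rotated])
qed

lemma ito_l2:
  assumes I: "ito_integral M F T (Z k) H I" and Hm: "(\<lambda>(t, \<omega>). H t \<omega>) \<in> borel_measurable PT"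
  shows "l2 PT (\<lambda>x. H (fst x) (snd x))" "t \<in> {0..T} \<Longrightarrow> l2 M (I t)"
    "t \<in> {0..T} \<Longrightarrow> expectation (\<lambda>\<omega>. (I t \<omega>)\<^sup>2) \<le> (\<integral>x. (H (fst x) (snd x))\<^sup>2 \<partial>PT)"
proof -
  show H2: "l2 PT (\<lambda>x. H (fst x) (snd x))" and "t \<in> {0..T} \<Longrightarrow> l2 M (I t)"
    using ito_approx[OF I Hm] by metis+
  assume t: "t \<in> {0..T}"
  have "expectation (\<lambda>\<omega>. (I t \<omega>)\<^sup>2) = (\<integral>x. indicator {0..t} (fst x) * H (fst x) (snd x) * H (fst x) (snd x) \<partial>PT)"
    using ito_isometry[OF I Hm I Hm t] by (simp add: power2_eq_square)
  also have "\<dots> \<le> (\<integral>x. (H (fst x) (snd x))\<^sup>2 \<partial>PT)"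
    by (intro integral_mono l2_integrable_mult l2_PT_indicator l2_integrable_sq H2)
      (simp add: indicator_def power2_eq_square)
  finally show "expectation (\<lambda>\<omega>. (I t \<omega>)\<^sup>2) \<le> (\<integral>x. (H (fst x) (snd x))\<^sup>2 \<partial>PT)" .
qed

lemma ito_martingale:
  assumes I: "ito_integral M F T (Z k) H I" and Hm: "(\<lambda>(t, \<omega>). H t \<omega>) \<in> borel_measurable PT"
    and rt: "0 \<le> r" "r \<le> t" "t \<le> T" and G: "G \<in> borel_measurable (F r)" "l2 M G"
  shows "expectation (\<lambda>\<omega>. G \<omega> * I t \<omega>) = expectation (\<lambda>\<omega>. G \<omega> * I r \<omega>)"
proof -
  obtain n g \<xi> where 1: "\<And>j. simple_integrand F T (n j) (g j) (\<xi> j)"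
    "l2 PT (\<lambda>x. H (fst x) (snd x))" "\<And>t. t \<in> {0..T} \<Longrightarrow> l2 M (I t)"
    "(\<lambda>j. \<integral>x. (simple_process (n j) (g j) (\<xi> j) (fst x) (snd x) - H (fst x) (snd x))\<^sup>2 \<partial>PT) \<longlonglongrightarrow> 0"
    "\<And>t. t \<in> {0..T} \<Longrightarrow> (\<lambda>j. \<integral>\<omega>. (simple_integral (Z k) (n j) (g j) (\<xi> j) t \<omega> - I t \<omega>)\<^sup>2 \<partial>M) \<longlonglongrightarrow> 0"
    using ito_approx[OF I Hm] by blast
  have lim: "(\<lambda>j. expectation (\<lambda>\<omega>. G \<omega> * simple_integral (Z k) (n j) (g j) (\<xi> j) t \<omega>)) \<longlonglongrightarrow> expectation (\<lambda>\<omega>. G \<omega> * I t \<omega>)"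
    if t: "t \<in> {0..T}" for t
    by (rule l2_tendsto_mult[OF G(2) G(2) _ simple_integral_l2[OF 1(1) t] 1(3)[OF t] 1(5)[OF t]]) simp
  have rt': "r \<in> {0..T}" "t \<in> {0..T}" using rt by auto
  have "expectation (\<lambda>\<omega>. G \<omega> * simple_integral (Z k) (n j) (g j) (\<xi> j) t \<omega>) =
      expectation (\<lambda>\<omega>. G \<omega> * simple_integral (Z k) (n j) (g j) (\<xi> j) r \<omega>)" for j
  proof -
    have "expectation (\<lambda>\<omega>. G \<omega> * simple_integral (Z k) (n j) (g j) (\<xi> j) t \<omega> - G \<omega> * simple_integral (Z k) (n j) (g j) (\<xi> j) r \<omega>) = 0"
      using simple_martingale[OF 1(1)[of j] rt G, of k] by (simp only: right_diff_distrib)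
    moreover have "integrable M (\<lambda>\<omega>. G \<omega> * simple_integral (Z k) (n j) (g j) (\<xi> j) s \<omega>)" if "s \<in> {0..T}" for s
      by (rule l2_integrable_mult[OF G(2) simple_integral_l2[OF 1(1) that]])
    ultimately show ?thesis using rt' by simp
  qed
  with lim[OF rt'(2)] have "(\<lambda>j. expectation (\<lambda>\<omega>. G \<omega> * simple_integral (Z k) (n j) (g j) (\<xi> j) r \<omega>)) \<longlonglongrightarrow> expectation (\<lambda>\<omega>. G \<omega> * I t \<omega>)"
    by (simp only:)
  then show ?thesis using lim[OF rt'(1)] by (rule LIMSEQ_unique)
qed

text \<open>The notion of Ito integral prescribes no initial value; the isometry over the null time
  set \<open>{0..0}\<close> supplies it.\<close>

lemma ito_zero:
  assumes I: "ito_integral M F T (Z k) H I" and Hm: "(\<lambda>(t, \<omega>). H t \<omega>) \<in> borel_measurable PT"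
  shows "AE \<omega> in M. I 0 \<omega> = 0"
proof -
  have 0: "0 \<in> {0..T}" using T_pos by simp
  have "(\<integral>x. indicator {0..0} (fst x) * H (fst x) (snd x) * H (fst x) (snd x) \<partial>PT) = 0"
  proof -
    have int: "integrable PT (\<lambda>x. H (fst x) (snd x) * H (fst x) (snd x))"
      using ito_l2(1)[OF I Hm] by (rule l2_integrable_mult[rotated]) (rule ito_l2(1)[OF I Hm])
    have "(LINT s:{0..0}|lborel. expectation (\<lambda>\<omega>. H s \<omega> * H s \<omega>)) = 0"
      by (rule set_integral_singleton)
    then show ?thesis using Fubini_PT(6)[OF int 0] unfolding fst_conv snd_conv mult.assoc by (simp only:)
  qed
  then have "expectation (\<lambda>\<omega>. (I 0 \<omega>)\<^sup>2) = 0"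
    using ito_isometry[OF I Hm I Hm 0] by (simp add: power2_eq_square)
  then have "AE \<omega> in M. (I 0 \<omega>)\<^sup>2 = 0"
    using integral_nonneg_eq_0_iff_AE[OF l2_integrable_sq[OF ito_l2(2)[OF I Hm 0]]] by simp
  then show ?thesis by simp
qed

lemma ito_mean:
  assumes I: "ito_integral M F T (Z k) H I" and Hm: "(\<lambda>(t, \<omega>). H t \<omega>) \<in> borel_measurable PT"
    and t: "t \<in> {0..T}"
  shows "expectation (I t) = 0"
proof -
  have "expectation (\<lambda>\<omega>. 1 * I t \<omega>) = expectation (\<lambda>\<omega>. 1 * I 0 \<omega>)"
    using t l2_const[OF finite_measure_axioms, of 1] by (intro ito_martingale[OF I Hm]) auto
  also have "\<dots> = expectation (\<lambda>\<omega>. 0)"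
    using ito_zero[OF I Hm] l2_measurable[OF ito_l2(2)[OF I Hm, of 0]] T_pos by (intro integral_cong_AE) auto
  finally show ?thesis by simp
qed

section \<open>Ito processes\<close>

definition proc :: "bool \<Rightarrow> real \<Rightarrow> (real \<Rightarrow> 'a \<Rightarrow> real) \<Rightarrow> (real \<Rightarrow> 'a \<Rightarrow> real) \<Rightarrow> (real \<Rightarrow> 'a \<Rightarrow> real) \<Rightarrow> bool" where
  "proc k x0 a b X \<longleftrightarrow> (a, b) \<in> admissible M F T \<and> state_process M F T (Z k) x0 a b X"

definition drift :: "(real \<Rightarrow> 'a \<Rightarrow> real) \<Rightarrow> real \<Rightarrow> 'a \<Rightarrow> real" where
  "drift a t \<omega> = (LINT s:{0..t}|lborel. a s \<omega>)"

lemma admissible_iff: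
  "(a, b) \<in> admissible M F T \<longleftrightarrow>
    l2 PT (\<lambda>x. a (fst x) (snd x)) \<and> l2 PT (\<lambda>x. b (fst x) (snd x)) \<and>
    (\<forall>t\<in>{0..T}. a t \<in> borel_measurable (F t) \<and> b t \<in> borel_measurable (F t))"
proof -
  let ?a = "\<lambda>x. a (fst x) (snd x)" and ?b = "\<lambda>x. b (fst x) (snd x)"
  have eq: "(\<integral>\<^sup>+\<omega>. (\<integral>\<^sup>+t\<in>{0..T}. ennreal ((a t \<omega>)\<^sup>2 + (b t \<omega>)\<^sup>2) \<partial>lborel) \<partial>M)
      = (\<integral>\<^sup>+x. ennreal ((?a x)\<^sup>2) \<partial>PT) + (\<integral>\<^sup>+x. ennreal ((?b x)\<^sup>2) \<partial>PT)"
    if m: "?a \<in> borel_measurable PT" "?b \<in> borel_measurable PT"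
  proof -
    have "(\<lambda>x. ennreal ((?a x)\<^sup>2 + (?b x)\<^sup>2)) \<in> borel_measurable PT" using m by simp
    from nn_integral_PT(1)[OF this]
    have "(\<integral>\<^sup>+\<omega>. (\<integral>\<^sup>+t\<in>{0..T}. ennreal ((a t \<omega>)\<^sup>2 + (b t \<omega>)\<^sup>2) \<partial>lborel) \<partial>M)
      = (\<integral>\<^sup>+x. ennreal ((?a x)\<^sup>2 + (?b x)\<^sup>2) \<partial>PT)" by simp
    also have "\<dots> = (\<integral>\<^sup>+x. ennreal ((?a x)\<^sup>2) + ennreal ((?b x)\<^sup>2) \<partial>PT)"
      by (simp add: ennreal_plus)
    also have "\<dots> = (\<integral>\<^sup>+x. ennreal ((?a x)\<^sup>2) \<partial>PT) + (\<integral>\<^sup>+x. ennreal ((?b x)\<^sup>2) \<partial>PT)"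
      using m by (intro nn_integral_add) auto
    finally show ?thesis .
  qed
  have fin: "(\<integral>\<^sup>+x. ennreal ((f x)\<^sup>2) \<partial>PT) < \<infinity> \<longleftrightarrow> l2 PT f" if "f \<in> borel_measurable PT" for f
    using l2_nn[OF that] l2_nn_eq[of PT f] by auto
  show ?thesis
  proof
    assume ad: "(a, b) \<in> admissible M F T"
    then have m: "?a \<in> borel_measurable PT" "?b \<in> borel_measurable PT"
      by (auto simp: admissible_def borel_measurable_PT_iff case_prod_beta')
    have "(\<integral>\<^sup>+x. ennreal ((?a x)\<^sup>2) \<partial>PT) + (\<integral>\<^sup>+x. ennreal ((?b x)\<^sup>2) \<partial>PT) < \<infinity>"
      unfolding eq[OF m, symmetric] using ad by (simp add: admissible_def)
    then have "l2 PT ?a" "l2 PT ?b" using fin m by auto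
    then show "l2 PT ?a \<and> l2 PT ?b \<and> (\<forall>t\<in>{0..T}. a t \<in> borel_measurable (F t) \<and> b t \<in> borel_measurable (F t))"
      using ad by (auto simp: admissible_def)
  next
    assume h: "l2 PT ?a \<and> l2 PT ?b \<and> (\<forall>t\<in>{0..T}. a t \<in> borel_measurable (F t) \<and> b t \<in> borel_measurable (F t))"
    then have m: "?a \<in> borel_measurable PT" "?b \<in> borel_measurable PT" by (auto dest: l2_measurable)
    have "(\<integral>\<^sup>+\<omega>. (\<integral>\<^sup>+t\<in>{0..T}. ennreal ((a t \<omega>)\<^sup>2 + (b t \<omega>)\<^sup>2) \<partial>lborel) \<partial>M) < \<infinity>"
      unfolding eq[OF m] using h fin m by auto
    then show "(a, b) \<in> admissible M F T"
      using h m by (auto simp: admissible_def borel_measurable_PT_iff case_prod_beta')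
  qed
qed

lemma adapted_M: "t \<in> {0..T} \<Longrightarrow> f \<in> borel_measurable (F t) \<Longrightarrow> f \<in> borel_measurable M"
  using F_imp_M by auto

lemma PT_section_l2:
  assumes "l2 PT (\<lambda>x. a (fst x) (snd x))"
  shows "AE t in LT. l2 M (a t)" "AE \<omega> in M. l2 LT (\<lambda>t. a t \<omega>)"
proof -
  have m: "(\<lambda>x. a (fst x) (snd x)) \<in> borel_measurable PT" by (rule l2_measurable[OF assms])
  note i = l2_integrable_sq[OF assms]
  have m1: "a t \<in> borel_measurable M" if "t \<in> space LT" for t
    using measurable_compose[OF measurable_Pair1'[OF that] m] by simp
  show "AE t in LT. l2 M (a t)"
    using Fubini_PT(1)[OF i] AE_space[of LT] by eventually_elim (simp add: l2_def m1)
  have m2: "(\<lambda>t. a t \<omega>) \<in> borel_measurable LT" if "\<omega> \<in> space M" for \<omega>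
    using measurable_compose[OF measurable_Pair2'[OF that] m] by simp
  show "AE \<omega> in M. l2 LT (\<lambda>t. a t \<omega>)"
    using Fubini_PT(3)[OF i] AE_space[of M] by eventually_elim (simp add: l2_def set_integrable_LT m2)
qed

text \<open>The variable upper limit is moved into the integrand as a condition on the integration
  time. What results is a parameter integral of a function of two times and a sample point.\<close>

lemma drift_joint_measurable:
  assumes "l2 PT (\<lambda>x. a (fst x) (snd x))"
  shows "(\<lambda>x. drift a (fst x) (snd x)) \<in> borel_measurable PT"
proof -
  interpret L: finite_measure LT by (rule finite_measure_LT)
  have m: "(\<lambda>x. a (fst x) (snd x)) \<in> borel_measurable PT" by (rule l2_measurable[OF assms])
  have 1: "(\<lambda>y. a (snd y) (snd (fst y))) \<in> borel_measurable (PT \<Otimes>\<^sub>M LT)"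
  proof -
    have "(\<lambda>y. (snd y, snd (fst y))) \<in> PT \<Otimes>\<^sub>M LT \<rightarrow>\<^sub>M PT"
      by (intro measurable_Pair measurable_snd measurable_compose[OF measurable_fst measurable_snd])
    from measurable_compose[OF this m] show ?thesis by simp
  qed
  have s: "(\<lambda>y. snd y) \<in> borel_measurable (PT \<Otimes>\<^sub>M LT)"
    by (rule measurable_compose[OF measurable_snd]) (rule measurable_restrict_space1, simp)
  have f: "(\<lambda>y. fst (fst y)) \<in> borel_measurable (PT \<Otimes>\<^sub>M LT)"
    by (rule measurable_compose[OF measurable_fst fst_measurable_PT])
  have "(\<lambda>y. (if 0 \<le> snd y \<and> snd y \<le> fst (fst y) then 1 else 0 :: real) * a (snd y) (snd (fst y))) \<in> borel_measurable (PT \<Otimes>\<^sub>M LT)"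
    by (intro borel_measurable_times 1 measurable_If borel_measurable_const sets.sets_Collect_conj borel_measurable_le s f)
  then have "(\<lambda>(x, s). (if 0 \<le> s \<and> s \<le> fst x then 1 else 0 :: real) * a s (snd x)) \<in> borel_measurable (PT \<Otimes>\<^sub>M LT)"
    by (simp only: case_prod_beta')
  then have "(\<lambda>x. \<integral>s. (if 0 \<le> s \<and> s \<le> fst x then 1 else 0 :: real) * a s (snd x) \<partial>LT) \<in> borel_measurable PT"
    by (rule L.borel_measurable_lebesgue_integral)
  then show ?thesis
  proof (rule measurable_cong[THEN iffD1, rotated])
    fix x assume "x \<in> space PT"
    then have "fst x \<in> {0..T}" by (auto simp: space_pair_measure space_restrict_space)
    then show "(\<integral>s. (if 0 \<le> s \<and> s \<le> fst x then 1 else 0 :: real) * a s (snd x) \<partial>LT) = drift a (fst x) (snd x)"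
      unfolding drift_def by (subst set_integral_LT) (auto simp: indicator_def intro!: Bochner_Integration.integral_cong)
  qed
qed

text \<open>Cauchy-Schwarz in time, path by path, against the indicator of \<open>{0..t}\<close>,
  whose squared norm is at most \<open>T\<close>. Fubini then gives the second moment.\<close>

lemma drift_l2:
  assumes a: "l2 PT (\<lambda>x. a (fst x) (snd x))" and t: "t \<in> {0..T}"
  shows "l2 M (drift a t)" "expectation (\<lambda>\<omega>. (drift a t \<omega>)\<^sup>2) \<le> T * (\<integral>x. (a (fst x) (snd x))\<^sup>2 \<partial>PT)"
proof -
  have aPT: "integrable PT (\<lambda>x. a (fst x) (snd x))" by (rule l2_integrable[OF finite_measure_PT a])
  have m: "drift a t \<in> borel_measurable M"
    using Fubini_PT(4)[OF aPT t] unfolding drift_def[abs_def] by simp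
  have Tin: "T \<in> {0..T}" using T_pos by simp
  note sq = l2_integrable_sq[OF a]
  have int2: "integrable M (\<lambda>\<omega>. LINT s:{0..T}|lborel. (a s \<omega>)\<^sup>2)" using Fubini_PT(4)[OF sq Tin] by simp
  have le: "AE \<omega> in M. (drift a t \<omega>)\<^sup>2 \<le> T * (LINT s:{0..T}|lborel. (a s \<omega>)\<^sup>2)"
    using PT_section_l2(2)[OF a]
  proof eventually_elim
    case (elim \<omega>)
    have ind: "l2 LT (indicator {0..t})"
      by (rule l2_bounded[OF finite_measure_LT, where C = 1]) (auto simp: indicator_def intro!: measurable_restrict_space1)
    have "(\<integral>s. (indicator {0..t} s :: real)\<^sup>2 \<partial>LT) \<le> (\<integral>s. 1 \<partial>LT)"
      using l2_integrable_sq[OF ind] finite_measure.integrable_const[OF finite_measure_LT]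
      by (intro integral_mono) (auto simp: indicator_def)
    also have "\<dots> = T" using emeasure_LT T_pos by (simp add: measure_def)
    finally have iT: "(\<integral>s. (indicator {0..t} s :: real)\<^sup>2 \<partial>LT) \<le> T" .
    have "(drift a t \<omega>)\<^sup>2 = (\<integral>s. indicator {0..t} s * a s \<omega> \<partial>LT)\<^sup>2"
      unfolding drift_def set_integral_LT[OF t] ..
    also have "\<dots> \<le> (\<integral>s. (indicator {0..t} s)\<^sup>2 \<partial>LT) * (\<integral>s. (a s \<omega>)\<^sup>2 \<partial>LT)"
      by (rule l2_Cauchy_Schwarz[OF ind elim])
    also have "\<dots> \<le> T * (\<integral>s. (a s \<omega>)\<^sup>2 \<partial>LT)"
      by (rule mult_right_mono[OF iT]) simp
    also have "(\<integral>s. (a s \<omega>)\<^sup>2 \<partial>LT) = (LINT s:{0..T}|lborel. (a s \<omega>)\<^sup>2)"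
      unfolding set_integral_LT[OF Tin] by (intro Bochner_Integration.integral_cong) (auto simp: space_restrict_space)
    finally show ?case .
  qed
  show l2: "l2 M (drift a t)"
    unfolding l2_def
  proof (intro conjI m)
    show "integrable M (\<lambda>\<omega>. (drift a t \<omega>)\<^sup>2)"
    proof (rule Bochner_Integration.integrable_bound[OF integrable_mult_right[OF int2, of T]])
      show "(\<lambda>\<omega>. (drift a t \<omega>)\<^sup>2) \<in> borel_measurable M" using m by simp
      show "AE \<omega> in M. norm ((drift a t \<omega>)\<^sup>2) \<le> norm (T * (LINT s:{0..T}|lborel. (a s \<omega>)\<^sup>2))"
        using le by eventually_elim auto
    qed
  qed
  have "expectation (\<lambda>\<omega>. (drift a t \<omega>)\<^sup>2) \<le> expectation (\<lambda>\<omega>. T * (LINT s:{0..T}|lborel. (a s \<omega>)\<^sup>2))"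
    by (intro integral_mono_AE l2_integrable_sq[OF l2] integrable_mult_right[OF int2] le)
  also have "\<dots> = T * (LINT s:{0..T}|lborel. expectation (\<lambda>\<omega>. (a s \<omega>)\<^sup>2))"
    using Fubini_PT(5)[OF sq Tin] by simp
  also have "(LINT s:{0..T}|lborel. expectation (\<lambda>\<omega>. (a s \<omega>)\<^sup>2)) = (\<integral>x. indicator {0..T} (fst x) * (a (fst x) (snd x))\<^sup>2 \<partial>PT)"
    using Fubini_PT(6)[OF sq Tin] by simp
  also have "\<dots> = (\<integral>x. (a (fst x) (snd x))\<^sup>2 \<partial>PT)"
    by (intro Bochner_Integration.integral_cong) (auto simp: space_pair_measure space_restrict_space)
  finally show "expectation (\<lambda>\<omega>. (drift a t \<omega>)\<^sup>2) \<le> T * (\<integral>x. (a (fst x) (snd x))\<^sup>2 \<partial>PT)" .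
qed

lemma drift_PT_l2:
  assumes a: "l2 PT (\<lambda>x. a (fst x) (snd x))"
  shows "l2 PT (\<lambda>x. drift a (fst x) (snd x))"
  using drift_l2[OF a] drift_joint_measurable[OF a]
  by (intro l2_PT_bound) (auto simp: case_prod_beta')

lemma expectation_drift_mult:
  assumes a: "l2 PT (\<lambda>x. a (fst x) (snd x))" and t: "t \<in> {0..T}" and Y: "l2 M Y"
  shows "set_integrable lborel {0..T} (\<lambda>s. expectation (\<lambda>\<omega>. a s \<omega> * Y \<omega>))"
    "expectation (\<lambda>\<omega>. drift a t \<omega> * Y \<omega>) = (LINT s:{0..t}|lborel. expectation (\<lambda>\<omega>. a s \<omega> * Y \<omega>))"
proof -
  have i: "integrable PT (\<lambda>x. a (fst x) (snd x) * Y (snd x))"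
    by (rule l2_integrable_mult[OF a l2_PT_snd[OF Y]])
  show "set_integrable lborel {0..T} (\<lambda>s. expectation (\<lambda>\<omega>. a s \<omega> * Y \<omega>))"
    using Fubini_PT(2)[OF i] by simp
  show "expectation (\<lambda>\<omega>. drift a t \<omega> * Y \<omega>) = (LINT s:{0..t}|lborel. expectation (\<lambda>\<omega>. a s \<omega> * Y \<omega>))"
    using Fubini_PT(5)[OF i t] by (simp add: drift_def)
qed

text \<open>For almost every path both drifts are absolutely continuous, so the pathwise product
  rule applies; only then is the expectation taken.\<close>

lemma expectation_drift_drift:
  assumes a: "l2 PT (\<lambda>x. a (fst x) (snd x))" and b: "l2 PT (\<lambda>x. b (fst x) (snd x))" and t: "t \<in> {0..T}"
  shows "expectation (\<lambda>\<omega>. drift a t \<omega> * drift b t \<omega>) =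
     (LINT s:{0..t}|lborel. expectation (\<lambda>\<omega>. a s \<omega> * drift b s \<omega> + drift a s \<omega> * b s \<omega>))"
proof -
  have i: "integrable PT (\<lambda>x. a (fst x) (snd x) * drift b (fst x) (snd x) + drift a (fst x) (snd x) * b (fst x) (snd x))"
    by (intro Bochner_Integration.integrable_add l2_integrable_mult a b drift_PT_l2)
  have "AE \<omega> in M. drift a t \<omega> * drift b t \<omega> = (LINT s:{0..t}|lborel. a s \<omega> * drift b s \<omega> + drift a s \<omega> * b s \<omega>)"
    using PT_section_l2(2)[OF a] PT_section_l2(2)[OF b]
  proof eventually_elim
    case (elim \<omega>)
    have z: "drift f 0 \<omega> = 0" for f
      unfolding drift_def by (rule set_integral_singleton)
    have "ac T (\<lambda>t. drift a t \<omega>) (\<lambda>t. a t \<omega>)" "ac T (\<lambda>t. drift b t \<omega>) (\<lambda>t. b t \<omega>)"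
      unfolding ac_def z using l2_integrable[OF finite_measure_LT elim(1)] l2_integrable[OF finite_measure_LT elim(2)]
      by (auto simp: set_integrable_LT drift_def)
    from acD[OF ac_mult[OF this] t] show ?case by (simp only: z mult_zero_left add_0)
  qed
  then have "expectation (\<lambda>\<omega>. drift a t \<omega> * drift b t \<omega>) = expectation (\<lambda>\<omega>. LINT s:{0..t}|lborel. a s \<omega> * drift b s \<omega> + drift a s \<omega> * b s \<omega>)"
    using Fubini_PT(4)[OF i t]
    by (intro integral_cong_AE borel_measurable_times l2_measurable[OF drift_l2(1)[OF a t]] l2_measurable[OF drift_l2(1)[OF b t]]) auto
  then show ?thesis using Fubini_PT(5)[OF i t] by simp
qed

lemma proc_decomp:
  assumes "proc k x0 a b X"
  obtains I where "ito_integral M F T (Z k) b I"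
    "\<And>t. t \<in> {0..T} \<Longrightarrow> AE \<omega> in M. X t \<omega> = x0 + drift a t \<omega> + I t \<omega>"
proof -
  obtain I where I: "ito_integral M F T (Z k) b I"
    "AE \<omega> in M. \<forall>t\<in>{0..T}. X t \<omega> = x0 + (LINT s:{0..t}|lborel. a s \<omega>) + I t \<omega>"
    using assms unfolding proc_def state_process_def by blast
  show thesis
  proof (rule that[OF I(1)])
    fix t assume "t \<in> {0..T}"
    with I(2) show "AE \<omega> in M. X t \<omega> = x0 + drift a t \<omega> + I t \<omega>"
      unfolding drift_def by auto
  qed
qed

lemma proc_control_l2:
  assumes "proc k x0 a b X"
  shows "l2 PT (\<lambda>x. a (fst x) (snd x))" "l2 PT (\<lambda>x. b (fst x) (snd x))"
    "t \<in> {0..T} \<Longrightarrow> a t \<in> borel_measurable (F t)" "(\<lambda>(t, \<omega>). b t \<omega>) \<in> borel_measurable PT"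
  using assms l2_measurable[of PT "\<lambda>x. b (fst x) (snd x)"] unfolding proc_def admissible_iff
  by (auto simp: case_prod_beta')

text \<open>Continuity of all paths gives joint measurability, and drift and Ito integral have
  second moments that are bounded uniformly in time.\<close>

lemma proc_l2:
  assumes p: "proc k x0 a b X"
  shows "t \<in> {0..T} \<Longrightarrow> l2 M (X t)" "l2 PT (\<lambda>x. X (fst x) (snd x))"
proof -
  note c = proc_control_l2[OF p]
  obtain I where I: "ito_integral M F T (Z k) b I"
    "\<And>t. t \<in> {0..T} \<Longrightarrow> AE \<omega> in M. X t \<omega> = x0 + drift a t \<omega> + I t \<omega>"
    by (rule proc_decomp[OF p]) (rule that)
  have Xm: "X t \<in> borel_measurable M" if "t \<in> {0..T}" for t
    using p that by (intro adapted_M[OF that]) (auto simp: proc_def state_process_def)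
  have Rl: "l2 M (\<lambda>\<omega>. x0 + drift a t \<omega> + I t \<omega>)" if t: "t \<in> {0..T}" for t
    by (intro l2_add l2_const finite_measure_axioms drift_l2(1)[OF c(1) t] ito_l2(2)[OF I(1) c(4) t])
  have Xl: "l2 M (X t)" if t: "t \<in> {0..T}" for t
    using l2_cong_AE[OF Rl[OF t] _ Xm[OF t]] I(2)[OF t] by (simp add: eq_commute)
  then show "t \<in> {0..T} \<Longrightarrow> l2 M (X t)" .
  have joint: "(\<lambda>(t, \<omega>). X t \<omega>) \<in> borel_measurable PT"
    unfolding borel_measurable_PT_iff using Xm p
    by (intro continuous_paths_joint_measurable) (auto simp: proc_def state_process_def)
  let ?C = "3 * x0\<^sup>2 + 3 * (T * (\<integral>x. (a (fst x) (snd x))\<^sup>2 \<partial>PT)) + 3 * (\<integral>x. (b (fst x) (snd x))\<^sup>2 \<partial>PT)"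
  show "l2 PT (\<lambda>x. X (fst x) (snd x))"
  proof (rule l2_PT_bound[OF joint Xl, where C = ?C])
    fix t assume t: "t \<in> {0..T}"
    note d = drift_l2[OF c(1) t] and i = ito_l2(2,3)[OF I(1) c(4) t]
    have "expectation (\<lambda>\<omega>. (X t \<omega>)\<^sup>2) \<le> expectation (\<lambda>\<omega>. 3 * x0\<^sup>2 + 3 * (drift a t \<omega>)\<^sup>2 + 3 * (I t \<omega>)\<^sup>2)"
    proof (rule integral_mono_AE)
      show "integrable M (\<lambda>\<omega>. (X t \<omega>)\<^sup>2)" by (rule l2_integrable_sq[OF Xl[OF t]])
      show "integrable M (\<lambda>\<omega>. 3 * x0\<^sup>2 + 3 * (drift a t \<omega>)\<^sup>2 + 3 * (I t \<omega>)\<^sup>2)"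
        using l2_integrable_sq[OF d(1)] l2_integrable_sq[OF i(1)] by simp
      show "AE \<omega> in M. (X t \<omega>)\<^sup>2 \<le> 3 * x0\<^sup>2 + 3 * (drift a t \<omega>)\<^sup>2 + 3 * (I t \<omega>)\<^sup>2"
        using I(2)[OF t]
      proof eventually_elim
        case (elim \<omega>)
        \<comment> \<open>Nonnegativity of the squared pairwise differences amounts to \<open>(a + b
          + c)\<^sup>2 \<le> 3 * a\<^sup>2 + 3 * b\<^sup>2 + 3 * c\<^sup>2\<close>.\<close>
        have "0 \<le> (x0 - drift a t \<omega>)\<^sup>2 + (x0 - I t \<omega>)\<^sup>2 + (drift a t \<omega> - I t \<omega>)\<^sup>2" by simp
        then show ?case unfolding elim by (simp add: power2_eq_square algebra_simps)
      qed
    qed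
    also have "\<dots> = 3 * x0\<^sup>2 + 3 * expectation (\<lambda>\<omega>. (drift a t \<omega>)\<^sup>2) + 3 * expectation (\<lambda>\<omega>. (I t \<omega>)\<^sup>2)"
      using l2_integrable_sq[OF d(1)] l2_integrable_sq[OF i(1)] by (simp add: prob_space)
    also have "\<dots> \<le> ?C" using d(2) i(2) by simp
    finally show "expectation (\<lambda>\<omega>. (X t \<omega>)\<^sup>2) \<le> ?C" .
  qed
qed

lemma proc_mean:
  assumes p: "proc k x0 a b X"
  shows "ac T (\<lambda>t. expectation (X t)) (\<lambda>t. expectation (a t))" "expectation (X 0) = x0"
proof -
  note c = proc_control_l2[OF p]
  obtain I where I: "ito_integral M F T (Z k) b I"
    "\<And>t. t \<in> {0..T} \<Longrightarrow> AE \<omega> in M. X t \<omega> = x0 + drift a t \<omega> + I t \<omega>"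
    by (rule proc_decomp[OF p]) (rule that)
  have 1: "l2 M (\<lambda>\<omega>. 1)" by (rule l2_const[OF finite_measure_axioms])
  have eq: "expectation (X t) = x0 + (LINT s:{0..t}|lborel. expectation (a s))" if t: "t \<in> {0..T}" for t
  proof -
    note d = drift_l2(1)[OF c(1) t] and i = ito_l2(2)[OF I(1) c(4) t]
    have "expectation (X t) = expectation (\<lambda>\<omega>. x0 + drift a t \<omega> + I t \<omega>)"
      using I(2)[OF t] l2_measurable[OF proc_l2(1)[OF p t]] l2_measurable[OF d] l2_measurable[OF i]
      by (intro integral_cong_AE) auto
    also have "\<dots> = x0 + expectation (drift a t) + expectation (I t)"
      using l2_integrable[OF finite_measure_axioms d] l2_integrable[OF finite_measure_axioms i] by (simp add: prob_space)
    also have "expectation (I t) = 0" by (rule ito_mean[OF I(1) c(4) t])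
    also have "expectation (drift a t) = (LINT s:{0..t}|lborel. expectation (a s))"
      using expectation_drift_mult(2)[OF c(1) t 1] by simp
    finally show ?thesis by simp
  qed
  show 0: "expectation (X 0) = x0" using eq[of 0] T_pos by (simp only: set_integral_singleton) simp
  have "set_integrable lborel {0..T} (\<lambda>t. expectation (a t))"
    using expectation_drift_mult(1)[OF c(1) _ 1, of 0] T_pos by simp
  then show "ac T (\<lambda>t. expectation (X t)) (\<lambda>t. expectation (a t))"
    unfolding ac_def 0 using eq by auto
qed

text \<open>Expand both states into initial value, drift and stochastic integral. Two drifts obey
  the pathwise product rule, two integrals the isometry, and a single integral has mean zero. In the
  product of a drift with an integral, the integral at time \<open>t\<close> may be replaced by the
  one at time \<open>s\<close> when multiplied by the drift rate at \<open>s\<close>: this rate is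
  adapted and the integral a martingale.\<close>

lemma proc_product:
  assumes p: "proc k x0 a b X" and p': "proc l y0 a' b' Y"
  shows "ac T (\<lambda>t. expectation (\<lambda>\<omega>. X t \<omega> * Y t \<omega>))
     (\<lambda>t. expectation (\<lambda>\<omega>. a t \<omega> * Y t \<omega> + X t \<omega> * a' t \<omega> + \<kappa> k l * (b t \<omega> * b' t \<omega>)))"
    "expectation (\<lambda>\<omega>. X 0 \<omega> * Y 0 \<omega>) = x0 * y0"
proof -
  note c = proc_control_l2[OF p] and c' = proc_control_l2[OF p']
  obtain I where I: "ito_integral M F T (Z k) b I"
    "\<And>t. t \<in> {0..T} \<Longrightarrow> AE \<omega> in M. X t \<omega> = x0 + drift a t \<omega> + I t \<omega>"
    by (rule proc_decomp[OF p]) (rule that)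
  obtain J where J: "ito_integral M F T (Z l) b' J"
    "\<And>t. t \<in> {0..T} \<Longrightarrow> AE \<omega> in M. Y t \<omega> = y0 + drift a' t \<omega> + J t \<omega>"
    by (rule proc_decomp[OF p']) (rule that)
  note fm = finite_measure_axioms
  let ?f = "\<lambda>t. expectation (\<lambda>\<omega>. a t \<omega> * Y t \<omega> + X t \<omega> * a' t \<omega> + \<kappa> k l * (b t \<omega> * b' t \<omega>))"
  have 1: "l2 M (\<lambda>\<omega>. 1)" by (rule l2_const[OF fm])
  have fint: "set_integrable lborel {0..T} ?f"
  proof -
    have "integrable PT (\<lambda>x. a (fst x) (snd x) * Y (fst x) (snd x) + X (fst x) (snd x) * a' (fst x) (snd x)
        + \<kappa> k l * (b (fst x) (snd x) * b' (fst x) (snd x)))"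
      by (intro Bochner_Integration.integrable_add integrable_mult_right l2_integrable_mult c(1,2) c'(1,2) proc_l2(2)[OF p] proc_l2(2)[OF p'])
    from Fubini_PT(2)[OF this] show ?thesis by simp
  qed
  have eq: "expectation (\<lambda>\<omega>. X t \<omega> * Y t \<omega>) = x0 * y0 + (LINT s:{0..t}|lborel. ?f s)" if t: "t \<in> {0..T}" for t
  proof -
    have It: "l2 M (I s)" if "s \<in> {0..T}" for s by (rule ito_l2(2)[OF I(1) c(4) that])
    have Jt: "l2 M (J s)" if "s \<in> {0..T}" for s by (rule ito_l2(2)[OF J(1) c'(4) that])
    \<comment> \<open>\<open>?f4\<close> and \<open>?f5\<close> contain the integrals at the fixed
      time \<open>t\<close>, as they arise from the expectation of a drift times an integral;
      \<open>?f\<close> contains the states at the running time instead.\<close>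
    let ?f1 = "\<lambda>s. expectation (\<lambda>\<omega>. a s \<omega> * 1)" and ?f2 = "\<lambda>s. expectation (\<lambda>\<omega>. a' s \<omega> * 1)"
    let ?f3 = "\<lambda>s. expectation (\<lambda>\<omega>. a s \<omega> * drift a' s \<omega> + drift a s \<omega> * a' s \<omega>)"
    let ?f4 = "\<lambda>s. expectation (\<lambda>\<omega>. a s \<omega> * J t \<omega>)" and ?f5 = "\<lambda>s. expectation (\<lambda>\<omega>. a' s \<omega> * I t \<omega>)"
    let ?f6 = "\<lambda>s. expectation (\<lambda>\<omega>. b s \<omega> * b' s \<omega>)"
    \<comment> \<open>The slices of the controls are square integrable only for almost every time,
      so the two densities can be compared only up to a null set.\<close>
    have "AE s in LT. l2 M (a s) \<and> l2 M (a' s) \<and> l2 M (b s) \<and> l2 M (b' s) \<and> s \<in> {0..T}"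
      using PT_section_l2(1)[OF c(1)] PT_section_l2(1)[OF c(2)] PT_section_l2(1)[OF c'(1)] PT_section_l2(1)[OF c'(2)]
        AE_space[of LT] by eventually_elim (simp add: space_restrict_space)
    then have AEeq: "AE s in LT. indicator {0..t} s * ?f s
       = indicator {0..t} s * (y0 * ?f1 s + x0 * ?f2 s + ?f3 s + ?f4 s + ?f5 s + \<kappa> k l * ?f6 s)"
    proof eventually_elim
      case (elim s)
      show ?case
      proof (cases "s \<le> t")
        case True
        have s: "s \<in> {0..T}" "0 \<le> s" using elim by auto
        have t': "t \<le> T" using t by simp
        note ls = drift_l2(1)[OF c(1) s(1)] drift_l2(1)[OF c'(1) s(1)] It[OF s(1)] Jt[OF s(1)]
        have la: "l2 M (a s)" "l2 M (a' s)" "l2 M (b s)" "l2 M (b' s)" using elim by auto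
        have "?f s = expectation (\<lambda>\<omega>. a s \<omega> * (y0 + drift a' s \<omega> + J s \<omega>) + (x0 + drift a s \<omega> + I s \<omega>) * a' s \<omega> + \<kappa> k l * (b s \<omega> * b' s \<omega>))"
        proof (rule integral_cong_AE)
          show "AE \<omega> in M. a s \<omega> * Y s \<omega> + X s \<omega> * a' s \<omega> + \<kappa> k l * (b s \<omega> * b' s \<omega>) =
             a s \<omega> * (y0 + drift a' s \<omega> + J s \<omega>) + (x0 + drift a s \<omega> + I s \<omega>) * a' s \<omega> + \<kappa> k l * (b s \<omega> * b' s \<omega>)"
            using I(2)[OF s(1)] J(2)[OF s(1)] by eventually_elim simp
        qed (intro borel_measurable_add borel_measurable_times borel_measurable_const la[THEN l2_measurable]
          ls[THEN l2_measurable] l2_measurable[OF proc_l2(1)[OF p s(1)]] l2_measurable[OF proc_l2(1)[OF p' s(1)]])+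
        also have "\<dots> = expectation (\<lambda>\<omega>. y0 * (a s \<omega> * 1) + x0 * (a' s \<omega> * 1) + (a s \<omega> * drift a' s \<omega> + drift a s \<omega> * a' s \<omega>)
           + a s \<omega> * J s \<omega> + a' s \<omega> * I s \<omega> + \<kappa> k l * (b s \<omega> * b' s \<omega>))"
          by (intro Bochner_Integration.integral_cong) (auto simp: algebra_simps)
        also have "\<dots> = y0 * ?f1 s + x0 * ?f2 s + ?f3 s + expectation (\<lambda>\<omega>. a s \<omega> * J s \<omega>) + expectation (\<lambda>\<omega>. a' s \<omega> * I s \<omega>) + \<kappa> k l * ?f6 s"
        proof -
          note ii = l2_integrable_mult[OF la(1) 1] l2_integrable_mult[OF la(2) 1] l2_integrable_mult[OF la(1) ls(2)]
            l2_integrable_mult[OF ls(1) la(2)] l2_integrable_mult[OF la(1) ls(4)] l2_integrable_mult[OF la(2) ls(3)] l2_integrable_mult[OF la(3,4)]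
          show ?thesis using ii by (simp del: mult_1_right)
        qed
        also have "expectation (\<lambda>\<omega>. a s \<omega> * J s \<omega>) = ?f4 s"
          by (rule ito_martingale[OF J(1) c'(4) s(2) True t' c(3)[OF s(1)] la(1), symmetric])
        also have "expectation (\<lambda>\<omega>. a' s \<omega> * I s \<omega>) = ?f5 s"
          by (rule ito_martingale[OF I(1) c(4) s(2) True t' c'(3)[OF s(1)] la(2), symmetric])
        finally show ?thesis by (simp only:)
      qed simp
    qed
    note s1 = expectation_drift_mult[OF c(1) t 1] and s2 = expectation_drift_mult[OF c'(1) t 1]
    note s4 = expectation_drift_mult[OF c(1) t Jt[OF t]] and s5 = expectation_drift_mult[OF c'(1) t It[OF t]]
    note s3 = expectation_drift_drift[OF c(1) c'(1) t]
    have i3: "integrable PT (\<lambda>x. a (fst x) (snd x) * drift a' (fst x) (snd x) + drift a (fst x) (snd x) * a' (fst x) (snd x))"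
      by (intro Bochner_Integration.integrable_add l2_integrable_mult c(1) c'(1) drift_PT_l2)
    have i6: "integrable PT (\<lambda>x. b (fst x) (snd x) * b' (fst x) (snd x))"
      by (intro l2_integrable_mult c(2) c'(2))
    have g3: "set_integrable lborel {0..T} ?f3" using Fubini_PT(2)[OF i3] by simp
    have g6: "set_integrable lborel {0..T} ?f6" using Fubini_PT(2)[OF i6] by simp
    have sum_int: "set_integrable lborel {0..T} (\<lambda>s. y0 * ?f1 s + x0 * ?f2 s + ?f3 s + ?f4 s + ?f5 s + \<kappa> k l * ?f6 s)"
      by (intro set_integral_add(1) set_integrable_mult_right s1 s2 s4 s5 g3 g6)
    have sub: "set_integrable lborel {0..t} f" if "set_integrable lborel {0..T} f" for f :: "real \<Rightarrow> real"
      by (rule set_integrable_subset[OF that]) (use t in auto)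
    have indm: "(\<lambda>s. indicator {0..t} s :: real) \<in> borel_measurable LT"
      by (rule measurable_restrict_space1) simp
    have "(LINT s:{0..t}|lborel. ?f s) = (LINT s:{0..t}|lborel. y0 * ?f1 s + x0 * ?f2 s + ?f3 s + ?f4 s + ?f5 s + \<kappa> k l * ?f6 s)"
      unfolding set_integral_LT[OF t]
    proof (rule integral_cong_AE[OF _ _ AEeq])
      show "(\<lambda>s. indicator {0..t} s * ?f s) \<in> borel_measurable LT"
        using fint unfolding set_integrable_LT by (intro borel_measurable_times indm) auto
      show "(\<lambda>s. indicator {0..t} s * (y0 * ?f1 s + x0 * ?f2 s + ?f3 s + ?f4 s + ?f5 s + \<kappa> k l * ?f6 s)) \<in> borel_measurable LT"
        using sum_int unfolding set_integrable_LT by (intro borel_measurable_times indm borel_measurable_integrable)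
    qed
    also have "\<dots> = y0 * (LINT s:{0..t}|lborel. ?f1 s) + x0 * (LINT s:{0..t}|lborel. ?f2 s) + (LINT s:{0..t}|lborel. ?f3 s)
       + (LINT s:{0..t}|lborel. ?f4 s) + (LINT s:{0..t}|lborel. ?f5 s) + \<kappa> k l * (LINT s:{0..t}|lborel. ?f6 s)"
    proof -
      note h1 = set_integrable_mult_right[OF sub[OF s1(1)], of y0] and h2 = set_integrable_mult_right[OF sub[OF s2(1)], of x0]
      note h6 = set_integrable_mult_right[OF sub[OF g6], of "\<kappa> k l"]
      note h3 = sub[OF g3] and h4 = sub[OF s4(1)] and h5 = sub[OF s5(1)]
      note k1 = set_integral_add[OF h1 h2]
      note k2 = set_integral_add[OF k1(1) h3]
      note k3 = set_integral_add[OF k2(1) h4]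
      note k4 = set_integral_add[OF k3(1) h5]
      note k5 = set_integral_add[OF k4(1) h6]
      show ?thesis unfolding k5(2) k4(2) k3(2) k2(2) k1(2) set_integral_mult_right ..
    qed
    also have "\<dots> = y0 * expectation (\<lambda>\<omega>. drift a t \<omega> * 1) + x0 * expectation (\<lambda>\<omega>. drift a' t \<omega> * 1)
       + expectation (\<lambda>\<omega>. drift a t \<omega> * drift a' t \<omega>) + expectation (\<lambda>\<omega>. drift a t \<omega> * J t \<omega>)
       + expectation (\<lambda>\<omega>. drift a' t \<omega> * I t \<omega>) + expectation (\<lambda>\<omega>. I t \<omega> * J t \<omega>)"
    proof -
      have "\<kappa> k l * (LINT s:{0..t}|lborel. ?f6 s) = expectation (\<lambda>\<omega>. I t \<omega> * J t \<omega>)"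
        unfolding ito_isometry[OF I(1) c(4) J(1) c'(4) t] using Fubini_PT(6)[OF i6 t] by (simp add: mult.assoc)
      then show ?thesis unfolding s1(2) s2(2) s3 s4(2) s5(2) by (simp only:)
    qed
    finally have L: "(LINT s:{0..t}|lborel. ?f s) = \<dots>" .
    note dl = drift_l2(1)[OF c(1) t] drift_l2(1)[OF c'(1) t]
    have "expectation (\<lambda>\<omega>. X t \<omega> * Y t \<omega>) = expectation (\<lambda>\<omega>. (x0 + drift a t \<omega> + I t \<omega>) * (y0 + drift a' t \<omega> + J t \<omega>))"
    proof (rule integral_cong_AE)
      show "AE \<omega> in M. X t \<omega> * Y t \<omega> = (x0 + drift a t \<omega> + I t \<omega>) * (y0 + drift a' t \<omega> + J t \<omega>)"
        using I(2)[OF t] J(2)[OF t] by eventually_elim simp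
      show "(\<lambda>\<omega>. X t \<omega> * Y t \<omega>) \<in> borel_measurable M"
        by (intro borel_measurable_times l2_measurable[OF proc_l2(1)[OF p t]] l2_measurable[OF proc_l2(1)[OF p' t]])
      show "(\<lambda>\<omega>. (x0 + drift a t \<omega> + I t \<omega>) * (y0 + drift a' t \<omega> + J t \<omega>)) \<in> borel_measurable M"
        by (intro borel_measurable_times borel_measurable_add borel_measurable_const dl[THEN l2_measurable] It[OF t, THEN l2_measurable] Jt[OF t, THEN l2_measurable])
    qed
    also have "\<dots> = expectation (\<lambda>\<omega>. x0 * y0 + y0 * (drift a t \<omega> * 1) + x0 * (drift a' t \<omega> * 1) + drift a t \<omega> * drift a' t \<omega>
       + drift a t \<omega> * J t \<omega> + drift a' t \<omega> * I t \<omega> + I t \<omega> * J t \<omega> + x0 * J t \<omega> + y0 * I t \<omega>)"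
      by (intro Bochner_Integration.integral_cong) (auto simp: algebra_simps)
    also have "\<dots> = x0 * y0 + y0 * expectation (\<lambda>\<omega>. drift a t \<omega> * 1) + x0 * expectation (\<lambda>\<omega>. drift a' t \<omega> * 1)
       + expectation (\<lambda>\<omega>. drift a t \<omega> * drift a' t \<omega>) + expectation (\<lambda>\<omega>. drift a t \<omega> * J t \<omega>)
       + expectation (\<lambda>\<omega>. drift a' t \<omega> * I t \<omega>) + expectation (\<lambda>\<omega>. I t \<omega> * J t \<omega>)
       + x0 * expectation (J t) + y0 * expectation (I t)"
    proof -
      note ii = l2_integrable_mult[OF dl(1) 1] l2_integrable_mult[OF dl(2) 1] l2_integrable_mult[OF dl]
        l2_integrable_mult[OF dl(1) Jt[OF t]] l2_integrable_mult[OF dl(2) It[OF t]] l2_integrable_mult[OF It[OF t] Jt[OF t]]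
        l2_integrable[OF fm It[OF t]] l2_integrable[OF fm Jt[OF t]]
      show ?thesis using ii by (simp add: prob_space del: mult_1_right)
    qed
    also have "\<dots> = x0 * y0 + (LINT s:{0..t}|lborel. ?f s)"
      unfolding L ito_mean[OF I(1) c(4) t] ito_mean[OF J(1) c'(4) t] by simp
    finally show ?thesis .
  qed
  have "0 \<in> {0..T}" using T_pos by simp
  from eq[OF this] show 0: "expectation (\<lambda>\<omega>. X 0 \<omega> * Y 0 \<omega>) = x0 * y0" unfolding set_integral_singleton by simp
  show "ac T (\<lambda>t. expectation (\<lambda>\<omega>. X t \<omega> * Y t \<omega>)) ?f"
    unfolding ac_def 0 using eq fint by (intro conjI ballI)
qed

text \<open>The second moment of the difference of two versions of the integral expands into three
  inner products, which the isometry makes equal. The equilibrium inequalities range over all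
  versions of the states; this carries the feedback law over to each of them.\<close>

lemma proc_AE_unique:
  assumes p: "proc k x0 a b X" and p': "proc k x0 a b X'" and t: "t \<in> {0..T}"
  shows "AE \<omega> in M. X t \<omega> = X' t \<omega>"
proof -
  note c = proc_control_l2[OF p]
  obtain I where I: "ito_integral M F T (Z k) b I"
    "\<And>t. t \<in> {0..T} \<Longrightarrow> AE \<omega> in M. X t \<omega> = x0 + drift a t \<omega> + I t \<omega>"
    by (rule proc_decomp[OF p]) (rule that)
  obtain J where J: "ito_integral M F T (Z k) b J"
    "\<And>t. t \<in> {0..T} \<Longrightarrow> AE \<omega> in M. X' t \<omega> = x0 + drift a t \<omega> + J t \<omega>"
    by (rule proc_decomp[OF p']) (rule that)
  note l = ito_l2(2)[OF I(1) c(4) t] ito_l2(2)[OF J(1) c(4) t]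
  have "expectation (\<lambda>\<omega>. (I t \<omega> - J t \<omega>)\<^sup>2) = expectation (\<lambda>\<omega>. I t \<omega> * I t \<omega> - 2 * (I t \<omega> * J t \<omega>) + J t \<omega> * J t \<omega>)"
    by (intro Bochner_Integration.integral_cong) (auto simp: power2_eq_square algebra_simps)
  also have "\<dots> = expectation (\<lambda>\<omega>. I t \<omega> * I t \<omega>) - 2 * expectation (\<lambda>\<omega>. I t \<omega> * J t \<omega>) + expectation (\<lambda>\<omega>. J t \<omega> * J t \<omega>)"
    using l2_integrable_mult[OF l(1,1)] l2_integrable_mult[OF l(1,2)] l2_integrable_mult[OF l(2,2)] by simp
  also have "\<dots> = 0"
    unfolding ito_isometry[OF I(1) c(4) I(1) c(4) t] ito_isometry[OF I(1) c(4) J(1) c(4) t] ito_isometry[OF J(1) c(4) J(1) c(4) t]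
    by simp
  finally have "AE \<omega> in M. (I t \<omega> - J t \<omega>)\<^sup>2 = 0"
    using integral_nonneg_eq_0_iff_AE[OF l2_integrable_sq[OF l2_diff[OF l]]] by simp
  then show ?thesis using I(2)[OF t] J(2)[OF t] by eventually_elim simp
qed

section \<open>The product rule with deterministic coefficients\<close>

lemma coef_measurable: "continuous_on {0..T} f \<Longrightarrow> (\<lambda>x. f (fst x) :: real) \<in> borel_measurable PT"
proof -
  assume "continuous_on {0..T} f"
  then have "f \<in> borel_measurable (restrict_space borel {0..T})"
    by (rule borel_measurable_continuous_on_restrict)
  moreover have "sets LT = sets (restrict_space borel {0..T})" by (rule sets_restrict_space_cong) simp
  ultimately have "f \<in> borel_measurable LT" by (simp cong: measurable_cong_sets)
  from measurable_compose[OF measurable_fst this] show ?thesis .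
qed

lemma coef_l2:
  assumes f: "continuous_on {0..T} f" and G: "l2 PT G"
  shows "l2 PT (\<lambda>x. f (fst x) * G x)"
proof -
  have "bounded (f ` {0..T})" using f by (intro compact_imp_bounded compact_continuous_image) auto
  then obtain C where C: "\<And>t. t \<in> {0..T} \<Longrightarrow> \<bar>f t\<bar> \<le> C" unfolding bounded_iff real_norm_def by blast
  show ?thesis
    by (rule l2_bounded_mult[OF G coef_measurable[OF f], where C = C])
      (auto simp: space_pair_measure space_restrict_space intro: C)
qed

lemma coef_integrable:
  fixes G :: "real \<times> 'a \<Rightarrow> real"
  assumes f: "continuous_on {0..T} f" and G: "integrable PT G"
  shows "integrable PT (\<lambda>x. f (fst x) * G x)"
    "set_integrable lborel {0..T} (\<lambda>t. f t * expectation (\<lambda>\<omega>. G (t, \<omega>)))"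
    "(LINT t:{0..T}|lborel. f t * expectation (\<lambda>\<omega>. G (t, \<omega>))) = (\<integral>x. f (fst x) * G x \<partial>PT)"
proof -
  have Tin: "T \<in> {0..T}" using T_pos by simp
  have "bounded (f ` {0..T})" using f by (intro compact_imp_bounded compact_continuous_image) auto
  then obtain C where C: "\<And>t. t \<in> {0..T} \<Longrightarrow> \<bar>f t\<bar> \<le> C" unfolding bounded_iff real_norm_def by blast
  show i: "integrable PT (\<lambda>x. f (fst x) * G x)"
  proof (rule Bochner_Integration.integrable_bound[OF integrable_mult_right[OF G, of C]])
    show "(\<lambda>x. f (fst x) * G x) \<in> borel_measurable PT"
      using G by (intro borel_measurable_times coef_measurable[OF f]) auto
    show "AE x in PT. norm (f (fst x) * G x) \<le> norm (C * G x)"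
    proof (intro AE_I2)
      fix x assume "x \<in> space PT"
      then have "\<bar>f (fst x)\<bar> \<le> C" by (auto simp: space_pair_measure space_restrict_space intro: C)
      then show "norm (f (fst x) * G x) \<le> norm (C * G x)"
        unfolding norm_mult by (intro mult_right_mono) auto
    qed
  qed
  have eq: "expectation (\<lambda>\<omega>. f (fst (t, \<omega>)) * G (t, \<omega>)) = f t * expectation (\<lambda>\<omega>. G (t, \<omega>))" for t
    by simp
  show "set_integrable lborel {0..T} (\<lambda>t. f t * expectation (\<lambda>\<omega>. G (t, \<omega>)))"
    using Fubini_PT(2)[OF i] unfolding eq .
  have "(LINT t:{0..T}|lborel. f t * expectation (\<lambda>\<omega>. G (t, \<omega>))) = (\<integral>x. indicator {0..T} (fst x) * (f (fst x) * G x) \<partial>PT)"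
    using Fubini_PT(6)[OF i Tin] unfolding eq .
  also have "\<dots> = (\<integral>x. f (fst x) * G x \<partial>PT)"
    by (intro Bochner_Integration.integral_cong) (auto simp: space_pair_measure space_restrict_space)
  finally show "(LINT t:{0..T}|lborel. f t * expectation (\<lambda>\<omega>. G (t, \<omega>))) = (\<integral>x. f (fst x) * G x \<partial>PT)" .
qed

text \<open>Multiply the product rules for \<open>X x\<close> and \<open>X y\<close> and the
  equation for the mean of \<open>X\<close> by the deterministic coefficients, using
  \<open>ac_mult\<close>. \<open>X\<close> and \<open>x\<close> have the same driving motion, so
  their volatilities contribute \<open>b * z\<close>; the volatility of \<open>y\<close> does not
  appear, as its motion is orthogonal to that of \<open>X\<close>.\<close>

lemma adjoint_product:
  assumes pX: "proc k X0 a b X" and px: "proc k x0 u z x" and py: "proc (\<not> k) y0 v w y"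
    and f: "\<And>t. t \<in> {0..T} \<Longrightarrow> (f has_real_derivative f' t) (at t within {0..T})" "continuous_on {0..T} f'"
    and e: "\<And>t. t \<in> {0..T} \<Longrightarrow> (e has_real_derivative e' t) (at t within {0..T})" "continuous_on {0..T} e'"
    and d: "\<And>t. t \<in> {0..T} \<Longrightarrow> (d has_real_derivative d' t) (at t within {0..T})" "continuous_on {0..T} d'"
  defines "R \<equiv> \<lambda>t \<omega>. f' t * (X t \<omega> * x t \<omega>) + f t * (a t \<omega> * x t \<omega> + X t \<omega> * u t \<omega> + b t \<omega> * z t \<omega>)
      + e' t * (X t \<omega> * y t \<omega>) + e t * (a t \<omega> * y t \<omega> + X t \<omega> * v t \<omega>) + d' t * X t \<omega> + d t * a t \<omega>"
  shows "integrable PT (\<lambda>s. R (fst s) (snd s))"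
    "expectation (\<lambda>\<omega>. X T \<omega> * (f T * x T \<omega> + e T * y T \<omega> + d T))
      = X0 * (f 0 * x0 + e 0 * y0 + d 0) + (\<integral>s. R (fst s) (snd s) \<partial>PT)"
proof -
  note lX = proc_control_l2(1,2)[OF pX] proc_l2(2)[OF pX]
  note lx = proc_control_l2(1,2)[OF px] proc_l2(2)[OF px]
  note ly = proc_control_l2(1,2)[OF py] proc_l2(2)[OF py]
  have Tin: "T \<in> {0..T}" "0 \<in> {0..T}" using T_pos by auto
  have cf: "continuous_on {0..T} f" "continuous_on {0..T} e" "continuous_on {0..T} d"
    using DERIV_continuous_on[OF f(1)] DERIV_continuous_on[OF e(1)] DERIV_continuous_on[OF d(1)] by blast+
  note acf = ac_C1[OF f] and ace = ac_C1[OF e] and acd = ac_C1[OF d]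
  note P1 = proc_product[OF pX px] and P2 = proc_product[OF pX py] and P3 = proc_mean[OF pX]
  note A = ac_add[OF ac_add[OF ac_mult[OF acf P1(1)] ac_mult[OF ace P2(1)]] ac_mult[OF acd P3(1)]]
  let ?g1 = "\<lambda>s. X (fst s) (snd s) * x (fst s) (snd s)"
  let ?g2 = "\<lambda>s. a (fst s) (snd s) * x (fst s) (snd s) + X (fst s) (snd s) * u (fst s) (snd s) + \<kappa> k k * (b (fst s) (snd s) * z (fst s) (snd s))"
  let ?g3 = "\<lambda>s. X (fst s) (snd s) * y (fst s) (snd s)"
  let ?g4 = "\<lambda>s. a (fst s) (snd s) * y (fst s) (snd s) + X (fst s) (snd s) * v (fst s) (snd s) + \<kappa> k (\<not> k) * (b (fst s) (snd s) * w (fst s) (snd s))"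
  let ?g5 = "\<lambda>s. X (fst s) (snd s)" and ?g6 = "\<lambda>s. a (fst s) (snd s)"
  have g: "integrable PT ?g1" "integrable PT ?g2" "integrable PT ?g3" "integrable PT ?g4" "integrable PT ?g5" "integrable PT ?g6"
    by (intro Bochner_Integration.integrable_add integrable_mult_right l2_integrable_mult lX lx ly l2_integrable[OF finite_measure_PT])+
  note h1 = coef_integrable[OF f(2) g(1)] and h2 = coef_integrable[OF cf(1) g(2)]
   and h3 = coef_integrable[OF e(2) g(3)] and h4 = coef_integrable[OF cf(2) g(4)]
   and h5 = coef_integrable[OF d(2) g(5)] and h6 = coef_integrable[OF cf(3) g(6)]
  have Req: "R (fst s) (snd s) = f' (fst s) * ?g1 s + f (fst s) * ?g2 s + (e' (fst s) * ?g3 s + e (fst s) * ?g4 s)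
      + (d' (fst s) * ?g5 s + d (fst s) * ?g6 s)" for s
    unfolding R_def by simp
  have int: "integrable PT (\<lambda>s. f' (fst s) * ?g1 s + f (fst s) * ?g2 s + (e' (fst s) * ?g3 s + e (fst s) * ?g4 s)
      + (d' (fst s) * ?g5 s + d (fst s) * ?g6 s))"
    by (intro Bochner_Integration.integrable_add h1(1) h2(1) h3(1) h4(1) h5(1) h6(1))
  show "integrable PT (\<lambda>s. R (fst s) (snd s))" unfolding Req by (rule int)
  let ?\<rho>1 = "\<lambda>t. f' t * expectation (\<lambda>\<omega>. ?g1 (t, \<omega>))" and ?\<rho>2 = "\<lambda>t. f t * expectation (\<lambda>\<omega>. ?g2 (t, \<omega>))"
  let ?\<rho>3 = "\<lambda>t. e' t * expectation (\<lambda>\<omega>. ?g3 (t, \<omega>))" and ?\<rho>4 = "\<lambda>t. e t * expectation (\<lambda>\<omega>. ?g4 (t, \<omega>))"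
  let ?\<rho>5 = "\<lambda>t. d' t * expectation (\<lambda>\<omega>. ?g5 (t, \<omega>))" and ?\<rho>6 = "\<lambda>t. d t * expectation (\<lambda>\<omega>. ?g6 (t, \<omega>))"
  have L: "(LINT t:{0..T}|lborel. (?\<rho>1 t + ?\<rho>2 t) + (?\<rho>3 t + ?\<rho>4 t) + (?\<rho>5 t + ?\<rho>6 t)) = (\<integral>s. R (fst s) (snd s) \<partial>PT)"
  proof -
    note k1 = set_integral_add[OF h1(2) h2(2)]
    note k2 = set_integral_add[OF h3(2) h4(2)]
    note k3 = set_integral_add[OF h5(2) h6(2)]
    note k4 = set_integral_add[OF k1(1) k2(1)]
    note k5 = set_integral_add[OF k4(1) k3(1)]
    show ?thesis
      unfolding k5(2) k4(2) k3(2) k2(2) k1(2) h1(3) h2(3) h3(3) h4(3) h5(3) h6(3) Req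
      using h1(1) h2(1) h3(1) h4(1) h5(1) h6(1) by (simp only: Bochner_Integration.integral_add Bochner_Integration.integrable_add)
  qed
  have lt: "l2 M (X T)" "l2 M (x T)" "l2 M (y T)" using proc_l2(1)[OF pX] proc_l2(1)[OF px] proc_l2(1)[OF py] Tin by auto
  have "expectation (\<lambda>\<omega>. X T \<omega> * (f T * x T \<omega> + e T * y T \<omega> + d T))
     = expectation (\<lambda>\<omega>. f T * (X T \<omega> * x T \<omega>) + e T * (X T \<omega> * y T \<omega>) + d T * X T \<omega>)"
    by (intro Bochner_Integration.integral_cong) (auto simp: algebra_simps)
  also have "\<dots> = f T * expectation (\<lambda>\<omega>. X T \<omega> * x T \<omega>) + e T * expectation (\<lambda>\<omega>. X T \<omega> * y T \<omega>) + d T * expectation (X T)"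
    using l2_integrable_mult[OF lt(1,2)] l2_integrable_mult[OF lt(1,3)] l2_integrable[OF finite_measure_axioms lt(1)] by simp
  also have "\<dots> = f 0 * expectation (\<lambda>\<omega>. X 0 \<omega> * x 0 \<omega>) + e 0 * expectation (\<lambda>\<omega>. X 0 \<omega> * y 0 \<omega>) + d 0 * expectation (X 0)
      + (LINT t:{0..T}|lborel. (?\<rho>1 t + ?\<rho>2 t) + (?\<rho>3 t + ?\<rho>4 t) + (?\<rho>5 t + ?\<rho>6 t))"
    using acD[OF A Tin(1)] unfolding fst_conv snd_conv .
  also have "\<dots> = X0 * (f 0 * x0 + e 0 * y0 + d 0) + (\<integral>s. R (fst s) (snd s) \<partial>PT)"
    unfolding L P1(2) P2(2) P3(2) by (simp add: algebra_simps)
  finally show "expectation (\<lambda>\<omega>. X T \<omega> * (f T * x T \<omega> + e T * y T \<omega> + d T))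
      = X0 * (f 0 * x0 + e 0 * y0 + d 0) + (\<integral>s. R (fst s) (snd s) \<partial>PT)" .
qed

section \<open>A linear-quadratic control problem\<close>

lemma AE_PT_eq:
  assumes G: "G \<in> borel_measurable PT" and H: "H \<in> borel_measurable PT"
    and eq: "\<And>t. t \<in> {0..T} \<Longrightarrow> AE \<omega> in M. G (t, \<omega>) = (H (t, \<omega>) :: real)"
  shows "AE s in PT. G s = H s"
proof (rule pair_sigma_finite.AE_pair_measure[OF pair_sigma_finite_PT])
  show "{s \<in> space PT. G s = H s} \<in> sets PT" using G H by measurable
  show "AE t in LT. AE \<omega> in M. G (t, \<omega>) = H (t, \<omega>)"
  proof (rule AE_I2)
    fix t assume "t \<in> space LT"
    then have "t \<in> {0..T}" by (simp add: space_restrict_space)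
    then show "AE \<omega> in M. G (t, \<omega>) = H (t, \<omega>)" by (rule eq)
  qed
qed

lemma LINT_PT:
  fixes G :: "real \<times> 'a \<Rightarrow> real"
  assumes "integrable PT G"
  shows "(LINT t:{0..T}|lborel. expectation (\<lambda>\<omega>. G (t, \<omega>))) = (\<integral>x. G x \<partial>PT)"
    "set_integrable lborel {0..T} (\<lambda>t. expectation (\<lambda>\<omega>. G (t, \<omega>)))"
  using coef_integrable[OF continuous_on_const assms, of 1] by simp_all

end

text \<open>
  The problem of one player, with state \<open>x\<close>, while the strategy behind the state \<open>y\<close> of the opponent
  is frozen. Up to constants, producer and consumer both maximize \<open>payoff\<close> below; for the producer
  \<open>(A, r, \<theta>, \<mu>, \<nu>, \<epsilon>, m, n)\<close> is \<open>(s\<^sub>0, \<rho>\<^sub>p, \<gamma> \<rho>\<^sub>c, \<lambda> \<rho>\<^sub>p, \<lambda> \<gamma> \<rho>\<^sub>c, \<eta>\<^sub>p \<lambda>\<^sup>2, \<rho>\<^sub>p, \<gamma> \<rho>\<^sub>c)\<close>.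
  The process \<open>k u\<close> equals \<open>2 (K + P\<^sub>1) x + 2 P\<^sub>2 y + d\<close> with a deterministic \<open>d\<close>; \<open>f'\<close>, \<open>e'\<close>, \<open>d'\<close> are the
  derivatives of the three coefficients.
\<close>

locale agent = brownian2 M T W B for M :: "'a measure" and T W B +
  fixes i :: bool and x0 y0 A r \<theta> k l \<sigma> \<mu> \<nu> \<epsilon> m n :: real
    and x u z y v w :: "real \<Rightarrow> 'a \<Rightarrow> real"
    and K K' \<Lambda> \<Lambda>' P\<^sub>1 P\<^sub>2 g f' e' d' \<zeta> :: "real \<Rightarrow> real"
  assumes px: "proc i x0 u z x" and py: "proc (\<not> i) y0 v w y"
    and r: "0 \<le> r" and k: "0 < k" and l: "0 \<le> l" and \<epsilon>: "0 \<le> \<epsilon>"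
    and f: "\<And>t. t \<in> {0..T} \<Longrightarrow> ((\<lambda>t. 2 * (K t + P\<^sub>1 t)) has_real_derivative f' t) (at t within {0..T})"
      "continuous_on {0..T} f'"
    and e: "\<And>t. t \<in> {0..T} \<Longrightarrow> ((\<lambda>t. 2 * P\<^sub>2 t) has_real_derivative e' t) (at t within {0..T})"
      "continuous_on {0..T} e'"
    and d: "\<And>t. t \<in> {0..T} \<Longrightarrow> ((\<lambda>t. 2 * (\<Lambda> t * mean M x t + g t) - 2 * (K t + P\<^sub>1 t) * mean M x t
        - 2 * P\<^sub>2 t * mean M y t) has_real_derivative d' t) (at t within {0..T})"
      "continuous_on {0..T} d'"
    and K: "\<And>t. t \<in> {0..T} \<Longrightarrow> (K has_real_derivative K' t) (at t within {0..T})"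
      "continuous_on {0..T} K'" "\<And>t. K' t = r + \<epsilon> * m\<^sup>2 - 2 / k * (K t)\<^sup>2"
    and \<Lambda>: "\<And>t. t \<in> {0..T} \<Longrightarrow> (\<Lambda> has_real_derivative \<Lambda>' t) (at t within {0..T})"
      "continuous_on {0..T} \<Lambda>'" "\<And>t. \<Lambda>' t = r - 2 / k * (\<Lambda> t)\<^sup>2"
    and xb: "\<And>t. t \<in> {0..T} \<Longrightarrow>
        (mean M x has_real_derivative 2 / k * (\<Lambda> t * mean M x t + g t)) (at t within {0..T})"
      "continuous_on {0..T} g"
    and final: "P\<^sub>1 T = 0" "P\<^sub>2 T = 0" "K T = 0" "\<Lambda> T = 0" "2 * g T = \<mu>"
    and ctrl: "\<And>t. t \<in> {0..T} \<Longrightarrow> AE \<omega> in M. u t \<omega> = 2 / k * ((K t + P\<^sub>1 t) * (x t \<omega> - mean M x t)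
        + P\<^sub>2 t * (y t \<omega> - mean M y t) + \<Lambda> t * mean M x t + g t)"
    and adj: "\<And>t. t \<in> {0..T} \<Longrightarrow> AE \<omega> in M.
        f' t * x t \<omega> + 2 * (K t + P\<^sub>1 t) * u t \<omega> + e' t * y t \<omega> + 2 * P\<^sub>2 t * v t \<omega> + d' t
        = - (A - 2 * r * x t \<omega> + \<theta> * y t \<omega>
            - 2 * \<epsilon> * m * (m * (x t \<omega> - mean M x t) - n * (y t \<omega> - mean M y t)))"
    and vol: "\<And>t \<omega>. t \<in> {0..T} \<Longrightarrow> \<omega> \<in> space M \<Longrightarrow> z t \<omega> = \<zeta> t"
      "\<And>t. t \<in> {0..T} \<Longrightarrow> \<zeta> t * (l - 2 * (K t + P\<^sub>1 t)) = l * \<sigma>"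
      "\<And>t. t \<in> {0..T} \<Longrightarrow> l - 2 * K t \<noteq> 0"
begin

definition run :: "(real \<Rightarrow> 'a \<Rightarrow> real) \<Rightarrow> (real \<Rightarrow> 'a \<Rightarrow> real) \<Rightarrow> (real \<Rightarrow> 'a \<Rightarrow> real) \<Rightarrow> real \<Rightarrow> 'a \<Rightarrow> real" where
  "run a b X t \<omega> = X t \<omega> * (A - r * X t \<omega> + \<theta> * y t \<omega>) - k / 2 * (a t \<omega>)\<^sup>2 - l / 2 * (b t \<omega> - \<sigma>)\<^sup>2"

text \<open>The weight \<open>\<nu>\<close> belongs to the terminal mean of the opponent, which is a
  constant for the player but part of the equilibrium value.\<close>

definition payoff :: "(real \<Rightarrow> 'a \<Rightarrow> real) \<Rightarrow> (real \<Rightarrow> 'a \<Rightarrow> real) \<Rightarrow> (real \<Rightarrow> 'a \<Rightarrow> real) \<Rightarrow> real" where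
  "payoff a b X = (LINT t:{0..T}|lborel. expectation (run a b X t)) + \<mu> * mean M X T - \<nu> * mean M y T
     - \<epsilon> * (LINT t:{0..T}|lborel. variance (\<lambda>\<omega>. m * X t \<omega> - n * y t \<omega>))"

text \<open>Not a covariance, but the centred combination whose second moment is the variance
  penalty.\<close>

definition cov :: "(real \<Rightarrow> 'a \<Rightarrow> real) \<Rightarrow> real \<times> 'a \<Rightarrow> real" where
  "cov X s = m * (X (fst s) (snd s) - mean M X (fst s)) - n * (y (fst s) (snd s) - mean M y (fst s))"

lemma mean_l2: "proc j c a b X \<Longrightarrow> l2 PT (\<lambda>s. mean M X (fst s))"
  using coef_l2[OF ac_continuous[OF proc_mean(1)] l2_const[OF finite_measure_PT, of 1]] by simp

lemma cov_l2: "proc j c a b X \<Longrightarrow> l2 PT (cov X)"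
  unfolding cov_def[abs_def]
  by (intro l2_diff l2_cmult mean_l2[OF py] mean_l2[of j c a b X] proc_l2(2)[OF py] proc_l2(2)[of j c a b X])

lemma run_integrable:
  assumes "proc j c a b X" shows "integrable PT (\<lambda>s. run a b X (fst s) (snd s))"
proof -
  note lX = proc_control_l2(1,2)[OF assms] proc_l2(2)[OF assms]
  show ?thesis
    unfolding run_def power2_eq_square mult.assoc
    by (intro Bochner_Integration.integrable_diff l2_integrable_mult integrable_mult_right l2_add l2_diff l2_cmult
      l2_const finite_measure_PT lX proc_l2(2)[OF py])
qed

lemma variance_cov:
  assumes p: "proc j c a b X"
  shows "(LINT t:{0..T}|lborel. variance (\<lambda>\<omega>. m * X t \<omega> - n * y t \<omega>)) = (\<integral>s. (cov X s)\<^sup>2 \<partial>PT)"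
    "t \<in> {0..T} \<Longrightarrow> variance (\<lambda>\<omega>. m * X t \<omega> - n * y t \<omega>) = expectation (\<lambda>\<omega>. (cov X (t, \<omega>))\<^sup>2)"
proof -
  show eq: "variance (\<lambda>\<omega>. m * X t \<omega> - n * y t \<omega>) = expectation (\<lambda>\<omega>. (cov X (t, \<omega>))\<^sup>2)" if "t \<in> {0..T}" for t
  proof -
    note i = l2_integrable[OF finite_measure_axioms proc_l2(1)[OF p that]] l2_integrable[OF finite_measure_axioms proc_l2(1)[OF py that]]
    have eq: "expectation (\<lambda>\<omega>. m * X t \<omega> - n * y t \<omega>) = m * mean M X t - n * mean M y t" using i by simp
    show ?thesis unfolding eq cov_def fst_conv snd_conv
      by (intro Bochner_Integration.integral_cong refl arg_cong[where f = "\<lambda>c. c\<^sup>2"]) (simp add: algebra_simps)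
  qed
  have "(LINT t:{0..T}|lborel. variance (\<lambda>\<omega>. m * X t \<omega> - n * y t \<omega>)) = (LINT t:{0..T}|lborel. expectation (\<lambda>\<omega>. (cov X (t, \<omega>))\<^sup>2))"
    by (intro set_lebesgue_integral_cong) (auto simp: eq)
  also have "\<dots> = (\<integral>s. (cov X s)\<^sup>2 \<partial>PT)"
    by (rule LINT_PT(1)[OF l2_integrable_sq[OF cov_l2[OF p]]])
  finally show "(LINT t:{0..T}|lborel. variance (\<lambda>\<omega>. m * X t \<omega> - n * y t \<omega>)) = (\<integral>s. (cov X s)\<^sup>2 \<partial>PT)" .
qed

text \<open>A deterministic function is orthogonal to a centred variable. This removes the mean of
  the deviation from the first variation of the penalty.\<close>

lemma cov_mean_zero:
  assumes p: "proc j c a b X" and h: "continuous_on {0..T} h"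
  shows "(\<integral>s. h (fst s) * cov X s \<partial>PT) = 0"
proof -
  have "(LINT t:{0..T}|lborel. h t * expectation (\<lambda>\<omega>. cov X (t, \<omega>))) = (LINT t:{0..T}|lborel. 0)"
  proof (intro set_lebesgue_integral_cong allI impI)
    fix t assume "t \<in> {0..T}"
    note i = l2_integrable[OF finite_measure_axioms proc_l2(1)[OF p this]] l2_integrable[OF finite_measure_axioms proc_l2(1)[OF py this]]
    show "h t * expectation (\<lambda>\<omega>. cov X (t, \<omega>)) = 0" unfolding cov_def using i by (simp add: prob_space)
  qed simp
  then show ?thesis
    using coef_integrable(3)[OF h l2_integrable[OF finite_measure_PT cov_l2[OF p]]] by simp
qed

text \<open>The integrand \<open>R\<close> of \<open>adjoint_product\<close> with the feedback
  coefficients of \<open>k u\<close>, that is, the density of the expectation of \<open>X\<close>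
  times the adjoint process.\<close>

definition adjoint :: "(real \<Rightarrow> 'a \<Rightarrow> real) \<Rightarrow> (real \<Rightarrow> 'a \<Rightarrow> real) \<Rightarrow> (real \<Rightarrow> 'a \<Rightarrow> real) \<Rightarrow> real \<Rightarrow> 'a \<Rightarrow> real" where
  "adjoint a b X t \<omega> = f' t * (X t \<omega> * x t \<omega>) + 2 * (K t + P\<^sub>1 t) * (a t \<omega> * x t \<omega> + X t \<omega> * u t \<omega> + b t \<omega> * z t \<omega>)
      + e' t * (X t \<omega> * y t \<omega>) + 2 * P\<^sub>2 t * (a t \<omega> * y t \<omega> + X t \<omega> * v t \<omega>) + d' t * X t \<omega>
      + (2 * (\<Lambda> t * mean M x t + g t) - 2 * (K t + P\<^sub>1 t) * mean M x t - 2 * P\<^sub>2 t * mean M y t) * a t \<omega>"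

text \<open>At \<open>T\<close> all feedback coefficients vanish and the affine part equals
  \<open>\<mu>\<close>. At 0 the terms with \<open>K\<close>, \<open>P\<^sub>1\<close>,
  \<open>P\<^sub>2\<close> cancel, because the means start at the initial values. The boundary term
  at 0 is therefore the same for every competitor, and the terminal reward turns into a running
  one.\<close>

lemma adjoint_integral:
  assumes "proc i x0 a b X"
  shows "integrable PT (\<lambda>s. adjoint a b X (fst s) (snd s))"
    "\<mu> * mean M X T = x0 * (2 * (\<Lambda> 0 * x0 + g 0)) + (\<integral>s. adjoint a b X (fst s) (snd s) \<partial>PT)"
proof -
  note a = adjoint_product[OF assms px py f e d, folded adjoint_def]
  show "integrable PT (\<lambda>s. adjoint a b X (fst s) (snd s))" by (rule a(1))
  show "\<mu> * mean M X T = x0 * (2 * (\<Lambda> 0 * x0 + g 0)) + (\<integral>s. adjoint a b X (fst s) (snd s) \<partial>PT)"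
    using a(2) proc_mean(2)[OF px] proc_mean(2)[OF py] final(1-4)
    unfolding final(5)[symmetric] by (simp add: algebra_simps)
qed

text \<open>The feedback law and the drift equation are given almost surely at each fixed time;
  comparing integrands needs them almost everywhere on \<open>PT\<close>.\<close>

lemma ctrl_PT: "AE s in PT. fst s \<in> {0..T} \<and> snd s \<in> space M \<and>
    k * u (fst s) (snd s) = 2 * (K (fst s) + P\<^sub>1 (fst s)) * x (fst s) (snd s) + 2 * P\<^sub>2 (fst s) * y (fst s) (snd s)
      + (2 * (\<Lambda> (fst s) * mean M x (fst s) + g (fst s)) - 2 * (K (fst s) + P\<^sub>1 (fst s)) * mean M x (fst s) - 2 * P\<^sub>2 (fst s) * mean M y (fst s)) \<and>
    f' (fst s) * x (fst s) (snd s) + 2 * (K (fst s) + P\<^sub>1 (fst s)) * u (fst s) (snd s) + e' (fst s) * y (fst s) (snd s)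
      + 2 * P\<^sub>2 (fst s) * v (fst s) (snd s) + d' (fst s)
      = - (A - 2 * r * x (fst s) (snd s) + \<theta> * y (fst s) (snd s) - 2 * \<epsilon> * m * cov x s)"
proof -
  have cf: "continuous_on {0..T} (\<lambda>t. 2 * (K t + P\<^sub>1 t))" "continuous_on {0..T} (\<lambda>t. 2 * P\<^sub>2 t)"
    "continuous_on {0..T} (\<lambda>t. 2 * (\<Lambda> t * mean M x t + g t) - 2 * (K t + P\<^sub>1 t) * mean M x t - 2 * P\<^sub>2 t * mean M y t)"
    using DERIV_continuous_on[OF f(1)] DERIV_continuous_on[OF e(1)] DERIV_continuous_on[OF d(1)] by blast+
  note meas = proc_control_l2(1)[OF px, THEN l2_measurable] proc_control_l2(1)[OF py, THEN l2_measurable]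
    proc_l2(2)[OF px, THEN l2_measurable] proc_l2(2)[OF py, THEN l2_measurable] cov_l2[OF px, THEN l2_measurable]
    coef_measurable[OF f(2)] coef_measurable[OF e(2)] coef_measurable[OF d(2)]
    coef_measurable[OF cf(1)] coef_measurable[OF cf(2)] coef_measurable[OF cf(3)]
  have 1: "AE s in PT. k * u (fst s) (snd s) = 2 * (K (fst s) + P\<^sub>1 (fst s)) * x (fst s) (snd s) + 2 * P\<^sub>2 (fst s) * y (fst s) (snd s)
      + (2 * (\<Lambda> (fst s) * mean M x (fst s) + g (fst s)) - 2 * (K (fst s) + P\<^sub>1 (fst s)) * mean M x (fst s) - 2 * P\<^sub>2 (fst s) * mean M y (fst s))"
  proof (rule AE_PT_eq)
    fix t assume "t \<in> {0..T}"
    from ctrl[OF this] show "AE \<omega> in M. k * u (fst (t, \<omega>)) (snd (t, \<omega>)) = 2 * (K (fst (t, \<omega>)) + P\<^sub>1 (fst (t, \<omega>))) * x (fst (t, \<omega>)) (snd (t, \<omega>)) + 2 * P\<^sub>2 (fst (t, \<omega>)) * y (fst (t, \<omega>)) (snd (t, \<omega>))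
      + (2 * (\<Lambda> (fst (t, \<omega>)) * mean M x (fst (t, \<omega>)) + g (fst (t, \<omega>))) - 2 * (K (fst (t, \<omega>)) + P\<^sub>1 (fst (t, \<omega>))) * mean M x (fst (t, \<omega>)) - 2 * P\<^sub>2 (fst (t, \<omega>)) * mean M y (fst (t, \<omega>)))"
    proof eventually_elim
      case (elim \<omega>)
      show ?case unfolding elim fst_conv snd_conv using k by (simp add: field_simps)
    qed
  qed (intro borel_measurable_add borel_measurable_times borel_measurable_const meas)+
  have 2: "AE s in PT. f' (fst s) * x (fst s) (snd s) + 2 * (K (fst s) + P\<^sub>1 (fst s)) * u (fst s) (snd s) + e' (fst s) * y (fst s) (snd s)
      + 2 * P\<^sub>2 (fst s) * v (fst s) (snd s) + d' (fst s)
      = - (A - 2 * r * x (fst s) (snd s) + \<theta> * y (fst s) (snd s) - 2 * \<epsilon> * m * cov x s)"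
  proof (rule AE_PT_eq)
    fix t assume "t \<in> {0..T}"
    from adj[OF this] show "AE \<omega> in M. f' (fst (t, \<omega>)) * x (fst (t, \<omega>)) (snd (t, \<omega>)) + 2 * (K (fst (t, \<omega>)) + P\<^sub>1 (fst (t, \<omega>))) * u (fst (t, \<omega>)) (snd (t, \<omega>)) + e' (fst (t, \<omega>)) * y (fst (t, \<omega>)) (snd (t, \<omega>))
      + 2 * P\<^sub>2 (fst (t, \<omega>)) * v (fst (t, \<omega>)) (snd (t, \<omega>)) + d' (fst (t, \<omega>))
      = - (A - 2 * r * x (fst (t, \<omega>)) (snd (t, \<omega>)) + \<theta> * y (fst (t, \<omega>)) (snd (t, \<omega>)) - 2 * \<epsilon> * m * cov x (t, \<omega>))"
      unfolding cov_def fst_conv snd_conv .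
  qed (intro borel_measurable_uminus borel_measurable_diff borel_measurable_add borel_measurable_times borel_measurable_const meas)+
  show ?thesis
    using 1 2 AE_space[of PT]
    by eventually_elim (auto simp: space_pair_measure space_restrict_space)
qed

text \<open>By \<open>adjoint_integral\<close> each payoff is a common constant plus the integral of
  \<open>run + adjoint\<close> minus the penalty. Terms linear in the deviation cancel, and
  concavity leaves only squares with a negative sign.\<close>

theorem payoff_optimal:
  assumes p: "proc i x0 a b X"
  shows "payoff a b X \<le> payoff u z x"
proof -
  let ?run' = "\<lambda>s. run a b X (fst s) (snd s)" and ?run = "\<lambda>s. run u z x (fst s) (snd s)"
  let ?adj' = "\<lambda>s. adjoint a b X (fst s) (snd s)" and ?adj = "\<lambda>s. adjoint u z x (fst s) (snd s)"
  let ?h = "\<lambda>t. m * (mean M X t - mean M x t)"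
  note ir = run_integrable[OF p] run_integrable[OF px]
  note ia = adjoint_integral[OF p] adjoint_integral[OF px]
  note cl = cov_l2[OF p] cov_l2[OF px]
  have ch: "continuous_on {0..T} ?h"
    by (intro continuous_intros ac_continuous[OF proc_mean(1)[OF p]] ac_continuous[OF proc_mean(1)[OF px]])
  let ?D = "\<lambda>s. m * (X (fst s) (snd s) - x (fst s) (snd s))"
  have D: "l2 PT ?D" by (intro l2_cmult l2_diff proc_l2(2)[OF p] proc_l2(2)[OF px])
  have iD: "integrable PT (\<lambda>s. ?D s * cov x s)" by (rule l2_integrable_mult[OF D cl(2)])
  have ih: "integrable PT (\<lambda>s. ?h (fst s) * cov x s)"
    by (rule coef_integrable(1)[OF ch l2_integrable[OF finite_measure_PT cl(2)]])
  \<comment> \<open>Convexity of the square, applied to \<open>cov X = cov x + ?D - ?h\<close>: the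
    deviation scaled by \<open>m\<close>, minus its mean. The product of \<open>cov x\<close> with
    the deterministic \<open>?h\<close> integrates to zero.\<close>
  have var: "(\<integral>s. (cov x s)\<^sup>2 \<partial>PT) + 2 * (\<integral>s. ?D s * cov x s \<partial>PT) \<le> (\<integral>s. (cov X s)\<^sup>2 \<partial>PT)"
  proof -
    have "(\<integral>s. (cov x s)\<^sup>2 + 2 * (?D s * cov x s) - 2 * (?h (fst s) * cov x s) \<partial>PT) \<le> (\<integral>s. (cov X s)\<^sup>2 \<partial>PT)"
    proof (rule integral_mono)
      show "integrable PT (\<lambda>s. (cov x s)\<^sup>2 + 2 * (?D s * cov x s) - 2 * (?h (fst s) * cov x s))"
        using iD ih l2_integrable_sq[OF cl(2)] by (intro Bochner_Integration.integrable_diff Bochner_Integration.integrable_add integrable_mult_right)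
      show "integrable PT (\<lambda>s. (cov X s)\<^sup>2)" by (rule l2_integrable_sq[OF cl(1)])
      fix s
      have square: "c\<^sup>2 + 2 * (D * c) - 2 * (H * c) \<le> C\<^sup>2" if "D = H + (C - c)" for c C D H :: real
        using zero_le_power2[of "C - c"] unfolding that by (simp add: power2_eq_square algebra_simps)
      show "(cov x s)\<^sup>2 + 2 * (?D s * cov x s) - 2 * (?h (fst s) * cov x s) \<le> (cov X s)\<^sup>2"
        by (rule square) (simp add: cov_def algebra_simps)
    qed
    also have "(\<integral>s. (cov x s)\<^sup>2 + 2 * (?D s * cov x s) - 2 * (?h (fst s) * cov x s) \<partial>PT)
      = (\<integral>s. (cov x s)\<^sup>2 \<partial>PT) + 2 * (\<integral>s. ?D s * cov x s \<partial>PT) - 2 * (\<integral>s. ?h (fst s) * cov x s \<partial>PT)"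
      using iD ih l2_integrable_sq[OF cl(2)] by simp
    finally show ?thesis unfolding cov_mean_zero[OF px ch] by simp
  qed
  \<comment> \<open>The first variation of the penalty is carried on the left and will be
    compensated by \<open>var\<close>. With it, all terms linear in the deviation cancel
    pointwise.\<close>
  have "(\<integral>s. ?run' s + ?adj' s - 2 * \<epsilon> * (?D s * cov x s) \<partial>PT) \<le> (\<integral>s. ?run s + ?adj s \<partial>PT)"
  proof (rule integral_mono_AE)
    show "integrable PT (\<lambda>s. ?run' s + ?adj' s - 2 * \<epsilon> * (?D s * cov x s))"
      by (intro Bochner_Integration.integrable_diff Bochner_Integration.integrable_add integrable_mult_right ir ia iD)
    show "integrable PT (\<lambda>s. ?run s + ?adj s)" by (intro Bochner_Integration.integrable_add ir ia)
    show "AE s in PT. ?run' s + ?adj' s - 2 * \<epsilon> * (?D s * cov x s) \<le> ?run s + ?adj s"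
      using ctrl_PT
    proof eventually_elim
      case (elim s)
      obtain t \<omega> where s: "s = (t, \<omega>)" by (cases s)
      have t: "t \<in> {0..T}" "\<omega> \<in> space M" using elim s by auto
      define c1 where "c1 = 2 * (K t + P\<^sub>1 t)"
      define c2 where "c2 = 2 * P\<^sub>2 t"
      define c3 where "c3 = 2 * (\<Lambda> t * mean M x t + g t) - 2 * (K t + P\<^sub>1 t) * mean M x t - 2 * P\<^sub>2 t * mean M y t"
      define C where "C = cov x s"
      define xx where "xx = x t \<omega>" define uu where "uu = u t \<omega>" define zz where "zz = z t \<omega>"
      define yy where "yy = y t \<omega>" define vv where "vv = v t \<omega>"
      define DX where "DX = X t \<omega> - xx" define Da where "Da = a t \<omega> - uu" define Db where "Db = b t \<omega> - zz"
      have 1: "k * uu = c1 * xx + c2 * yy + c3"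
        and 2: "f' t * xx + c1 * uu + e' t * yy + c2 * vv + d' t = - (A - 2 * r * xx + \<theta> * yy - 2 * \<epsilon> * m * C)"
        using elim unfolding s c1_def c2_def c3_def C_def xx_def uu_def yy_def vv_def by simp_all
      \<comment> \<open>First-order condition in the volatility: the feedback coefficient times
        \<open>z\<close> balances the marginal cost of \<open>z\<close>.\<close>
      have 3: "c1 * zz = l * (zz - \<sigma>)"
        using vol(2)[OF t(1)] vol(1)[OF t] unfolding c1_def zz_def by (simp add: algebra_simps)
      have Xe: "X t \<omega> = xx + DX" "a t \<omega> = uu + Da" "b t \<omega> = zz + Db" by (auto simp: DX_def Da_def Db_def)
      have adjd: "adjoint a b X t \<omega> - adjoint u z x t \<omega> =
          DX * (f' t * xx + c1 * uu + e' t * yy + c2 * vv + d' t) + Da * (c1 * xx + c2 * yy + c3) + Db * (c1 * zz)"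
        unfolding adjoint_def c3_def[symmetric] Xe
        unfolding c1_def[symmetric] c2_def[symmetric]
          xx_def[symmetric] uu_def[symmetric] zz_def[symmetric] yy_def[symmetric] vv_def[symmetric]
        by (simp add: algebra_simps)
      have rund: "run a b X t \<omega> - run u z x t \<omega> = DX * (A - 2 * r * xx + \<theta> * yy) - r * DX\<^sup>2
          - k * uu * Da - k / 2 * Da\<^sup>2 - l * (zz - \<sigma>) * Db - l / 2 * Db\<^sup>2"
        unfolding run_def Xe xx_def[symmetric] uu_def[symmetric] zz_def[symmetric] yy_def[symmetric]
        by (simp add: algebra_simps power2_eq_square)
      have "run a b X t \<omega> - run u z x t \<omega> + (adjoint a b X t \<omega> - adjoint u z x t \<omega>) - 2 * \<epsilon> * (m * DX * C)
          = - (r * DX\<^sup>2 + k / 2 * Da\<^sup>2 + l / 2 * Db\<^sup>2)"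
        unfolding adjd rund 2 3 1[symmetric] by (simp add: algebra_simps)
      also have "\<dots> \<le> 0"
        using mult_nonneg_nonneg[OF r zero_le_power2[of DX]] mult_nonneg_nonneg[OF less_imp_le[OF k] zero_le_power2[of Da]]
          mult_nonneg_nonneg[OF l zero_le_power2[of Db]] by linarith
      finally show ?case unfolding s fst_conv snd_conv C_def[unfolded s, symmetric] DX_def xx_def by (simp add: s C_def)
    qed
  qed
  also have "(\<integral>s. ?run' s + ?adj' s - 2 * \<epsilon> * (?D s * cov x s) \<partial>PT)
     = (\<integral>s. ?run' s \<partial>PT) + (\<integral>s. ?adj' s \<partial>PT) - 2 * \<epsilon> * (\<integral>s. ?D s * cov x s \<partial>PT)"
    using ir ia(1,3) iD by simp
  also have "(\<integral>s. ?run s + ?adj s \<partial>PT) = (\<integral>s. ?run s \<partial>PT) + (\<integral>s. ?adj s \<partial>PT)"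
    using ir ia(1,3) by simp
  finally have main: "(\<integral>s. ?run' s \<partial>PT) + (\<integral>s. ?adj' s \<partial>PT) - 2 * \<epsilon> * (\<integral>s. ?D s * cov x s \<partial>PT)
      \<le> (\<integral>s. ?run s \<partial>PT) + (\<integral>s. ?adj s \<partial>PT)" .
  have L: "(LINT t:{0..T}|lborel. expectation (run a b X t)) = (\<integral>s. ?run' s \<partial>PT)"
    "(LINT t:{0..T}|lborel. expectation (run u z x t)) = (\<integral>s. ?run s \<partial>PT)"
    using LINT_PT(1)[OF ir(1)] LINT_PT(1)[OF ir(2)] by simp_all
  have "\<epsilon> * ((\<integral>s. (cov x s)\<^sup>2 \<partial>PT) + 2 * (\<integral>s. ?D s * cov x s \<partial>PT)) \<le> \<epsilon> * (\<integral>s. (cov X s)\<^sup>2 \<partial>PT)"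
    by (rule mult_left_mono[OF var \<epsilon>])
  then show ?thesis
    unfolding payoff_def variance_cov(1)[OF p] variance_cov(1)[OF px] L
    using main ia(2,4) by (simp add: distrib_left)
qed

text \<open>Reducing the feedback coefficients by \<open>K\<close> and \<open>\<Lambda>\<close>
  keeps the terminal value, as both vanish at \<open>T\<close>, and leaves
  \<open>\<Lambda> 0 * x0 + 2 * g 0\<close> at the start. Once the control is inserted, the Riccati
  equations of \<open>K\<close> and \<open>\<Lambda>\<close> cancel the quadratic terms in
  \<open>x - E x\<close> and in \<open>E x\<close>. What remains is \<open>2 / k\<close> times a
  complete square, the variance of the opponent's state and the volatility terms.\<close>

theorem payoff_value:
  "payoff u z x = \<Lambda> 0 * x0\<^sup>2 + 2 * g 0 * x0
    + (LINT t:{0..T}|lborel. 2 / k * expectation (\<lambda>\<omega>. (P\<^sub>1 t * (x t \<omega> - mean M x t) + P\<^sub>2 t * (y t \<omega> - mean M y t) + g t)\<^sup>2)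
        - \<epsilon> * n\<^sup>2 * variance (y t) + 2 * (P\<^sub>1 t * \<zeta> t + l * \<sigma> / 2)\<^sup>2 / (l - 2 * K t))
    - l / 2 * \<sigma>\<^sup>2 * T - \<nu> * mean M y T"
proof -
  let ?u = "\<lambda>t. 2 / k * (\<Lambda> t * mean M x t + g t)"
  let ?d = "\<lambda>t. 2 * (\<Lambda> t * mean M x t + g t) - 2 * (K t + P\<^sub>1 t) * mean M x t - 2 * P\<^sub>2 t * mean M y t"
  let ?h = "\<lambda>t. 2 / k * expectation (\<lambda>\<omega>. (P\<^sub>1 t * (x t \<omega> - mean M x t) + P\<^sub>2 t * (y t \<omega> - mean M y t) + g t)\<^sup>2)
        - \<epsilon> * n\<^sup>2 * variance (y t) + 2 * (P\<^sub>1 t * \<zeta> t + l * \<sigma> / 2)\<^sup>2 / (l - 2 * K t)"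
  have cxb: "continuous_on {0..T} (mean M x)" by (rule ac_continuous[OF proc_mean(1)[OF px]])
  have cK: "continuous_on {0..T} K" "continuous_on {0..T} \<Lambda>"
    using DERIV_continuous_on[OF K(1)] DERIV_continuous_on[OF \<Lambda>(1)] by blast+
  have df: "((\<lambda>t. 2 * (K t + P\<^sub>1 t) - K t) has_real_derivative (f' t - K' t)) (at t within {0..T})" if "t \<in> {0..T}" for t
    by (rule DERIV_diff[OF f(1)[OF that] K(1)[OF that]])
  have cf: "continuous_on {0..T} (\<lambda>t. f' t - K' t)" by (intro continuous_intros f(2) K(2))
  have dd: "((\<lambda>t. ?d t - (\<Lambda> t - K t) * mean M x t) has_real_derivative
      (d' t - ((\<Lambda>' t - K' t) * mean M x t + ?u t * (\<Lambda> t - K t)))) (at t within {0..T})" if "t \<in> {0..T}" for t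
    by (rule DERIV_diff[OF d(1)[OF that] DERIV_mult[OF DERIV_diff[OF \<Lambda>(1)[OF that] K(1)[OF that]] xb(1)[OF that]]])
  have cd: "continuous_on {0..T} (\<lambda>t. d' t - ((\<Lambda>' t - K' t) * mean M x t + ?u t * (\<Lambda> t - K t)))"
    by (intro continuous_intros d(2) K(2) \<Lambda>(2) cxb cK xb(2))
  define R where "R t \<omega> = (f' t - K' t) * (x t \<omega> * x t \<omega>) + (2 * (K t + P\<^sub>1 t) - K t) * (u t \<omega> * x t \<omega> + x t \<omega> * u t \<omega> + z t \<omega> * z t \<omega>)
      + e' t * (x t \<omega> * y t \<omega>) + 2 * P\<^sub>2 t * (u t \<omega> * y t \<omega> + x t \<omega> * v t \<omega>)
      + (d' t - ((\<Lambda>' t - K' t) * mean M x t + ?u t * (\<Lambda> t - K t))) * x t \<omega>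
      + (?d t - (\<Lambda> t - K t) * mean M x t) * u t \<omega>" for t \<omega>
  note adj_prod = adjoint_product[OF px px py df cf e dd cd, folded R_def]
  have mu: "\<mu> * mean M x T = x0 * (\<Lambda> 0 * x0 + 2 * g 0) + (\<integral>s. R (fst s) (snd s) \<partial>PT)"
    using adj_prod(2) proc_mean(2)[OF px] proc_mean(2)[OF py] final(1-4)
    unfolding final(5)[symmetric] by (simp add: algebra_simps)
  note ir = run_integrable[OF px] and ic = l2_integrable_sq[OF cov_l2[OF px]]
  let ?G = "\<lambda>s. run u z x (fst s) (snd s) + R (fst s) (snd s) - \<epsilon> * (cov x s)\<^sup>2"
  have iG: "integrable PT ?G"
    by (intro Bochner_Integration.integrable_diff Bochner_Integration.integrable_add integrable_mult_right ir adj_prod(1) ic)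
  \<comment> \<open>The two integrands differ by terms linear in \<open>x - E x\<close> and \<open>y - E y\<close>, which have mean zero.\<close>
  have EG: "expectation (\<lambda>\<omega>. ?G (t, \<omega>)) = ?h t - l / 2 * \<sigma>\<^sup>2" if t: "t \<in> {0..T}" for t
  proof -
    define c where "c = 2 / k"
    have kc: "k / 2 * c = 1" "k * c = 2" using k by (auto simp: c_def)
    define a where "a = mean M x t"
    define b where "b = mean M y t"
    have lx: "l2 M (\<lambda>\<omega>. x t \<omega> - a)" and ly: "l2 M (\<lambda>\<omega>. y t \<omega> - b)"
      using proc_l2(1)[OF px t] proc_l2(1)[OF py t] by (auto intro!: l2_diff l2_const finite_measure_axioms)
    define V where "V \<omega> = P\<^sub>1 t * (x t \<omega> - a) + P\<^sub>2 t * (y t \<omega> - b) + g t" for \<omega>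
    have lV: "l2 M V" unfolding V_def[abs_def] by (intro l2_add l2_cmult lx ly l2_const finite_measure_axioms)
    define S where "S = 2 * (P\<^sub>1 t * \<zeta> t + l * \<sigma> / 2)\<^sup>2 / (l - 2 * K t)"
    \<comment> \<open>The coefficients of the centred states that are left over in the expansion
      \<open>ae\<close>; what matters is that they are deterministic.\<close>
    define C1 where "C1 = \<epsilon> * m\<^sup>2 * a + c * ((\<Lambda> t - K t) * a * P\<^sub>1 t + (K t - \<Lambda> t) * g t)"
    define C2 where "C2 = - 2 * \<epsilon> * m * n * a + c * (\<Lambda> t - K t) * a * P\<^sub>2 t"
    \<comment> \<open>With \<open>q = l - 2 * K t\<close>, the equation for \<open>\<zeta>\<close>
      says that \<open>P\<^sub>1 t * \<zeta> t + l * \<sigma> / 2\<close> equals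
      \<open>\<zeta> t * q / 2\<close>. So \<open>S\<close> is
      \<open>(\<zeta> t)\<^sup>2 * q / 2\<close>, and up to the constant
      \<open>l / 2 * \<sigma>\<^sup>2\<close> this is the sum of the volatility cost and the
      volatility term of the product rule.\<close>
    have Z: "- l / 2 * (\<zeta> t - \<sigma>)\<^sup>2 + (2 * (K t + P\<^sub>1 t) - K t) * (\<zeta> t * \<zeta> t) = S - l / 2 * \<sigma>\<^sup>2"
    proof -
      define q where "q = l - 2 * K t"
      have q: "q \<noteq> 0" using vol(3)[OF t] by (simp add: q_def)
      have ls: "l * \<sigma> = \<zeta> t * (q - 2 * P\<^sub>1 t)" using vol(2)[OF t] by (simp add: q_def algebra_simps)
      have "P\<^sub>1 t * \<zeta> t + l * \<sigma> / 2 = \<zeta> t * q / 2" unfolding ls by (simp add: field_simps)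
      then have "S = 2 * (\<zeta> t * q / 2)\<^sup>2 / q" unfolding S_def q_def[symmetric] by (simp only:)
      also have "\<dots> = (\<zeta> t)\<^sup>2 * q / 2" using q by (simp add: power2_eq_square)
      finally have S: "S = (\<zeta> t)\<^sup>2 * q / 2" .
      have "- l / 2 * (\<zeta> t - \<sigma>)\<^sup>2 + (2 * (K t + P\<^sub>1 t) - K t) * (\<zeta> t * \<zeta> t) =
        - l / 2 * (\<zeta> t)\<^sup>2 + \<zeta> t * (l * \<sigma>) - l / 2 * \<sigma>\<^sup>2 + (K t + 2 * P\<^sub>1 t) * (\<zeta> t)\<^sup>2"
        by (simp add: power2_eq_square field_simps)
      also have "\<dots> = S - l / 2 * \<sigma>\<^sup>2"
        unfolding S ls by (simp add: q_def power2_eq_square field_simps)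
      finally show ?thesis .
    qed
    have ae: "AE \<omega> in M. ?G (t, \<omega>) = c * (V \<omega>)\<^sup>2 - \<epsilon> * n\<^sup>2 * (y t \<omega> - b)\<^sup>2 + (S - l / 2 * \<sigma>\<^sup>2)
        + C1 * (x t \<omega> - a) + C2 * (y t \<omega> - b)"
      using ctrl[OF t] adj[OF t] AE_space[of M]
    proof eventually_elim
      case (elim \<omega>)
      define X where "X = x t \<omega> - a"
      define Y where "Y = y t \<omega> - b"
      define U where "U = u t \<omega>"
      define v' where "v' = v t \<omega>"
      have xe: "x t \<omega> = X + a" "y t \<omega> = Y + b" by (auto simp: X_def Y_def)
      have Vd: "V \<omega> = P\<^sub>1 t * X + P\<^sub>2 t * Y + g t" by (simp add: V_def X_def Y_def)
      have Ue: "U = c * (K t * X + \<Lambda> t * a + V \<omega>)"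
        using elim(1) unfolding U_def c_def[symmetric] a_def[symmetric] b_def[symmetric] Vd X_def[symmetric] Y_def[symmetric]
        by (simp add: algebra_simps)
      have De: "f' t * (X + a) + 2 * (K t + P\<^sub>1 t) * U + e' t * (Y + b) + 2 * P\<^sub>2 t * v' + d' t
        = - (A - 2 * r * (X + a) + \<theta> * (Y + b) - 2 * \<epsilon> * m * (m * X - n * Y))"
        using elim(2) unfolding U_def v'_def a_def[symmetric] b_def[symmetric] xe by simp
      have ku: "k * U = 2 * (K t * X + \<Lambda> t * a + V \<omega>)" unfolding Ue using kc by (simp add: mult.assoc[symmetric])
      have kuu: "k / 2 * U\<^sup>2 = U * (K t * X + \<Lambda> t * a + V \<omega>)" using ku by (simp add: power2_eq_square)
      define df where "df = 2 * (\<Lambda> t * a + g t) - 2 * (K t + P\<^sub>1 t) * a - 2 * P\<^sub>2 t * b"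
      have P: "2 * (K t + P\<^sub>1 t) * (X + a) + 2 * P\<^sub>2 t * (Y + b) + df = 2 * (K t * X + \<Lambda> t * a + V \<omega>)"
        unfolding df_def Vd by (simp add: algebra_simps)
      \<comment> \<open>\<open>R\<close> is the density for the full adjoint process minus the
        contributions of \<open>K\<close> and \<open>\<Lambda>\<close>, arranged so that the drift
        equation \<open>De\<close> and the form \<open>P\<close> of the adjoint process can be
        inserted.\<close>
      have Re: "R t \<omega> = (X + a) * (f' t * (X + a) + 2 * (K t + P\<^sub>1 t) * U + e' t * (Y + b) + 2 * P\<^sub>2 t * v' + d' t)
        + U * (2 * (K t + P\<^sub>1 t) * (X + a) + 2 * P\<^sub>2 t * (Y + b) + df) + (2 * (K t + P\<^sub>1 t) - K t) * (\<zeta> t * \<zeta> t)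
        - K' t * (X + a)\<^sup>2 - 2 * K t * U * (X + a) - ((\<Lambda>' t - K' t) * a + c * (\<Lambda> t * a + g t) * (\<Lambda> t - K t)) * (X + a)
        - (\<Lambda> t - K t) * a * U"
        unfolding R_def a_def[symmetric] b_def[symmetric] df_def[symmetric] c_def[symmetric] U_def[symmetric] v'_def[symmetric] xe vol(1)[OF t elim(3)]
        by (simp add: power2_eq_square algebra_simps)
      have run_e: "run u z x t \<omega> = (X + a) * (A - r * (X + a) + \<theta> * (Y + b)) - U * (K t * X + \<Lambda> t * a + V \<omega>) - l / 2 * (\<zeta> t - \<sigma>)\<^sup>2"
        unfolding run_def xe U_def[symmetric] kuu vol(1)[OF t elim(3)] ..
      have cov_e: "cov x (t, \<omega>) = m * X - n * Y"
        unfolding cov_def fst_conv snd_conv a_def[symmetric] b_def[symmetric] xe by simp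
      have "?G (t, \<omega>) = (X + a) * (A - r * (X + a) + \<theta> * (Y + b))
         - (X + a) * (A - 2 * r * (X + a) + \<theta> * (Y + b) - 2 * \<epsilon> * m * (m * X - n * Y))
         + U * (K t * X + \<Lambda> t * a + V \<omega>)
         - K' t * (X + a)\<^sup>2 - 2 * K t * U * (X + a) - ((\<Lambda>' t - K' t) * a + c * (\<Lambda> t * a + g t) * (\<Lambda> t - K t)) * (X + a)
         - (\<Lambda> t - K t) * a * U - \<epsilon> * (m * X - n * Y)\<^sup>2
         + (- l / 2 * (\<zeta> t - \<sigma>)\<^sup>2 + (2 * (K t + P\<^sub>1 t) - K t) * (\<zeta> t * \<zeta> t))"
        unfolding fst_conv snd_conv run_e Re De P cov_e by (simp add: algebra_simps)
      also have "\<dots> = c * (V \<omega>)\<^sup>2 - \<epsilon> * n\<^sup>2 * Y\<^sup>2 + (S - l / 2 * \<sigma>\<^sup>2) + C1 * X + C2 * Y"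
        unfolding Z K(3) \<Lambda>(3) c_def[symmetric] Ue C1_def C2_def Vd
        by (simp add: power2_eq_square algebra_simps)
      finally show ?case unfolding X_def Y_def .
    qed
    have iVy: "integrable M (\<lambda>\<omega>. (V \<omega>)\<^sup>2)" "integrable M (\<lambda>\<omega>. (y t \<omega> - b)\<^sup>2)" "integrable M (\<lambda>\<omega>. x t \<omega> - a)" "integrable M (\<lambda>\<omega>. y t \<omega> - b)"
      by (rule l2_integrable_sq[OF lV], rule l2_integrable_sq[OF ly], rule l2_integrable[OF finite_measure_axioms lx], rule l2_integrable[OF finite_measure_axioms ly])
    have z0: "expectation (\<lambda>\<omega>. x t \<omega> - a) = 0" "expectation (\<lambda>\<omega>. y t \<omega> - b) = 0"
      unfolding a_def b_def using l2_integrable[OF finite_measure_axioms proc_l2(1)[OF px t]] l2_integrable[OF finite_measure_axioms proc_l2(1)[OF py t]]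
      by (simp_all add: prob_space)
    have "t \<in> space LT" using t by (simp add: space_restrict_space)
    then have Gm: "(\<lambda>\<omega>. ?G (t, \<omega>)) \<in> borel_measurable M"
      by (rule measurable_compose[OF measurable_Pair1' borel_measurable_integrable[OF iG]])
    have "expectation (\<lambda>\<omega>. ?G (t, \<omega>)) = expectation (\<lambda>\<omega>. c * (V \<omega>)\<^sup>2 - \<epsilon> * n\<^sup>2 * (y t \<omega> - b)\<^sup>2 + (S - l / 2 * \<sigma>\<^sup>2)
        + C1 * (x t \<omega> - a) + C2 * (y t \<omega> - b))"
      by (rule integral_cong_AE[OF Gm _ ae])
        (intro borel_measurable_integrable Bochner_Integration.integrable_add Bochner_Integration.integrable_diff integrable_mult_right iVy integrable_const)
    also have "\<dots> = c * expectation (\<lambda>\<omega>. (V \<omega>)\<^sup>2) - \<epsilon> * n\<^sup>2 * expectation (\<lambda>\<omega>. (y t \<omega> - b)\<^sup>2) + (S - l / 2 * \<sigma>\<^sup>2)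
        + C1 * expectation (\<lambda>\<omega>. x t \<omega> - a) + C2 * expectation (\<lambda>\<omega>. y t \<omega> - b)"
    proof -
      note j1 = integrable_mult_right[OF iVy(1), of c] and j2 = integrable_mult_right[OF iVy(2), of "\<epsilon> * n\<^sup>2"]
        and j3 = integrable_mult_right[OF iVy(3), of C1] and j4 = integrable_mult_right[OF iVy(4), of C2]
      note j12 = Bochner_Integration.integrable_diff[OF j1 j2]
      note jc = integrable_const[of "S - l / 2 * \<sigma>\<^sup>2"]
      note j5 = Bochner_Integration.integrable_add[OF j12 jc]
      note j6 = Bochner_Integration.integrable_add[OF j5 j3]
      show ?thesis
        unfolding Bochner_Integration.integral_add[OF j6 j4] Bochner_Integration.integral_add[OF j5 j3]
          Bochner_Integration.integral_add[OF j12 jc] Bochner_Integration.integral_diff[OF j1 j2] integral_mult_right_zero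
        by (simp add: prob_space)
    qed
    also have "\<dots> = ?h t - l / 2 * \<sigma>\<^sup>2"
      unfolding z0 unfolding S_def c_def b_def V_def[abs_def] a_def by simp
    finally show ?thesis .
  qed
  have Gint: "set_integrable lborel {0..T} (\<lambda>t. expectation (\<lambda>\<omega>. ?G (t, \<omega>)))" by (rule LINT_PT(2)[OF iG])
  have cint: "set_integrable lborel {0..T} (\<lambda>t. l / 2 * \<sigma>\<^sup>2)" by (rule borel_integrable_atLeastAtMost') simp
  have "(LINT t:{0..T}|lborel. ?h t) = (LINT t:{0..T}|lborel. expectation (\<lambda>\<omega>. ?G (t, \<omega>)) + l / 2 * \<sigma>\<^sup>2)"
    using EG by (intro set_lebesgue_integral_cong) auto
  also have "\<dots> = (\<integral>s. ?G s \<partial>PT) + l / 2 * \<sigma>\<^sup>2 * T"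
    unfolding set_integral_add(2)[OF Gint cint] LINT_PT(1)[OF iG] using T_pos by (simp add: set_lebesgue_integral_def)
  also have "(\<integral>s. ?G s \<partial>PT) = (\<integral>s. run u z x (fst s) (snd s) \<partial>PT) + (\<integral>s. R (fst s) (snd s) \<partial>PT) - \<epsilon> * (\<integral>s. (cov x s)\<^sup>2 \<partial>PT)"
    using ir adj_prod(1) ic by simp
  also have "(\<integral>s. run u z x (fst s) (snd s) \<partial>PT) = (LINT t:{0..T}|lborel. expectation (run u z x t))"
    using LINT_PT(1)[OF ir] by simp
  finally show ?thesis
    unfolding payoff_def variance_cov(1)[OF px] mu by (simp add: power2_eq_square algebra_simps)
qed

end

section \<open>Integrals of deterministic functions\<close>

context brownian2
begin

text \<open>One measurable null set for both motions: initial value and continuity are given only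
  almost surely, while states must be continuous along every path.\<close>

definition exceptional :: "'a set" where
  "exceptional = (SOME N. N \<in> null_sets M \<and>
     (\<forall>\<omega>\<in>space M - N. \<forall>k. Z k 0 \<omega> = 0 \<and> continuous_on {0..T} (\<lambda>t. Z k t \<omega>)))"

lemma exceptional:
  "exceptional \<in> null_sets M"
  "\<omega> \<in> space M - exceptional \<Longrightarrow> Z k 0 \<omega> = 0"
  "\<omega> \<in> space M - exceptional \<Longrightarrow> continuous_on {0..T} (\<lambda>t. Z k t \<omega>)"
proof -
  have "AE \<omega> in M. W 0 \<omega> = 0 \<and> B 0 \<omega> = 0"
    "AE \<omega> in M. continuous_on {0..T} (\<lambda>t. W t \<omega>) \<and> continuous_on {0..T} (\<lambda>t. B t \<omega>)"
    using bm unfolding brownian_motion_2d_def by auto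
  then have "AE \<omega> in M. \<forall>k. Z k 0 \<omega> = 0 \<and> continuous_on {0..T} (\<lambda>t. Z k t \<omega>)"
    by eventually_elim (simp add: Z_def)
  then obtain N where N: "{\<omega> \<in> space M. \<not> (\<forall>k. Z k 0 \<omega> = 0 \<and> continuous_on {0..T} (\<lambda>t. Z k t \<omega>))} \<subseteq> N"
    "emeasure M N = 0" "N \<in> sets M"
    by (rule AE_E)
  have "\<exists>N. N \<in> null_sets M \<and> (\<forall>\<omega>\<in>space M - N. \<forall>k. Z k 0 \<omega> = 0 \<and> continuous_on {0..T} (\<lambda>t. Z k t \<omega>))"
    using N by (intro exI[of _ N]) (auto simp: null_sets_def)
  from someI_ex[OF this, folded exceptional_def]
  show "exceptional \<in> null_sets M"
    "\<omega> \<in> space M - exceptional \<Longrightarrow> Z k 0 \<omega> = 0"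
    "\<omega> \<in> space M - exceptional \<Longrightarrow> continuous_on {0..T} (\<lambda>t. Z k t \<omega>)"
    by blast+
qed

text \<open>
  The exceptional set belongs to every \<open>F t\<close>, so that the modification below is still adapted,
  while all its paths are continuous.
\<close>

definition Zc :: "bool \<Rightarrow> real \<Rightarrow> 'a \<Rightarrow> real" where
  "Zc k t \<omega> = (if \<omega> \<in> exceptional then 0 else Z k t \<omega>)"

lemma Zc_AE: "AE \<omega> in M. \<forall>t. Zc k t \<omega> = Z k t \<omega>"
  using AE_not_in[OF exceptional(1)] by eventually_elim (simp add: Zc_def)

lemma Zc_0: "\<omega> \<in> space M \<Longrightarrow> Zc k 0 \<omega> = 0"
  using exceptional(2)[of \<omega> k] by (simp add: Zc_def)

lemma Zc_continuous: "\<omega> \<in> space M \<Longrightarrow> continuous_on {0..T} (\<lambda>t. Zc k t \<omega>)"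
  using exceptional(3)[of \<omega> k] by (cases "\<omega> \<in> exceptional") (simp_all add: Zc_def)

lemma Zc_measurable_F:
  assumes "0 \<le> s" "s \<le> t"
  shows "Zc k s \<in> borel_measurable (F t)"
  unfolding Zc_def[abs_def]
proof (rule measurable_If)
  have "{\<omega> \<in> space (F t). \<omega> \<in> exceptional} = exceptional"
    using exceptional(1) by (auto simp: null_sets_def dest: sets.sets_into_space)
  then show "{\<omega> \<in> space (F t). \<omega> \<in> exceptional} \<in> sets (F t)"
    using null_sets_F[OF exceptional(1)] by simp
qed (auto intro: Z_measurable_F assms)

lemma Zc_measurable_M: "t \<in> {0..T} \<Longrightarrow> Zc k t \<in> borel_measurable M"
  using Zc_measurable_F[of t t k] F_imp_M by auto

lemma Zc_joint: "(\<lambda>x. Zc k (fst x) (snd x)) \<in> borel_measurable PT"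
  using continuous_paths_joint_measurable[of T "Zc k" M] Zc_measurable_M Zc_continuous
  unfolding borel_measurable_PT_iff by (simp add: case_prod_beta')

lemma Zc_l2: "t \<in> {0..T} \<Longrightarrow> l2 M (Zc k t)"
proof -
  assume t: "t \<in> {0..T}"
  have "AE \<omega> in M. Z k t \<omega> - Z k 0 \<omega> = Zc k t \<omega>"
    using Zc_AE[of k] AE_space[of M]
  proof eventually_elim
    case (elim \<omega>)
    have "Z k 0 \<omega> = 0" using elim Zc_0[of \<omega> k] by simp
    then show ?case using elim by simp
  qed
  then show ?thesis using t by (intro l2_cong_AE[OF Z_l2[of 0 t k]] Zc_measurable_M) auto
qed

text \<open>Progressive measurability. Up to time \<open>t\<close> all values are
  \<open>F t\<close>-measurable and the paths are continuous, so the process is jointly measurable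
  relative to \<open>F t\<close>; integration over time then stays within
  \<open>F t\<close>.\<close>

lemma drift_adapted:
  assumes adapted: "\<And>s. s \<in> {0..T} \<Longrightarrow> X s \<in> borel_measurable (F s)"
    and cont: "\<And>\<omega>. \<omega> \<in> space M \<Longrightarrow> continuous_on {0..T} (\<lambda>s. X s \<omega>)"
    and t: "t \<in> {0..T}"
  shows "drift X t \<in> borel_measurable (F t)"
proof -
  let ?L = "restrict_space lborel {0..t}"
  interpret L: sigma_finite_measure ?L
  proof (rule finite_measure.axioms(1), rule finite_measureI)
    have "emeasure ?L (space ?L) = emeasure lborel {0..t}"
      unfolding space_restrict_space by (subst emeasure_restrict_space) auto
    then show "emeasure ?L (space ?L) \<noteq> \<infinity>"
      using emeasure_lborel_Icc[of 0 t] t by simp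
  qed
  have "(\<lambda>(s, \<omega>). X s \<omega>) \<in> borel_measurable (restrict_space borel {0..t} \<Otimes>\<^sub>M F t)"
  proof (rule continuous_paths_joint_measurable)
    show "X s \<in> borel_measurable (F t)" if "s \<in> {0..t}" for s
      using that t by (intro F_mono[OF adapted[of s]]) auto
    show "continuous_on {0..t} (\<lambda>s. X s \<omega>)" if "\<omega> \<in> space (F t)" for \<omega>
      using t that by (intro continuous_on_subset[OF cont]) auto
  qed
  then have "(\<lambda>(\<omega>, s). X s \<omega>) \<in> borel_measurable (F t \<Otimes>\<^sub>M restrict_space borel {0..t})"
    by (subst measurable_pair_swap_iff) (simp add: case_prod_beta')
  moreover have "sets (F t \<Otimes>\<^sub>M restrict_space borel {0..t}) = sets (F t \<Otimes>\<^sub>M ?L)"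
    by (intro sets_pair_measure_cong refl sets_restrict_space_cong) simp
  ultimately have "(\<lambda>(\<omega>, s). X s \<omega>) \<in> borel_measurable (F t \<Otimes>\<^sub>M ?L)"
    by (simp cong: measurable_cong_sets)
  then have "(\<lambda>\<omega>. \<integral>s. X s \<omega> \<partial>?L) \<in> borel_measurable (F t)"
    by (rule L.borel_measurable_lebesgue_integral)
  moreover have "(\<integral>s. X s \<omega> \<partial>?L) = drift X t \<omega>" for \<omega>
    unfolding drift_def set_lebesgue_integral_def by (rule integral_restrict_space) simp
  ultimately show ?thesis by (simp cong: measurable_cong)
qed

text \<open>Grid of the integrand 1 on a single interval. It makes the motion itself a simple
  integral, so that its covariances with other simple integrals come from the isometry.\<close>

abbreviation unit_grid :: "nat \<Rightarrow> real" where "unit_grid \<equiv> \<lambda>i. if i = 0 then 0 else T"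

lemma unit_integrand: "simple_integrand F T 1 unit_grid (\<lambda>_ _. 1)"
  using T_pos by (auto simp: simple_integrand_def)

lemma unit_process:
  "simple_process 1 unit_grid (\<lambda>_ _. 1) s = (\<lambda>\<omega>. indicator {0<..T} s)"
  by (simp add: simple_process_def fun_eq_iff)

lemma unit_integral:
  assumes "t \<in> {0..T}"
  shows "AE \<omega> in M. simple_integral (Z k) 1 unit_grid (\<lambda>_ _. 1) t \<omega> = Zc k t \<omega>"
  using Zc_AE[of k] AE_space[of M]
proof eventually_elim
  case (elim \<omega>)
  have "Z k 0 \<omega> = 0" using elim Zc_0[of \<omega> k] by simp
  moreover have "min T t = t" "min 0 t = 0" using assms by auto
  ultimately show ?case using elim by (simp add: simple_integral_def)
qed

text \<open>The martingale property moves the integral from \<open>t\<close> back to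
  \<open>r\<close>; there the isometry applies with the unit integrand.\<close>

lemma simple_integral_times_Zc:
  assumes s: "simple_integrand F T n g \<xi>" and rt: "0 \<le> r" "r \<le> t" "t \<le> T"
  shows "expectation (\<lambda>\<omega>. simple_integral (Z k) n g \<xi> t \<omega> * Zc k r \<omega>)
    = (LINT s:{0..r}|lborel. expectation (simple_process n g \<xi> s))"
proof -
  have r: "r \<in> {0..T}" and t: "t \<in> {0..T}" using rt by auto
  let ?U = "simple_integral (Z k) 1 unit_grid (\<lambda>_ _. 1) r"
  note lS = simple_integral_l2[OF s t, of k] simple_integral_l2[OF s r, of k]
  have "expectation (\<lambda>\<omega>. Zc k r \<omega> * (simple_integral (Z k) n g \<xi> t \<omega> - simple_integral (Z k) n g \<xi> r \<omega>)) = 0"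
    by (rule simple_martingale[OF s rt Zc_measurable_F[OF rt(1) order_refl] Zc_l2[OF r]])
  then have "expectation (\<lambda>\<omega>. simple_integral (Z k) n g \<xi> t \<omega> * Zc k r \<omega>) = expectation (\<lambda>\<omega>. simple_integral (Z k) n g \<xi> r \<omega> * Zc k r \<omega>)"
    using l2_integrable_mult[OF Zc_l2[OF r, of k] lS(1)] l2_integrable_mult[OF Zc_l2[OF r, of k] lS(2)]
    by (simp add: right_diff_distrib mult.commute)
  also have "\<dots> = expectation (\<lambda>\<omega>. simple_integral (Z k) n g \<xi> r \<omega> * ?U \<omega>)"
  proof (rule integral_cong_AE)
    show "AE \<omega> in M. simple_integral (Z k) n g \<xi> r \<omega> * Zc k r \<omega> = simple_integral (Z k) n g \<xi> r \<omega> * ?U \<omega>"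
      using unit_integral[OF r, of k] by eventually_elim simp
  qed (intro borel_measurable_times lS[THEN l2_measurable] Zc_l2[OF r, THEN l2_measurable] simple_integral_l2[OF unit_integrand r, THEN l2_measurable])+
  also have "\<dots> = (\<integral>x. indicator {0..r} (fst x) * simple_process n g \<xi> (fst x) (snd x) * simple_process 1 unit_grid (\<lambda>_ _. 1) (fst x) (snd x) \<partial>PT)"
    using simple_isometry[OF s unit_integrand r, of k k] by simp
  also have "\<dots> = (LINT s:{0..r}|lborel. expectation (\<lambda>\<omega>. simple_process n g \<xi> s \<omega> * simple_process 1 unit_grid (\<lambda>_ _. 1) s \<omega>))"
    using Fubini_PT(6)[OF l2_integrable_mult[OF simple_process_l2[OF s] simple_process_l2[OF unit_integrand]] r]
    by (simp add: mult.assoc)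
  also have "\<dots> = (LINT s:{0..r}|lborel. expectation (simple_process n g \<xi> s))"
    unfolding set_lebesgue_integral_def
  proof (rule integral_cong_AE)
    \<comment> \<open>The interval of the unit integrand is left-open, so the two integrands differ
      at most at time 0.\<close>
    show "AE s in lborel. indicator {0..r} s *\<^sub>R expectation (\<lambda>\<omega>. simple_process n g \<xi> s \<omega> * simple_process 1 unit_grid (\<lambda>_ _. 1) s \<omega>)
        = indicator {0..r} s *\<^sub>R expectation (simple_process n g \<xi> s)"
      using AE_lborel_singleton[of 0]
    proof eventually_elim
      case (elim s)
      show ?case
      proof (cases "s \<in> {0..r}")
        case True
        then have "indicator {0<..T} s = (1 :: real)" using elim r by simp
        then show ?thesis unfolding unit_process by simp
      qed simp
    qed
    have sub: "(\<lambda>s. indicator {0..r} s *\<^sub>R h s) \<in> borel_measurable lborel" if "set_integrable lborel {0..T} h" for h :: "real \<Rightarrow> real"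
      using set_integrable_subset[OF that, of "{0..r}"] rt unfolding set_integrable_def by auto
    show "(\<lambda>s. indicator {0..r} s *\<^sub>R expectation (simple_process n g \<xi> s)) \<in> borel_measurable lborel"
      using sub[OF Fubini_PT(2)[OF l2_integrable[OF finite_measure_PT simple_process_l2[OF s]]]] by simp
    show "(\<lambda>s. indicator {0..r} s *\<^sub>R expectation (\<lambda>\<omega>. simple_process n g \<xi> s \<omega> * simple_process 1 unit_grid (\<lambda>_ _. 1) s \<omega>)) \<in> borel_measurable lborel"
      using sub[OF Fubini_PT(2)[OF l2_integrable_mult[OF simple_process_l2[OF s] simple_process_l2[OF unit_integrand]]]] by simp
  qed
  finally show ?thesis .
qed

end

locale wiener_integrand = brownian2 M T W B for M :: "'a measure" and T W B +
  fixes k :: bool and \<zeta> \<zeta>' :: "real \<Rightarrow> real"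
  assumes \<zeta>: "\<And>t. t \<in> {0..T} \<Longrightarrow> (\<zeta> has_real_derivative \<zeta>' t) (at t within {0..T})"
    and \<zeta>': "continuous_on {0..T} \<zeta>'"
begin

lemma \<zeta>_continuous: "continuous_on {0..T} \<zeta>"
  using DERIV_continuous_on[OF \<zeta>] by blast

text \<open>The integral \<open>\<integral>\<^sub>0\<^sup>t \<zeta> dZ\<close>, defined pathwise by partial integration.\<close>

definition wiener :: "real \<Rightarrow> 'a \<Rightarrow> real" where
  "wiener t \<omega> = \<zeta> t * Zc k t \<omega> - (LINT s:{0..t}|lborel. \<zeta>' s * Zc k s \<omega>)"

lemma Zc_PT_l2: "l2 PT (\<lambda>x. Zc k (fst x) (snd x))"
proof (rule l2_PT_bound)
  show "(\<lambda>(t, \<omega>). Zc k t \<omega>) \<in> borel_measurable PT" using Zc_joint[of k] by (simp add: case_prod_beta')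
  fix t assume t: "t \<in> {0..T}"
  show "l2 M (Zc k t)" by (rule Zc_l2[OF t])
  let ?U = "simple_integral (Z k) 1 unit_grid (\<lambda>_ _. 1) t"
  let ?u = "\<lambda>x. simple_process 1 unit_grid (\<lambda>_ _. 1) (fst x) (snd x)"
  have "expectation (\<lambda>\<omega>. (Zc k t \<omega>)\<^sup>2) = expectation (\<lambda>\<omega>. ?U \<omega> * ?U \<omega>)"
  proof (rule integral_cong_AE)
    show "AE \<omega> in M. (Zc k t \<omega>)\<^sup>2 = ?U \<omega> * ?U \<omega>"
      using unit_integral[OF t, of k] by eventually_elim (simp add: power2_eq_square)
  qed (intro borel_measurable_times borel_measurable_power Zc_l2[OF t, THEN l2_measurable] simple_integral_l2[OF unit_integrand t, THEN l2_measurable])+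
  also have "\<dots> = (\<integral>x. indicator {0..t} (fst x) * ?u x * ?u x \<partial>PT)"
    using simple_isometry[OF unit_integrand unit_integrand t, of k k] by simp
  also have "\<dots> \<le> (\<integral>x. (?u x)\<^sup>2 \<partial>PT)"
    by (intro integral_mono l2_integrable_mult l2_PT_indicator l2_integrable_sq simple_process_l2[OF unit_integrand])
      (simp add: indicator_def power2_eq_square)
  finally show "expectation (\<lambda>\<omega>. (Zc k t \<omega>)\<^sup>2) \<le> (\<integral>x. (?u x)\<^sup>2 \<partial>PT)" .
qed

lemma drift_\<zeta>': "wiener t \<omega> = \<zeta> t * Zc k t \<omega> - drift (\<lambda>s \<omega>. \<zeta>' s * Zc k s \<omega>) t \<omega>"
  by (simp add: wiener_def drift_def)

lemma \<zeta>'Z_l2: "l2 PT (\<lambda>x. \<zeta>' (fst x) * Zc k (fst x) (snd x))"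
  by (rule coef_l2[OF \<zeta>' Zc_PT_l2])

lemma wiener_l2: "t \<in> {0..T} \<Longrightarrow> l2 M (wiener t)"
  unfolding drift_\<zeta>'[abs_def] by (intro l2_diff l2_cmult Zc_l2 drift_l2(1)[OF \<zeta>'Z_l2])

text \<open>
  Covariances with \<open>wiener t\<close> reduce to covariances with the Brownian path. This gives the distance
  of \<open>wiener t\<close> from simple integrals without any pathwise estimate.
\<close>

lemma wiener_pairing:
  assumes t: "t \<in> {0..T}" and Y: "l2 M Y" and \<phi>: "set_integrable lborel {0..t} \<phi>"
    and eq: "\<And>s. s \<in> {0..t} \<Longrightarrow> expectation (\<lambda>\<omega>. Y \<omega> * Zc k s \<omega>) = (LINT r:{0..s}|lborel. \<phi> r)"
  shows "expectation (\<lambda>\<omega>. Y \<omega> * wiener t \<omega>) = (LINT r:{0..t}|lborel. \<zeta> r * \<phi> r)"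
proof -
  have sub: "{0..t} \<subseteq> {0..T}" using t by auto
  have "expectation (\<lambda>\<omega>. Y \<omega> * Zc k 0 \<omega>) = expectation (\<lambda>\<omega>. 0)"
    by (intro Bochner_Integration.integral_cong) (auto simp: Zc_0)
  then have 0: "expectation (\<lambda>\<omega>. Y \<omega> * Zc k 0 \<omega>) = 0" by simp
  \<comment> \<open>The covariance of \<open>Y\<close> with the path is absolutely continuous with
    density \<open>\<phi>\<close>. Partial integration of its product with \<open>\<zeta>\<close>
    therefore undoes the one in the definition of \<open>wiener\<close>.\<close>
  have G: "ac t (\<lambda>s. expectation (\<lambda>\<omega>. Y \<omega> * Zc k s \<omega>)) \<phi>"
    unfolding ac_def 0 using \<phi> eq by simp
  have Fz: "ac t \<zeta> \<zeta>'"
    using sub by (intro ac_C1 has_field_derivative_subset[OF \<zeta>] continuous_on_subset[OF \<zeta>']) auto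
  have t': "t \<in> {0..t}" using t by simp
  note lZ = Zc_l2[OF t, of k] and ld = drift_l2(1)[OF \<zeta>'Z_l2 t]
  have D: "expectation (\<lambda>\<omega>. drift (\<lambda>s \<omega>. \<zeta>' s * Zc k s \<omega>) t \<omega> * Y \<omega>)
      = (LINT s:{0..t}|lborel. \<zeta>' s * expectation (\<lambda>\<omega>. Y \<omega> * Zc k s \<omega>))"
  proof -
    have "expectation (\<lambda>\<omega>. \<zeta>' s * Zc k s \<omega> * Y \<omega>) = \<zeta>' s * expectation (\<lambda>\<omega>. Y \<omega> * Zc k s \<omega>)" for s
      unfolding integral_mult_right_zero[symmetric] by (simp only: mult_ac)
    then show ?thesis unfolding expectation_drift_mult(2)[OF \<zeta>'Z_l2 t Y] by (simp only:)
  qed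
  have P: "\<zeta> t * expectation (\<lambda>\<omega>. Y \<omega> * Zc k t \<omega>) =
     (LINT s:{0..t}|lborel. \<zeta>' s * expectation (\<lambda>\<omega>. Y \<omega> * Zc k s \<omega>)) + (LINT s:{0..t}|lborel. \<zeta> s * \<phi> s)"
  proof -
    have i1: "set_integrable lborel {0..t} (\<lambda>s. \<zeta>' s * expectation (\<lambda>\<omega>. Y \<omega> * Zc k s \<omega>))"
    proof (rule borel_integrable_atLeastAtMost')
      show "continuous_on {0..t} (\<lambda>s. \<zeta>' s * expectation (\<lambda>\<omega>. Y \<omega> * Zc k s \<omega>))"
      proof -
        have "\<phi> integrable_on {0..t}" by (rule set_borel_integral_eq_integral(1)[OF \<phi>])
        then have "continuous_on {0..t} (\<lambda>s. integral {0..s} \<phi>)" by (rule indefinite_integral_continuous_1)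
        moreover have "integral {0..s} \<phi> = expectation (\<lambda>\<omega>. Y \<omega> * Zc k s \<omega>)" if "s \<in> {0..t}" for s
          using set_borel_integral_eq_integral(2)[OF set_integrable_subset[OF \<phi>, of "{0..s}"]] that eq[OF that] by simp
        ultimately have "continuous_on {0..t} (\<lambda>s. expectation (\<lambda>\<omega>. Y \<omega> * Zc k s \<omega>))"
          by (rule continuous_on_eq)
        then show ?thesis by (intro continuous_on_mult continuous_on_subset[OF \<zeta>' sub])
      qed
    qed
    have "set_integrable lborel {0..t} (\<lambda>s. (\<zeta>' s * expectation (\<lambda>\<omega>. Y \<omega> * Zc k s \<omega>) + \<zeta> s * \<phi> s) - \<zeta>' s * expectation (\<lambda>\<omega>. Y \<omega> * Zc k s \<omega>))"
      by (rule set_integral_diff(1)[OF ac_int[OF ac_mult[OF Fz G]] i1])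
    then have i2: "set_integrable lborel {0..t} (\<lambda>s. \<zeta> s * \<phi> s)" by simp
    show ?thesis using acD[OF ac_mult[OF Fz G] t'] unfolding 0 set_integral_add(2)[OF i1 i2] by simp
  qed
  have "expectation (\<lambda>\<omega>. Y \<omega> * wiener t \<omega>) = expectation (\<lambda>\<omega>. \<zeta> t * (Y \<omega> * Zc k t \<omega>) - drift (\<lambda>s \<omega>. \<zeta>' s * Zc k s \<omega>) t \<omega> * Y \<omega>)"
    by (intro Bochner_Integration.integral_cong) (auto simp: drift_\<zeta>' algebra_simps)
  also have "\<dots> = \<zeta> t * expectation (\<lambda>\<omega>. Y \<omega> * Zc k t \<omega>) - expectation (\<lambda>\<omega>. drift (\<lambda>s \<omega>. \<zeta>' s * Zc k s \<omega>) t \<omega> * Y \<omega>)"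
    using l2_integrable_mult[OF Y lZ] l2_integrable_mult[OF ld Y] by simp
  finally show ?thesis unfolding D P by simp
qed

lemma Zc_covariance:
  assumes s: "s \<in> {0..T}" and r: "r \<in> {0..T}"
  shows "expectation (\<lambda>\<omega>. Zc k s \<omega> * Zc k r \<omega>) = min s r"
proof -
  have le: "expectation (\<lambda>\<omega>. Zc k t \<omega> * Zc k r \<omega>) = r" if rt: "0 \<le> r" "r \<le> t" "t \<le> T" for r t
  proof -
    have t: "t \<in> {0..T}" and r: "r \<in> {0..T}" using rt by auto
    let ?U = "simple_integral (Z k) 1 unit_grid (\<lambda>_ _. 1) t"
    have "expectation (\<lambda>\<omega>. Zc k t \<omega> * Zc k r \<omega>) = expectation (\<lambda>\<omega>. ?U \<omega> * Zc k r \<omega>)"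
    proof (rule integral_cong_AE)
      show "AE \<omega> in M. Zc k t \<omega> * Zc k r \<omega> = ?U \<omega> * Zc k r \<omega>"
        using unit_integral[OF t, of k] by eventually_elim simp
    qed (intro borel_measurable_times Zc_l2[OF t, THEN l2_measurable] Zc_l2[OF r, THEN l2_measurable] simple_integral_l2[OF unit_integrand t, THEN l2_measurable])+
    also have "\<dots> = (LINT s:{0..r}|lborel. expectation (simple_process 1 unit_grid (\<lambda>_ _. 1) s))"
      by (rule simple_integral_times_Zc[OF unit_integrand rt])
    also have "\<dots> = (LINT s:{0<..r}|lborel. 1)"
      unfolding set_lebesgue_integral_def unit_process using rt
      by (intro Bochner_Integration.integral_cong) (auto simp: indicator_def prob_space)
    also have "\<dots> = r" using rt by (simp add: set_lebesgue_integral_def)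
    finally show ?thesis .
  qed
  show ?thesis
  proof (cases "r \<le> s")
    case True
    then show ?thesis using le[of r s] s r by (simp add: min_def)
  next
    case False
    then have "expectation (\<lambda>\<omega>. Zc k r \<omega> * Zc k s \<omega>) = s" using le[of s r] s r by simp
    then show ?thesis using False by (simp add: mult.commute)
  qed
qed

text \<open>Pair with \<open>Y = Zc k s\<close>: as a function of the other time, the covariance of
  the motion has the indicator of \<open>{0..s}\<close> as its density.\<close>

lemma wiener_Zc:
  assumes t: "t \<in> {0..T}" and s: "s \<in> {0..t}"
  shows "expectation (\<lambda>\<omega>. wiener t \<omega> * Zc k s \<omega>) = (LINT r:{0..s}|lborel. \<zeta> r)"
proof -
  have sT: "s \<in> {0..T}" using s t by auto
  have "expectation (\<lambda>\<omega>. Zc k s \<omega> * wiener t \<omega>) = (LINT r:{0..t}|lborel. \<zeta> r * indicator {0..s} r)"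
  proof (rule wiener_pairing[OF t Zc_l2[OF sT]])
    show "set_integrable lborel {0..t} (indicator {0..s} :: real \<Rightarrow> real)"
    proof -
      have eq: "(\<lambda>x. indicator {0..t} x *\<^sub>R indicator {0..s} x) = (indicator {0..s} :: real \<Rightarrow> real)"
        using s by (auto simp: fun_eq_iff indicator_def)
      show ?thesis unfolding set_integrable_def eq
        by (rule integrable_real_indicator) (simp_all add: emeasure_lborel_Icc_eq)
    qed
    fix r assume r: "r \<in> {0..t}"
    then have "r \<in> {0..T}" using t by auto
    then have "expectation (\<lambda>\<omega>. Zc k s \<omega> * Zc k r \<omega>) = min s r" by (rule Zc_covariance[OF sT])
    also have "\<dots> = (\<integral>x. indicator {0..min s r} x \<partial>lborel)" using r s by simp
    also have "\<dots> = (LINT x:{0..r}|lborel. indicator {0..s} x)"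
      unfolding set_lebesgue_integral_def by (intro Bochner_Integration.integral_cong) (auto simp: indicator_def)
    finally show "expectation (\<lambda>\<omega>. Zc k s \<omega> * Zc k r \<omega>) = (LINT x:{0..r}|lborel. indicator {0..s} x)" .
  qed
  also have "\<dots> = (LINT r:{0..s}|lborel. \<zeta> r)"
    unfolding set_lebesgue_integral_def using s by (intro Bochner_Integration.integral_cong) (auto simp: indicator_def)
  finally show ?thesis by (simp add: mult.commute)
qed

lemma \<zeta>_integrable: "t \<in> {0..T} \<Longrightarrow> set_integrable lborel {0..t} \<zeta>"
  by (intro borel_integrable_atLeastAtMost' continuous_on_subset[OF \<zeta>_continuous]) auto

text \<open>\<open>wiener_pairing\<close> with the integral itself in the role of \<open>Y\<close>:
  by \<open>wiener_Zc\<close> its covariance with the path has density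
  \<open>\<zeta>\<close>.\<close>

lemma wiener_variance:
  assumes t: "t \<in> {0..T}"
  shows "expectation (\<lambda>\<omega>. wiener t \<omega> * wiener t \<omega>) = (LINT r:{0..t}|lborel. \<zeta> r * \<zeta> r)"
  by (rule wiener_pairing[OF t wiener_l2[OF t] \<zeta>_integrable[OF t] wiener_Zc[OF t]])

text \<open>The coefficients are deterministic, so the step function does not depend on the sample
  point and \<open>undefined\<close> stands for an arbitrary one. Expanding the square leaves three
  second moments, the mixed one being another instance of \<open>wiener_pairing\<close>.\<close>

lemma wiener_distance:
  assumes s: "simple_integrand F T n g (\<lambda>i _. c i)" and t: "t \<in> {0..T}"
  shows "expectation (\<lambda>\<omega>. (simple_integral (Z k) n g (\<lambda>i _. c i) t \<omega> - wiener t \<omega>)\<^sup>2)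
    = (LINT r:{0..t}|lborel. (simple_process n g (\<lambda>i _. c i) r (undefined :: 'a) - \<zeta> r)\<^sup>2)"
proof -
  let ?S = "simple_integral (Z k) n g (\<lambda>i _. c i) t"
  define H where "H r = simple_process n g (\<lambda>i _. c i) r (undefined :: 'a)" for r
  have H: "simple_process n g (\<lambda>i _. c i) r \<omega> = H r" for r and \<omega> :: 'a by (simp add: H_def simple_process_def)
  note lS = simple_integral_l2[OF s t, of k] and lN = wiener_l2[OF t]
  have sub: "set_integrable lborel {0..t} h" if "set_integrable lborel {0..T} h" for h :: "real \<Rightarrow> real"
    by (rule set_integrable_subset[OF that]) (use t in auto)
  have Hl: "l2 PT (\<lambda>x. H (fst x))" using simple_process_l2[OF s] unfolding H .
  have HL: "set_integrable lborel {0..T} H"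
    using Fubini_PT(2)[OF l2_integrable[OF finite_measure_PT Hl]] by (simp add: prob_space)
  have HHi: "integrable PT (\<lambda>x. H (fst x) * H (fst x))" by (rule l2_integrable_mult[OF Hl Hl])
  have Hzi: "integrable PT (\<lambda>x. \<zeta> (fst x) * H (fst x))"
    by (rule coef_integrable(1)[OF \<zeta>_continuous l2_integrable[OF finite_measure_PT Hl]])
  have HH: "set_integrable lborel {0..t} (\<lambda>r. H r * H r)"
    using sub[OF Fubini_PT(2)[OF HHi]] by (simp add: prob_space)
  have zH: "set_integrable lborel {0..t} (\<lambda>r. \<zeta> r * H r)"
    using sub[OF Fubini_PT(2)[OF Hzi]] by (simp add: prob_space)
  have zz: "set_integrable lborel {0..t} (\<lambda>r. \<zeta> r * \<zeta> r)"
    using t by (intro borel_integrable_atLeastAtMost' continuous_on_mult continuous_on_subset[OF \<zeta>_continuous]) auto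
  have e1: "expectation (\<lambda>\<omega>. ?S \<omega> * ?S \<omega>) = (LINT r:{0..t}|lborel. H r * H r)"
    using simple_isometry[OF s s t, of k k] Fubini_PT(6)[OF HHi t] unfolding H by (simp add: prob_space mult.assoc)
  have e2: "expectation (\<lambda>\<omega>. ?S \<omega> * wiener t \<omega>) = (LINT r:{0..t}|lborel. \<zeta> r * H r)"
  proof (rule wiener_pairing[OF t lS sub[OF HL]])
    fix r assume "r \<in> {0..t}"
    then have rt: "0 \<le> r" "r \<le> t" "t \<le> T" using t by auto
    have "(simple_process n g (\<lambda>i _. c i) q :: 'a \<Rightarrow> real) = (\<lambda>\<omega>. H q)" for q by (rule ext) (rule H)
    then have "expectation (simple_process n g (\<lambda>i _. c i) q) = H q" for q by (simp add: prob_space)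
    then show "expectation (\<lambda>\<omega>. ?S \<omega> * Zc k r \<omega>) = (LINT r:{0..r}|lborel. H r)"
      using simple_integral_times_Zc[OF s rt, of k] by (simp only:)
  qed
  have "expectation (\<lambda>\<omega>. (?S \<omega> - wiener t \<omega>)\<^sup>2) = expectation (\<lambda>\<omega>. ?S \<omega> * ?S \<omega> - 2 * (?S \<omega> * wiener t \<omega>) + wiener t \<omega> * wiener t \<omega>)"
    by (intro Bochner_Integration.integral_cong) (auto simp: power2_eq_square algebra_simps)
  also have "\<dots> = (LINT r:{0..t}|lborel. H r * H r) - 2 * (LINT r:{0..t}|lborel. \<zeta> r * H r) + (LINT r:{0..t}|lborel. \<zeta> r * \<zeta> r)"
    using l2_integrable_mult[OF lS lS] l2_integrable_mult[OF lS lN] l2_integrable_mult[OF lN lN] by (simp add: e1 e2 wiener_variance[OF t])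
  also have "\<dots> = (LINT r:{0..t}|lborel. H r * H r - 2 * (\<zeta> r * H r) + \<zeta> r * \<zeta> r)"
  proof -
    note z2 = set_integrable_mult_right[OF zH, of 2]
    show ?thesis
      unfolding set_integral_add(2)[OF set_integral_diff(1)[OF HH z2] zz] set_integral_diff(2)[OF HH z2] set_integral_mult_right ..
  qed
  also have "\<dots> = (LINT r:{0..t}|lborel. (H r - \<zeta> r)\<^sup>2)"
    by (intro set_lebesgue_integral_cong) (auto simp: power2_eq_square algebra_simps)
  finally show ?thesis unfolding H .
qed

lemma wiener_adapted:
  assumes t: "t \<in> {0..T}" shows "wiener t \<in> borel_measurable (F t)"
proof -
  have "drift (\<lambda>s \<omega>. \<zeta>' s * Zc k s \<omega>) t \<in> borel_measurable (F t)"
  proof (rule drift_adapted[OF _ _ t])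
    show "(\<lambda>\<omega>. \<zeta>' s * Zc k s \<omega>) \<in> borel_measurable (F s)" if "s \<in> {0..T}" for s
      using Zc_measurable_F[of s s k] that by simp
    show "continuous_on {0..T} (\<lambda>s. \<zeta>' s * Zc k s \<omega>)" if "\<omega> \<in> space M" for \<omega>
      by (intro continuous_on_mult \<zeta>' Zc_continuous that)
  qed
  then show ?thesis
    unfolding drift_\<zeta>'[abs_def] using Zc_measurable_F[of t t k] t
    by (intro borel_measurable_diff borel_measurable_times) auto
qed

lemma wiener_continuous:
  assumes "\<omega> \<in> space M" shows "continuous_on {0..T} (\<lambda>t. wiener t \<omega>)"
proof -
  have c: "continuous_on {0..T} (\<lambda>s. \<zeta>' s * Zc k s \<omega>)"
    by (intro continuous_on_mult \<zeta>' Zc_continuous[OF assms])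
  have i: "set_integrable lborel {0..t} (\<lambda>s. \<zeta>' s * Zc k s \<omega>)" if "t \<in> {0..T}" for t
    using that by (intro borel_integrable_atLeastAtMost' continuous_on_subset[OF c]) auto
  have "continuous_on {0..T} (\<lambda>t. \<zeta> t * Zc k t \<omega> - integral {0..t} (\<lambda>s. \<zeta>' s * Zc k s \<omega>))"
    by (intro continuous_on_diff continuous_on_mult \<zeta>_continuous Zc_continuous[OF assms] indefinite_integral_continuous_1
      integrable_continuous_real c)
  then show ?thesis
    by (rule continuous_on_eq) (simp add: wiener_def set_borel_integral_eq_integral(2)[OF i])
qed

section \<open>Step approximation of a deterministic integrand\<close>

lemma \<zeta>_Lipschitz: "\<exists>C\<ge>0. \<forall>s\<in>{0..T}. \<forall>t\<in>{0..T}. \<bar>\<zeta> s - \<zeta> t\<bar> \<le> C * \<bar>s - t\<bar>"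
proof -
  have "bounded (\<zeta>' ` {0..T})" using \<zeta>' by (intro compact_imp_bounded compact_continuous_image) auto
  then obtain C where C: "\<And>t. t \<in> {0..T} \<Longrightarrow> norm (\<zeta>' t) \<le> C" unfolding bounded_iff by blast
  have "norm (\<zeta> s - \<zeta> t) \<le> C * norm (s - t)" if "s \<in> {0..T}" "t \<in> {0..T}" for s t
    by (rule field_differentiable_bound[OF convex_real_interval(5) \<zeta> C that])
  moreover have "0 \<le> C" using C[of 0] T_pos norm_ge_zero[of "\<zeta>' 0"] by (auto intro: order_trans)
  ultimately show ?thesis by auto
qed

definition grid :: "nat \<Rightarrow> nat \<Rightarrow> real" where "grid N i = T * real i / real (Suc N)"

lemma grid_simple: "simple_integrand F T (Suc N) (grid N) (\<lambda>i _. \<zeta> (grid N i))"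
  using T_pos unfolding simple_integrand_def
  by (auto simp: grid_def divide_le_cancel intro!: divide_right_mono mult_left_mono)

lemma grid_process_error:
  assumes C: "0 \<le> C" "\<And>s t. s \<in> {0..T} \<Longrightarrow> t \<in> {0..T} \<Longrightarrow> \<bar>\<zeta> s - \<zeta> t\<bar> \<le> C * \<bar>s - t\<bar>" and t: "0 < t" "t \<le> T"
  shows "\<bar>simple_process (Suc N) (grid N) (\<lambda>i _. \<zeta> (grid N i)) t \<omega> - \<zeta> t\<bar> \<le> C * (T / real (Suc N))"
proof -
  \<comment> \<open>The grid intervals are left-open and right-closed, hence the ceiling minus one;
    \<open>0 < t\<close> keeps this nonnegative.\<close>
  define i where "i = nat (\<lceil>t * real (Suc N) / T\<rceil> - 1)"
  let ?q = "t * real (Suc N) / T"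
  have q: "0 < ?q" "?q \<le> real (Suc N)" using t T_pos by (auto simp: divide_le_eq)
  have c: "1 \<le> \<lceil>?q\<rceil>" "\<lceil>?q\<rceil> \<le> int (Suc N)" using q by (auto simp: ceiling_le_iff)
  have ri: "real i = real_of_int \<lceil>?q\<rceil> - 1" using c by (simp add: i_def)
  have i: "i < Suc N" using c unfolding i_def by auto
  have qi: "real i < ?q" "?q \<le> real (Suc i)" unfolding of_nat_Suc ri by linarith+
  have gi: "grid N i < t" "t \<le> grid N (Suc i)"
    using qi T_pos unfolding grid_def by (simp_all add: field_simps)
  have mono: "a \<le> b \<Longrightarrow> grid N a \<le> grid N b" for a b
    using T_pos unfolding grid_def by (intro divide_right_mono mult_left_mono) auto
  have "simple_process (Suc N) (grid N) (\<lambda>i _. \<zeta> (grid N i)) t \<omega>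
    = (\<Sum>j<Suc N. if j = i then \<zeta> (grid N i) else 0)"
    unfolding simple_process_def
  proof (rule sum.cong[OF refl])
    fix j
    have "t \<in> {grid N j<..grid N (Suc j)} \<longleftrightarrow> j = i"
    proof
      assume tj: "t \<in> {grid N j<..grid N (Suc j)}"
      show "j = i"
      proof (rule ccontr)
        assume "j \<noteq> i"
        then have "Suc j \<le> i \<or> Suc i \<le> j" by auto
        then show False using mono[of "Suc j" i] mono[of "Suc i" j] gi tj by auto
      qed
    qed (use gi in auto)
    then show "\<zeta> (grid N j) * indicator {grid N j<..grid N (Suc j)} t = (if j = i then \<zeta> (grid N i) else 0)"
      by (auto simp: indicator_def)
  qed
  also have "\<dots> = \<zeta> (grid N i)" using i by simp
  finally have eq: "simple_process (Suc N) (grid N) (\<lambda>i _. \<zeta> (grid N i)) t \<omega> = \<zeta> (grid N i)" .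
  have g0: "0 \<le> grid N i" using T_pos by (simp add: grid_def)
  have "grid N (Suc i) - grid N i = T / real (Suc N)"
    unfolding grid_def of_nat_Suc[of i] distrib_left add_divide_distrib by simp
  then have d: "\<bar>grid N i - t\<bar> \<le> T / real (Suc N)" using gi by linarith
  have "\<bar>\<zeta> (grid N i) - \<zeta> t\<bar> \<le> C * \<bar>grid N i - t\<bar>"
    using g0 gi t by (intro C(2)) auto
  also have "\<dots> \<le> C * (T / real (Suc N))" by (rule mult_left_mono[OF d C(1)])
  finally show ?thesis unfolding eq .
qed

text \<open>Both limits in \<open>ito_integral\<close> reduce to the distance in time between
  \<open>\<zeta>\<close> and its step functions, for the integrals by
  \<open>wiener_distance\<close>. The Lipschitz bound makes this distance uniformly small.\<close>

theorem wiener_ito: "ito_integral M F T (Z k) (\<lambda>t \<omega>. \<zeta> t) wiener"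
proof -
  obtain C where C: "0 \<le> C" "\<And>s t. s \<in> {0..T} \<Longrightarrow> t \<in> {0..T} \<Longrightarrow> \<bar>\<zeta> s - \<zeta> t\<bar> \<le> C * \<bar>s - t\<bar>"
    using \<zeta>_Lipschitz by blast
  let ?H = "\<lambda>N t \<omega>. simple_process (Suc N) (grid N) (\<lambda>i _. \<zeta> (grid N i)) t \<omega>"
  define \<epsilon> where "\<epsilon> N = (C * (T / real (Suc N)))\<^sup>2" for N
  have sq: "(?H N t \<omega> - \<zeta> t)\<^sup>2 \<le> \<epsilon> N" if "0 < t" "t \<le> T" for N t \<omega>
    using power_mono[OF grid_process_error[OF C that, of N \<omega>], of 2] by (simp add: \<epsilon>_def)
  have e0: "0 \<le> \<epsilon> N" for N by (simp add: \<epsilon>_def)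
  have lim: "(\<lambda>N. ennreal (\<epsilon> N * T)) \<longlonglongrightarrow> 0"
  proof -
    have "(\<lambda>N. C * (T * inverse (real (Suc N)))) \<longlonglongrightarrow> C * (T * 0)"
      by (intro tendsto_mult tendsto_const LIMSEQ_inverse_real_of_nat)
    then have "(\<lambda>N. (C * (T / real (Suc N)))\<^sup>2 * T) \<longlonglongrightarrow> 0\<^sup>2 * T"
      by (intro tendsto_mult tendsto_power tendsto_const) (simp add: divide_inverse)
    then have "(\<lambda>N. ennreal (\<epsilon> N * T)) \<longlonglongrightarrow> ennreal 0"
      unfolding \<epsilon>_def by (intro tendsto_ennrealI) simp
    then show ?thesis by simp
  qed
  have nn: "(\<integral>\<^sup>+t\<in>{0..T}. ennreal ((?H N t \<omega> - \<zeta> t)\<^sup>2) \<partial>lborel) \<le> ennreal (\<epsilon> N * T)" for N and \<omega> :: 'a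
  proof -
    have "(\<integral>\<^sup>+t\<in>{0..T}. ennreal ((?H N t \<omega> - \<zeta> t)\<^sup>2) \<partial>lborel) \<le> (\<integral>\<^sup>+t. ennreal (\<epsilon> N) * indicator {0..T} t \<partial>lborel)"
    proof (rule nn_integral_mono_AE)
      \<comment> \<open>Time 0 lies in no grid interval, so the error bound fails to cover this one
        point.\<close>
      show "AE t in lborel. ennreal ((?H N t \<omega> - \<zeta> t)\<^sup>2) * indicator {0..T} t \<le> ennreal (\<epsilon> N) * indicator {0..T} t"
        using AE_lborel_singleton[of 0]
      proof eventually_elim
        case (elim t)
        then show ?case using sq[of t N \<omega>] by (cases "t \<in> {0..T}") (auto intro!: ennreal_leI)
      qed
    qed
    also have "\<dots> = ennreal (\<epsilon> N) * emeasure lborel {0..T}" by (rule nn_integral_cmult_indicator) simp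
    also have "\<dots> = ennreal (\<epsilon> N * T)" using T_pos e0[of N] by (simp add: ennreal_mult)
    finally show ?thesis .
  qed
  show ?thesis
    unfolding ito_integral_def
  proof (intro conjI ballI exI allI)
    show "wiener t \<in> borel_measurable (F t)" if "t \<in> {0..T}" for t by (rule wiener_adapted[OF that])
    show "AE \<omega> in M. continuous_on {0..T} (\<lambda>t. wiener t \<omega>)" by (intro AE_I2 wiener_continuous)
    show "simple_integrand F T (Suc N) (grid N) (\<lambda>i _. \<zeta> (grid N i))" for N by (rule grid_simple)
    show "(\<lambda>N. \<integral>\<^sup>+\<omega>. (\<integral>\<^sup>+t\<in>{0..T}. ennreal ((?H N t \<omega> - \<zeta> t)\<^sup>2) \<partial>lborel) \<partial>M) \<longlonglongrightarrow> 0"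
    proof (rule tendsto_sandwich[OF _ _ tendsto_const lim]; intro always_eventually allI)
      fix N
      have "(\<integral>\<^sup>+\<omega>. (\<integral>\<^sup>+t\<in>{0..T}. ennreal ((?H N t \<omega> - \<zeta> t)\<^sup>2) \<partial>lborel) \<partial>M) \<le> (\<integral>\<^sup>+\<omega>. ennreal (\<epsilon> N * T) \<partial>M)"
        by (intro nn_integral_mono nn)
      then show "(\<integral>\<^sup>+\<omega>. (\<integral>\<^sup>+t\<in>{0..T}. ennreal ((?H N t \<omega> - \<zeta> t)\<^sup>2) \<partial>lborel) \<partial>M) \<le> ennreal (\<epsilon> N * T)"
        by (simp add: emeasure_space_1)
    qed simp
    fix t assume t: "t \<in> {0..T}"
    show "(\<lambda>N. \<integral>\<^sup>+\<omega>. ennreal ((simple_integral (Z k) (Suc N) (grid N) (\<lambda>i _. \<zeta> (grid N i)) t \<omega> - wiener t \<omega>)\<^sup>2) \<partial>M) \<longlonglongrightarrow> 0"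
    proof (rule tendsto_sandwich[OF _ _ tendsto_const lim]; intro always_eventually allI)
      fix N
      let ?h = "\<lambda>r. (?H N r (undefined :: 'a) - \<zeta> r)\<^sup>2"
      have "(\<integral>\<^sup>+\<omega>. ennreal ((simple_integral (Z k) (Suc N) (grid N) (\<lambda>i _. \<zeta> (grid N i)) t \<omega> - wiener t \<omega>)\<^sup>2) \<partial>M)
        = ennreal (LINT r:{0..t}|lborel. ?h r)"
        unfolding l2_nn_eq[OF l2_diff[OF simple_integral_l2[OF grid_simple t] wiener_l2[OF t]]] wiener_distance[OF grid_simple t] ..
      \<comment> \<open>This holds without integrability, since the Bochner integral of a
        non-integrable function is 0.\<close>
      also have "\<dots> \<le> (\<integral>\<^sup>+r. ennreal (indicator {0..t} r *\<^sub>R ?h r) \<partial>lborel)"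
        unfolding set_lebesgue_integral_def
        by (cases "integrable lborel (\<lambda>r. indicator {0..t} r *\<^sub>R ?h r)")
          (simp_all add: nn_integral_eq_integral not_integrable_integral_eq)
      also have "\<dots> \<le> (\<integral>\<^sup>+r\<in>{0..T}. ennreal (?h r) \<partial>lborel)"
        using t by (intro nn_integral_mono) (auto simp: indicator_def)
      also have "\<dots> \<le> ennreal (\<epsilon> N * T)" by (rule nn)
      finally show "(\<integral>\<^sup>+\<omega>. ennreal ((simple_integral (Z k) (Suc N) (grid N) (\<lambda>i _. \<zeta> (grid N i)) t \<omega> - wiener t \<omega>)\<^sup>2) \<partial>M)
          \<le> ennreal (\<epsilon> N * T)" .
    qed simp
  qed
qed

end

section \<open>Linear stochastic differential equations\<close>

text \<open>Solve the integral equation with \<open>n\<close> as forcing term. Its right-hand side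
  is differentiable because the solution, and with it the integrand, is continuous.\<close>

lemma linear_ode_exists:
  fixes n :: "real \<Rightarrow> 'b::banach"
  assumes T: "0 \<le> T"
    and lin: "\<And>t x y. t \<in> {0..T} \<Longrightarrow> L t (x + y) = L t x + L t y"
    and bd: "\<And>t x. t \<in> {0..T} \<Longrightarrow> norm (L t x) \<le> C * norm x"
    and cont: "\<And>x. continuous_on {0..T} x \<Longrightarrow> continuous_on {0..T} (\<lambda>t. L t (x t))"
    and n: "\<And>t. t \<in> {0..T} \<Longrightarrow> (n has_vector_derivative b t) (at t within {0..T})"
  obtains x where "x 0 = n 0"
    "\<And>t. t \<in> {0..T} \<Longrightarrow> (x has_vector_derivative (b t + L t (x t))) (at t within {0..T})"
proof -
  have nc: "continuous_on {0..T} n"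
    using n has_vector_derivative_continuous by (fastforce simp: continuous_on_eq_continuous_within)
  obtain x where x: "continuous_on {0..T} x" "\<And>t. t \<in> {0..T} \<Longrightarrow> x t = n t + integral {0..t} (\<lambda>s. L s (x s))"
    using linear_volterra_exists[where L = L, OF T lin bd cont nc] by blast
  show thesis
  proof (rule that)
    show "x 0 = n 0" using x(2)[of 0] T by simp
    fix t assume t: "t \<in> {0..T}"
    have "((\<lambda>t. n t + integral {0..t} (\<lambda>s. L s (x s))) has_vector_derivative (b t + L t (x t))) (at t within {0..T})"
      by (intro has_vector_derivative_add n[OF t] integral_has_vector_derivative cont[OF x(1)] t)
    then show "(x has_vector_derivative (b t + L t (x t))) (at t within {0..T})"
      by (rule has_vector_derivative_transform[OF t x(2), rotated])
  qed
qed

section \<open>Matrix equations and fundamental matrices\<close>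

lemma bounded_bilinear_matrix_mult: "bounded_bilinear ((**) :: real^2^2 \<Rightarrow> real^2^2 \<Rightarrow> real^2^2)"
  unfolding bilinear_conv_bounded_bilinear[symmetric] bilinear_def linear_iff
  by (auto simp: vec_eq_iff matrix_matrix_mult_def sum_2 algebra_simps)

lemma bounded_bilinear_matrix_vector: "bounded_bilinear ((*v) :: real^2^2 \<Rightarrow> real^2 \<Rightarrow> real^2)"
  unfolding bilinear_conv_bounded_bilinear[symmetric] bilinear_def linear_iff
  by (auto simp: vec_eq_iff matrix_vector_mult_def sum_2 algebra_simps)

lemma bounded_bilinear_coefficient:
  fixes A :: "real \<Rightarrow> 'a::real_normed_vector"
  assumes h: "bounded_bilinear h" and A: "continuous_on {0..T} A"
  shows "\<exists>C. \<forall>t\<in>{0..T}. \<forall>x. norm (h (A t) x) \<le> C * norm x"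
proof -
  obtain K where K: "\<And>a b. norm (h a b) \<le> norm a * norm b * K" "0 \<le> K"
    using bounded_bilinear.nonneg_bounded[OF h] by blast
  have "bounded (A ` {0..T})" using A by (intro compact_imp_bounded compact_continuous_image) auto
  then obtain D where D: "\<And>t. t \<in> {0..T} \<Longrightarrow> norm (A t) \<le> D" unfolding bounded_iff by blast
  show ?thesis
  proof (intro exI ballI allI)
    fix t x assume t: "t \<in> {0..T}"
    have "norm (h (A t) x) \<le> norm (A t) * norm x * K" by (rule K(1))
    also have "\<dots> \<le> D * norm x * K" by (intro mult_right_mono D t K(2) norm_ge_zero)
    finally show "norm (h (A t) x) \<le> D * K * norm x" by (simp add: mult_ac)
  qed
qed

text \<open>Along with \<open>\<Phi>' = A \<Phi>\<close> solve \<open>\<Psi>' = - \<Psi> A\<close>,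
  both starting from the identity. The product \<open>\<Psi> \<Phi>\<close> has derivative zero,
  hence stays the identity, and for square matrices a left inverse is a right inverse. The letters
  denote new functions here, not the coefficients of the game.\<close>

lemma fundamental_matrices:
  fixes A :: "real \<Rightarrow> real^2^2"
  assumes T: "0 \<le> T" and A: "continuous_on {0..T} A"
  obtains \<Phi> \<Psi> :: "real \<Rightarrow> real^2^2" where
    "\<And>t. t \<in> {0..T} \<Longrightarrow> (\<Phi> has_vector_derivative A t ** \<Phi> t) (at t within {0..T})"
    "continuous_on {0..T} \<Psi>"
    "\<And>t. t \<in> {0..T} \<Longrightarrow> \<Phi> t ** \<Psi> t = mat 1"
proof -
  note mm = bounded_bilinear_matrix_mult
  obtain C where C: "\<And>t X. t \<in> {0..T} \<Longrightarrow> norm (A t ** (X :: real^2^2)) \<le> C * norm X"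
    using bounded_bilinear_coefficient[OF mm A] by blast
  obtain C' where C': "\<And>t X. t \<in> {0..T} \<Longrightarrow> norm ((X :: real^2^2) ** A t) \<le> C' * norm X"
    using bounded_bilinear_coefficient[OF bounded_bilinear.flip[OF mm] A] by blast
  have one: "((\<lambda>t. mat 1 :: real^2^2) has_vector_derivative 0) (at t within {0..T})" for t by simp
  obtain \<Phi> :: "real \<Rightarrow> real^2^2" where \<Phi>: "\<Phi> 0 = mat 1" "\<And>t. t \<in> {0..T} \<Longrightarrow> (\<Phi> has_vector_derivative (0 + A t ** \<Phi> t)) (at t within {0..T})"
  proof (rule linear_ode_exists[where L = "\<lambda>t X. A t ** X", OF T _ C _ one])
    show "continuous_on {0..T} (\<lambda>t. A t ** x t)" if "continuous_on {0..T} x" for x :: "real \<Rightarrow> real^2^2"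
      by (rule bounded_bilinear.continuous_on[OF mm A that])
  qed (auto simp: matrix_add_ldistrib intro: that)
  obtain \<Psi> :: "real \<Rightarrow> real^2^2" where \<Psi>: "\<Psi> 0 = mat 1" "\<And>t. t \<in> {0..T} \<Longrightarrow> (\<Psi> has_vector_derivative (0 + - (\<Psi> t ** A t))) (at t within {0..T})"
  proof (rule linear_ode_exists[where L = "\<lambda>t X. - (X ** A t)" and C = C', OF T _ _ _ one])
    show "continuous_on {0..T} (\<lambda>t. - (x t ** A t))" if "continuous_on {0..T} x" for x :: "real \<Rightarrow> real^2^2"
      by (intro continuous_on_minus bounded_bilinear.continuous_on[OF mm that A])
  qed (auto simp: bounded_bilinear.add_left[OF mm] C' intro: that)
  have neg: "(- X) ** Y = - (X ** Y)" for X Y :: "real^2^2"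
    by (rule bounded_bilinear.minus_left[OF mm])
  have "((\<lambda>t. \<Psi> t ** \<Phi> t) has_derivative (\<lambda>h. 0)) (at t within {0..T})" if "t \<in> {0..T}" for t
  proof -
    have "((\<lambda>t. \<Psi> t ** \<Phi> t) has_vector_derivative (\<Psi> t ** (0 + A t ** \<Phi> t) + (0 + - (\<Psi> t ** A t)) ** \<Phi> t)) (at t within {0..T})"
      by (rule bounded_bilinear.has_vector_derivative[OF mm \<Psi>(2)[OF that] \<Phi>(2)[OF that]])
    then show ?thesis by (simp add: neg matrix_mul_assoc has_vector_derivative_def)
  qed
  then obtain c where c: "\<And>t. t \<in> {0..T} \<Longrightarrow> \<Psi> t ** \<Phi> t = c"
    using has_derivative_zero_constant[OF convex_real_interval(5)[of 0 T], of "\<lambda>t. \<Psi> t ** \<Phi> t"] by blast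
  have "c = mat 1" using c[of 0] T \<Phi>(1) \<Psi>(1) by simp
  show thesis
  proof (rule that)
    show "(\<Phi> has_vector_derivative A t ** \<Phi> t) (at t within {0..T})" if "t \<in> {0..T}" for t
      using \<Phi>(2)[OF that] by simp
    show "continuous_on {0..T} \<Psi>"
      using \<Psi>(2) has_vector_derivative_continuous by (fastforce simp: continuous_on_eq_continuous_within)
    show "\<Phi> t ** \<Psi> t = mat 1" if "t \<in> {0..T}" for t
      using c[OF that] \<open>c = mat 1\<close> matrix_left_right_inverse by metis
  qed
qed

lemma LINT_has_real_derivative:
  fixes f :: "real \<Rightarrow> real"
  assumes f: "continuous_on {0..T} f" and t: "t \<in> {0..T}"
  shows "((\<lambda>t. LINT s:{0..t}|lborel. f s) has_real_derivative f t) (at t within {0..T})"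
proof -
  have "((\<lambda>t. integral {0..t} f) has_vector_derivative f t) (at t within {0..T})"
    by (rule integral_has_vector_derivative[OF f t])
  moreover have "(LINT s:{0..r}|lborel. f s) = integral {0..r} f" if "r \<in> {0..T}" for r
    using that by (intro set_borel_integral_eq_integral(2) borel_integrable_atLeastAtMost' continuous_on_subset[OF f]) auto
  ultimately show ?thesis
    unfolding has_real_derivative_iff_has_vector_derivative
    by (rule has_vector_derivative_transform[OF t, rotated])
qed

context brownian2
begin

text \<open>The mean satisfies a linear equation of its own and is found first. The fluctuation
  \<open>D\<close> has to satisfy \<open>dD = A D dt + dN\<close> with noise \<open>N\<close>.
  Writing \<open>D = Y + N\<close> turns this into the pathwise equation
  \<open>Y' = A Y + A N\<close>, which \<open>Y = \<Phi> G\<close> with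
  \<open>G' = \<Psi> A N\<close> solves. Thus no stochastic integral beyond the noise itself is
  formed.\<close>

lemma linear_states_exist:
  fixes \<zeta> \<zeta>' :: "2 \<Rightarrow> real \<Rightarrow> real" and A A' :: "real \<Rightarrow> real^2^2" and b :: "real \<Rightarrow> real^2" and x0 :: "real^2"
  assumes wi: "\<And>i. wiener_integrand M T W B (\<zeta> i) (\<zeta>' i)"
    and A: "continuous_on {0..T} A" and A': "continuous_on {0..T} A'" and b: "continuous_on {0..T} b"
  obtains X U :: "2 \<Rightarrow> real \<Rightarrow> 'a \<Rightarrow> real" and \<mu> :: "real \<Rightarrow> real^2"
  where "\<And>i. proc (i = 1) (x0 $ i) (U i) (\<lambda>t \<omega>. \<zeta> i t) (X i)"
    "\<And>i t. t \<in> {0..T} \<Longrightarrow> mean M (X i) t = \<mu> t $ i"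
    "\<And>t. t \<in> {0..T} \<Longrightarrow> (\<mu> has_vector_derivative (b t + A' t *v \<mu> t)) (at t within {0..T})"
    "\<And>i t \<omega>. t \<in> {0..T} \<Longrightarrow> \<omega> \<in> space M \<Longrightarrow>
      U i t \<omega> = (b t + A' t *v \<mu> t) $ i + (\<Sum>j\<in>UNIV. A t $ i $ j * (X j t \<omega> - \<mu> t $ j))"
proof -
  have T0: "0 \<le> T" and z: "0 \<in> {0..T}" using T_pos by auto
  obtain \<Phi> \<Psi> :: "real \<Rightarrow> real^2^2" where \<Phi>: "\<And>t. t \<in> {0..T} \<Longrightarrow> (\<Phi> has_vector_derivative A t ** \<Phi> t) (at t within {0..T})"
    and \<Psi>: "continuous_on {0..T} \<Psi>" and inv: "\<And>t. t \<in> {0..T} \<Longrightarrow> \<Phi> t ** \<Psi> t = mat 1"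
    by (rule fundamental_matrices[OF T0 A]) (rule that)
  obtain \<mu> where \<mu>: "\<mu> 0 = x0" "\<And>t. t \<in> {0..T} \<Longrightarrow> (\<mu> has_vector_derivative (b t + A' t *v \<mu> t)) (at t within {0..T})"
  proof -
    obtain C where C: "\<And>t x. t \<in> {0..T} \<Longrightarrow> norm (A' t *v x) \<le> C * norm x"
      using bounded_bilinear_coefficient[OF bounded_bilinear_matrix_vector A'] by blast
    have n: "((\<lambda>t. x0 + integral {0..t} b) has_vector_derivative b t) (at t within {0..T})" if "t \<in> {0..T}" for t
      using has_vector_derivative_add[OF has_vector_derivative_const integral_has_vector_derivative[OF b that]] by simp
    show thesis
    proof (rule linear_ode_exists[where L = "\<lambda>t x. A' t *v x", OF T0 _ C _ n])
      show "continuous_on {0..T} (\<lambda>t. A' t *v x t)" if "continuous_on {0..T} x" for x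
        by (rule bounded_bilinear.continuous_on[OF bounded_bilinear_matrix_vector A' that])
    qed (auto simp: matrix_vector_right_distrib intro: that)
  qed
  define N where "N i = wiener_integrand.wiener M T W B (i = 1) (\<zeta> i) (\<zeta>' i)" for i :: 2
  have Nc: "continuous_on {0..T} (\<lambda>t. N i t \<omega>)" if "\<omega> \<in> space M" for i \<omega>
    unfolding N_def by (rule wiener_integrand.wiener_continuous[OF wi that])
  have Na: "N i t \<in> borel_measurable (F t)" if "t \<in> {0..T}" for i t
    unfolding N_def by (rule wiener_integrand.wiener_adapted[OF wi that])
  have Ni: "ito_integral M F T (Z (i = 1)) (\<lambda>t \<omega>. \<zeta> i t) (N i)" for i
    unfolding N_def by (rule wiener_integrand.wiener_ito[OF wi])
  have \<zeta>l: "l2 PT (\<lambda>x. \<zeta> i (fst x))" for i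
    using coef_l2[OF wiener_integrand.\<zeta>_continuous[OF wi] l2_const[OF finite_measure_PT, of 1]] by simp
  have Np: "proc (i = 1) 0 (\<lambda>t \<omega>. 0) (\<lambda>t \<omega>. \<zeta> i t) (N i)" for i
    unfolding proc_def admissible_iff state_process_def
  proof (intro conjI ballI exI AE_I2)
    show "ito_integral M F T (Z (i = 1)) (\<lambda>t \<omega>. \<zeta> i t) (N i)" by (rule Ni)
  qed (use \<zeta>l Na Nc in \<open>auto simp: l2_def\<close>)
  have Nl: "l2 PT (\<lambda>x. N i (fst x) (snd x))" and Nlt: "t \<in> {0..T} \<Longrightarrow> l2 M (N i t)" for i t
    using proc_l2[OF Np] by auto
  have Nm: "expectation (N i t) = 0" if "t \<in> {0..T}" for i t
    using acD[OF proc_mean(1)[OF Np] that, of i] proc_mean(2)[OF Np, of i] by simp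
  define H where "H t = \<Psi> t ** A t" for t
  have Hc: "continuous_on {0..T} (\<lambda>t. H t $ i $ j)" for i j
    unfolding H_def by (intro continuous_on_component bounded_bilinear.continuous_on[OF bounded_bilinear_matrix_mult \<Psi> A])
  have Ac: "continuous_on {0..T} (\<lambda>t. A t $ i $ j)" for i j by (intro continuous_on_component A)
  define g where "g i t \<omega> = (\<Sum>j\<in>UNIV. H t $ i $ j * N j t \<omega>)" for i t \<omega>
  define G where "G i = drift (g i)" for i
  have gl: "l2 PT (\<lambda>x. g i (fst x) (snd x))" for i
    unfolding g_def by (intro l2_sum coef_l2[OF Hc] Nl)
  have gc: "continuous_on {0..T} (\<lambda>t. g i t \<omega>)" if "\<omega> \<in> space M" for i \<omega>
    unfolding g_def by (intro continuous_on_sum continuous_on_mult Hc Nc that)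
  have ga: "g i t \<in> borel_measurable (F t)" if "t \<in> {0..T}" for i t
    unfolding g_def[abs_def] by (intro borel_measurable_sum borel_measurable_times borel_measurable_const Na that)
  have gm: "expectation (g i t) = 0" if "t \<in> {0..T}" for i t
    unfolding g_def using Nm[OF that] l2_integrable[OF finite_measure_axioms Nlt[OF that]]
    by (subst Bochner_Integration.integral_sum) auto
  have Gl: "l2 PT (\<lambda>x. G i (fst x) (snd x))" and Glt: "t \<in> {0..T} \<Longrightarrow> l2 M (G i t)" for i t
    unfolding G_def using drift_PT_l2[OF gl] drift_l2(1)[OF gl] by auto
  have Ga: "G i t \<in> borel_measurable (F t)" if "t \<in> {0..T}" for i t
    unfolding G_def by (rule drift_adapted[OF ga gc that])
  have Gd: "((\<lambda>t. G i t \<omega>) has_real_derivative g i t \<omega>) (at t within {0..T})" if "t \<in> {0..T}" "\<omega> \<in> space M" for i t \<omega>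
    unfolding G_def drift_def by (rule LINT_has_real_derivative[OF gc[OF that(2)] that(1)])
  have Gm: "expectation (G i t) = 0" if t: "t \<in> {0..T}" for i t
  proof -
    have "expectation (G i t) = (LINT s:{0..t}|lborel. expectation (g i s))"
      unfolding G_def drift_def[abs_def] using Fubini_PT(5)[OF l2_integrable[OF finite_measure_PT gl] t] by simp
    also have "\<dots> = (LINT s:{0..t}|lborel. 0)"
      using t by (intro set_lebesgue_integral_cong) (auto simp: gm)
    finally show ?thesis by simp
  qed
  have \<Phi>d: "((\<lambda>t. \<Phi> t $ i $ j) has_real_derivative (\<Sum>l\<in>UNIV. A t $ i $ l * \<Phi> t $ l $ j)) (at t within {0..T})"
    if "t \<in> {0..T}" for i j t
    using bounded_linear.has_vector_derivative[OF bounded_linear_compose[OF bounded_linear_vec_nth bounded_linear_vec_nth] \<Phi>[OF that], of i j]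
    by (simp add: has_real_derivative_iff_has_vector_derivative matrix_matrix_mult_def)
  have \<Phi>c: "continuous_on {0..T} (\<lambda>t. \<Phi> t $ i $ j)" for i j
    using DERIV_continuous_on[OF \<Phi>d] by blast
  define Y where "Y i t \<omega> = (\<Sum>j\<in>UNIV. \<Phi> t $ i $ j * G j t \<omega>)" for i t \<omega>
  define D where "D i t \<omega> = Y i t \<omega> + N i t \<omega>" for i t \<omega>
  have Yd: "((\<lambda>t. Y i t \<omega>) has_real_derivative (\<Sum>j\<in>UNIV. A t $ i $ j * D j t \<omega>)) (at t within {0..T})"
    if t: "t \<in> {0..T}" and \<omega>: "\<omega> \<in> space M" for i t \<omega>
  proof -
    have "((\<lambda>t. Y i t \<omega>) has_real_derivative (\<Sum>j\<in>UNIV. (\<Sum>l\<in>UNIV. A t $ i $ l * \<Phi> t $ l $ j) * G j t \<omega> + g j t \<omega> * \<Phi> t $ i $ j)) (at t within {0..T})"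
      unfolding Y_def by (intro DERIV_sum DERIV_mult \<Phi>d Gd t \<omega>)
    \<comment> \<open>\<open>\<Phi>\<close> and its inverse in \<open>H\<close> drop out, which
      leaves \<open>A N\<close> as the forcing term.\<close>
    moreover have "(\<Sum>j\<in>UNIV. g j t \<omega> * \<Phi> t $ i $ j) = (\<Sum>l\<in>UNIV. A t $ i $ l * N l t \<omega>)"
    proof -
      have "A t = \<Phi> t ** H t" unfolding H_def matrix_mul_assoc inv[OF t] by simp
      then have "A t $ i $ l = (\<Sum>j\<in>UNIV. \<Phi> t $ i $ j * H t $ j $ l)" for l
        by (simp add: matrix_matrix_mult_def)
      then show ?thesis unfolding g_def by (simp add: sum_2 algebra_simps)
    qed
    ultimately show ?thesis
      by (simp add: D_def Y_def sum.distrib distrib_left) (simp add: sum_2 algebra_simps)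
  qed
  define X where "X i t \<omega> = \<mu> t $ i + D i t \<omega>" for i t \<omega>
  define \<mu>' where "\<mu>' t = b t + A' t *v \<mu> t" for t
  define U where "U i t \<omega> = \<mu>' t $ i + (\<Sum>j\<in>UNIV. A t $ i $ j * D j t \<omega>)" for i t \<omega>
  have \<mu>c: "continuous_on {0..T} \<mu>"
    using \<mu>(2) has_vector_derivative_continuous by (fastforce simp: continuous_on_eq_continuous_within)
  have \<mu>'c: "continuous_on {0..T} (\<lambda>t. \<mu>' t $ i)" for i
    unfolding \<mu>'_def by (intro continuous_on_component continuous_on_add b bounded_bilinear.continuous_on[OF bounded_bilinear_matrix_vector A' \<mu>c])
  have \<mu>d: "((\<lambda>t. \<mu> t $ i) has_real_derivative \<mu>' t $ i) (at t within {0..T})" if "t \<in> {0..T}" for i t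
    using bounded_linear.has_vector_derivative[OF bounded_linear_vec_nth \<mu>(2)[OF that]]
    by (simp add: has_real_derivative_iff_has_vector_derivative \<mu>'_def)
  have Dl: "l2 PT (\<lambda>x. D i (fst x) (snd x))" for i
    unfolding D_def Y_def by (intro l2_add l2_sum coef_l2[OF \<Phi>c] Gl Nl)
  have Da: "D i t \<in> borel_measurable (F t)" if "t \<in> {0..T}" for i t
    unfolding D_def[abs_def] Y_def
    by (intro borel_measurable_add borel_measurable_sum borel_measurable_times borel_measurable_const Ga Na that)
  have Dc: "continuous_on {0..T} (\<lambda>t. D i t \<omega>)" if "\<omega> \<in> space M" for i \<omega>
    unfolding D_def using DERIV_continuous_on[OF Yd[OF _ that]] by (intro continuous_on_add Nc that) blast
  \<comment> \<open>\<open>D\<close> is a combination of centred variables with deterministic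
    coefficients, so \<open>\<mu>\<close> is indeed the mean of the state.\<close>
  have Dm: "expectation (D i t) = 0" if t: "t \<in> {0..T}" for i t
  proof -
    have "integrable M (G j t)" "integrable M (N j t)" for j
      by (rule l2_integrable[OF finite_measure_axioms Glt[OF t]], rule l2_integrable[OF finite_measure_axioms Nlt[OF t]])
    then show ?thesis unfolding D_def[abs_def] Y_def by (simp add: sum_2 Gm[OF t] Nm[OF t])
  qed
  have Dmi: "integrable M (D i t)" if t: "t \<in> {0..T}" for i t
  proof -
    have "l2 M (D i t)" unfolding D_def[abs_def] Y_def by (intro l2_add l2_sum l2_cmult Glt Nlt t)
    then show ?thesis by (rule l2_integrable[OF finite_measure_axioms])
  qed
  have Ul: "l2 PT (\<lambda>x. U i (fst x) (snd x))" for i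
    unfolding U_def using coef_l2[OF \<mu>'c l2_const[OF finite_measure_PT, of 1]]
    by (intro l2_add l2_sum coef_l2[OF Ac] Dl) simp
  have Ua: "U i t \<in> borel_measurable (F t)" if "t \<in> {0..T}" for i t
    unfolding U_def[abs_def] by (intro borel_measurable_add borel_measurable_sum borel_measurable_times borel_measurable_const Da that)
  have state: "X i t \<omega> = x0 $ i + (LINT s:{0..t}|lborel. U i s \<omega>) + N i t \<omega>" if t: "t \<in> {0..T}" and \<omega>: "\<omega> \<in> space M" for i t \<omega>
  proof -
    have "ac T (\<lambda>t. \<mu> t $ i + Y i t \<omega>) (\<lambda>t. U i t \<omega>)"
    proof (rule ac_C1)
      show "((\<lambda>t. \<mu> t $ i + Y i t \<omega>) has_real_derivative U i t \<omega>) (at t within {0..T})" if "t \<in> {0..T}" for t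
        unfolding U_def by (intro DERIV_add \<mu>d Yd that \<omega>)
      show "continuous_on {0..T} (\<lambda>t. U i t \<omega>)"
        unfolding U_def by (intro continuous_on_add \<mu>'c continuous_on_sum continuous_on_mult Ac Dc \<omega>)
    qed
    from acD[OF this t] have "\<mu> t $ i + Y i t \<omega> = \<mu> 0 $ i + Y i 0 \<omega> + (LINT s:{0..t}|lborel. U i s \<omega>)" .
    moreover have "G j 0 \<omega> = 0" for j
      unfolding G_def drift_def by (rule set_integral_singleton)
    ultimately show ?thesis by (simp add: X_def D_def Y_def \<mu>(1))
  qed
  show thesis
  proof (rule that)
    show "proc (i = 1) (x0 $ i) (U i) (\<lambda>t \<omega>. \<zeta> i t) (X i)" for i
      unfolding proc_def admissible_iff state_process_def
    proof (intro conjI ballI exI AE_I2)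
      show "X i t \<in> borel_measurable (F t)" if "t \<in> {0..T}" for t
        unfolding X_def[abs_def] by (intro borel_measurable_add borel_measurable_const Da that)
      show "continuous_on {0..T} (\<lambda>t. X i t \<omega>)" if "\<omega> \<in> space M" for \<omega>
        unfolding X_def by (intro continuous_on_add continuous_on_component \<mu>c Dc that)
      show "ito_integral M F T (Z (i = 1)) (\<lambda>t \<omega>. \<zeta> i t) (N i)" by (rule Ni)
    qed (use \<zeta>l Ul Ua state in auto)
    show m: "mean M (X i) t = \<mu> t $ i" if "t \<in> {0..T}" for i t
      unfolding X_def[abs_def] using Dm[OF that] Dmi[OF that] by (simp add: prob_space)
    show "(\<mu> has_vector_derivative (b t + A' t *v \<mu> t)) (at t within {0..T})" if "t \<in> {0..T}" for t by (rule \<mu>(2)[OF that])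
    show "U i t \<omega> = (b t + A' t *v \<mu> t) $ i + (\<Sum>j\<in>UNIV. A t $ i $ j * (X j t \<omega> - \<mu> t $ j))"
      if "t \<in> {0..T}" "\<omega> \<in> space M" for i t \<omega>
      by (simp add: U_def \<mu>'_def X_def)
  qed
qed

end

section \<open>The equilibrium\<close>

text \<open>Follows from \<open>tanh' = 1 - tanh\<^sup>2\<close>; the rate \<open>a\<close> is the
  one with \<open>k / 2 * a\<^sup>2 = c\<close>.\<close>

lemma riccati_tanh:
  fixes k c T :: real
  assumes k: "0 < k" and c: "0 \<le> c"
  defines "a \<equiv> sqrt (2 * c / k)"
  shows "((\<lambda>t. - (k / 2) * a * tanh (a * (T - t))) has_real_derivative
    (c - 2 / k * (- (k / 2) * a * tanh (a * (T - t)))\<^sup>2)) (at t within S)"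
proof -
  have a2: "a\<^sup>2 = 2 * c / k" using k c by (simp add: a_def)
  have "((\<lambda>t. - (k / 2) * a * tanh (a * (T - t))) has_real_derivative
     (- (k / 2) * a * ((1 - (tanh (a * (T - t)))\<^sup>2) * (a * (0 - 1))))) (at t within S)"
    by (intro DERIV_cmult DERIV_chain2[where f = tanh] DERIV_diff DERIV_const DERIV_ident)
      (auto intro!: derivative_eq_intros)
  moreover have "- (k / 2) * a * ((1 - (tanh (a * (T - t)))\<^sup>2) * (a * (0 - 1)))
      = k / 2 * a\<^sup>2 - k / 2 * a\<^sup>2 * (tanh (a * (T - t)))\<^sup>2"
    by (simp add: power2_eq_square algebra_simps)
  moreover have "k / 2 * a\<^sup>2 = c" using k by (simp add: a2)
  moreover have "2 / k * (- (k / 2) * a * tanh (a * (T - t)))\<^sup>2 = k / 2 * a\<^sup>2 * (tanh (a * (T - t)))\<^sup>2"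
    using k by (simp add: power_mult_distrib power2_eq_square field_simps)
  ultimately show ?thesis by (simp only:)
qed

text \<open>Matching the coefficients of \<open>x - E x\<close>, \<open>y - E y\<close>, \<open>E x\<close>, \<open>E y\<close> and \<open>1\<close> gives exactly the
  Riccati equations and the equation for \<open>h\<close>.\<close>

lemma adjoint_identity:
  fixes x y xb yb u v K Kj \<Lambda> \<Lambda>j c cj p11 p12 p21 p22 q11 q12 q21 q22 h1 h2 :: real
  defines "g \<equiv> q11 * xb + q12 * yb + h1" and "gj \<equiv> q22 * yb + q21 * xb + h2"
  defines "ub \<equiv> c * (\<Lambda> * xb + g)" and "vb \<equiv> cj * (\<Lambda>j * yb + gj)"
  assumes u: "u = c * ((K + p11) * (x - xb) + p12 * (y - yb) + \<Lambda> * xb + g)"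
    and v: "v = cj * ((Kj + p22) * (y - yb) + p21 * (x - xb) + \<Lambda>j * yb + gj)"
    and K': "K' = r + \<epsilon> * m\<^sup>2 - c * K\<^sup>2" and \<Lambda>': "\<Lambda>' = r - c * \<Lambda>\<^sup>2"
    and p11': "p11' = - 2 * c * K * p11 - c * p11\<^sup>2 - cj * p12 * p21"
    and p12': "p12' = - \<theta> / 2 - \<epsilon> * m * n - c * K * p12 - cj * Kj * p12 - c * p11 * p12 - cj * p12 * p22"
    and q11': "q11' = - 2 * c * \<Lambda> * q11 - c * q11\<^sup>2 - cj * q12 * q21"
    and q12': "q12' = - \<theta> / 2 - c * \<Lambda> * q12 - cj * \<Lambda>j * q12 - c * q11 * q12 - cj * q12 * q22"
    and h1': "h1' = - c * (q11 + \<Lambda>) * h1 - cj * q12 * h2 - A / 2"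
  shows "2 * (K' + p11') * x + 2 * (K + p11) * u + 2 * p12' * y + 2 * p12 * v
     + (2 * ((\<Lambda>' * xb + ub * \<Lambda>) + ((q11' * xb + ub * q11) + (q12' * yb + vb * q12) + h1'))
        - (2 * (K' + p11') * xb + ub * (2 * (K + p11))) - (2 * p12' * yb + vb * (2 * p12)))
     = - (A - 2 * r * x + \<theta> * y - 2 * \<epsilon> * m * (m * (x - xb) - n * (y - yb)))"
proof -
  define X where "X = x - xb"
  define Y where "Y = y - yb"
  have xy: "x = X + xb" "y = Y + yb" by (auto simp: X_def Y_def)
  show ?thesis
    unfolding u v xy K' \<Lambda>' p11' p12' q11' q12' h1' ub_def vb_def g_def gj_def
    by (simp add: power2_eq_square algebra_simps)
qed

context agent
begin

text \<open>For either player the price is \<open>s0 + s * (m * X - n * y)\<close>, with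
  \<open>s = -1\<close> for the producer, whose state lowers it, and \<open>s = 1\<close> for the
  consumer. Since \<open>s\<^sup>2 = 1\<close>, the sign disappears from the variance and matters
  only for the terminal payment.\<close>

lemma payoff_eq:
  assumes p: "proc i x0 a b X" and s: "s\<^sup>2 = 1" and \<eta>: "\<epsilon> = \<eta> * c\<^sup>2" and c1: "c1 * s * m = \<mu>" "c1 * s * n = \<nu>"
  shows "expectation (\<lambda>\<omega>. (LINT t:{0..T}|lborel. run a b X t \<omega>) + (c0 + c1 * (s0 + s * (m * X T \<omega> - n * y T \<omega>))))
     - \<eta> * (LINT t:{0..T}|lborel. variance (\<lambda>\<omega>. c * (s0 + s * (m * X t \<omega> - n * y t \<omega>))))
     = payoff a b X + c0 + c1 * s0"
proof -
  have Tin: "T \<in> {0..T}" using T_pos by simp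
  note iX = l2_integrable[OF finite_measure_axioms proc_l2(1)[OF p]] l2_integrable[OF finite_measure_axioms proc_l2(1)[OF py]]
  note ir = run_integrable[OF p]
  have ir': "integrable M (\<lambda>\<omega>. LINT t:{0..T}|lborel. run a b X t \<omega>)" using Fubini_PT(4)[OF ir Tin] by simp
  have e1: "expectation (\<lambda>\<omega>. LINT t:{0..T}|lborel. run a b X t \<omega>) = (LINT t:{0..T}|lborel. expectation (run a b X t))"
    using Fubini_PT(5)[OF ir Tin] by simp
  have "expectation (\<lambda>\<omega>. c0 + c1 * (s0 + s * (m * X T \<omega> - n * y T \<omega>)))
     = c0 + c1 * s0 + (c1 * s * m) * mean M X T - (c1 * s * n) * mean M y T"
    using iX(1)[OF Tin] iX(2)[OF Tin] by (simp add: prob_space algebra_simps)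
  moreover have "integrable M (\<lambda>\<omega>. c0 + c1 * (s0 + s * (m * X T \<omega> - n * y T \<omega>)))"
    using iX(1)[OF Tin] iX(2)[OF Tin] by simp
  ultimately have e2: "expectation (\<lambda>\<omega>. (LINT t:{0..T}|lborel. run a b X t \<omega>) + (c0 + c1 * (s0 + s * (m * X T \<omega> - n * y T \<omega>))))
    = (LINT t:{0..T}|lborel. expectation (run a b X t)) + c0 + c1 * s0 + \<mu> * mean M X T - \<nu> * mean M y T"
    using ir' by (simp add: e1 c1)
  have var: "variance (\<lambda>\<omega>. c * (s0 + s * (m * X t \<omega> - n * y t \<omega>))) = c\<^sup>2 * variance (\<lambda>\<omega>. m * X t \<omega> - n * y t \<omega>)"
    if t: "t \<in> {0..T}" for t
  proof -
    have D: "expectation (\<lambda>\<omega>. c * (s0 + s * (m * X t \<omega> - n * y t \<omega>))) = c * (s0 + s * expectation (\<lambda>\<omega>. m * X t \<omega> - n * y t \<omega>))"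
      using iX(1)[OF t] iX(2)[OF t] by (simp add: prob_space)
    have "(c * (s0 + s * D) - c * (s0 + s * E))\<^sup>2 = c\<^sup>2 * (D - E)\<^sup>2" for D E
    proof -
      have "(c * (s0 + s * D) - c * (s0 + s * E))\<^sup>2 = s\<^sup>2 * (c\<^sup>2 * (D - E)\<^sup>2)"
        by (simp add: power2_eq_square algebra_simps)
      then show ?thesis using s by simp
    qed
    then show ?thesis unfolding D by simp
  qed
  have "(LINT t:{0..T}|lborel. variance (\<lambda>\<omega>. c * (s0 + s * (m * X t \<omega> - n * y t \<omega>))))
     = (LINT t:{0..T}|lborel. c\<^sup>2 * variance (\<lambda>\<omega>. m * X t \<omega> - n * y t \<omega>))"
    by (intro set_lebesgue_integral_cong allI impI var) auto
  also have "\<dots> = c\<^sup>2 * (LINT t:{0..T}|lborel. variance (\<lambda>\<omega>. m * X t \<omega> - n * y t \<omega>))" by (rule set_integral_mult_right)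
  finally have V: "(LINT t:{0..T}|lborel. variance (\<lambda>\<omega>. c * (s0 + s * (m * X t \<omega> - n * y t \<omega>)))) = \<dots>" .
  show ?thesis unfolding e2 V payoff_def unfolding \<eta> by (simp only: mult.assoc)
qed

end

context brownian2
begin

text \<open>Reduces the assumptions of \<open>agent\<close> to scalar equations for the entries of
  the solutions. \<open>x\<close> and the coefficients of the first row belong to the player,
  \<open>y\<close> and those of the second row to the opponent; exchanging the indices makes the
  same argument serve the other player.\<close>

lemma agentI:
  fixes r \<epsilon> m k kj :: real and x y :: "real \<Rightarrow> 'a \<Rightarrow> real" and K Kj \<Lambda> \<Lambda>j p11 p12 p21 p22 q11 q12 q21 q22 h1 h2 p11' p12' q11' q12' h1' \<zeta> :: "real \<Rightarrow> real"
  assumes px: "proc i x0 u z x" and py: "proc (\<not> i) y0 v w y"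
    and r: "0 \<le> r" and k: "0 < k" and l: "0 \<le> l" and \<epsilon>: "0 \<le> \<epsilon>"
    and K: "\<And>t. t \<in> {0..T} \<Longrightarrow> (K has_real_derivative (r + \<epsilon> * m\<^sup>2 - 2 / k * (K t)\<^sup>2)) (at t within {0..T})"
    and \<Lambda>: "\<And>t. t \<in> {0..T} \<Longrightarrow> (\<Lambda> has_real_derivative (r - 2 / k * (\<Lambda> t)\<^sup>2)) (at t within {0..T})"
    and cont: "continuous_on {0..T} Kj" "continuous_on {0..T} \<Lambda>j" "continuous_on {0..T} p21" "continuous_on {0..T} p22"
      "continuous_on {0..T} q21" "continuous_on {0..T} q22" "continuous_on {0..T} h2"
    and p11: "\<And>t. t \<in> {0..T} \<Longrightarrow> (p11 has_real_derivative p11' t) (at t within {0..T})"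
    and p12: "\<And>t. t \<in> {0..T} \<Longrightarrow> (p12 has_real_derivative p12' t) (at t within {0..T})"
    and q11: "\<And>t. t \<in> {0..T} \<Longrightarrow> (q11 has_real_derivative q11' t) (at t within {0..T})"
    and q12: "\<And>t. t \<in> {0..T} \<Longrightarrow> (q12 has_real_derivative q12' t) (at t within {0..T})"
    and h1: "\<And>t. t \<in> {0..T} \<Longrightarrow> (h1 has_real_derivative h1' t) (at t within {0..T})"
    and p11': "\<And>t. p11' t = - 2 * (2 / k) * K t * p11 t - 2 / k * (p11 t)\<^sup>2 - 2 / kj * p12 t * p21 t"
    and p12': "\<And>t. p12' t = - \<theta> / 2 - \<epsilon> * m * n - 2 / k * K t * p12 t - 2 / kj * Kj t * p12 t
        - 2 / k * p11 t * p12 t - 2 / kj * p12 t * p22 t"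
    and q11': "\<And>t. q11' t = - 2 * (2 / k) * \<Lambda> t * q11 t - 2 / k * (q11 t)\<^sup>2 - 2 / kj * q12 t * q21 t"
    and q12': "\<And>t. q12' t = - \<theta> / 2 - 2 / k * \<Lambda> t * q12 t - 2 / kj * \<Lambda>j t * q12 t
        - 2 / k * q11 t * q12 t - 2 / kj * q12 t * q22 t"
    and h1': "\<And>t. h1' t = - (2 / k) * (q11 t + \<Lambda> t) * h1 t - 2 / kj * q12 t * h2 t - A / 2"
    and final: "p11 T = 0" "p12 T = 0" "q11 T = 0" "q12 T = 0" "K T = 0" "\<Lambda> T = 0" "2 * h1 T = \<mu>"
    and mx: "\<And>t. t \<in> {0..T} \<Longrightarrow> (mean M x has_real_derivative
        2 / k * (\<Lambda> t * mean M x t + (q11 t * mean M x t + q12 t * mean M y t + h1 t))) (at t within {0..T})"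
    and my: "\<And>t. t \<in> {0..T} \<Longrightarrow> (mean M y has_real_derivative
        2 / kj * (\<Lambda>j t * mean M y t + (q22 t * mean M y t + q21 t * mean M x t + h2 t))) (at t within {0..T})"
    and u: "\<And>t. t \<in> {0..T} \<Longrightarrow> AE \<omega> in M. u t \<omega> = 2 / k * ((K t + p11 t) * (x t \<omega> - mean M x t)
        + p12 t * (y t \<omega> - mean M y t) + \<Lambda> t * mean M x t + (q11 t * mean M x t + q12 t * mean M y t + h1 t))"
    and v: "\<And>t. t \<in> {0..T} \<Longrightarrow> AE \<omega> in M. v t \<omega> = 2 / kj * ((Kj t + p22 t) * (y t \<omega> - mean M y t)
        + p21 t * (x t \<omega> - mean M x t) + \<Lambda>j t * mean M y t + (q22 t * mean M y t + q21 t * mean M x t + h2 t))"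
    and z: "\<And>t \<omega>. t \<in> {0..T} \<Longrightarrow> \<omega> \<in> space M \<Longrightarrow> z t \<omega> = \<zeta> t"
    and \<zeta>: "\<And>t. t \<in> {0..T} \<Longrightarrow> \<zeta> t * (l - 2 * (K t + p11 t)) = l * \<sigma>"
    and lK: "\<And>t. t \<in> {0..T} \<Longrightarrow> l - 2 * K t \<noteq> 0"
  shows "\<exists>K' \<Lambda>' f' e' d'. agent M T W B i x0 y0 A r \<theta> k l \<sigma> \<mu> \<epsilon> m n x u z y v w K K' \<Lambda> \<Lambda>' p11 p12
    (\<lambda>t. q11 t * mean M x t + q12 t * mean M y t + h1 t) f' e' d' \<zeta>"
proof -
  define g where "g = (\<lambda>t. q11 t * mean M x t + q12 t * mean M y t + h1 t)"
  define K' where "K' = (\<lambda>t. r + \<epsilon> * m\<^sup>2 - 2 / k * (K t)\<^sup>2)"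
  define \<Lambda>' where "\<Lambda>' = (\<lambda>t. r - 2 / k * (\<Lambda> t)\<^sup>2)"
  define ub where "ub = (\<lambda>t. 2 / k * (\<Lambda> t * mean M x t + g t))"
  define vb where "vb = (\<lambda>t. 2 / kj * (\<Lambda>j t * mean M y t + (q22 t * mean M y t + q21 t * mean M x t + h2 t)))"
  have c: "continuous_on {0..T} K" "continuous_on {0..T} \<Lambda>" "continuous_on {0..T} p11" "continuous_on {0..T} p12"
    "continuous_on {0..T} q11" "continuous_on {0..T} q12" "continuous_on {0..T} h1"
    "continuous_on {0..T} (mean M x)" "continuous_on {0..T} (mean M y)"
    using DERIV_continuous_on[OF K] DERIV_continuous_on[OF \<Lambda>] DERIV_continuous_on[OF p11] DERIV_continuous_on[OF p12]
      DERIV_continuous_on[OF q11] DERIV_continuous_on[OF q12] DERIV_continuous_on[OF h1] DERIV_continuous_on[OF mx] DERIV_continuous_on[OF my]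
    by blast+
  have c': "continuous_on {0..T} K'" "continuous_on {0..T} \<Lambda>'" "continuous_on {0..T} p11'" "continuous_on {0..T} p12'"
    "continuous_on {0..T} q11'" "continuous_on {0..T} q12'" "continuous_on {0..T} h1'" "continuous_on {0..T} g"
    unfolding K'_def \<Lambda>'_def p11'[abs_def] p12'[abs_def] q11'[abs_def] q12'[abs_def] h1'[abs_def] g_def
    by (intro continuous_intros c cont)+
  have cb: "continuous_on {0..T} ub" "continuous_on {0..T} vb"
    unfolding ub_def vb_def by (intro continuous_intros c cont c')+
  \<comment> \<open>The last of the three derivatives is the product rule for the affine part of the
    adjoint process, with \<open>ub\<close> and \<open>vb\<close> as derivatives of the two
    means.\<close>
  have "agent M T W B i x0 y0 A r \<theta> k l \<sigma> \<mu> \<epsilon> m n x u z y v w K K' \<Lambda> \<Lambda>' p11 p12 g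
    (\<lambda>t. 2 * (K' t + p11' t)) (\<lambda>t. 2 * p12' t)
    (\<lambda>t. 2 * ((\<Lambda>' t * mean M x t + ub t * \<Lambda> t) + ((q11' t * mean M x t + ub t * q11 t) + (q12' t * mean M y t + vb t * q12 t) + h1' t))
        - (2 * (K' t + p11' t) * mean M x t + ub t * (2 * (K t + p11 t))) - (2 * p12' t * mean M y t + vb t * (2 * p12 t)))
    \<zeta>"
  proof (unfold_locales)
    show "((\<lambda>t. 2 * (K t + p11 t)) has_real_derivative 2 * (K' t + p11' t)) (at t within {0..T})" if "t \<in> {0..T}" for t
      unfolding K'_def by (intro DERIV_cmult DERIV_add K p11 that)
    show "((\<lambda>t. 2 * p12 t) has_real_derivative 2 * p12' t) (at t within {0..T})" if "t \<in> {0..T}" for t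
      by (intro DERIV_cmult p12 that)
    show "((\<lambda>t. 2 * (\<Lambda> t * mean M x t + g t) - 2 * (K t + p11 t) * mean M x t - 2 * p12 t * mean M y t) has_real_derivative
      (2 * ((\<Lambda>' t * mean M x t + ub t * \<Lambda> t) + ((q11' t * mean M x t + ub t * q11 t) + (q12' t * mean M y t + vb t * q12 t) + h1' t))
        - (2 * (K' t + p11' t) * mean M x t + ub t * (2 * (K t + p11 t))) - (2 * p12' t * mean M y t + vb t * (2 * p12 t)))) (at t within {0..T})"
      if "t \<in> {0..T}" for t
      unfolding K'_def \<Lambda>'_def ub_def vb_def g_def
      by (intro DERIV_diff DERIV_cmult DERIV_add DERIV_mult K \<Lambda> p11 p12 q11 q12 h1 mx my that)
    show "continuous_on {0..T} (\<lambda>t. 2 * (K' t + p11' t))" "continuous_on {0..T} (\<lambda>t. 2 * p12' t)" by (intro continuous_intros c')+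
    show "continuous_on {0..T} (\<lambda>t. 2 * ((\<Lambda>' t * mean M x t + ub t * \<Lambda> t) + ((q11' t * mean M x t + ub t * q11 t) + (q12' t * mean M y t + vb t * q12 t) + h1' t))
        - (2 * (K' t + p11' t) * mean M x t + ub t * (2 * (K t + p11 t))) - (2 * p12' t * mean M y t + vb t * (2 * p12 t)))"
      by (intro continuous_intros c c' cb)
    show "AE \<omega> in M. 2 * (K' t + p11' t) * x t \<omega> + 2 * (K t + p11 t) * u t \<omega> + 2 * p12' t * y t \<omega> + 2 * p12 t * v t \<omega> +
        (2 * ((\<Lambda>' t * mean M x t + ub t * \<Lambda> t) + ((q11' t * mean M x t + ub t * q11 t) + (q12' t * mean M y t + vb t * q12 t) + h1' t))
        - (2 * (K' t + p11' t) * mean M x t + ub t * (2 * (K t + p11 t))) - (2 * p12' t * mean M y t + vb t * (2 * p12 t)))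
      = - (A - 2 * r * x t \<omega> + \<theta> * y t \<omega> - 2 * \<epsilon> * m * (m * (x t \<omega> - mean M x t) - n * (y t \<omega> - mean M y t)))"
      if t: "t \<in> {0..T}" for t
      using u[OF t] v[OF t]
    proof eventually_elim
      case (elim \<omega>)
      show ?case
        unfolding ub_def vb_def g_def
        by (rule adjoint_identity[OF elim _ _ p11' p12' q11' q12' h1']) (simp_all add: K'_def \<Lambda>'_def)
    qed
    show "2 * g T = \<mu>" using final by (simp add: g_def)
    show "AE \<omega> in M. u t \<omega> = 2 / k * ((K t + p11 t) * (x t \<omega> - mean M x t) + p12 t * (y t \<omega> - mean M y t) + \<Lambda> t * mean M x t + g t)"
      if "t \<in> {0..T}" for t using u[OF that] unfolding g_def .
    show "(mean M x has_real_derivative 2 / k * (\<Lambda> t * mean M x t + g t)) (at t within {0..T})" if "t \<in> {0..T}" for t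
      using mx[OF that] unfolding g_def .
    show "(K has_real_derivative K' t) (at t within {0..T})" if "t \<in> {0..T}" for t using K[OF that] unfolding K'_def .
    show "(\<Lambda> has_real_derivative \<Lambda>' t) (at t within {0..T})" if "t \<in> {0..T}" for t using \<Lambda>[OF that] unfolding \<Lambda>'_def .
  qed (fact px py r k l \<epsilon> c' final z \<zeta> lK | simp add: K'_def \<Lambda>'_def)+
  then show ?thesis unfolding g_def by blast
qed

end

section \<open>Entries of the coefficient matrices and their equations\<close>

lemma continuous_on_mat2:
  "continuous_on S a \<Longrightarrow> continuous_on S b \<Longrightarrow> continuous_on S c \<Longrightarrow> continuous_on S d \<Longrightarrow>
    continuous_on S (\<lambda>t. mat2 (a t) (b t) (c t) (d t))"
proof -
  assume a: "continuous_on S a" "continuous_on S b" "continuous_on S c" "continuous_on S d"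
  have "mat2 (a t) (b t) (c t) (d t) = (\<chi> i j. if i = 1 then (if j = 1 then a t else b t) else (if j = 1 then c t else d t))" for t
    by (simp add: mat2_def vec_eq_iff forall_2)
  moreover have "continuous_on S (\<lambda>t. \<chi> i j. if i = 1 then (if j = 1 then a t else b t) else (if j = 1 then c t else d t) :: real^2^2)"
  proof (intro continuous_on_vec_lambda)
    show "continuous_on S (\<lambda>t. if i = 1 then (if j = 1 then a t else b t) else (if j = 1 then c t else d t))" for i j :: 2
      by (cases "i = 1"; cases "j = 1"; simp add: a)
  qed
  ultimately show ?thesis by simp
qed

lemma continuous_on_vector2:
  "continuous_on S a \<Longrightarrow> continuous_on S b \<Longrightarrow> continuous_on S (\<lambda>t. vector [a t, b t] :: real^2)"
proof -
  assume a: "continuous_on S a" "continuous_on S b"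
  have "(vector [a t, b t] :: real^2) = (\<chi> i. if i = 1 then a t else b t)" for t
    by (simp add: vec_eq_iff forall_2)
  moreover have "continuous_on S (\<lambda>t. \<chi> i. if i = 1 then a t else b t :: real^2)"
  proof (intro continuous_on_vec_lambda)
    show "continuous_on S (\<lambda>t. if i = 1 then a t else b t)" for i :: 2
      by (cases "i = 1"; simp add: a)
  qed
  ultimately show ?thesis by simp
qed

lemma mat2_nth [simp]:
  "mat2 a b c d $ 1 $ 1 = a" "mat2 a b c d $ 1 $ 2 = b" "mat2 a b c d $ 2 $ 1 = c" "mat2 a b c d $ 2 $ 2 = d"
  by (simp_all add: mat2_def)

text \<open>Written in the form that \<open>agentI\<close> asks for. The order 11, 12, 22, 21 puts a
  player's own entry before the cross entry, first for the producer, then for the consumer.\<close>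

lemma riccati_rhs_nth:
  "riccati_rhs P lam T t X $ 1 $ 1 = - 2 * (2 / k_p P) * K_p P lam T t * X $ 1 $ 1 - 2 / k_p P * (X $ 1 $ 1)\<^sup>2
     - 2 / k_c P * X $ 1 $ 2 * X $ 2 $ 1"
  "riccati_rhs P lam T t X $ 1 $ 2 = - (\<gamma> P * \<rho>_c P) / 2 - \<eta>_p P * lam\<^sup>2 * \<rho>_p P * (\<gamma> P * \<rho>_c P)
     - 2 / k_p P * K_p P lam T t * X $ 1 $ 2 - 2 / k_c P * K_c P lam T t * X $ 1 $ 2
     - 2 / k_p P * X $ 1 $ 1 * X $ 1 $ 2 - 2 / k_c P * X $ 1 $ 2 * X $ 2 $ 2"
  "riccati_rhs P lam T t X $ 2 $ 2 = - 2 * (2 / k_c P) * K_c P lam T t * X $ 2 $ 2 - 2 / k_c P * (X $ 2 $ 2)\<^sup>2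
     - 2 / k_p P * X $ 2 $ 1 * X $ 1 $ 2"
  "riccati_rhs P lam T t X $ 2 $ 1 = - (\<rho>_p P * (\<gamma> P - p_1 P)) / 2 - \<eta>_c P * lam\<^sup>2 * (\<gamma> P * \<rho>_c P) * \<rho>_p P
     - 2 / k_c P * K_c P lam T t * X $ 2 $ 1 - 2 / k_p P * K_p P lam T t * X $ 2 $ 1
     - 2 / k_c P * X $ 2 $ 2 * X $ 2 $ 1 - 2 / k_p P * X $ 2 $ 1 * X $ 1 $ 1"
  unfolding riccati_rhs_def \<Xi>_def \<Phi>_def R_mat_def
  by (simp_all add: matrix_matrix_mult_def sum_2 power2_eq_square algebra_simps diff_divide_distrib add_divide_distrib)

lemma riccati_hat_rhs_nth:
  "riccati_hat_rhs P T t X $ 1 $ 1 = - 2 * (2 / k_p P) * \<Lambda>_p P T t * X $ 1 $ 1 - 2 / k_p P * (X $ 1 $ 1)\<^sup>2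
     - 2 / k_c P * X $ 1 $ 2 * X $ 2 $ 1"
  "riccati_hat_rhs P T t X $ 1 $ 2 = - (\<gamma> P * \<rho>_c P) / 2
     - 2 / k_p P * \<Lambda>_p P T t * X $ 1 $ 2 - 2 / k_c P * \<Lambda>_c P T t * X $ 1 $ 2
     - 2 / k_p P * X $ 1 $ 1 * X $ 1 $ 2 - 2 / k_c P * X $ 1 $ 2 * X $ 2 $ 2"
  "riccati_hat_rhs P T t X $ 2 $ 2 = - 2 * (2 / k_c P) * \<Lambda>_c P T t * X $ 2 $ 2 - 2 / k_c P * (X $ 2 $ 2)\<^sup>2
     - 2 / k_p P * X $ 2 $ 1 * X $ 1 $ 2"
  "riccati_hat_rhs P T t X $ 2 $ 1 = - (\<rho>_p P * (\<gamma> P - p_1 P)) / 2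
     - 2 / k_c P * \<Lambda>_c P T t * X $ 2 $ 1 - 2 / k_p P * \<Lambda>_p P T t * X $ 2 $ 1
     - 2 / k_c P * X $ 2 $ 2 * X $ 2 $ 1 - 2 / k_p P * X $ 2 $ 1 * X $ 1 $ 1"
  unfolding riccati_hat_rhs_def \<Xi>_hat_def \<Phi>_hat_def R_mat_def
  by (simp_all add: matrix_matrix_mult_def sum_2 power2_eq_square algebra_simps diff_divide_distrib add_divide_distrib)

lemma h_rhs_nth:
  "((X ** R_mat P + \<Phi>_hat P T t) *v h + \<Psi> P) $ 1 = - (2 / k_p P) * (X $ 1 $ 1 + \<Lambda>_p P T t) * h $ 1
     - 2 / k_c P * X $ 1 $ 2 * h $ 2 - s_0 P / 2"
  "((X ** R_mat P + \<Phi>_hat P T t) *v h + \<Psi> P) $ 2 = - (2 / k_c P) * (X $ 2 $ 2 + \<Lambda>_c P T t) * h $ 2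
     - 2 / k_p P * X $ 2 $ 1 * h $ 1 - (p_0 P + p_1 P * s_0 P - \<gamma> P * (\<delta> P + s_0 P)) / 2"
  unfolding \<Phi>_hat_def R_mat_def \<Psi>_def
  by (simp_all add: matrix_matrix_mult_def matrix_vector_mult_def sum_2 power2_eq_square algebra_simps diff_divide_distrib add_divide_distrib)

lemma nth_nth_has_real_derivative:
  fixes X :: "real \<Rightarrow> real^2^2"
  assumes "(X has_vector_derivative D) (at t within S)"
  shows "((\<lambda>t. X t $ i $ j) has_real_derivative D $ i $ j) (at t within S)"
  using bounded_linear.has_vector_derivative[OF bounded_linear_compose[OF bounded_linear_vec_nth bounded_linear_vec_nth] assms, of i j]
  by (simp add: has_real_derivative_iff_has_vector_derivative)

lemma nth_has_real_derivative:
  fixes X :: "real \<Rightarrow> real^2"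
  assumes "(X has_vector_derivative D) (at t within S)"
  shows "((\<lambda>t. X t $ i) has_real_derivative D $ i) (at t within S)"
  using bounded_linear.has_vector_derivative[OF bounded_linear_vec_nth assms, of i]
  by (simp add: has_real_derivative_iff_has_vector_derivative)

lemma coefficient_derivatives:
  assumes P: "valid_params P"
  shows "(K_p P lam T has_real_derivative (\<rho>_p P + \<eta>_p P * lam\<^sup>2 * (\<rho>_p P)\<^sup>2 - 2 / k_p P * (K_p P lam T t)\<^sup>2)) (at t within S)"
    "(\<Lambda>_p P T has_real_derivative (\<rho>_p P - 2 / k_p P * (\<Lambda>_p P T t)\<^sup>2)) (at t within S)"
    "(K_c P lam T has_real_derivative (\<gamma> P * \<rho>_c P * (\<gamma> P - p_1 P) + \<eta>_c P * lam\<^sup>2 * (\<gamma> P * \<rho>_c P)\<^sup>2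
      - 2 / k_c P * (K_c P lam T t)\<^sup>2)) (at t within S)"
    "(\<Lambda>_c P T has_real_derivative (\<gamma> P * \<rho>_c P * (\<gamma> P - p_1 P) - 2 / k_c P * (\<Lambda>_c P T t)\<^sup>2)) (at t within S)"
proof -
  have pos: "0 < k_p P" "0 < k_c P" "0 < \<rho>_p P" "0 < \<rho>_c P" "0 < \<gamma> P" "0 < \<gamma> P - p_1 P" "0 < \<eta>_p P" "0 < \<eta>_c P"
    using P by (auto simp: valid_params_def)
  have c: "0 \<le> \<rho>_p P + \<eta>_p P * lam\<^sup>2 * (\<rho>_p P)\<^sup>2" "0 \<le> \<rho>_p P"
    "0 \<le> \<gamma> P * \<rho>_c P * (\<gamma> P - p_1 P) + \<eta>_c P * lam\<^sup>2 * (\<gamma> P)\<^sup>2 * (\<rho>_c P)\<^sup>2" "0 \<le> \<gamma> P * \<rho>_c P * (\<gamma> P - p_1 P)"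
    using pos by (simp_all add: add_nonneg_nonneg)
  show "(K_p P lam T has_real_derivative (\<rho>_p P + \<eta>_p P * lam\<^sup>2 * (\<rho>_p P)\<^sup>2 - 2 / k_p P * (K_p P lam T t)\<^sup>2)) (at t within S)"
    using riccati_tanh[OF pos(1) c(1), of T t S] unfolding K_p_def[abs_def] Let_def .
  show "(\<Lambda>_p P T has_real_derivative (\<rho>_p P - 2 / k_p P * (\<Lambda>_p P T t)\<^sup>2)) (at t within S)"
    using riccati_tanh[OF pos(1) c(2), of T t S] unfolding \<Lambda>_p_def[abs_def] Let_def .
  have m2: "\<eta>_c P * lam\<^sup>2 * (\<gamma> P * \<rho>_c P)\<^sup>2 = \<eta>_c P * lam\<^sup>2 * (\<gamma> P)\<^sup>2 * (\<rho>_c P)\<^sup>2"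
    by (simp add: power_mult_distrib)
  show "(K_c P lam T has_real_derivative (\<gamma> P * \<rho>_c P * (\<gamma> P - p_1 P) + \<eta>_c P * lam\<^sup>2 * (\<gamma> P * \<rho>_c P)\<^sup>2
      - 2 / k_c P * (K_c P lam T t)\<^sup>2)) (at t within S)"
    using riccati_tanh[OF pos(2) c(3), of T t S] unfolding m2 K_c_def[abs_def] Let_def .
  show "(\<Lambda>_c P T has_real_derivative (\<gamma> P * \<rho>_c P * (\<gamma> P - p_1 P) - 2 / k_c P * (\<Lambda>_c P T t)\<^sup>2)) (at t within S)"
    using riccati_tanh[OF pos(2) c(4), of T t S] unfolding \<Lambda>_c_def[abs_def] Let_def by (simp only: mult.assoc)
qed

text \<open>This sign of \<open>K\<close> keeps the denominator \<open>l - 2 * K\<close> in the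
  payoff formulas positive as soon as \<open>l\<close> is.\<close>

lemma tanh_coefficient_nonpos:
  fixes k c T t :: real
  assumes "0 < k" "0 \<le> c" "t \<le> T"
  shows "- (k / 2) * sqrt (2 * c / k) * tanh (sqrt (2 * c / k) * (T - t)) \<le> 0"
  using assms by (auto simp: mult_nonpos_nonneg)

section \<open>Assembly of the game from the two control problems\<close>

context brownian2
begin

text \<open>Positivity of the denominator makes the equilibrium volatility continuously
  differentiable, as the pathwise definition of its integral requires. The derivative is left as the
  quotient rule produces it.\<close>

lemma volatility_wiener_integrand:
  assumes K: "\<And>t. t \<in> {0..T} \<Longrightarrow> (K has_real_derivative K' t) (at t within {0..T})" "continuous_on {0..T} K'"
    and p: "\<And>t. t \<in> {0..T} \<Longrightarrow> (p has_real_derivative p' t) (at t within {0..T})" "continuous_on {0..T} p'"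
    and pos: "\<And>t. t \<in> {0..T} \<Longrightarrow> l - 2 * (K t + p t) > 0"
  shows "wiener_integrand M T W B (\<lambda>t. s / (l - 2 * (K t + p t)))
    (\<lambda>t. (0 * (l - 2 * (K t + p t)) - s * (0 - 2 * (K' t + p' t))) / ((l - 2 * (K t + p t)) * (l - 2 * (K t + p t))))"
proof
  have c: "continuous_on {0..T} K" "continuous_on {0..T} p"
    using DERIV_continuous_on[OF K(1)] DERIV_continuous_on[OF p(1)] by blast+
  show "((\<lambda>t. s / (l - 2 * (K t + p t))) has_real_derivative
    (0 * (l - 2 * (K t + p t)) - s * (0 - 2 * (K' t + p' t))) / ((l - 2 * (K t + p t)) * (l - 2 * (K t + p t)))) (at t within {0..T})"
    if t: "t \<in> {0..T}" for t
    using pos[OF t] by (intro DERIV_divide DERIV_const DERIV_diff DERIV_cmult DERIV_add K p t) simp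
  show "continuous_on {0..T} (\<lambda>t. (0 * (l - 2 * (K t + p t)) - s * (0 - 2 * (K' t + p' t))) / ((l - 2 * (K t + p t)) * (l - 2 * (K t + p t))))"
    using pos by (intro continuous_intros c K(2) p(2)) fastforce
qed

lemma proc_mean_unique:
  assumes "proc k x0 a b X" "proc k x0 a b X'" "t \<in> {0..T}"
  shows "mean M X' t = mean M X t"
  using proc_AE_unique[OF assms(2,1,3)] l2_measurable[OF proc_l2(1)[OF assms(1,3)]] l2_measurable[OF proc_l2(1)[OF assms(2,3)]]
  by (intro integral_cong_AE) auto

text \<open>The fixed payment is called \<open>c\<^sub>0\<close> here, since \<open>F\<close>
  denotes the filtration in this context.\<close>

theorem equilibrium:
  fixes P :: params and lam c\<^sub>0 :: real and \<pi> \<pi>_hat :: "real \<Rightarrow> real^2^2" and h :: "real \<Rightarrow> real^2"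
  assumes P: "valid_params P"
    and ric: "riccati_solution P lam T \<pi> \<pi>_hat"
    and hs: "h_solution P lam T \<pi>_hat h"
    and A2_p: "\<And>t. t \<in> {0..T} \<Longrightarrow> l_p P - 2 * (K_p P lam T t + \<pi> t $ 1 $ 1) > 0"
    and A2_c: "\<And>t. t \<in> {0..T} \<Longrightarrow> l_c P - 2 * (K_c P lam T t + \<pi> t $ 2 $ 2) > 0"
  shows "\<exists>u z v y q c.
    nash_equilibrium P lam c\<^sub>0 M T W B (u, z) (v, y) \<and>
    state_process M (augmented_filtration M W B) T W (q_0 P) u z q \<and>
    state_process M (augmented_filtration M W B) T B (c_0 P) v y c \<and>
    (\<forall>t\<in>{0..T}. \<forall>\<omega>\<in>space M.
      u t \<omega> = 2 / k_p P *
        ((K_p P lam T t + \<pi> t $ 1 $ 1) * (q t \<omega> - mean M q t)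
         + \<pi> t $ 1 $ 2 * (c t \<omega> - mean M c t)
         + (\<Lambda>_p P T t + \<pi>_hat t $ 1 $ 1) * mean M q t
         + \<pi>_hat t $ 1 $ 2 * mean M c t + h t $ 1) \<and>
      z t \<omega> = z_star P lam T \<pi> t \<and>
      v t \<omega> = 2 / k_c P *
        ((K_c P lam T t + \<pi> t $ 2 $ 2) * (c t \<omega> - mean M c t)
         + \<pi> t $ 2 $ 1 * (q t \<omega> - mean M q t)
         + (\<Lambda>_c P T t + \<pi>_hat t $ 2 $ 2) * mean M c t
         + \<pi>_hat t $ 2 $ 1 * mean M q t + h t $ 2) \<and>
      y t \<omega> = y_star P lam T \<pi> t) \<and>
    J_p P lam c\<^sub>0 M T u z q c =
      \<Lambda>_p P T 0 * (q_0 P)\<^sup>2 + 2 * Y_bar 1 M \<pi>_hat h q c 0 * q_0 P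
      + R_p P lam M T \<pi> \<pi>_hat h q c + c\<^sub>0 - lam * s_0 P - 1 / 2 * l_p P * (\<sigma>_p P)\<^sup>2 * T \<and>
    J_c P lam c\<^sub>0 M T v y q c =
      \<Lambda>_c P T 0 * (c_0 P)\<^sup>2 + 2 * Y_bar 2 M \<pi>_hat h q c 0 * c_0 P
      + R_c P lam M T \<pi> \<pi>_hat h q c - c\<^sub>0 + lam * s_0 P - 1 / 2 * l_c P * (\<sigma>_c P)\<^sup>2 * T"
proof -
  have pos: "0 < k_p P" "0 < k_c P" "0 \<le> l_p P" "0 \<le> l_c P" "0 < \<rho>_p P" "0 < \<rho>_c P" "0 < \<gamma> P" "0 < \<gamma> P - p_1 P" "0 < \<eta>_p P" "0 < \<eta>_c P"
    using P by (auto simp: valid_params_def)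
  have Tin: "T \<in> {0..T}" "0 \<in> {0..T}" using T_pos by auto
  have rc: "0 \<le> \<gamma> P * \<rho>_c P * (\<gamma> P - p_1 P)" using pos by (intro mult_nonneg_nonneg) auto
  have Kp0: "K_p P lam T T = 0" "\<Lambda>_p P T T = 0" "K_c P lam T T = 0" "\<Lambda>_c P T T = 0"
    by (simp_all add: K_p_def \<Lambda>_p_def K_c_def \<Lambda>_c_def)
  have pi0: "\<pi> T = 0" "\<pi>_hat T = 0" using ric by (auto simp: riccati_solution_def)
  have pi: "((\<lambda>t. \<pi> t $ i $ j) has_real_derivative riccati_rhs P lam T t (\<pi> t) $ i $ j) (at t within {0..T})"
    and pih: "((\<lambda>t. \<pi>_hat t $ i $ j) has_real_derivative riccati_hat_rhs P T t (\<pi>_hat t) $ i $ j) (at t within {0..T})"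
    if "t \<in> {0..T}" for t i j
    using ric that by (intro nth_nth_has_real_derivative; simp add: riccati_solution_def)+
  have hd: "((\<lambda>t. h t $ i) has_real_derivative ((\<pi>_hat t ** R_mat P + \<Phi>_hat P T t) *v h t + \<Psi> P) $ i) (at t within {0..T})"
    if "t \<in> {0..T}" for t i
    using hs that by (intro nth_has_real_derivative) (auto simp: h_solution_def)
  have hT: "2 * h T $ 1 = lam * \<rho>_p P" "2 * h T $ 2 = lam * (\<gamma> P * \<rho>_c P)"
    using hs by (auto simp: h_solution_def)
  have cpi: "continuous_on {0..T} (\<lambda>t. \<pi> t $ i $ j)" and cpih: "continuous_on {0..T} (\<lambda>t. \<pi>_hat t $ i $ j)"
    and ch: "continuous_on {0..T} (\<lambda>t. h t $ i)" for i j
    using DERIV_continuous_on[OF pi] DERIV_continuous_on[OF pih] DERIV_continuous_on[OF hd] by blast+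
  have cK: "continuous_on {0..T} (K_p P lam T)" "continuous_on {0..T} (\<Lambda>_p P T)"
      "continuous_on {0..T} (K_c P lam T)" "continuous_on {0..T} (\<Lambda>_c P T)"
    using DERIV_continuous_on[OF coefficient_derivatives(1)[OF P]] DERIV_continuous_on[OF coefficient_derivatives(2)[OF P]]
      DERIV_continuous_on[OF coefficient_derivatives(3)[OF P]] DERIV_continuous_on[OF coefficient_derivatives(4)[OF P]]
    by blast+
  have nz: "k_p P \<noteq> 0" "k_c P \<noteq> 0" using pos by auto
  have cK': "continuous_on {0..T} (\<lambda>t. \<rho>_p P + \<eta>_p P * lam\<^sup>2 * (\<rho>_p P)\<^sup>2 - 2 / k_p P * (K_p P lam T t)\<^sup>2)"
    "continuous_on {0..T} (\<lambda>t. \<gamma> P * \<rho>_c P * (\<gamma> P - p_1 P) + \<eta>_c P * lam\<^sup>2 * (\<gamma> P * \<rho>_c P)\<^sup>2 - 2 / k_c P * (K_c P lam T t)\<^sup>2)"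
    using nz by (auto intro!: continuous_intros cK)
  have cric: "continuous_on {0..T} (\<lambda>t. riccati_rhs P lam T t (\<pi> t) $ 1 $ 1)"
    "continuous_on {0..T} (\<lambda>t. riccati_rhs P lam T t (\<pi> t) $ 2 $ 2)"
    unfolding riccati_rhs_nth using nz by (auto intro!: continuous_intros cK cpi)
  have "wiener_integrand M T W B (z_star P lam T \<pi>)
      (\<lambda>t. (0 * (l_p P - 2 * (K_p P lam T t + \<pi> t $ 1 $ 1)) - \<sigma>_p P * l_p P * (0 - 2 * ((\<rho>_p P + \<eta>_p P * lam\<^sup>2 * (\<rho>_p P)\<^sup>2 - 2 / k_p P * (K_p P lam T t)\<^sup>2)
         + riccati_rhs P lam T t (\<pi> t) $ 1 $ 1))) / ((l_p P - 2 * (K_p P lam T t + \<pi> t $ 1 $ 1)) * (l_p P - 2 * (K_p P lam T t + \<pi> t $ 1 $ 1))))"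
    unfolding z_star_def[abs_def]
    by (rule volatility_wiener_integrand[OF coefficient_derivatives(1)[OF P] cK'(1) pi cric(1) A2_p])
  moreover have "wiener_integrand M T W B (y_star P lam T \<pi>)
      (\<lambda>t. (0 * (l_c P - 2 * (K_c P lam T t + \<pi> t $ 2 $ 2)) - \<sigma>_c P * l_c P * (0 - 2 * ((\<gamma> P * \<rho>_c P * (\<gamma> P - p_1 P) + \<eta>_c P * lam\<^sup>2 * (\<gamma> P * \<rho>_c P)\<^sup>2 - 2 / k_c P * (K_c P lam T t)\<^sup>2)
         + riccati_rhs P lam T t (\<pi> t) $ 2 $ 2))) / ((l_c P - 2 * (K_c P lam T t + \<pi> t $ 2 $ 2)) * (l_c P - 2 * (K_c P lam T t + \<pi> t $ 2 $ 2))))"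
    unfolding y_star_def[abs_def]
    by (rule volatility_wiener_integrand[OF coefficient_derivatives(3)[OF P] cK'(2) pi cric(2) A2_c])
  ultimately have vol: "\<exists>\<zeta>'. wiener_integrand M T W B (z_star P lam T \<pi>) \<zeta>'" "\<exists>\<zeta>'. wiener_integrand M T W B (y_star P lam T \<pi>) \<zeta>'"
    by blast+
  define \<zeta> where "\<zeta> i = (if i = (1::2) then z_star P lam T \<pi> else y_star P lam T \<pi>)" for i
  have "\<exists>\<zeta>'. wiener_integrand M T W B (\<zeta> i) \<zeta>'" for i
    unfolding \<zeta>_def using vol by (cases "i = 1") simp_all
  then have "wiener_integrand M T W B (\<zeta> i) (SOME \<zeta>'. wiener_integrand M T W B (\<zeta> i) \<zeta>')" for i
    by (rule someI_ex)
  then obtain \<zeta>' where wi: "\<And>i. wiener_integrand M T W B (\<zeta> i) (\<zeta>' i)" by (rule that)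
  define A where "A t = mat2 (2 / k_p P * (K_p P lam T t + \<pi> t $ 1 $ 1)) (2 / k_p P * \<pi> t $ 1 $ 2)
      (2 / k_c P * \<pi> t $ 2 $ 1) (2 / k_c P * (K_c P lam T t + \<pi> t $ 2 $ 2))" for t
  define A' where "A' t = mat2 (2 / k_p P * (\<Lambda>_p P T t + \<pi>_hat t $ 1 $ 1)) (2 / k_p P * \<pi>_hat t $ 1 $ 2)
      (2 / k_c P * \<pi>_hat t $ 2 $ 1) (2 / k_c P * (\<Lambda>_c P T t + \<pi>_hat t $ 2 $ 2))" for t
  define b :: "real \<Rightarrow> real^2" where "b t = vector [2 / k_p P * h t $ 1, 2 / k_c P * h t $ 2]" for t
  have cA: "continuous_on {0..T} A" "continuous_on {0..T} A'" "continuous_on {0..T} b"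
    unfolding A_def A'_def b_def
    by (intro continuous_on_mat2 continuous_on_vector2 continuous_on_mult continuous_on_add continuous_on_const cK cpi cpih ch)+
  obtain X U :: "2 \<Rightarrow> real \<Rightarrow> 'a \<Rightarrow> real" and \<mu> :: "real \<Rightarrow> real^2"
    where X: "\<And>i. proc (i = 1) (vector [q_0 P, c_0 P] $ i) (U i) (\<lambda>t \<omega>. \<zeta> i t) (X i)"
    "\<And>i t. t \<in> {0..T} \<Longrightarrow> mean M (X i) t = \<mu> t $ i"
    "\<And>t. t \<in> {0..T} \<Longrightarrow> (\<mu> has_vector_derivative (b t + A' t *v \<mu> t)) (at t within {0..T})"
    "\<And>i t \<omega>. t \<in> {0..T} \<Longrightarrow> \<omega> \<in> space M \<Longrightarrow>
      U i t \<omega> = (b t + A' t *v \<mu> t) $ i + (\<Sum>j\<in>UNIV. A t $ i $ j * (X j t \<omega> - \<mu> t $ j))"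
    by (rule linear_states_exist[OF wi cA, where ?x0.0 = "vector [q_0 P, c_0 P]"]) (rule that)
  define q where "q = X 1"
  define c where "c = X 2"
  define u where "u = U 1"
  define v where "v = U 2"
  define z where "z = (\<lambda>t (\<omega>::'a). z_star P lam T \<pi> t)"
  define y where "y = (\<lambda>t (\<omega>::'a). y_star P lam T \<pi> t)"
  have pq: "proc True (q_0 P) u z q" using X(1)[of 1] by (simp add: q_def u_def z_def \<zeta>_def)
  have pc: "proc False (c_0 P) v y c" using X(1)[of 2] by (simp add: c_def v_def y_def \<zeta>_def)
  have mqc: "mean M q t = \<mu> t $ 1" "mean M c t = \<mu> t $ 2" if "t \<in> {0..T}" for t
    using X(2)[OF that] by (auto simp: q_def c_def)
  have uq: "u t \<omega> = 2 / k_p P * ((K_p P lam T t + \<pi> t $ 1 $ 1) * (q t \<omega> - mean M q t) + \<pi> t $ 1 $ 2 * (c t \<omega> - mean M c t)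
      + \<Lambda>_p P T t * mean M q t + (\<pi>_hat t $ 1 $ 1 * mean M q t + \<pi>_hat t $ 1 $ 2 * mean M c t + h t $ 1))"
    and vc: "v t \<omega> = 2 / k_c P * ((K_c P lam T t + \<pi> t $ 2 $ 2) * (c t \<omega> - mean M c t) + \<pi> t $ 2 $ 1 * (q t \<omega> - mean M q t)
      + \<Lambda>_c P T t * mean M c t + (\<pi>_hat t $ 2 $ 2 * mean M c t + \<pi>_hat t $ 2 $ 1 * mean M q t + h t $ 2))"
    if t: "t \<in> {0..T}" and \<omega>: "\<omega> \<in> space M" for t \<omega>
    unfolding u_def v_def X(4)[OF t \<omega>] q_def c_def X(2)[OF t]
    by (simp_all add: A_def A'_def b_def matrix_vector_mult_def sum_2 algebra_simps add_divide_distrib diff_divide_distrib)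
  have dm: "((\<lambda>t. \<mu> t $ 1) has_real_derivative
      2 / k_p P * (\<Lambda>_p P T t * \<mu> t $ 1 + (\<pi>_hat t $ 1 $ 1 * \<mu> t $ 1 + \<pi>_hat t $ 1 $ 2 * \<mu> t $ 2 + h t $ 1))) (at t within {0..T})"
    "((\<lambda>t. \<mu> t $ 2) has_real_derivative
      2 / k_c P * (\<Lambda>_c P T t * \<mu> t $ 2 + (\<pi>_hat t $ 2 $ 2 * \<mu> t $ 2 + \<pi>_hat t $ 2 $ 1 * \<mu> t $ 1 + h t $ 2))) (at t within {0..T})"
    if t: "t \<in> {0..T}" for t
  proof -
    have "(b t + A' t *v \<mu> t) $ 1 = 2 / k_p P * (\<Lambda>_p P T t * \<mu> t $ 1 + (\<pi>_hat t $ 1 $ 1 * \<mu> t $ 1 + \<pi>_hat t $ 1 $ 2 * \<mu> t $ 2 + h t $ 1))"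
      "(b t + A' t *v \<mu> t) $ 2 = 2 / k_c P * (\<Lambda>_c P T t * \<mu> t $ 2 + (\<pi>_hat t $ 2 $ 2 * \<mu> t $ 2 + \<pi>_hat t $ 2 $ 1 * \<mu> t $ 1 + h t $ 2))"
      by (simp_all add: A'_def b_def matrix_vector_mult_def sum_2 algebra_simps add_divide_distrib diff_divide_distrib)
    with nth_has_real_derivative[OF X(3)[OF t], of 1] nth_has_real_derivative[OF X(3)[OF t], of 2]
    show "((\<lambda>t. \<mu> t $ 1) has_real_derivative
      2 / k_p P * (\<Lambda>_p P T t * \<mu> t $ 1 + (\<pi>_hat t $ 1 $ 1 * \<mu> t $ 1 + \<pi>_hat t $ 1 $ 2 * \<mu> t $ 2 + h t $ 1))) (at t within {0..T})"
      "((\<lambda>t. \<mu> t $ 2) has_real_derivative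
      2 / k_c P * (\<Lambda>_c P T t * \<mu> t $ 2 + (\<pi>_hat t $ 2 $ 2 * \<mu> t $ 2 + \<pi>_hat t $ 2 $ 1 * \<mu> t $ 1 + h t $ 2))) (at t within {0..T})"
      by (simp_all only:)
  qed
  have lpos: "l_p P - 2 * K_p P lam T t \<noteq> 0" "l_c P - 2 * K_c P lam T t \<noteq> 0" if t: "t \<in> {0..T}" for t
  proof -
    \<comment> \<open>At time \<open>T\<close>, where \<open>K\<close> and \<open>\<pi>\<close>
      vanish, the positivity assumptions reduce to these.\<close>
    have l: "0 < l_p P" "0 < l_c P" using A2_p[OF Tin(1)] A2_c[OF Tin(1)] by (simp_all add: Kp0 pi0)
    have "K_p P lam T t \<le> 0" "K_c P lam T t \<le> 0"
      unfolding K_p_def K_c_def Let_def using pos t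
      by (intro tanh_coefficient_nonpos add_nonneg_nonneg mult_nonneg_nonneg; simp)+
    with l show "l_p P - 2 * K_p P lam T t \<noteq> 0" "l_c P - 2 * K_c P lam T t \<noteq> 0" by linarith+
  qed
  have volz: "z_star P lam T \<pi> t * (l_p P - 2 * (K_p P lam T t + \<pi> t $ 1 $ 1)) = l_p P * \<sigma>_p P"
    "y_star P lam T \<pi> t * (l_c P - 2 * (K_c P lam T t + \<pi> t $ 2 $ 2)) = l_c P * \<sigma>_c P" if "t \<in> {0..T}" for t
    using A2_p[OF that] A2_c[OF that] by (simp_all add: z_star_def y_star_def)
  \<comment> \<open>The notion of equilibrium ranges over all versions \<open>q'\<close>,
    \<open>c'\<close> of the equilibrium states. They have the means of \<open>q\<close> and
    \<open>c\<close> and satisfy the feedback law almost surely at each time, which is what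
    \<open>agent\<close> asks for.\<close>
  have main: "(\<forall>a b X. proc True (q_0 P) a b X \<longrightarrow> J_p P lam c\<^sub>0 M T a b X c' \<le> J_p P lam c\<^sub>0 M T u z q' c') \<and>
      (\<forall>a b X. proc False (c_0 P) a b X \<longrightarrow> J_c P lam c\<^sub>0 M T a b q' X \<le> J_c P lam c\<^sub>0 M T v y q' c') \<and>
      J_p P lam c\<^sub>0 M T u z q' c' = \<Lambda>_p P T 0 * (q_0 P)\<^sup>2 + 2 * Y_bar 1 M \<pi>_hat h q' c' 0 * q_0 P
      + R_p P lam M T \<pi> \<pi>_hat h q' c' + c\<^sub>0 - lam * s_0 P - 1 / 2 * l_p P * (\<sigma>_p P)\<^sup>2 * T \<and>
      J_c P lam c\<^sub>0 M T v y q' c' = \<Lambda>_c P T 0 * (c_0 P)\<^sup>2 + 2 * Y_bar 2 M \<pi>_hat h q' c' 0 * c_0 P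
      + R_c P lam M T \<pi> \<pi>_hat h q' c' - c\<^sub>0 + lam * s_0 P - 1 / 2 * l_c P * (\<sigma>_c P)\<^sup>2 * T"
    if pq': "proc True (q_0 P) u z q'" and pc': "proc False (c_0 P) v y c'" for q' c'
  proof -
    have m': "mean M q' t = \<mu> t $ 1" "mean M c' t = \<mu> t $ 2" if "t \<in> {0..T}" for t
      using proc_mean_unique[OF pq pq' that] proc_mean_unique[OF pc pc' that] mqc[OF that] by simp_all
    have mq': "(mean M q' has_real_derivative 2 / k_p P * (\<Lambda>_p P T t * mean M q' t +
        (\<pi>_hat t $ 1 $ 1 * mean M q' t + \<pi>_hat t $ 1 $ 2 * mean M c' t + h t $ 1))) (at t within {0..T})"
      and mc': "(mean M c' has_real_derivative 2 / k_c P * (\<Lambda>_c P T t * mean M c' t +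
        (\<pi>_hat t $ 2 $ 2 * mean M c' t + \<pi>_hat t $ 2 $ 1 * mean M q' t + h t $ 2))) (at t within {0..T})"
      if t: "t \<in> {0..T}" for t
      using dm[OF t] unfolding m'[OF t] has_real_derivative_iff_has_vector_derivative
      by (auto intro: has_vector_derivative_transform[OF t] m')
    have uq': "AE \<omega> in M. u t \<omega> = 2 / k_p P * ((K_p P lam T t + \<pi> t $ 1 $ 1) * (q' t \<omega> - mean M q' t) + \<pi> t $ 1 $ 2 * (c' t \<omega> - mean M c' t)
      + \<Lambda>_p P T t * mean M q' t + (\<pi>_hat t $ 1 $ 1 * mean M q' t + \<pi>_hat t $ 1 $ 2 * mean M c' t + h t $ 1))"
      if t: "t \<in> {0..T}" for t
      using proc_AE_unique[OF pq pq' t] proc_AE_unique[OF pc pc' t] AE_space[of M]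
      by eventually_elim (simp only: uq[OF t] m'[OF t] mqc[OF t])
    have vc': "AE \<omega> in M. v t \<omega> = 2 / k_c P * ((K_c P lam T t + \<pi> t $ 2 $ 2) * (c' t \<omega> - mean M c' t) + \<pi> t $ 2 $ 1 * (q' t \<omega> - mean M q' t)
      + \<Lambda>_c P T t * mean M c' t + (\<pi>_hat t $ 2 $ 2 * mean M c' t + \<pi>_hat t $ 2 $ 1 * mean M q' t + h t $ 2))"
      if t: "t \<in> {0..T}" for t
      using proc_AE_unique[OF pq pq' t] proc_AE_unique[OF pc pc' t] AE_space[of M]
      by eventually_elim (simp only: vc[OF t] m'[OF t] mqc[OF t])
    \<comment> \<open>The producer: own entries 11, cross entries 12. The producer pays
      \<open>lam\<close> times the price, which contains the own state with a minus sign; hence the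
      terminal weight \<open>lam * \<rho>_p P\<close>.\<close>
    have "\<exists>K' \<Lambda>' f' e' d'. agent M T W B True (q_0 P) (c_0 P) (s_0 P) (\<rho>_p P) (\<gamma> P * \<rho>_c P) (k_p P) (l_p P) (\<sigma>_p P)
       (lam * \<rho>_p P) (\<eta>_p P * lam\<^sup>2) (\<rho>_p P) (\<gamma> P * \<rho>_c P) q' u z c' v y (K_p P lam T) K' (\<Lambda>_p P T) \<Lambda>'
       (\<lambda>t. \<pi> t $ 1 $ 1) (\<lambda>t. \<pi> t $ 1 $ 2) (\<lambda>t. \<pi>_hat t $ 1 $ 1 * mean M q' t + \<pi>_hat t $ 1 $ 2 * mean M c' t + h t $ 1)
       f' e' d' (z_star P lam T \<pi>)"
      by (rule agentI[where kj = "k_c P" and Kj = "K_c P lam T" and \<Lambda>j = "\<Lambda>_c P T"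
        and ?p21.0 = "\<lambda>t. \<pi> t $ 2 $ 1" and ?p22.0 = "\<lambda>t. \<pi> t $ 2 $ 2" and ?q11.0 = "\<lambda>t. \<pi>_hat t $ 1 $ 1" and ?q12.0 = "\<lambda>t. \<pi>_hat t $ 1 $ 2"
        and ?q21.0 = "\<lambda>t. \<pi>_hat t $ 2 $ 1" and ?q22.0 = "\<lambda>t. \<pi>_hat t $ 2 $ 2" and ?h1.0 = "\<lambda>t. h t $ 1" and ?h2.0 = "\<lambda>t. h t $ 2"
        and p11' = "\<lambda>t. riccati_rhs P lam T t (\<pi> t) $ 1 $ 1" and p12' = "\<lambda>t. riccati_rhs P lam T t (\<pi> t) $ 1 $ 2"
        and q11' = "\<lambda>t. riccati_hat_rhs P T t (\<pi>_hat t) $ 1 $ 1" and q12' = "\<lambda>t. riccati_hat_rhs P T t (\<pi>_hat t) $ 1 $ 2"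
        and h1' = "\<lambda>t. ((\<pi>_hat t ** R_mat P + \<Phi>_hat P T t) *v h t + \<Psi> P) $ 1"])
        ((rule pq' coefficient_derivatives[OF P] cK cpi cpih ch pi pih hd riccati_rhs_nth riccati_hat_rhs_nth h_rhs_nth
          hT Kp0 mq' mc' uq' vc' volz lpos pos; assumption?) | simp add: pi0 pc' z_def pos less_imp_le)+
    then obtain K' \<Lambda>' f' e' d' where agp: "agent M T W B True (q_0 P) (c_0 P) (s_0 P) (\<rho>_p P) (\<gamma> P * \<rho>_c P) (k_p P) (l_p P) (\<sigma>_p P)
       (lam * \<rho>_p P) (\<eta>_p P * lam\<^sup>2) (\<rho>_p P) (\<gamma> P * \<rho>_c P) q' u z c' v y (K_p P lam T) K' (\<Lambda>_p P T) \<Lambda>'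
       (\<lambda>t. \<pi> t $ 1 $ 1) (\<lambda>t. \<pi> t $ 1 $ 2) (\<lambda>t. \<pi>_hat t $ 1 $ 1 * mean M q' t + \<pi>_hat t $ 1 $ 2 * mean M c' t + h t $ 1)
       f' e' d' (z_star P lam T \<pi>)" by blast
    \<comment> \<open>The value of \<open>\<nu>\<close> is fixed here: it occurs in
      \<open>payoff\<close> but in no assumption, so the locale predicate does not carry it.\<close>
    interpret agp: agent M T W B True "q_0 P" "c_0 P" "s_0 P" "\<rho>_p P" "\<gamma> P * \<rho>_c P" "k_p P" "l_p P" "\<sigma>_p P"
       "lam * \<rho>_p P" "lam * (\<gamma> P * \<rho>_c P)" "\<eta>_p P * lam\<^sup>2" "\<rho>_p P" "\<gamma> P * \<rho>_c P" q' u z c' v y "K_p P lam T" K' "\<Lambda>_p P T" \<Lambda>'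
       "\<lambda>t. \<pi> t $ 1 $ 1" "\<lambda>t. \<pi> t $ 1 $ 2" "\<lambda>t. \<pi>_hat t $ 1 $ 1 * mean M q' t + \<pi>_hat t $ 1 $ 2 * mean M c' t + h t $ 1"
       f' e' d' "z_star P lam T \<pi>" by (fact agp)
    \<comment> \<open>The consumer, with all indices exchanged. Factoring the own state out of the
      profit rate leaves the constant \<open>p_0 + p_1 s_0 - \<gamma> (\<delta> + s_0)\<close>, and
      gives \<open>r = \<gamma> \<rho>_c (\<gamma> - p_1)\<close> for the own state and
      \<open>\<theta> = \<rho>_p (\<gamma> - p_1)\<close> for the opponent's.\<close>
    have "\<exists>K' \<Lambda>' f' e' d'. agent M T W B False (c_0 P) (q_0 P) (p_0 P + p_1 P * s_0 P - \<gamma> P * (\<delta> P + s_0 P))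
       (\<gamma> P * \<rho>_c P * (\<gamma> P - p_1 P)) (\<rho>_p P * (\<gamma> P - p_1 P)) (k_c P) (l_c P) (\<sigma>_c P)
       (lam * (\<gamma> P * \<rho>_c P)) (\<eta>_c P * lam\<^sup>2) (\<gamma> P * \<rho>_c P) (\<rho>_p P) c' v y q' u z (K_c P lam T) K' (\<Lambda>_c P T) \<Lambda>'
       (\<lambda>t. \<pi> t $ 2 $ 2) (\<lambda>t. \<pi> t $ 2 $ 1) (\<lambda>t. \<pi>_hat t $ 2 $ 2 * mean M c' t + \<pi>_hat t $ 2 $ 1 * mean M q' t + h t $ 2)
       f' e' d' (y_star P lam T \<pi>)"
      by (rule agentI[where kj = "k_p P" and Kj = "K_p P lam T" and \<Lambda>j = "\<Lambda>_p P T"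
        and ?p21.0 = "\<lambda>t. \<pi> t $ 1 $ 2" and ?p22.0 = "\<lambda>t. \<pi> t $ 1 $ 1" and ?q11.0 = "\<lambda>t. \<pi>_hat t $ 2 $ 2" and ?q12.0 = "\<lambda>t. \<pi>_hat t $ 2 $ 1"
        and ?q21.0 = "\<lambda>t. \<pi>_hat t $ 1 $ 2" and ?q22.0 = "\<lambda>t. \<pi>_hat t $ 1 $ 1" and ?h1.0 = "\<lambda>t. h t $ 2" and ?h2.0 = "\<lambda>t. h t $ 1"
        and p11' = "\<lambda>t. riccati_rhs P lam T t (\<pi> t) $ 2 $ 2" and p12' = "\<lambda>t. riccati_rhs P lam T t (\<pi> t) $ 2 $ 1"
        and q11' = "\<lambda>t. riccati_hat_rhs P T t (\<pi>_hat t) $ 2 $ 2" and q12' = "\<lambda>t. riccati_hat_rhs P T t (\<pi>_hat t) $ 2 $ 1"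
        and h1' = "\<lambda>t. ((\<pi>_hat t ** R_mat P + \<Phi>_hat P T t) *v h t + \<Psi> P) $ 2"])
        ((rule pc' rc coefficient_derivatives[OF P] cK cpi cpih ch pi pih hd riccati_rhs_nth riccati_hat_rhs_nth h_rhs_nth
          hT Kp0 mq' mc' uq' vc' volz lpos pos; assumption?) | simp add: pi0 pq' y_def pos less_imp_le)+
    then obtain L' \<Theta>' f2 e2 d2 where agc: "agent M T W B False (c_0 P) (q_0 P) (p_0 P + p_1 P * s_0 P - \<gamma> P * (\<delta> P + s_0 P))
       (\<gamma> P * \<rho>_c P * (\<gamma> P - p_1 P)) (\<rho>_p P * (\<gamma> P - p_1 P)) (k_c P) (l_c P) (\<sigma>_c P)
       (lam * (\<gamma> P * \<rho>_c P)) (\<eta>_c P * lam\<^sup>2) (\<gamma> P * \<rho>_c P) (\<rho>_p P) c' v y q' u z (K_c P lam T) L' (\<Lambda>_c P T) \<Theta>'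
       (\<lambda>t. \<pi> t $ 2 $ 2) (\<lambda>t. \<pi> t $ 2 $ 1) (\<lambda>t. \<pi>_hat t $ 2 $ 2 * mean M c' t + \<pi>_hat t $ 2 $ 1 * mean M q' t + h t $ 2)
       f2 e2 d2 (y_star P lam T \<pi>)" by blast
    interpret agc: agent M T W B False "c_0 P" "q_0 P" "p_0 P + p_1 P * s_0 P - \<gamma> P * (\<delta> P + s_0 P)"
       "\<gamma> P * \<rho>_c P * (\<gamma> P - p_1 P)" "\<rho>_p P * (\<gamma> P - p_1 P)" "k_c P" "l_c P" "\<sigma>_c P"
       "lam * (\<gamma> P * \<rho>_c P)" "lam * \<rho>_p P" "\<eta>_c P * lam\<^sup>2" "\<gamma> P * \<rho>_c P" "\<rho>_p P" c' v y q' u z "K_c P lam T" L' "\<Lambda>_c P T" \<Theta>'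
       "\<lambda>t. \<pi> t $ 2 $ 2" "\<lambda>t. \<pi> t $ 2 $ 1" "\<lambda>t. \<pi>_hat t $ 2 $ 2 * mean M c' t + \<pi>_hat t $ 2 $ 1 * mean M q' t + h t $ 2"
       f2 e2 d2 "y_star P lam T \<pi>" by (fact agc)
    have Jp: "J_p P lam c\<^sub>0 M T a b X c' = agp.payoff a b X + c\<^sub>0 - lam * s_0 P" if p: "proc True (q_0 P) a b X" for a b X
    proof -
      have run: "profit_p P a b X c' t \<omega> = agp.run a b X t \<omega>" for t \<omega>
        unfolding profit_p_def price_def agp.run_def by (simp add: algebra_simps)
      have price: "price P X c' t \<omega> = s_0 P + - 1 * (\<rho>_p P * X t \<omega> - \<gamma> P * \<rho>_c P * c' t \<omega>)" for t \<omega>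
        by (simp add: price_def)
      have "J_p P lam c\<^sub>0 M T a b X c' = agp.payoff a b X + c\<^sub>0 + - lam * s_0 P"
        unfolding J_p_def run price
        using agp.payoff_eq[OF p, where s = "- 1" and \<eta> = "\<eta>_p P" and c = lam and ?c1.0 = "- lam" and ?c0.0 = c\<^sub>0 and ?s0.0 = "s_0 P"]
        by (simp only: power2_minus power_one simp_thms minus_mult_minus mult_minus1_right mult_minus_left minus_minus mult_1_left diff_conv_add_uminus add.assoc)
      then show ?thesis by simp
    qed
    have Jc: "J_c P lam c\<^sub>0 M T a b q' X = agc.payoff a b X - c\<^sub>0 + lam * s_0 P" if p: "proc False (c_0 P) a b X" for a b X
    proof -
      have run: "profit_c P a b q' X t \<omega> = agc.run a b X t \<omega>" for t \<omega>
        unfolding profit_c_def price_def agc.run_def by (simp add: power2_eq_square algebra_simps)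
      have price: "price P q' X t \<omega> = s_0 P + 1 * (\<gamma> P * \<rho>_c P * X t \<omega> - \<rho>_p P * q' t \<omega>)" for t \<omega>
        by (simp add: price_def)
      have "J_c P lam c\<^sub>0 M T a b q' X = agc.payoff a b X + - c\<^sub>0 + lam * s_0 P"
        unfolding J_c_def run price
        using agc.payoff_eq[OF p, where s = 1 and \<eta> = "\<eta>_c P" and c = lam and ?c1.0 = lam and ?c0.0 = "- c\<^sub>0" and ?s0.0 = "s_0 P"]
        by (simp only: power_one simp_thms mult_1_left mult_1_right diff_conv_add_uminus add.assoc)
      then show ?thesis by simp
    qed
    have Rp: "R_p P lam M T \<pi> \<pi>_hat h q' c' = (LINT t:{0..T}|lborel. 2 / k_p P * expectation (\<lambda>\<omega>. (\<pi> t $ 1 $ 1 * (q' t \<omega> - mean M q' t)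
         + \<pi> t $ 1 $ 2 * (c' t \<omega> - mean M c' t) + (\<pi>_hat t $ 1 $ 1 * mean M q' t + \<pi>_hat t $ 1 $ 2 * mean M c' t + h t $ 1))\<^sup>2)
        - \<eta>_p P * lam\<^sup>2 * (\<gamma> P * \<rho>_c P)\<^sup>2 * variance (c' t) + 2 * (\<pi> t $ 1 $ 1 * z_star P lam T \<pi> t + l_p P * \<sigma>_p P / 2)\<^sup>2 / (l_p P - 2 * K_p P lam T t))
      - lam * (\<gamma> P * \<rho>_c P) * mean M c' T"
      unfolding R_p_def Y_i_def by (simp only: power_mult_distrib mult.assoc add.assoc)
    have Rc: "R_c P lam M T \<pi> \<pi>_hat h q' c' = (LINT t:{0..T}|lborel. 2 / k_c P * expectation (\<lambda>\<omega>. (\<pi> t $ 2 $ 2 * (c' t \<omega> - mean M c' t)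
         + \<pi> t $ 2 $ 1 * (q' t \<omega> - mean M q' t) + (\<pi>_hat t $ 2 $ 2 * mean M c' t + \<pi>_hat t $ 2 $ 1 * mean M q' t + h t $ 2))\<^sup>2)
        - \<eta>_c P * lam\<^sup>2 * (\<rho>_p P)\<^sup>2 * variance (q' t) + 2 * (\<pi> t $ 2 $ 2 * y_star P lam T \<pi> t + l_c P * \<sigma>_c P / 2)\<^sup>2 / (l_c P - 2 * K_c P lam T t))
      - lam * \<rho>_p P * mean M q' T"
      unfolding R_c_def Y_i_def by (simp only: add_ac)
    show ?thesis
    proof (intro conjI allI impI)
      show "J_p P lam c\<^sub>0 M T a b X c' \<le> J_p P lam c\<^sub>0 M T u z q' c'" if "proc True (q_0 P) a b X" for a b X
        unfolding Jp[OF that] Jp[OF pq'] using agp.payoff_optimal[OF that] by simp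
      show "J_c P lam c\<^sub>0 M T a b q' X \<le> J_c P lam c\<^sub>0 M T v y q' c'" if "proc False (c_0 P) a b X" for a b X
        unfolding Jc[OF that] Jc[OF pc'] using agc.payoff_optimal[OF that] by simp
      show "J_p P lam c\<^sub>0 M T u z q' c' = \<Lambda>_p P T 0 * (q_0 P)\<^sup>2 + 2 * Y_bar 1 M \<pi>_hat h q' c' 0 * q_0 P
          + R_p P lam M T \<pi> \<pi>_hat h q' c' + c\<^sub>0 - lam * s_0 P - 1 / 2 * l_p P * (\<sigma>_p P)\<^sup>2 * T"
        unfolding Jp[OF pq'] Rp agp.payoff_value Y_bar_def by simp
      show "J_c P lam c\<^sub>0 M T v y q' c' = \<Lambda>_c P T 0 * (c_0 P)\<^sup>2 + 2 * Y_bar 2 M \<pi>_hat h q' c' 0 * c_0 P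
          + R_c P lam M T \<pi> \<pi>_hat h q' c' - c\<^sub>0 + lam * s_0 P - 1 / 2 * l_c P * (\<sigma>_c P)\<^sup>2 * T"
        unfolding Jc[OF pc'] Rc agc.payoff_value Y_bar_def by (simp add: add_ac)
    qed
  qed
  have procW: "proc True x0 a b X \<longleftrightarrow> (a, b) \<in> admissible M F T \<and> state_process M F T W x0 a b X"
    and procB: "proc False x0 a b X \<longleftrightarrow> (a, b) \<in> admissible M F T \<and> state_process M F T B x0 a b X" for x0 a b X
    by (auto simp: proc_def Z_def)
  have nash: "nash_equilibrium P lam c\<^sub>0 M T W B (u, z) (v, y)"
    using pq pc main unfolding nash_equilibrium_def Let_def split procW procB by blast
  show ?thesis
  proof (intro exI conjI ballI)
    show "nash_equilibrium P lam c\<^sub>0 M T W B (u, z) (v, y)" by (rule nash)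
    show "state_process M F T W (q_0 P) u z q" "state_process M F T B (c_0 P) v y c" using pq pc by (auto simp: procW procB)
  next
    fix t \<omega> assume t: "t \<in> {0..T}" "\<omega> \<in> space M"
    show "u t \<omega> = 2 / k_p P *
        ((K_p P lam T t + \<pi> t $ 1 $ 1) * (q t \<omega> - mean M q t)
         + \<pi> t $ 1 $ 2 * (c t \<omega> - mean M c t)
         + (\<Lambda>_p P T t + \<pi>_hat t $ 1 $ 1) * mean M q t
         + \<pi>_hat t $ 1 $ 2 * mean M c t + h t $ 1)"
      unfolding uq[OF t] by (simp add: distrib_right)
    show "v t \<omega> = 2 / k_c P *
        ((K_c P lam T t + \<pi> t $ 2 $ 2) * (c t \<omega> - mean M c t)
         + \<pi> t $ 2 $ 1 * (q t \<omega> - mean M q t)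
         + (\<Lambda>_c P T t + \<pi>_hat t $ 2 $ 2) * mean M c t
         + \<pi>_hat t $ 2 $ 1 * mean M q t + h t $ 2)"
      unfolding vc[OF t] by (simp add: distrib_right)
    show "z t \<omega> = z_star P lam T \<pi> t" "y t \<omega> = y_star P lam T \<pi> t" by (simp_all add: z_def y_def)
  qed (use main[OF pq pc] in blast)+
qed

end

theorem theorem3p1:
  fixes M :: "'a measure" and W B :: "real \<Rightarrow> 'a \<Rightarrow> real"
    and P :: params and T lam F :: real
    and \<pi> \<pi>_hat :: "real \<Rightarrow> real^2^2" and h :: "real \<Rightarrow> real^2"
  assumes "prob_space M"
    and "T > 0"
    and "brownian_motion_2d M T W B"
    and "valid_params P"
    and "riccati_solution P lam T \<pi> \<pi>_hat"
    and "h_solution P lam T \<pi>_hat h"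
    and A1: "ereal T < T_max P lam"
    and A2_p: "\<And>t. t \<in> {0..T} \<Longrightarrow> l_p P - 2 * (K_p P lam T t + \<pi> t $ 1 $ 1) > 0"
    and A2_c: "\<And>t. t \<in> {0..T} \<Longrightarrow> l_c P - 2 * (K_c P lam T t + \<pi> t $ 2 $ 2) > 0"
  shows "\<exists>u z v y q c.
    nash_equilibrium P lam F M T W B (u, z) (v, y) \<and>
    state_process M (augmented_filtration M W B) T W (q_0 P) u z q \<and>
    state_process M (augmented_filtration M W B) T B (c_0 P) v y c \<and>
    (\<forall>t\<in>{0..T}. \<forall>\<omega>\<in>space M.
      u t \<omega> = 2 / k_p P *
        ((K_p P lam T t + \<pi> t $ 1 $ 1) * (q t \<omega> - mean M q t)
         + \<pi> t $ 1 $ 2 * (c t \<omega> - mean M c t)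
         + (\<Lambda>_p P T t + \<pi>_hat t $ 1 $ 1) * mean M q t
         + \<pi>_hat t $ 1 $ 2 * mean M c t + h t $ 1) \<and>
      z t \<omega> = z_star P lam T \<pi> t \<and>
      v t \<omega> = 2 / k_c P *
        ((K_c P lam T t + \<pi> t $ 2 $ 2) * (c t \<omega> - mean M c t)
         + \<pi> t $ 2 $ 1 * (q t \<omega> - mean M q t)
         + (\<Lambda>_c P T t + \<pi>_hat t $ 2 $ 2) * mean M c t
         + \<pi>_hat t $ 2 $ 1 * mean M q t + h t $ 2) \<and>
      y t \<omega> = y_star P lam T \<pi> t) \<and>
    J_p P lam F M T u z q c =
      \<Lambda>_p P T 0 * (q_0 P)\<^sup>2 + 2 * Y_bar 1 M \<pi>_hat h q c 0 * q_0 P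
      + R_p P lam M T \<pi> \<pi>_hat h q c + F - lam * s_0 P - 1 / 2 * l_p P * (\<sigma>_p P)\<^sup>2 * T \<and>
    J_c P lam F M T v y q c =
      \<Lambda>_c P T 0 * (c_0 P)\<^sup>2 + 2 * Y_bar 2 M \<pi>_hat h q c 0 * c_0 P
      + R_c P lam M T \<pi> \<pi>_hat h q c - F + lam * s_0 P - 1 / 2 * l_c P * (\<sigma>_c P)\<^sup>2 * T"
proof -
  interpret b: brownian2 M T W B
    using assms by (intro brownian2.intro brownian2_axioms.intro)
  show ?thesis
    using b.equilibrium[OF assms(4,5,6) A2_p A2_c] .
qed

end
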